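(* Consider a sequence of problems indexed by $N$, with integers $L=L(N)$, $K=K(N)$, $r=r(N)$ and $d=\frac{L^2-L}{2}$. For each $N$ let $\mathcal{I}\subset\{1,\dots,N\}$ be a deterministic index set with $|\mathcal{I}|=N-K$, and let $\mathcal{C}=\{\boldsymbol{x}\in\mathbb{R}^N \mid x_i\ge 0 \text{ for all } i\in\mathcal{I}\}$. Let $\boldsymbol{A}_{\mathrm{RI}}\in\mathbb{R}^{d\times N}$ be a right rotationally-invariant random matrix of rank $r=\operatorname{rank}(\boldsymbol{A}_{\mathrm{RI}})$ that has the same spectrum (limiting singular value distribution) as the matrix $\boldsymbol{A}_2\in\mathbb{R}^{d\times N}$ built from the signature matrix $\boldsymbol{S}\in\mathbb{R}^{L\times N}$, and let $$\boldsymbol{A}_{\text{semi-random}}=\begin{pmatrix}\boldsymbol{1}_{1\times N}\\ \boldsymbol{A}_{\mathrm{RI}}\end{pmatrix}\in\mathbb{R}^{(d+1)\times N}.$$ For every $\epsilon\in(0,1)$, the equation in $\mu$ $$(1-\epsilon)\bigl(\mu(1-\Phi(\mu))-\phi(\mu)\bigr)+\epsilon\mu=0$$ has a unique solution $\mu_*(\epsilon)$ in $(0,\infty)$. Define $$\delta_*(\epsilon):=1-(1-\epsilon)\,\Phi(\mu_*(\epsilon)).$$ Then, as $N,K,r\to\infty$ with $r/N\to\alpha\in(0,1)$ and $K/N\to\epsilon\in(0,1)$: (i) if $\alpha>\delta_*(\epsilon)$, then $\Pr\{\mathcal{N}(\boldsymbol{A}_{\text{semi-random}})\cap\mathcal{C}=\{\boldsymbol{0}\}\}\to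 1$; (ii) if $\alpha<\delta_*(\epsilon)$, then $\Pr\{\mathcal{N}(\boldsymbol{A}_{\text{semi-random}})\cap\mathcal{C}\neq\{\boldsymbol{0}\}\}\to 1$.
   Context: $\mathcal{N}(\boldsymbol{A})$ denotes the null space of a matrix $\boldsymbol{A}$; $\boldsymbol{1}_{1\times N}$ is the all-ones row vector of length $N$. $\phi$ and $\Phi$ denote the PDF and CDF of the standard normal distribution. A random matrix $\boldsymbol{A}\in\mathbb{R}^{d\times N}$ is right rotationally-invariant if $\boldsymbol{A}\boldsymbol{Q}$ has the same distribution as $\boldsymbol{A}$ for every deterministic orthogonal matrix $\boldsymbol{Q}\in\mathbb{R}^{N\times N}$. The rank $r=r(N)$ is regarded as a deterministic number for each $N$ (i.e. $\operatorname{rank}(\boldsymbol{A}_{\mathrm{RI}})=r$ almost surely). Matrix $\boldsymbol{A}_2$: $\boldsymbol{S}=[\boldsymbol{s}_1,\dots,\boldsymbol{s}_N]\in\mathbb{R}^{L\times N}$ is the (random) user signature matrix, and the $n$-th column of $\boldsymbol{A}_2\in\mathbb{R}^{d\times N}$ is the $d$-dimensional vector of the strictly lower-triangular entries of $\boldsymbol{s}_n\boldsymbol{s}_n^T$. "Same spectrum" means that the limits, as $N\to\infty$, of the empirical singular value distributions of $\boldsymbol{A}_{\mathrm{RI}}$ and $\boldsymbol{A}_2$ exist and coincide; this is the way the surrogate matrix $\boldsymbol{A}_{\mathrm{RI}}$ is chosen. Interpretation of the index set: $\mathcal{I}$ is the set of zero entries of a deterministic true parameter $\boldsymbol{\gamma}^\circ\in\mathbb{R}_+^N$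 with exactly $K$ nonzero entries. *)

theory Defs
  imports
    "HOL-Probability.Probability"
    "Jordan_Normal_Form.Char_Poly"
    "Jordan_Normal_Form.Matrix_Kernel"
    "Jordan_Normal_Form.DL_Rank"
begin

unbundle no vec_syntax
hide_const (open) Finite_Cartesian_Product.vec Finite_Cartesian_Product.mat
  Finite_Cartesian_Product.row Finite_Cartesian_Product.column Finite_Cartesian_Product.transpose
  Cartesian_Space.rank Determinants.det
hide_type (open) Finite_Cartesian_Product.vec

definition std_normal_cdf :: "real \<Rightarrow> real" where
  "std_normal_cdf = cdf std_normal_distribution"

definition mu_equation :: "real \<Rightarrow> real \<Rightarrow> bool" where
  "mu_equation \<epsilon> \<mu> \<longleftrightarrow>
     (1 - \<epsilon>) * (\<mu> * (1 - std_normal_cdf \<mu>) - std_normal_density \<mu>) + \<epsilon> * \<mu> = 0"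

(* Meaningful for \<epsilon> in (0,1), where the root is unique. *)
definition mu_star :: "real \<Rightarrow> real" where
  "mu_star \<epsilon> = (THE \<mu>. 0 < \<mu> \<and> mu_equation \<epsilon> \<mu>)"

definition delta_star :: "real \<Rightarrow> real" where
  "delta_star \<epsilon> = 1 - (1 - \<epsilon>) * std_normal_cdf (mu_star \<epsilon>)"

(* The type of JNF matrices carries no topology; this is the Borel sigma-algebra of
   R^(d x n), transported along the entries. *)
definition mat_borel :: "nat \<Rightarrow> nat \<Rightarrow> real mat measure" where
  "mat_borel d n = vimage_algebra (carrier_mat d n)
     (\<lambda>A. \<lambda>ij\<in>{..<d} \<times> {..<n}. A $$ ij)
     (Pi\<^sub>M ({..<d} \<times> {..<n}) (\<lambda>_. borel))"

(* The library's orthogonal_mat only asks for orthogonal nonzero columns, so it is not used. *)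
definition right_rotationally_invariant ::
    "'a measure \<Rightarrow> nat \<Rightarrow> nat \<Rightarrow> ('a \<Rightarrow> real mat) \<Rightarrow> bool" where
  "right_rotationally_invariant M d n A \<longleftrightarrow>
     (\<forall>Q \<in> carrier_mat n n. transpose_mat Q * Q = 1\<^sub>m n \<longrightarrow>
        distr M (mat_borel d n) (\<lambda>\<omega>. A \<omega> * Q) = distr M (mat_borel d n) A)"

(* The min (dim_row A) (dim_col A) singular values with multiplicity: square roots of the
   eigenvalues of the smaller of the two Gram matrices. *)
definition singular_values :: "real mat \<Rightarrow> real multiset" where
  "singular_values A = image_mset sqrt (proots (char_poly
     (if dim_row A \<le> dim_col A then A * transpose_mat A else transpose_mat A * A)))"

(* Unspecified for matrices without rows or columns, which have no singular values. *)
definition empirical_sv_distribution :: "real mat \<Rightarrow> real measure" where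
  "empirical_sv_distribution A =
     distr (measure_pmf (pmf_of_multiset (singular_values A))) borel (\<lambda>x. x)"

(* Weak convergence, in probability, of the random empirical measures to a deterministic
   probability measure; implied by almost sure weak convergence. *)
definition limiting_sv_distribution ::
    "(nat \<Rightarrow> 'a measure) \<Rightarrow> (nat \<Rightarrow> 'a \<Rightarrow> real mat) \<Rightarrow> real measure \<Rightarrow> bool" where
  "limiting_sv_distribution M A \<nu> \<longleftrightarrow> real_distribution \<nu> \<and>
     (\<forall>f :: real \<Rightarrow> real. continuous_on UNIV f \<longrightarrow> bounded (range f) \<longrightarrow>
       (\<forall>e>0. (\<lambda>N. measure (M N) {\<omega> \<in> space (M N).
            \<bar>(\<integral>x. f x \<partial>empirical_sv_distribution (A N \<omega>)) - (\<integral>x. f x \<partial>\<nu>)\<bar> > e})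
          \<longlonglongrightarrow> 0))"

definition same_spectrum ::
    "(nat \<Rightarrow> 'a measure) \<Rightarrow> (nat \<Rightarrow> 'a \<Rightarrow> real mat) \<Rightarrow> (nat \<Rightarrow> 'a \<Rightarrow> real mat) \<Rightarrow> bool" where
  "same_spectrum M A B \<longleftrightarrow>
     (\<exists>\<nu>. limiting_sv_distribution M A \<nu> \<and> limiting_sv_distribution M B \<nu>)"

definition strict_lower_entries :: "'a mat \<Rightarrow> 'a vec" where
  "strict_lower_entries B =
     vec_of_list [B $$ (i, j). j \<leftarrow> [0..<dim_col B], i \<leftarrow> [Suc j..<dim_row B]]"

definition outer_square :: "'a :: times vec \<Rightarrow> 'a mat" where
  "outer_square s = mat (dim_vec s) (dim_vec s) (\<lambda>(i, j). s $ i * s $ j)"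

definition num_lower :: "nat \<Rightarrow> nat" where
  "num_lower L = (L\<^sup>2 - L) div 2"

definition A2_mat :: "real mat \<Rightarrow> real mat" where
  "A2_mat S = mat_of_cols (num_lower (dim_row S))
     (map (\<lambda>n. strict_lower_entries (outer_square (col S n))) [0..<dim_col S])"

lemma dim_strict_lower_entries_outer_square:
  "dim_vec (strict_lower_entries (outer_square s)) = num_lower (dim_vec s)"
proof -
  let ?L = "dim_vec s"
  have eq: "dim_vec (strict_lower_entries (outer_square s)) = (\<Sum>j<?L. ?L - Suc j)"
    by (simp add: strict_lower_entries_def outer_square_def length_concat comp_def
        interv_sum_list_conv_sum_set_nat atLeast0LessThan)
  also have "\<dots> = (\<Sum>j<?L. j)"
    by (rule sum.nat_diff_reindex)
  also have "\<dots> = num_lower ?L"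
    unfolding num_lower_def lessThan_atLeast0 gauss_sum_nat
    by (simp add: Sum_Ico_nat power2_eq_square diff_mult_distrib2)
  finally show ?thesis .
qed

definition A_semi_random :: "real mat \<Rightarrow> real mat" where
  "A_semi_random A = mat 1 (dim_col A) (\<lambda>_. 1) @\<^sub>r A"

definition nonneg_on :: "nat \<Rightarrow> nat set \<Rightarrow> real vec set" where
  "nonneg_on n I = {x \<in> carrier_vec n. \<forall>i\<in>I. 0 \<le> x $ i}"

end

theory Submission
  imports Defs
begin

text \<open>Only the row space of the matrix matters, and its law is invariant under reflections. Let \<open>E\<close> be the
  kernel and \<open>D\<close> the cone of all \<open>x\<close> with \<open>x\<^sub>i \<ge> 0\<close> on the index set and \<open>\<Sum>i. x\<^sub>i = 0\<close>; the question is whether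
  \<open>E \<inter> D = {0}\<close>. Take a standard Gaussian vector \<open>g\<close> independent of \<open>E\<close>. For a face of \<open>D\<close> with span \<open>S\<close> and
  \<open>S + E\<close> the whole space, decompose \<open>g = x + y + e\<close> with \<open>x \<in> S \<inter> E\<close>, \<open>y\<close> orthogonal to \<open>S\<close> and \<open>e\<close> orthogonal to
  \<open>E\<close>. The directions of \<open>x\<close> and \<open>y\<close> are uniform and independent, exactly as for the orthogonal
  components of \<open>g\<close> along \<open>S\<close>; hence the probability that \<open>x\<close> lies in the relative interior of the face
  and \<open>y\<close> in its normal cone is the probability that the projection of \<open>g\<close> onto \<open>D\<close> lies in that
  face. These events are disjoint for different faces, since \<open>x\<close> is then the projection of \<open>g\<close> onto
  \<open>D \<inter> E\<close>. Summing over the faces of dimension larger than the rank bounds \<open>Pr(E \<inter> D \<noteq> {0})\<close> from below by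
  the probability that the projection of \<open>g\<close> lies in such a face. The same argument for the polar cone
  and the orthogonal complement of \<open>E\<close>, with the faces of dimension smaller than the rank, bounds
  \<open>Pr(E \<inter> D = {0})\<close> from below. The projection of \<open>g\<close> onto \<open>D\<close> is explicit: a common threshold \<open>t\<close> is
  subtracted from all coordinates and negative values on the index set are replaced by \<open>0\<close>. By the law of
  large numbers \<open>t\<close> concentrates at \<open>\<mu>\<^sub>*\<close>, and the dimension of the face divided by \<open>N\<close> at \<open>\<delta>\<^sub>*\<close>.\<close>

section \<open>Orthogonal projection matrices\<close>

unbundle no inner_syntax

text \<open>No Haar measure is constructed and no exact kinematic formula is used: the two one-sided
  bounds suffice because on each side of the threshold one of them tends to 1. That \<open>x\<close>
  and \<open>y\<close> have the same directions in law as orthogonal components is a uniqueness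
  statement. The law of the pair of directions is invariant under reflections along vectors of the
  range or the kernel of a fixed projection; these move any pair of unit vectors in the two
  subspaces to any other pair, and two laws with this symmetry are compared by double counting over
  small caps. The price is joint measurability in the random subspace and in \<open>g\<close>. Hence
  subspaces are encoded by projection matrices, the decomposition by an explicit determinant
  formula, and existential events by zero sets over compact boxes. The transversality that the
  decomposition requires is itself derived from reflection invariance. Strict inequalities on one
  component and weak ones on the other make the face unique and also cover ties in \<open>g\<close>,
  so that no null set of ties has to be removed.\<close>

lemma mat_eq_by_mult_vec:
  assumes "A \<in> carrier_mat m n" "B \<in> carrier_mat m n"
    and "\<And>x. x \<in> carrier_vec n \<Longrightarrow> A *\<^sub>v x = B *\<^sub>v (x :: real vec)"
  shows "A = B"
proof (rule eq_matI)
  fix i j assume ij: "i < dim_row B" "j < dim_col B"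
  have "(A *\<^sub>v unit_vec n j) $ i = (B *\<^sub>v unit_vec n j) $ i"
    using assms by simp
  then show "A $$ (i, j) = B $$ (i, j)"
    using assms(1,2) ij by auto
qed (use assms in auto)

lemma vec_eq_by_scalar_prod:
  assumes "x \<in> carrier_vec n" "y \<in> carrier_vec n"
    and "\<And>z. z \<in> carrier_vec n \<Longrightarrow> x \<bullet> z = y \<bullet> (z :: real vec)"
  shows "x = y"
proof (rule eq_vecI)
  fix i assume i: "i < dim_vec y"
  have "x \<bullet> unit_vec n i = y \<bullet> unit_vec n i" using assms(3) by simp
  then show "x $ i = y $ i" using assms(1,2) i by auto
qed (use assms in auto)

lemma vec_zero_diff_eq:
  assumes "x \<in> carrier_vec n" "y \<in> carrier_vec n" "x - y = 0\<^sub>v n"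
  shows "x = (y :: real vec)"
proof (rule eq_vecI)
  fix i assume i: "i < dim_vec y"
  have "(x - y) $ i = 0" using assms i by simp
  then show "x $ i = y $ i" using assms(1,2) i by auto
qed (use assms in auto)

lemma scalar_prod_self_nonneg: "0 \<le> x \<bullet> (x :: real vec)"
  by (auto simp: scalar_prod_def intro!: sum_nonneg)

lemma scalar_prod_self_eq_0:
  fixes x :: "real vec"
  assumes "x \<in> carrier_vec n"
  shows "x \<bullet> x = 0 \<longleftrightarrow> x = 0\<^sub>v n"
proof
  assume "x \<bullet> x = 0"
  then have "\<And>i. i < n \<Longrightarrow> x $ i * x $ i = 0"
    using assms by (subst (asm) scalar_prod_def, subst (asm) sum_nonneg_eq_0_iff) auto
  then show "x = 0\<^sub>v n"
    using assms by (intro eq_vecI) auto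
qed (use assms in auto)

lemma scalar_prod_self_pos:
  fixes x :: "real vec"
  assumes "x \<in> carrier_vec n" "x \<noteq> 0\<^sub>v n"
  shows "0 < x \<bullet> x"
  using assms scalar_prod_self_nonneg[of x] scalar_prod_self_eq_0[OF assms(1)] by linarith

text \<open>The zero vector is sent to itself, so statements about directions need no case
  distinction until unit length is used.\<close>

definition normalize_vec :: "real vec \<Rightarrow> real vec" where
  "normalize_vec x = (1 / sqrt (x \<bullet> x)) \<cdot>\<^sub>v x"

lemma normalize_vec_carrier [simp]: "normalize_vec x \<in> carrier_vec n \<longleftrightarrow> x \<in> carrier_vec n"
  by (simp add: normalize_vec_def)

lemma dim_normalize_vec [simp]: "dim_vec (normalize_vec x) = dim_vec x"
  by (simp add: normalize_vec_def)

lemma scalar_prod_normalize_vec: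
  assumes "x \<in> carrier_vec n" "x \<noteq> 0\<^sub>v n"
  shows "normalize_vec x \<bullet> normalize_vec x = 1"
proof -
  have "0 < x \<bullet> x" using scalar_prod_self_pos[OF assms] .
  then show ?thesis using assms
    by (simp add: normalize_vec_def power2_eq_square[symmetric])
qed

lemma outer_square_carrier [simp]: "outer_square x \<in> carrier_mat n n \<longleftrightarrow> dim_vec x = n"
  by (auto simp: outer_square_def)

lemma dim_outer_square [simp]: "dim_row (outer_square x) = dim_vec x" "dim_col (outer_square x) = dim_vec x"
  by (auto simp: outer_square_def)

lemma outer_square_mult_vec:
  assumes "x \<in> carrier_vec n" "y \<in> carrier_vec n"
  shows "outer_square x *\<^sub>v y = (x \<bullet> y) \<cdot>\<^sub>v (x :: real vec)"
  using assms
  by (intro eq_vecI) (auto simp: outer_square_def scalar_prod_def sum_distrib_left mult_ac)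

definition mat_trace :: "real mat \<Rightarrow> real" where
  "mat_trace A = (\<Sum>i<dim_row A. A $$ (i, i))"

lemma mat_trace_mult_comm:
  assumes "A \<in> carrier_mat m n" "B \<in> carrier_mat n m"
  shows "mat_trace (A * B) = mat_trace (B * A)"
proof -
  have "mat_trace (A * B) = (\<Sum>i<m. \<Sum>j<n. A $$ (i, j) * B $$ (j, i))"
    using assms by (auto simp: mat_trace_def scalar_prod_def lessThan_atLeast0 intro!: sum.cong)
  also have "\<dots> = (\<Sum>j<n. \<Sum>i<m. B $$ (j, i) * A $$ (i, j))"
    by (subst sum.swap) (simp add: mult.commute)
  also have "\<dots> = mat_trace (B * A)"
    using assms by (auto simp: mat_trace_def scalar_prod_def lessThan_atLeast0 intro!: sum.cong)
  finally show ?thesis .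
qed

lemma mat_trace_add:
  assumes "A \<in> carrier_mat n n" "B \<in> carrier_mat n n"
  shows "mat_trace (A + B) = mat_trace A + mat_trace B"
  using assms by (simp add: mat_trace_def sum.distrib)

lemma mat_trace_diff:
  assumes "A \<in> carrier_mat n n" "B \<in> carrier_mat n n"
  shows "mat_trace (A - B) = mat_trace A - mat_trace B"
  using assms by (simp add: mat_trace_def sum_subtractf)

lemma mat_trace_one [simp]: "mat_trace (1\<^sub>m n) = n"
  by (simp add: mat_trace_def)

lemma mat_trace_outer_square: "mat_trace (outer_square x) = x \<bullet> x"
  by (simp add: mat_trace_def outer_square_def scalar_prod_def lessThan_atLeast0)

text \<open>A subspace of dimension \<open>k\<close> is represented by the symmetric idempotent
  matrix of trace \<open>k\<close> that projects onto it. The encoding is canonical, so a random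
  subspace is simply a random element of \<open>mat_borel n n\<close>, and no random basis has to be
  chosen measurably.\<close>

definition is_proj :: "nat \<Rightarrow> real mat \<Rightarrow> bool" where
  "is_proj n R \<longleftrightarrow> R \<in> carrier_mat n n \<and> transpose_mat R = R \<and> R * R = R"

lemma is_proj_carrier: "is_proj n R \<Longrightarrow> R \<in> carrier_mat n n"
  by (simp add: is_proj_def)

lemma is_proj_mult_vec_carrier [simp]: "is_proj n R \<Longrightarrow> R *\<^sub>v x \<in> carrier_vec n"
  unfolding is_proj_def by (metis carrier_matD(1) carrier_vec_dim_vec dim_mult_mat_vec)

lemma is_proj_idem [simp]:
  assumes "is_proj n R" "x \<in> carrier_vec n"
  shows "R *\<^sub>v (R *\<^sub>v x) = R *\<^sub>v x"
  using assms by (metis assoc_mult_mat_vec is_proj_def)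

lemma is_proj_self_adjoint:
  assumes "is_proj n R" "x \<in> carrier_vec n" "y \<in> carrier_vec n"
  shows "(R *\<^sub>v x) \<bullet> y = x \<bullet> (R *\<^sub>v y)"
  using assms by (metis is_proj_def transpose_vec_mult_scalar)

lemma is_projI:
  assumes c: "R \<in> carrier_mat n n"
    and sym: "\<And>x y. x \<in> carrier_vec n \<Longrightarrow> y \<in> carrier_vec n \<Longrightarrow> (R *\<^sub>v x) \<bullet> y = x \<bullet> (R *\<^sub>v y)"
    and idem: "\<And>x. x \<in> carrier_vec n \<Longrightarrow> R *\<^sub>v (R *\<^sub>v x) = R *\<^sub>v x"
  shows "is_proj n R"
proof -
  have "transpose_mat R = R"
  proof (rule mat_eq_by_mult_vec[of _ n n])
    fix x :: "real vec" assume x: "x \<in> carrier_vec n"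
    show "transpose_mat R *\<^sub>v x = R *\<^sub>v x"
    proof (rule vec_eq_by_scalar_prod[of _ n])
      fix z :: "real vec" assume z: "z \<in> carrier_vec n"
      show "(transpose_mat R *\<^sub>v x) \<bullet> z = (R *\<^sub>v x) \<bullet> z"
        using transpose_vec_mult_scalar[OF c z x] sym[OF x z] by simp
    qed (use c x in auto)
  qed (use c in auto)
  moreover have "R * R = R"
    using c idem by (intro mat_eq_by_mult_vec[of _ n n]) (auto simp: assoc_mult_mat_vec[OF c c])
  ultimately show ?thesis using c by (simp add: is_proj_def)
qed

text \<open>Adjoining a unit vector orthogonal to the range: the basic move that raises a dimension
  by one. It takes the place of orthonormal bases in the inductions below.\<close>

lemma proj_add_outer:
  assumes R: "is_proj n R" and x: "x \<in> carrier_vec n" "R *\<^sub>v x = 0\<^sub>v n" "x \<bullet> x = 1"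
  shows "is_proj n (R + outer_square x)"
    and "mat_trace (R + outer_square x) = mat_trace R + 1"
    and "\<And>y. y \<in> carrier_vec n \<Longrightarrow> (R + outer_square x) *\<^sub>v y = R *\<^sub>v y + (x \<bullet> y) \<cdot>\<^sub>v x"
proof -
  note c = is_proj_carrier[OF R]
  show m: "(R + outer_square x) *\<^sub>v y = R *\<^sub>v y + (x \<bullet> y) \<cdot>\<^sub>v x" if y: "y \<in> carrier_vec n" for y
    using c x y by (subst add_mult_distrib_mat_vec[OF c]) (auto simp: outer_square_mult_vec)
  have x0: "x \<bullet> (R *\<^sub>v y) = 0" if "y \<in> carrier_vec n" for y
    using is_proj_self_adjoint[OF R x(1) that] x that by simp
  show "is_proj n (R + outer_square x)"
  proof (rule is_projI)
    fix y z :: "real vec" assume y: "y \<in> carrier_vec n" and z: "z \<in> carrier_vec n"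
    have "(R *\<^sub>v y + (x \<bullet> y) \<cdot>\<^sub>v x) \<bullet> z = (R *\<^sub>v y) \<bullet> z + (x \<bullet> y) * (x \<bullet> z)"
      using R x y z by (subst add_scalar_prod_distrib[of _ n]) auto
    moreover have "y \<bullet> (R *\<^sub>v z + (x \<bullet> z) \<cdot>\<^sub>v x) = y \<bullet> (R *\<^sub>v z) + (x \<bullet> z) * (y \<bullet> x)"
      using R x y z by (subst scalar_prod_add_distrib[of _ n]) auto
    ultimately show "((R + outer_square x) *\<^sub>v y) \<bullet> z = y \<bullet> ((R + outer_square x) *\<^sub>v z)"
      using is_proj_self_adjoint[OF R y z] comm_scalar_prod[OF x(1) y] by (simp add: m y z)
  next
    fix y :: "real vec" assume y: "y \<in> carrier_vec n"
    have "R *\<^sub>v (R *\<^sub>v y + (x \<bullet> y) \<cdot>\<^sub>v x) = R *\<^sub>v y"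
      using R x y c by (subst mult_add_distrib_mat_vec[OF c]) (auto simp: mult_mat_vec[OF c])
    moreover have "x \<bullet> (R *\<^sub>v y + (x \<bullet> y) \<cdot>\<^sub>v x) = x \<bullet> y"
      using R x y by (subst scalar_prod_add_distrib[of _ n]) (auto simp: x0)
    ultimately show "(R + outer_square x) *\<^sub>v ((R + outer_square x) *\<^sub>v y) = (R + outer_square x) *\<^sub>v y"
      using R x y by (simp add: m)
  qed (use c x in auto)
  show "mat_trace (R + outer_square x) = mat_trace R + 1"
    using c x by (subst mat_trace_add[of _ n]) (auto simp: mat_trace_outer_square)
qed

lemma proj_compl:
  assumes R: "is_proj n R"
  shows "is_proj n (1\<^sub>m n - R)"
    and "mat_trace (1\<^sub>m n - R) = n - mat_trace R"
    and "\<And>y. y \<in> carrier_vec n \<Longrightarrow> (1\<^sub>m n - R) *\<^sub>v y = y - R *\<^sub>v y"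
proof -
  note c = is_proj_carrier[OF R]
  show m: "(1\<^sub>m n - R) *\<^sub>v y = y - R *\<^sub>v y" if y: "y \<in> carrier_vec n" for y
    using c y by (subst minus_mult_distrib_mat_vec[of _ n n]) auto
  show "is_proj n (1\<^sub>m n - R)"
  proof (rule is_projI)
    fix y z :: "real vec" assume y: "y \<in> carrier_vec n" and z: "z \<in> carrier_vec n"
    show "((1\<^sub>m n - R) *\<^sub>v y) \<bullet> z = y \<bullet> ((1\<^sub>m n - R) *\<^sub>v z)"
      using R y z is_proj_self_adjoint[OF R y z]
      by (simp add: m minus_scalar_prod_distrib[of _ n] scalar_prod_minus_distrib[of _ n])
  next
    fix y :: "real vec" assume y: "y \<in> carrier_vec n"
    have "R *\<^sub>v (y - R *\<^sub>v y) = 0\<^sub>v n"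
      using R y c by (subst mult_minus_distrib_mat_vec[OF c]) auto
    then show "(1\<^sub>m n - R) *\<^sub>v ((1\<^sub>m n - R) *\<^sub>v y) = (1\<^sub>m n - R) *\<^sub>v y"
      using R y by (simp add: m)
  qed (use c in \<open>auto intro: minus_carrier_mat\<close>)
  show "mat_trace (1\<^sub>m n - R) = n - mat_trace R"
    using c by (subst mat_trace_diff[of _ n]) auto
qed

lemma proj_compl_eq_0:
  assumes R: "is_proj n R" and x: "x \<in> carrier_vec n"
  shows "(1\<^sub>m n - R) *\<^sub>v x = 0\<^sub>v n \<longleftrightarrow> R *\<^sub>v x = x"
    and "(1\<^sub>m n - R) *\<^sub>v x = x \<longleftrightarrow> R *\<^sub>v x = 0\<^sub>v n"
proof -
  have eq: "R *\<^sub>v x = x - (1\<^sub>m n - R) *\<^sub>v x"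
  proof -
    have "x - (x - R *\<^sub>v x) = R *\<^sub>v x"
      using R x is_proj_carrier[OF R] by (intro eq_vecI) auto
    then show ?thesis using proj_compl(3)[OF R x] by simp
  qed
  show "(1\<^sub>m n - R) *\<^sub>v x = 0\<^sub>v n \<longleftrightarrow> R *\<^sub>v x = x"
    using eq x R by (auto simp: proj_compl(3))
  show "(1\<^sub>m n - R) *\<^sub>v x = x \<longleftrightarrow> R *\<^sub>v x = 0\<^sub>v n"
    using eq x R by (auto simp: proj_compl(3))
qed

lemma proj_sub_outer:
  assumes R: "is_proj n R" and x: "x \<in> carrier_vec n" "R *\<^sub>v x = x" "x \<bullet> x = 1"
  shows "is_proj n (R - outer_square x)"
    and "mat_trace (R - outer_square x) = mat_trace R - 1"
    and "\<And>y. y \<in> carrier_vec n \<Longrightarrow> (R - outer_square x) *\<^sub>v y = R *\<^sub>v y - (x \<bullet> y) \<cdot>\<^sub>v x"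
proof -
  note c = is_proj_carrier[OF R]
  show m: "(R - outer_square x) *\<^sub>v y = R *\<^sub>v y - (x \<bullet> y) \<cdot>\<^sub>v x" if y: "y \<in> carrier_vec n" for y
    using c x y by (subst minus_mult_distrib_mat_vec[OF c]) (auto simp: outer_square_mult_vec)
  \<comment> \<open>Removing \<open>x\<close> from the range of \<open>R\<close> is adjoining it to
    the orthogonal complement, so \<open>proj_add_outer\<close> applies to
    \<open>1\<^sub>m n - R\<close>.\<close>
  have "is_proj n (1\<^sub>m n - R + outer_square x)"
    using proj_compl_eq_0[OF R x(1)] x by (intro proj_add_outer(1) proj_compl(1)[OF R]) auto
  then have "is_proj n (1\<^sub>m n - (1\<^sub>m n - R + outer_square x))"
    by (rule proj_compl)
  also have "1\<^sub>m n - (1\<^sub>m n - R + outer_square x) = R - outer_square x"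
    using c x by (intro eq_matI) auto
  finally show "is_proj n (R - outer_square x)" .
  show "mat_trace (R - outer_square x) = mat_trace R - 1"
    using c x by (subst mat_trace_diff[of _ n]) (auto simp: mat_trace_outer_square)
qed

lemma zero_mat_mult_vec:
  "x \<in> carrier_vec n \<Longrightarrow> 0\<^sub>m m n *\<^sub>v x = 0\<^sub>v m" for x :: "real vec"
  by (intro eq_vecI) auto

lemma is_proj_zero [simp]: "is_proj n (0\<^sub>m n n)"
  by (simp add: is_proj_def)

lemma mat_trace_zero [simp]: "mat_trace (0\<^sub>m n n) = 0"
  by (simp add: mat_trace_def)

text \<open>A symmetric idempotent satisfies \<open>R = transpose_mat R * R\<close>, so its trace is
  a squared Frobenius norm. Hence traces of projections are nonnegative and vanish only for the zero
  matrix, and all entries are bounded in terms of the trace.\<close>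

lemma proj_trace_eq:
  assumes R: "is_proj n R"
  shows "mat_trace R = (\<Sum>i<n. \<Sum>j<n. (R $$ (i, j))\<^sup>2)"
proof -
  have "mat_trace R = mat_trace (transpose_mat R * R)" using R by (simp add: is_proj_def)
  also have "\<dots> = (\<Sum>i<n. \<Sum>j<n. (R $$ (j, i))\<^sup>2)"
    using is_proj_carrier[OF R]
    by (auto simp: mat_trace_def scalar_prod_def lessThan_atLeast0 power2_eq_square intro!: sum.cong)
  finally show ?thesis by (subst sum.swap)
qed

lemma proj_trace_nonneg: "is_proj n R \<Longrightarrow> 0 \<le> mat_trace R"
  by (simp add: proj_trace_eq sum_nonneg)

lemma proj_trace_le: "is_proj n R \<Longrightarrow> mat_trace R \<le> n"
  using proj_trace_nonneg[OF proj_compl(1)] proj_compl(2) by fastforce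

lemma proj_unit_vec_in_range:
  assumes R: "is_proj n R" and "0 < mat_trace R"
  obtains x where "x \<in> carrier_vec n" "R *\<^sub>v x = x" "x \<bullet> x = 1"
proof -
  note c = is_proj_carrier[OF R]
  have "R \<noteq> 0\<^sub>m n n" using assms by auto
  then obtain y where y: "y \<in> carrier_vec n" "R *\<^sub>v y \<noteq> 0\<^sub>v n"
    using mat_eq_by_mult_vec[OF c, of "0\<^sub>m n n"] by (metis zero_carrier_mat zero_mat_mult_vec)
  have "R *\<^sub>v normalize_vec (R *\<^sub>v y) = normalize_vec (R *\<^sub>v y)"
    using R y c unfolding normalize_vec_def by (simp add: mult_mat_vec[OF c])
  with y show thesis
    using R scalar_prod_normalize_vec[of "R *\<^sub>v y" n] that[of "normalize_vec (R *\<^sub>v y)"] by simp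
qed

lemma proj_trace_le_0:
  assumes R: "is_proj n R" and "mat_trace R \<le> 0"
  shows "R = 0\<^sub>m n n"
proof -
  have "mat_trace R = 0" using assms proj_trace_nonneg by fastforce
  then have 0: "(\<Sum>i<n. \<Sum>j<n. (R $$ (i, j))\<^sup>2) = 0" using proj_trace_eq[OF R] by simp
  have "R $$ (i, j) = 0" if "i < n" "j < n" for i j
  proof -
    have "(\<Sum>j<n. (R $$ (i, j))\<^sup>2) = 0"
      using 0 that by (subst (asm) sum_nonneg_eq_0_iff) (auto intro: sum_nonneg)
    then show ?thesis using that by (subst (asm) sum_nonneg_eq_0_iff) auto
  qed
  then show ?thesis using is_proj_carrier[OF R] by (intro eq_matI) auto
qed

section \<open>Joins of projections and row spaces\<close>

lemma smult_zero_vec [simp]: "a \<cdot>\<^sub>v 0\<^sub>v n = (0\<^sub>v n :: real vec)"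
  by (intro eq_vecI) auto

lemma mat_mult_zero_vec: "A \<in> carrier_mat m n \<Longrightarrow> A *\<^sub>v 0\<^sub>v n = (0\<^sub>v m :: real vec)"
  by (intro eq_vecI) auto

lemma mat_mult_unit_vec:
  assumes "A \<in> carrier_mat m n" "j < n"
  shows "A *\<^sub>v unit_vec n j = col (A :: real mat) j"
  using assms by (intro eq_vecI) auto

lemma is_proj_transpose: "is_proj n R \<Longrightarrow> transpose_mat R = R"
  by (simp add: is_proj_def)

lemma is_proj_mult_transpose:
  assumes "is_proj n R" "is_proj n Q"
  shows "transpose_mat (R * Q) = Q * R"
  using transpose_mult[OF is_proj_carrier is_proj_carrier, OF assms] assms
  by (simp add: is_proj_transpose)

text \<open>One Gram-Schmidt step. The last conclusion records the explicit form of the new matrix,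
  from which \<open>row_proj_ex\<close> sees that the range has not left the row space.\<close>

lemma proj_extend_by_vec:
  assumes W: "is_proj n W" and v: "v \<in> carrier_vec n"
  obtains W' where "is_proj n W'" "mat_trace W' \<le> mat_trace W + 1" "W' *\<^sub>v v = v"
    "\<And>x. x \<in> carrier_vec n \<Longrightarrow> W *\<^sub>v x = x \<Longrightarrow> W' *\<^sub>v x = x"
    "W' = W \<or> (\<exists>c. W' = W + outer_square (c \<cdot>\<^sub>v (v - W *\<^sub>v v)))"
proof (cases "W *\<^sub>v v = v")
  case True
  then show thesis using that[OF W] by simp
next
  case False
  note c = is_proj_carrier[OF W]
  define p where "p = v - W *\<^sub>v v"
  have p: "p \<in> carrier_vec n" using W v by (simp add: p_def)
  have p0: "p \<noteq> 0\<^sub>v n"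
    using False vec_zero_diff_eq[OF v, of "W *\<^sub>v v"] W by (auto simp: p_def)
  have Wp: "W *\<^sub>v p = 0\<^sub>v n"
    unfolding p_def using W v c by (subst mult_minus_distrib_mat_vec[OF c]) auto
  define q where "q = normalize_vec p"
  have q: "q \<in> carrier_vec n" "q \<bullet> q = 1" using p p0 scalar_prod_normalize_vec by (auto simp: q_def)
  have Wq: "W *\<^sub>v q = 0\<^sub>v n"
    unfolding q_def normalize_vec_def using p Wp by (simp add: mult_mat_vec[OF c])
  note add = proj_add_outer[OF W q(1) Wq q(2)]
  have ortho: "q \<bullet> x = 0" if x: "x \<in> carrier_vec n" "W *\<^sub>v x = x" for x
    using is_proj_self_adjoint[OF W q(1) x(1)] x Wq by simp
  have "W' *\<^sub>v v = v" if "W' = W + outer_square q" for W'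
  proof -
    have "v = p + W *\<^sub>v v" using W v c by (intro eq_vecI) (auto simp: p_def)
    then have "q \<bullet> v = q \<bullet> p + q \<bullet> (W *\<^sub>v v)"
      using scalar_prod_add_distrib[OF q(1) p, of "W *\<^sub>v v"] W by simp
    also have "q \<bullet> (W *\<^sub>v v) = 0" using ortho W v by simp
    finally have "(q \<bullet> v) \<cdot>\<^sub>v q = p"
      using p scalar_prod_self_pos[OF p p0]
      by (simp add: q_def normalize_vec_def smult_smult_assoc)
    then show ?thesis using add(3)[OF v] W v c that by (intro eq_vecI) (auto simp: p_def)
  qed
  moreover have "(W + outer_square q) *\<^sub>v x = x" if "x \<in> carrier_vec n" "W *\<^sub>v x = x" for x
    using add(3)[OF that(1)] ortho[OF that] that q by (intro eq_vecI) auto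
  moreover have "\<exists>c. W + outer_square q = W + outer_square (c \<cdot>\<^sub>v (v - W *\<^sub>v v))"
    unfolding q_def normalize_vec_def p_def[symmetric] by blast
  ultimately show thesis using add by (intro that[of "W + outer_square q"]) auto
qed

lemma proj_join:
  assumes R: "is_proj n R" and Q: "is_proj n Q"
  obtains W where "is_proj n W" "mat_trace W \<le> mat_trace R + mat_trace Q"
    "\<And>x. x \<in> carrier_vec n \<Longrightarrow> R *\<^sub>v x = x \<Longrightarrow> W *\<^sub>v x = x"
    "\<And>x. x \<in> carrier_vec n \<Longrightarrow> Q *\<^sub>v x = x \<Longrightarrow> W *\<^sub>v x = x"
proof -
  \<comment> \<open>Traces are not known to be integers at this point, so the induction runs over a
    natural bound \<open>k\<close> for the trace of \<open>Q\<close>, which drops by one whenever a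
    unit vector is split off.\<close>
  have "\<exists>W. is_proj n W \<and> mat_trace W \<le> mat_trace R + mat_trace Q \<and>
    (\<forall>x\<in>carrier_vec n. R *\<^sub>v x = x \<longrightarrow> W *\<^sub>v x = x) \<and> (\<forall>x\<in>carrier_vec n. Q *\<^sub>v x = x \<longrightarrow> W *\<^sub>v x = x)"
    if "mat_trace Q \<le> real k" "is_proj n Q" for k Q
    using that
  proof (induction k arbitrary: Q)
    case 0
    then have "Q = 0\<^sub>m n n" using proj_trace_le_0 by simp
    then show ?case using R by (intro exI[of _ R]) (auto simp: zero_mat_mult_vec mat_mult_zero_vec is_proj_carrier)
  next
    case (Suc k)
    show ?case
    proof (cases "0 < mat_trace Q")
      case False
      then have "Q = 0\<^sub>m n n" using proj_trace_le_0 Suc.prems by simp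
      then show ?thesis using R by (intro exI[of _ R]) (auto simp: zero_mat_mult_vec mat_mult_zero_vec is_proj_carrier)
    next
      case True
      then obtain q where q: "q \<in> carrier_vec n" "Q *\<^sub>v q = q" "q \<bullet> q = 1"
        using proj_unit_vec_in_range[OF Suc.prems(2)] by blast
      note sub = proj_sub_outer[OF Suc.prems(2) q]
      have "mat_trace (Q - outer_square q) \<le> real k" using sub(2) Suc.prems by simp
      from Suc.IH[OF this sub(1)] obtain W where W: "is_proj n W"
        "mat_trace W \<le> mat_trace R + mat_trace (Q - outer_square q)"
        "\<And>x. x \<in> carrier_vec n \<Longrightarrow> R *\<^sub>v x = x \<Longrightarrow> W *\<^sub>v x = x"
        "\<And>x. x \<in> carrier_vec n \<Longrightarrow> (Q - outer_square q) *\<^sub>v x = x \<Longrightarrow> W *\<^sub>v x = x"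
        by blast
      obtain W' where W': "is_proj n W'" "mat_trace W' \<le> mat_trace W + 1" "W' *\<^sub>v q = q"
        "\<And>x. x \<in> carrier_vec n \<Longrightarrow> W *\<^sub>v x = x \<Longrightarrow> W' *\<^sub>v x = x"
        using proj_extend_by_vec[OF W(1) q(1)] by metis
      have "W' *\<^sub>v x = x" if x: "x \<in> carrier_vec n" "Q *\<^sub>v x = x" for x
      proof -
        \<comment> \<open>A vector of the range of \<open>Q\<close> is split into its part along
          \<open>q\<close>, fixed by the last extension, and a rest \<open>y\<close> in the smaller
          range, handled by the induction hypothesis.\<close>
        define y where "y = x - (q \<bullet> x) \<cdot>\<^sub>v q"
        have y: "y \<in> carrier_vec n" using x q by (simp add: y_def)
        have "q \<bullet> y = 0"
          unfolding y_def using x q by (subst scalar_prod_minus_distrib[of _ n]) auto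
        moreover have "Q *\<^sub>v y = y"
          unfolding y_def using x q is_proj_carrier[OF Suc.prems(2)]
          by (subst mult_minus_distrib_mat_vec[of _ n n]) (auto simp: mult_mat_vec[of _ n n])
        ultimately have "(Q - outer_square q) *\<^sub>v y = y"
          using sub(3)[OF y] y q by (intro eq_vecI) auto
        then have "W' *\<^sub>v y = y" using W(4) W'(4) y by blast
        moreover have "W' *\<^sub>v x = W' *\<^sub>v (y + (q \<bullet> x) \<cdot>\<^sub>v q)"
          using x q by (intro arg_cong[of _ _ "\<lambda>z. W' *\<^sub>v z"] eq_vecI) (auto simp: y_def)
        ultimately have "W' *\<^sub>v x = y + (q \<bullet> x) \<cdot>\<^sub>v q"
          using W' y q is_proj_carrier[OF W'(1)]
          by (subst (asm) mult_add_distrib_mat_vec[of _ n n]) (auto simp: mult_mat_vec[of _ n n])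
        then show ?thesis using x q by (auto simp: y_def)
      qed
      then show ?thesis using W W' sub(2) by (intro exI[of _ W']) auto
    qed
  qed
  from this[of Q "nat \<lceil>mat_trace Q\<rceil>"] show thesis using Q that
    by (metis real_nat_ceiling_ge)
qed

text \<open>If the range of \<open>R\<close> lies in that of \<open>W\<close>, then
  \<open>W - R\<close> is again a projection, and its trace is nonnegative.\<close>

lemma range_subset_imp_trace_le:
  assumes R: "is_proj n R" and W: "is_proj n W" and WR: "W * R = R"
  shows "mat_trace R \<le> mat_trace W"
proof -
  note cR = is_proj_carrier[OF R] and cW = is_proj_carrier[OF W]
  have "R * W = transpose_mat (W * R)"
    using is_proj_mult_transpose[OF W R] by simp
  then have RW: "R * W = R" using WR R by (simp add: is_proj_def)
  have "is_proj n (W - R)"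
    unfolding is_proj_def
  proof (intro conjI)
    show "transpose_mat (W - R) = W - R"
      using R W by (subst transpose_minus[of _ n n]) (auto simp: is_proj_def)
    have "(W - R) * (W - R) = W * W - R * W - (W * R - R * R)"
      using cR cW by (simp add: minus_mult_distrib_mat[of _ n n] mult_minus_distrib_mat[of _ n n] minus_carrier_mat)
    also have "\<dots> = W - R"
      using RW WR R W cR cW by (intro eq_matI) (auto simp: is_proj_def)
    finally show "(W - R) * (W - R) = W - R" .
  qed (use cR cW in \<open>auto intro: minus_carrier_mat\<close>)
  from proj_trace_nonneg[OF this] show ?thesis
    using mat_trace_diff[OF cW cR] by simp
qed

text \<open>The dimension count behind the general position arguments: the join of the two ranges
  has dimension below \<open>n\<close>, and a unit vector of its complement is orthogonal to
  both.\<close>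

lemma proj_common_orthogonal:
  assumes R: "is_proj n R" and Q: "is_proj n Q" and lt: "mat_trace R + mat_trace Q < n"
  obtains y where "y \<in> carrier_vec n" "y \<bullet> y = 1" "R *\<^sub>v y = 0\<^sub>v n" "Q *\<^sub>v y = 0\<^sub>v n"
proof -
  obtain W where W: "is_proj n W" "mat_trace W \<le> mat_trace R + mat_trace Q"
    "\<And>x. x \<in> carrier_vec n \<Longrightarrow> R *\<^sub>v x = x \<Longrightarrow> W *\<^sub>v x = x"
    "\<And>x. x \<in> carrier_vec n \<Longrightarrow> Q *\<^sub>v x = x \<Longrightarrow> W *\<^sub>v x = x"
    using proj_join[OF R Q] by blast
  have "0 < mat_trace (1\<^sub>m n - W)" using W lt proj_compl(2)[OF W(1)] by simp
  then obtain y where y: "y \<in> carrier_vec n" "(1\<^sub>m n - W) *\<^sub>v y = y" "y \<bullet> y = 1"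
    using proj_unit_vec_in_range[OF proj_compl(1)[OF W(1)]] by blast
  then have Wy: "W *\<^sub>v y = 0\<^sub>v n" using proj_compl_eq_0(2)[OF W(1) y(1)] by simp
  have *: "U *\<^sub>v y = 0\<^sub>v n" if U: "is_proj n U"
    and "\<And>x. x \<in> carrier_vec n \<Longrightarrow> U *\<^sub>v x = x \<Longrightarrow> W *\<^sub>v x = x" for U
  proof (rule vec_eq_by_scalar_prod[of _ n])
    fix z :: "real vec" assume z: "z \<in> carrier_vec n"
    have "(U *\<^sub>v y) \<bullet> z = y \<bullet> (W *\<^sub>v (U *\<^sub>v z))"
      using that z y is_proj_self_adjoint[OF U y(1) z] by simp
    also have "\<dots> = 0" using is_proj_self_adjoint[OF W(1) y(1), of "U *\<^sub>v z"] U Wy by simp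
    finally show "(U *\<^sub>v y) \<bullet> z = 0\<^sub>v n \<bullet> z" using z by simp
  qed (use U y in auto)
  show thesis using that[OF y(1,3)] * R Q W by blast
qed

text \<open>The equation \<open>A * R = A\<close> puts the row space into the range of
  \<open>R\<close>; the factorisation through \<open>transpose_mat A\<close> puts the range of
  \<open>R\<close> into the row space. Together they single out the orthogonal projection onto the
  row space.\<close>

definition is_row_proj :: "real mat \<Rightarrow> real mat \<Rightarrow> bool" where
  "is_row_proj A R \<longleftrightarrow> is_proj (dim_col A) R \<and> A * R = A \<and>
     (\<exists>C \<in> carrier_mat (dim_row A) (dim_col A). R = transpose_mat A * C)"

text \<open>Gram-Schmidt over the rows of \<open>A\<close>; each row raises the trace by at most
  one, whence the bound by \<open>d\<close>.\<close>

lemma row_proj_ex: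
  assumes A: "A \<in> carrier_mat d n"
  shows "\<exists>R. is_row_proj A R \<and> mat_trace R \<le> d"
proof -
  have "\<exists>R. is_proj n R \<and> mat_trace R \<le> k \<and> (\<forall>i<k. R *\<^sub>v row A i = row A i) \<and>
     (\<exists>C \<in> carrier_mat d n. R = transpose_mat A * C)" if "k \<le> d" for k
    using that
  proof (induction k)
    case 0
    have "0\<^sub>m n n = transpose_mat A * 0\<^sub>m d n" using A by simp
    moreover have "0\<^sub>m d n \<in> carrier_mat d n" by simp
    ultimately show ?case using is_proj_zero mat_trace_zero by (metis bot_nat_0.extremum_strict not_le_imp_less of_nat_0 order_refl)
  next
    case (Suc k)
    then obtain R C where R: "is_proj n R" "mat_trace R \<le> k" "\<And>i. i < k \<Longrightarrow> R *\<^sub>v row A i = row A i"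
      and C: "C \<in> carrier_mat d n" "R = transpose_mat A * C"
      by auto
    have row: "row A i \<in> carrier_vec n" for i using A by (auto simp: row_def)
    obtain R' where R': "is_proj n R'" "mat_trace R' \<le> mat_trace R + 1" "R' *\<^sub>v row A k = row A k"
      "\<And>x. x \<in> carrier_vec n \<Longrightarrow> R *\<^sub>v x = x \<Longrightarrow> R' *\<^sub>v x = x"
      and R'C: "R' = R \<or> (\<exists>c. R' = R + outer_square (c \<cdot>\<^sub>v (row A k - R *\<^sub>v row A k)))"
      using proj_extend_by_vec[OF R(1) row] by metis
    have "\<exists>C' \<in> carrier_mat d n. R' = transpose_mat A * C'"
      using R'C
    proof
      assume "\<exists>c. R' = R + outer_square (c \<cdot>\<^sub>v (row A k - R *\<^sub>v row A k))"
      then obtain c where c: "R' = R + outer_square (c \<cdot>\<^sub>v (row A k - R *\<^sub>v row A k))" by blast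
      \<comment> \<open>Since \<open>R = transpose_mat A * C\<close>, the Gram-Schmidt remainder of
        row \<open>k\<close> is \<open>transpose_mat A\<close> applied to
        \<open>unit_vec d k - C *\<^sub>v row A k\<close>. So the enlarged matrix still factors
        through \<open>transpose_mat A\<close>.\<close>
      define u where "u = c \<cdot>\<^sub>v (unit_vec d k - C *\<^sub>v row A k)"
      have u: "u \<in> carrier_vec d" using mult_mat_vec_carrier[OF C(1) row] by (simp add: u_def)
      have col: "transpose_mat A *\<^sub>v unit_vec d k = row A k"
        using A Suc.prems by (intro eq_vecI) auto
      have eq: "c \<cdot>\<^sub>v (row A k - R *\<^sub>v row A k) = transpose_mat A *\<^sub>v u"
        unfolding u_def using A C row[of k]
        by (simp add: mult_mat_vec[of _ n d] mult_minus_distrib_mat_vec[of _ n d] col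
            assoc_mult_mat_vec[of _ n d _ n])
      define D where "D = mat d n (\<lambda>(i, j). u $ i * (transpose_mat A *\<^sub>v u) $ j)"
      have "outer_square (transpose_mat A *\<^sub>v u) = transpose_mat A * D"
        using A u by (intro eq_matI)
          (auto simp: outer_square_def D_def scalar_prod_def sum_distrib_right mult_ac)
      then have "R' = transpose_mat A * (C + D)"
        using c A C unfolding eq by (subst mult_add_distrib_mat[of _ n d _ n]) (auto simp: D_def)
      moreover have "C + D \<in> carrier_mat d n" using C by (auto simp: D_def)
      ultimately show ?thesis by blast
    qed (use C in blast)
    moreover have "mat_trace R' \<le> Suc k" using R' R by simp
    moreover have "R' *\<^sub>v row A i = row A i" if "i < Suc k" for i
      using that R'(3) R'(4)[OF row] R(3) by (cases "i = k") auto
    ultimately show ?case using R' by blast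
  qed
  from this[of d] obtain R C where R: "is_proj n R" "mat_trace R \<le> d" "\<And>i. i < d \<Longrightarrow> R *\<^sub>v row A i = row A i"
      and C: "C \<in> carrier_mat d n" "R = transpose_mat A * C"
    by auto
  have "A * R = A"
  proof (rule eq_matI)
    fix i j assume ij: "i < dim_row A" "j < dim_col A"
    have "(A * R) $$ (i, j) = row A i \<bullet> col R j" using ij is_proj_carrier[OF R(1)] A by simp
    also have "col R j = row R j"
      using R(1) ij A by (metis carrier_matD(2) is_proj_def row_transpose)
    also have "row A i \<bullet> row R j = (R *\<^sub>v row A i) $ j"
      using ij A is_proj_carrier[OF R(1)] by (simp add: comm_scalar_prod[of _ n])
    finally show "(A * R) $$ (i, j) = A $$ (i, j)" using R(3) ij A by simp
  qed (use A is_proj_carrier[OF R(1)] in auto)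
  then show ?thesis using A R C by (auto simp: is_row_proj_def)
qed

text \<open>Transposing the factorisation of the symmetric matrix \<open>R\<close> turns it into a
  left multiple of \<open>A\<close>; the factor \<open>X\<close> is a generalised inverse of
  \<open>A\<close>.\<close>

lemma row_proj_left_factor:
  assumes A: "A \<in> carrier_mat d n" and R: "is_row_proj A R"
  obtains X where "X \<in> carrier_mat n d" "R = X * A" "A * X * A = A"
proof -
  obtain C where C: "C \<in> carrier_mat d n" "R = transpose_mat A * C" using R A by (auto simp: is_row_proj_def)
  have "R = transpose_mat R" using R by (simp add: is_row_proj_def is_proj_def)
  also have "\<dots> = transpose_mat C * A" using C A by (simp add: transpose_mult[of _ n d _ n])
  finally have eq: "R = transpose_mat C * A" .
  show thesis
    using that[of "transpose_mat C"] eq C A R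
    by (simp add: is_row_proj_def assoc_mult_mat[of _ d n _ d _ n])
qed

text \<open>Each of two candidates is a left multiple of \<open>A\<close> and is therefore fixed by
  right multiplication with the other; symmetry then identifies them.\<close>

lemma row_proj_unique:
  assumes A: "A \<in> carrier_mat d n" and R: "is_row_proj A R" and R': "is_row_proj A R'"
  shows "R = R'"
proof -
  have *: "R1 * R2 = R1" if R1: "is_row_proj A R1" and R2: "is_row_proj A R2" for R1 R2
  proof -
    obtain X where X: "X \<in> carrier_mat n d" "R1 = X * A" using row_proj_left_factor[OF A R1] by blast
    then show ?thesis using R2 A
      by (simp add: is_row_proj_def is_proj_def assoc_mult_mat[of _ n d _ n _ n])
  qed
  have "R = transpose_mat (R * R')" using *[OF R R'] R by (simp add: is_row_proj_def is_proj_def)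
  also have "\<dots> = R' * R" using R R' by (intro is_proj_mult_transpose) (auto simp: is_row_proj_def)
  finally show ?thesis using *[OF R' R] by simp
qed

definition row_proj :: "real mat \<Rightarrow> real mat" where
  "row_proj A = (THE R. is_row_proj A R)"

lemma row_proj:
  assumes A: "A \<in> carrier_mat d n"
  shows "is_row_proj A (row_proj A)" "is_proj n (row_proj A)" "A * row_proj A = A"
    "mat_trace (row_proj A) \<le> d"
proof -
  obtain R where R: "is_row_proj A R" "mat_trace R \<le> d" using row_proj_ex[OF A] by blast
  have eq: "row_proj A = R"
    unfolding row_proj_def using R row_proj_unique[OF A] by blast
  show "is_row_proj A (row_proj A)" "is_proj n (row_proj A)" "A * row_proj A = A"
    "mat_trace (row_proj A) \<le> d"
    using R A unfolding eq by (auto simp: is_row_proj_def)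
qed

lemma row_proj_eqI:
  assumes "A \<in> carrier_mat d n" "is_row_proj A R"
  shows "row_proj A = R"
  using row_proj_unique[OF assms(1) row_proj(1)[OF assms(1)] assms(2)] .

lemma row_proj_kernel:
  assumes A: "A \<in> carrier_mat d n" and x: "x \<in> carrier_vec n"
  shows "row_proj A *\<^sub>v x = 0\<^sub>v n \<longleftrightarrow> A *\<^sub>v x = 0\<^sub>v d"
proof -
  note R = row_proj[OF A]
  obtain X where X: "X \<in> carrier_mat n d" "row_proj A = X * A" using row_proj_left_factor[OF A R(1)] by blast
  have 1: "row_proj A *\<^sub>v x = X *\<^sub>v (A *\<^sub>v x)" using X A x by (simp add: assoc_mult_mat_vec[of _ n d])
  have 2: "A *\<^sub>v x = A *\<^sub>v (row_proj A *\<^sub>v x)"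
    using R A x is_proj_carrier[OF R(2)] by (metis assoc_mult_mat_vec)
  show ?thesis using 1 2 X A by auto
qed

text \<open>The rows of \<open>A\<close> are combinations of the rows of \<open>B\<close>, so the
  row spaces are nested; the conclusion is this inclusion written for projections.\<close>

lemma row_proj_mult_right:
  assumes A: "A \<in> carrier_mat d n" and B: "B \<in> carrier_mat m n" and BX: "A = X * B" "X \<in> carrier_mat d m"
  shows "row_proj B * row_proj A = row_proj A"
proof -
  have "A * row_proj B = A"
    using row_proj[OF B] B BX by (simp add: assoc_mult_mat[of _ d m _ n _ n] is_proj_carrier)
  moreover obtain Y where Y: "Y \<in> carrier_mat n d" "row_proj A = Y * A" using row_proj_left_factor[OF A row_proj(1)[OF A]] by blast
  ultimately have eq: "row_proj A * row_proj B = row_proj A"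
    using A row_proj(2)[OF B] by (simp add: assoc_mult_mat[of _ n d _ n _ n] is_proj_carrier)
  have "row_proj B * row_proj A = transpose_mat (row_proj A * row_proj B)"
    using is_proj_mult_transpose[OF row_proj(2)[OF A] row_proj(2)[OF B]] by simp
  then show ?thesis using row_proj(2)[OF A] by (simp add: eq is_proj_def)
qed

text \<open>Row rank equals column rank by cyclicity of the trace. With a generalised inverse
  \<open>X\<close> of \<open>A\<close>, the row projection is \<open>X * A\<close>, and its trace is
  that of \<open>A * X\<close>. The column projection \<open>L = A * Y\<close> fixes
  \<open>A\<close> from the left, and \<open>A * X * L\<close> collapses to \<open>L\<close> because
  \<open>A * X * A = A\<close>.\<close>

lemma mat_trace_row_proj_transpose:
  assumes A: "A \<in> carrier_mat d n"
  shows "mat_trace (row_proj (transpose_mat A)) = mat_trace (row_proj A)"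
proof -
  have At: "transpose_mat A \<in> carrier_mat n d" using A by simp
  define L where "L = row_proj (transpose_mat A)"
  have L: "is_proj d L" "transpose_mat A * L = transpose_mat A" using row_proj[OF At] by (auto simp: L_def)
  note cL = is_proj_carrier[OF L(1)]
  obtain Y where Y: "Y \<in> carrier_mat n d" "L = A * Y"
    using row_proj(1)[OF At] A by (auto simp: is_row_proj_def L_def)
  have LA: "L * A = A"
  proof -
    have "L * A = transpose_mat (transpose_mat A * L)"
      using transpose_mult[OF At cL] is_proj_transpose[OF L(1)] by simp
    then show ?thesis using L(2) by simp
  qed
  obtain X where X: "X \<in> carrier_mat n d" "row_proj A = X * A" "A * X * A = A"
    using row_proj_left_factor[OF A row_proj(1)[OF A]] by blast
  have "mat_trace (row_proj A) = mat_trace (A * X)" using X A mat_trace_mult_comm by metis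
  also have "A * X = L * (A * X)" using LA A X cL by (metis assoc_mult_mat)
  also have "mat_trace \<dots> = mat_trace ((A * X) * L)"
    using A X cL by (intro mat_trace_mult_comm[of _ d d]) auto
  also have "(A * X) * L = A * X * A * Y"
    unfolding Y(2) using A X(1) Y(1) by (intro assoc_mult_mat[of _ d d _ n _ d, symmetric]) auto
  also have "\<dots> = L" using X Y by simp
  finally show ?thesis by (simp add: L_def)
qed

text \<open>Links the rank, the size of a maximal independent set of columns, to the trace. With
  \<open>B\<close> formed from such columns, \<open>A = B * C\<close> bounds the trace by
  \<open>r\<close>; conversely \<open>B = A * D\<close>, together with the injectivity of
  \<open>B\<close>, bounds it from below.\<close>

lemma rank_eq_mat_trace_row_proj:
  fixes A :: "real mat"
  assumes A: "A \<in> carrier_mat d n"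
  shows "real (vec_space.rank d A) = mat_trace (row_proj A)"
proof -
  interpret vec_space "TYPE(real)" d .
  define P where "P T \<longleftrightarrow> T \<subseteq> set (cols A) \<and> lin_indpt T" for T
  have "P {}" unfolding P_def using finite_lin_indpt2[of "{}"] by simp
  then obtain S where S: "maximal S P"
    using maximal_exists_superset[of "set (cols A)" P "{}"] by (auto simp: P_def)
  have rank: "rank A = card S" using rank_card_indpt[OF A] S by (simp add: P_def[abs_def])
  have Ssub: "S \<subseteq> set (cols A)" and Sind: "lin_indpt S" using S by (auto simp: maximal_def P_def)
  have fin: "finite S" using Ssub finite_subset by blast
  obtain bs where bs: "set bs = S" "distinct bs" using finite_distinct_list[OF fin] by blast
  define r where "r = length bs"
  have r: "rank A = r" using rank bs by (simp add: r_def distinct_card[symmetric])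
  have Ac: "set (cols A) \<subseteq> carrier_vec d" using A cols_dim by blast
  then have Sc: "S \<subseteq> carrier_vec d" using Ssub by blast
  define B where "B = mat_of_cols d bs"
  have B: "B \<in> carrier_mat d r" by (simp add: B_def r_def)
  have colsB: "cols B = bs" using Sc bs by (simp add: B_def)
  have inj: "v = 0\<^sub>v r" if "v \<in> carrier_vec r" "B *\<^sub>v v = 0\<^sub>v d" for v
    using lin_depI[OF B that(1) _ that(2)] Sind bs colsB by auto
  have B_unit: "B *\<^sub>v unit_vec r k = bs ! k" if "k < r" for k
    using that mat_mult_unit_vec[OF B that] colsB B cols_nth[of k B] by simp
  have span: "\<exists>v\<in>carrier_vec r. c = B *\<^sub>v v" if c: "c \<in> set (cols A)" for c
  proof (cases "c \<in> S")
    case True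
    then obtain k where "k < r" "c = bs ! k" using bs by (auto simp: in_set_conv_nth r_def)
    then show ?thesis using B_unit by (metis unit_vec_carrier)
  next
    case False
    then have "\<not> P (insert c S)" using S by (auto simp: maximal_def)
    then have "lin_dep (insert c S)" using c Ssub by (auto simp: P_def)
    then have "c \<in> span S"
      using lin_dep_iff_in_span[of S c] Sc Sind Ac c False by auto
    then obtain a where "c = lincomb a S" using finite_in_span[OF fin Sc] by blast
    then have "c = B *\<^sub>v vec r (\<lambda>i. a (col B i))"
      using mat_mult_eq_lincomb[OF B, of a] bs colsB by simp
    then show ?thesis by auto
  qed
  have "\<forall>j<n. \<exists>v\<in>carrier_vec r. col A j = B *\<^sub>v v"
    using span A by (auto simp: cols_def)
  then obtain f where f: "\<And>j. j < n \<Longrightarrow> f j \<in> carrier_vec r \<and> col A j = B *\<^sub>v f j"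
    by metis
  define C where "C = mat_of_cols r (map f [0..<n])"
  have C: "C \<in> carrier_mat r n" by (intro carrier_matI) (simp_all add: C_def)
  have colC: "col C j = f j" if "j < n" for j
    using that f by (simp add: C_def)
  have AC: "A = B * C"
  proof (rule eq_matI)
    fix i j assume ij: "i < dim_row (B * C)" "j < dim_col (B * C)"
    then have "(B * C) $$ (i, j) = (B *\<^sub>v f j) $ i" using B C colC by simp
    also have "\<dots> = col A j $ i" using f ij C by simp
    finally show "A $$ (i, j) = (B * C) $$ (i, j)" using A B C ij by simp
  qed (use A B C in auto)
  have "mat_trace (row_proj A) \<le> mat_trace (row_proj C)"
    using range_subset_imp_trace_le[OF row_proj(2)[OF A] row_proj(2)[OF C]]
      row_proj_mult_right[OF A C AC B] by blast
  then have le: "mat_trace (row_proj A) \<le> r" using row_proj(4)[OF C] by simp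
  have "\<exists>D \<in> carrier_mat n r. B = A * D"
  proof -
    have "\<forall>k<r. \<exists>j<n. bs ! k = col A j"
      using bs Ssub A by (fastforce simp: r_def cols_def dest: nth_mem)
    then obtain g where g: "\<And>k. k < r \<Longrightarrow> g k < n \<and> bs ! k = col A (g k)" by metis
    define D :: "real mat" where "D = mat_of_cols n (map (\<lambda>k. unit_vec n (g k)) [0..<r])"
    have D: "D \<in> carrier_mat n r" by (intro carrier_matI) (simp_all add: D_def)
    have "B = A * D"
    proof (rule eq_matI)
      fix i j assume ij: "i < dim_row (A * D)" "j < dim_col (A * D)"
      then have j: "j < r" and i: "i < d" using A D by auto
      have "(A * D) $$ (i, j) = row A i \<bullet> col D j" using ij by simp
      also have "col D j = unit_vec n (g j)" using j by (simp add: D_def)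
      also have "row A i \<bullet> unit_vec n (g j) = A $$ (i, g j)"
        using i j g[OF j] A by (subst scalar_prod_right_unit[of _ n]) auto
      also have "\<dots> = (bs ! j) $ i" using i g[OF j] A by simp
      also have "\<dots> = B $$ (i, j)" using i j by (simp add: B_def mat_of_cols_def r_def)
      finally show "B $$ (i, j) = (A * D) $$ (i, j)" by simp
    qed (use A B D in auto)
    then show ?thesis using D by blast
  qed
  then obtain D where D: "D \<in> carrier_mat n r" "B = A * D" by blast
  have "transpose_mat B = transpose_mat D * transpose_mat A"
    using A D by (simp add: transpose_mult[of _ d n _ r])
  then have "mat_trace (row_proj (transpose_mat B)) \<le> mat_trace (row_proj (transpose_mat A))"
    using A B D row_proj_mult_right[of "transpose_mat B" r d "transpose_mat A" n "transpose_mat D"]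
    by (intro range_subset_imp_trace_le[of d] row_proj(2)) auto
  then have ge: "mat_trace (row_proj B) \<le> mat_trace (row_proj A)"
    using mat_trace_row_proj_transpose A B by simp
  have "row_proj B = 1\<^sub>m r"
  proof (rule mat_eq_by_mult_vec[of _ r r])
    fix x :: "real vec" assume x: "x \<in> carrier_vec r"
    note PB = row_proj[OF B]
    have "B *\<^sub>v (x - row_proj B *\<^sub>v x) = 0\<^sub>v d"
      using B x PB is_proj_carrier[OF PB(2)]
      by (simp add: mult_minus_distrib_mat_vec[of _ d r] assoc_mult_mat_vec[of _ d r _ r, symmetric])
    then have "x - row_proj B *\<^sub>v x = 0\<^sub>v r" using inj[of "x - row_proj B *\<^sub>v x"] x PB(2) by simp
    then show "row_proj B *\<^sub>v x = 1\<^sub>m r *\<^sub>v x"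
      using vec_zero_diff_eq[OF x, of "row_proj B *\<^sub>v x"] x PB(2) by simp
  qed (use is_proj_carrier[OF row_proj(2)[OF B]] in auto)
  then show ?thesis using r le ge by simp
qed

section \<open>Reflection invariance of the standard Gaussian measure\<close>

abbreviation lborel_PiM :: "nat set \<Rightarrow> (nat \<Rightarrow> real) measure" where
  "lborel_PiM I \<equiv> Pi\<^sub>M I (\<lambda>_. lborel)"

interpretation lborel_product: product_sigma_finite "\<lambda>_::nat. lborel :: real measure"
  by unfold_locales

lemma nn_integral_lborel_reflect_translate:
  assumes F: "F \<in> borel_measurable borel" and s: "s = 1 \<or> s = -1"
  shows "(\<integral>\<^sup>+y. F (s * y + c) \<partial>lborel) = (\<integral>\<^sup>+y. F y \<partial>(lborel :: real measure))"
  using nn_integral_real_affine[OF F, of s c] s by (auto simp: add.commute)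

text \<open>Fubini in coordinate \<open>i\<close>: with the other coordinates fixed, the map is a
  translation of the line, possibly reflected, and the offset \<open>c\<close> does not depend on
  the coordinate being integrated.\<close>

lemma nn_integral_PiM_lborel_shear:
  assumes I: "finite I" "i \<in> I"
    and F: "F \<in> borel_measurable (Pi\<^sub>M I (\<lambda>_. borel))" and s: "s = 1 \<or> s = -1"
    and c: "c \<in> borel_measurable (Pi\<^sub>M I (\<lambda>_. borel))" "\<And>x y. c (x(i := y)) = c x"
  shows "(\<integral>\<^sup>+x. F (x(i := s * x i + c x)) \<partial>lborel_PiM I) = (\<integral>\<^sup>+x. F x \<partial>lborel_PiM I)"
proof -
  let ?J = "I - {i}"
  have Iins: "insert i ?J = I" using I by blast
  have J: "finite ?J" "i \<notin> ?J" using I by auto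
  have "sets (lborel_PiM I) = sets (Pi\<^sub>M I (\<lambda>_. borel :: real measure))"
    by (intro sets_PiM_cong) auto
  then have meas: "f \<in> borel_measurable (lborel_PiM I)"
    if "f \<in> borel_measurable (Pi\<^sub>M I (\<lambda>_. borel))" for f :: "_ \<Rightarrow> 'x :: topological_space"
    using that by (simp cong: measurable_cong_sets)
  have upd: "(\<lambda>x. x(i := s * x i + c x)) \<in> Pi\<^sub>M I (\<lambda>_. borel) \<rightarrow>\<^sub>M Pi\<^sub>M I (\<lambda>_. borel)"
    using I c by (intro measurable_fun_upd[where J = I]) auto
  have updy: "(\<lambda>y. x(i := y)) \<in> borel \<rightarrow>\<^sub>M Pi\<^sub>M I (\<lambda>_. borel)" if "x \<in> space (lborel_PiM ?J)" for x :: "nat \<Rightarrow> real"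
    using that I by (intro measurable_fun_upd[where J = "?J"]) (auto simp: space_PiM)
  have Fc: "(\<lambda>x. F (x(i := s * x i + c x))) \<in> borel_measurable (Pi\<^sub>M I (\<lambda>_. borel))"
    using measurable_compose[OF upd F] .
  have "(\<integral>\<^sup>+x. F (x(i := s * x i + c x)) \<partial>lborel_PiM I) =
    (\<integral>\<^sup>+x. \<integral>\<^sup>+y. F (x(i := s * y + c x)) \<partial>lborel \<partial>lborel_PiM ?J)"
    using lborel_product.product_nn_integral_insert[OF J, of "\<lambda>x. F (x(i := s * x i + c x))", unfolded Iins] meas[OF Fc]
    by (simp add: c(2))
  also have "\<dots> = (\<integral>\<^sup>+x. \<integral>\<^sup>+y. F (x(i := y)) \<partial>lborel \<partial>lborel_PiM ?J)"
  proof (rule nn_integral_cong)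
    fix x :: "nat \<Rightarrow> real" assume x: "x \<in> space (lborel_PiM ?J)"
    show "(\<integral>\<^sup>+y. F (x(i := s * y + c x)) \<partial>lborel) = (\<integral>\<^sup>+y. F (x(i := y)) \<partial>lborel)"
      using nn_integral_lborel_reflect_translate[OF measurable_compose[OF updy[OF x] F] s] .
  qed
  also have "\<dots> = (\<integral>\<^sup>+x. F x \<partial>lborel_PiM I)"
    using lborel_product.product_nn_integral_insert[OF J, of F, unfolded Iins] meas[OF F] by simp
  finally show ?thesis .
qed

lemma nn_integral_PiM_lborel_shear_many:
  assumes I: "finite I" "i \<in> I" and J: "J \<subseteq> I - {i}"
    and F: "F \<in> borel_measurable (Pi\<^sub>M I (\<lambda>_. borel))"
  shows "(\<integral>\<^sup>+x. F (\<lambda>j. if j \<in> J then x j + a j * x i else x j) \<partial>lborel_PiM I) = (\<integral>\<^sup>+x. F x \<partial>lborel_PiM I)"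
proof -
  have "finite J" using I J finite_subset by blast
  then show ?thesis using J F
  proof (induction J arbitrary: F rule: finite_induct)
    case (insert k J)
    let ?F = "\<lambda>x. F (x(k := 1 * x k + a k * x i))"
    have k: "k \<in> I" "k \<noteq> i" using insert by auto
    have upd: "(\<lambda>x. x(k := 1 * x k + a k * x i)) \<in> Pi\<^sub>M I (\<lambda>_. borel) \<rightarrow>\<^sub>M Pi\<^sub>M I (\<lambda>_. borel :: real measure)"
      using I k by (intro measurable_fun_upd[where J = I]) auto
    have eq: "(\<lambda>j. if j \<in> insert k J then x j + a j * x i else x j) =
      (\<lambda>x. x(k := 1 * x k + a k * x i)) (\<lambda>j. if j \<in> J then x j + a j * x i else x j)" for x :: "nat \<Rightarrow> real"
      using insert k by (auto simp: fun_eq_iff)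
    have "(\<integral>\<^sup>+x. F (\<lambda>j. if j \<in> insert k J then x j + a j * x i else x j) \<partial>lborel_PiM I) =
      (\<integral>\<^sup>+x. ?F (\<lambda>j. if j \<in> J then x j + a j * x i else x j) \<partial>lborel_PiM I)"
      unfolding eq ..
    also have "\<dots> = (\<integral>\<^sup>+x. ?F x \<partial>lborel_PiM I)"
      using insert by (intro insert.IH measurable_compose[OF upd]) auto
    also have "\<dots> = (\<integral>\<^sup>+x. F x \<partial>lborel_PiM I)"
      using I insert k by (intro nn_integral_PiM_lborel_shear) auto
    finally show ?case .
  qed auto
qed

text \<open>The reflection is factored into three maps of shear type relative to a coordinate
  \<open>i\<close> with \<open>v i \<noteq> 0\<close>, so that only one-dimensional changes of
  variable occur and no determinant is computed.\<close>

lemma nn_integral_PiM_lborel_reflection: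
  fixes v :: "nat \<Rightarrow> real"
  assumes I: "finite I" and v: "(\<Sum>i\<in>I. (v i)\<^sup>2) = 1"
    and F: "F \<in> borel_measurable (Pi\<^sub>M I (\<lambda>_. borel))"
  shows "(\<integral>\<^sup>+x. F (\<lambda>i\<in>I. x i - 2 * (\<Sum>j\<in>I. v j * x j) * v i) \<partial>lborel_PiM I) = (\<integral>\<^sup>+x. F x \<partial>lborel_PiM I)"
proof -
  obtain i where i: "i \<in> I" "v i \<noteq> 0"
    using v by (metis (mono_tags, lifting) power_zero_numeral sum.neutral zero_neq_one)
  let ?J = "I - {i}"
  define c where "c x = (\<Sum>j\<in>?J. v j / v i * x j)" for x :: "nat \<Rightarrow> real"
  \<comment> \<open>With \<open>s\<close> the inner product of \<open>v\<close> and
    \<open>x\<close>: \<open>T1\<close> puts \<open>s / v i\<close> into coordinate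
    \<open>i\<close>, \<open>T2\<close> uses this value to subtract \<open>2 * s * v j\<close> from
    every other coordinate \<open>j\<close>, and \<open>T3\<close> recovers the reflected coordinate
    \<open>i\<close> from the changed ones. The sign in \<open>T3\<close> accounts for the
    determinant -1 of a reflection.\<close>
  define T1 where "T1 x = x(i := 1 * x i + c x)" for x :: "nat \<Rightarrow> real"
  define T2 where "T2 x = (\<lambda>j. if j \<in> ?J then x j + (- 2 * v j * v i) * x i else x j)" for x :: "nat \<Rightarrow> real"
  define T3 where "T3 x = x(i := (-1) * x i + - c x)" for x :: "nat \<Rightarrow> real"
  have c: "c \<in> borel_measurable (Pi\<^sub>M I (\<lambda>_. borel))" "\<And>x y. c (x(i := y)) = c x"
    unfolding c_def by (auto intro!: borel_measurable_sum borel_measurable_times measurable_component_singleton sum.cong)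
  have T3m: "T3 \<in> Pi\<^sub>M I (\<lambda>_. borel) \<rightarrow>\<^sub>M Pi\<^sub>M I (\<lambda>_. borel)"
    unfolding T3_def using I i c by (intro measurable_fun_upd[where J = I]) auto
  have T2m: "T2 \<in> Pi\<^sub>M I (\<lambda>_. borel) \<rightarrow>\<^sub>M Pi\<^sub>M I (\<lambda>_. borel)"
  proof (rule measurable_PiM_single')
    fix k assume k: "k \<in> I"
    show "(\<lambda>x. T2 x k) \<in> Pi\<^sub>M I (\<lambda>_. borel) \<rightarrow>\<^sub>M borel"
      unfolding T2_def using i(1) k by (cases "k \<in> ?J") auto
  qed (use i in \<open>auto simp: T2_def space_PiM PiE_def extensional_def\<close>)
  have eq: "(\<lambda>k\<in>I. x k - 2 * (\<Sum>j\<in>I. v j * x j) * v k) = T3 (T2 (T1 x))"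
    if x: "x \<in> space (lborel_PiM I)" for x
  proof
    fix k
    define s where "s = (\<Sum>j\<in>I. v j * x j)"
    have s: "s = v i * x i + (\<Sum>j\<in>?J. v j * x j)"
      unfolding s_def using I i by (simp add: sum.remove)
    have cx: "c x = (s - v i * x i) / v i"
      unfolding c_def s by (simp add: sum_divide_distrib)
    then have 1: "T1 x i = s / v i" using i by (simp add: T1_def field_simps)
    have T1k: "T1 x k = x k" if "k \<noteq> i" for k using that by (simp add: T1_def)
    have T2k: "T2 (T1 x) k = x k - 2 * s * v k" if "k \<in> ?J" for k
      using that i 1 T1k by (auto simp: T2_def field_simps)
    have T2i: "T2 (T1 x) i = s / v i" using 1 by (simp add: T2_def)
    have vv: "(\<Sum>j\<in>?J. (v j)\<^sup>2) = 1 - (v i)\<^sup>2"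
      using v I i by (simp add: sum.remove)
    have "c (T2 (T1 x)) = (\<Sum>j\<in>?J. v j / v i * (x j - 2 * s * v j))"
      unfolding c_def by (intro sum.cong) (auto simp: T2k)
    also have "\<dots> = c x - 2 * s / v i * (\<Sum>j\<in>?J. (v j)\<^sup>2)"
      by (simp add: c_def sum_subtractf sum_distrib_left power2_eq_square algebra_simps)
    finally have cT: "c (T2 (T1 x)) = c x - 2 * s / v i * (1 - (v i)\<^sup>2)"
      unfolding vv .
    have "T3 (T2 (T1 x)) i = - (s / v i) - c (T2 (T1 x))"
      by (simp add: T3_def T2i)
    also have "\<dots> = x i - 2 * s * v i"
      unfolding cT cx using i by (simp add: field_simps power2_eq_square)
    finally have "T3 (T2 (T1 x)) i = x i - 2 * s * v i" .
    moreover have "T3 (T2 (T1 x)) k = x k - 2 * s * v k" if "k \<in> I" "k \<noteq> i"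
      using T2k[of k] that by (simp add: T3_def)
    moreover have "T3 (T2 (T1 x)) k = undefined" if "k \<notin> I"
      using that i x by (auto simp: T3_def T2_def T1_def space_PiM PiE_def extensional_def)
    ultimately show "(\<lambda>k\<in>I. x k - 2 * (\<Sum>j\<in>I. v j * x j) * v k) k = T3 (T2 (T1 x)) k"
      unfolding s_def[symmetric] by (cases "k = i") auto
  qed
  have "(\<integral>\<^sup>+x. F (\<lambda>i\<in>I. x i - 2 * (\<Sum>j\<in>I. v j * x j) * v i) \<partial>lborel_PiM I) =
      (\<integral>\<^sup>+x. F (T3 (T2 (T1 x))) \<partial>lborel_PiM I)"
    using eq by (intro nn_integral_cong) auto
  also have "\<dots> = (\<integral>\<^sup>+x. F (T3 (T2 x)) \<partial>lborel_PiM I)"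
    unfolding T1_def
    by (rule nn_integral_PiM_lborel_shear[OF I i(1), of "\<lambda>x. F (T3 (T2 x))" 1 c])
       (use c in \<open>auto intro!: measurable_compose[OF T2m] measurable_compose[OF T3m] F\<close>)
  also have "\<dots> = (\<integral>\<^sup>+x. F (T3 x) \<partial>lborel_PiM I)"
    unfolding T2_def
    by (rule nn_integral_PiM_lborel_shear_many[OF I i(1), of ?J "\<lambda>x. F (T3 x)"])
       (auto intro!: measurable_compose[OF T3m] F)
  also have "\<dots> = (\<integral>\<^sup>+x. F x \<partial>lborel_PiM I)"
    unfolding T3_def
    by (rule nn_integral_PiM_lborel_shear[OF I i(1), of F "-1" "\<lambda>x. - c x"])
       (use c F in auto)
  finally show ?thesis .
qed

section \<open>The standard Gaussian measure on coordinate functions\<close>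

definition gauss :: "nat \<Rightarrow> (nat \<Rightarrow> real) measure" where
  "gauss n = Pi\<^sub>M {..<n} (\<lambda>_. std_normal_distribution)"

interpretation std_normal: prob_space std_normal_distribution
  using real_dist_normal_dist by (simp add: real_distribution_def)

interpretation std_normal_product: product_sigma_finite "\<lambda>_::nat. std_normal_distribution"
  by unfold_locales

interpretation gauss: prob_space "gauss n" for n
  unfolding gauss_def by (rule prob_space_PiM) unfold_locales

lemma sets_gauss [measurable_cong]: "sets (gauss n) = sets (Pi\<^sub>M {..<n} (\<lambda>_. borel))"
  unfolding gauss_def by (intro sets_PiM_cong) auto

lemma space_gauss: "space (gauss n) = {..<n} \<rightarrow>\<^sub>E UNIV"
  by (simp add: gauss_def space_PiM)

lemma measurable_gauss_component [measurable]: "i < n \<Longrightarrow> (\<lambda>g. g i) \<in> borel_measurable (gauss n)"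
  using measurable_component_singleton[of i "{..<n}" "\<lambda>_. borel :: real measure"]
  by (simp cong: measurable_cong_sets add: sets_gauss)

lemma gauss_density:
  "gauss n = density (lborel_PiM {..<n}) (\<lambda>x. ennreal (\<Prod>i<n. std_normal_density (x i)))"
  unfolding gauss_def
proof (rule std_normal_product.PiM_eqI[symmetric])
  show "sets (density (lborel_PiM {..<n}) (\<lambda>x. ennreal (\<Prod>i<n. std_normal_density (x i)))) =
    sets (Pi\<^sub>M {..<n} (\<lambda>_. std_normal_distribution))"
    by (simp cong: sets_PiM_cong)
  fix A :: "nat \<Rightarrow> real set" assume A: "\<And>i. i \<in> {..<n} \<Longrightarrow> A i \<in> sets std_normal_distribution"
  have m: "(\<lambda>x. ennreal (\<Prod>i<n. std_normal_density (x i))) \<in> borel_measurable (lborel_PiM {..<n})"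
    by measurable
  have "Pi\<^sub>E {..<n} A \<in> sets (lborel_PiM {..<n})" using A by (intro sets_PiM_I_finite) auto
  then have "emeasure (density (lborel_PiM {..<n}) (\<lambda>x. ennreal (\<Prod>i<n. std_normal_density (x i)))) (Pi\<^sub>E {..<n} A) =
    (\<integral>\<^sup>+x. ennreal (\<Prod>i<n. std_normal_density (x i)) * indicator (Pi\<^sub>E {..<n} A) x \<partial>lborel_PiM {..<n})"
    using m by (simp add: emeasure_density)
  also have "\<dots> = (\<integral>\<^sup>+x. (\<Prod>i<n. ennreal (std_normal_density (x i)) * indicator (A i) (x i)) \<partial>lborel_PiM {..<n})"
  proof (rule nn_integral_cong)
    fix x assume "x \<in> space (lborel_PiM {..<n})"
    then have "indicator (Pi\<^sub>E {..<n} A) x = (\<Prod>i<n. indicator (A i) (x i) :: ennreal)"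
      by (cases "\<forall>i<n. x i \<in> A i")
        (auto simp: indicator_def space_PiM PiE_def Pi_def intro!: prod.neutral prod_zero[symmetric])
    then show "ennreal (\<Prod>i<n. std_normal_density (x i)) * indicator (Pi\<^sub>E {..<n} A) x =
      (\<Prod>i<n. ennreal (std_normal_density (x i)) * indicator (A i) (x i))"
      by (simp add: prod.distrib prod_ennreal)
  qed
  also have "\<dots> = (\<Prod>i<n. \<integral>\<^sup>+x. ennreal (std_normal_density x) * indicator (A i) x \<partial>lborel)"
    using A by (intro lborel_product.product_nn_integral_prod) auto
  also have "\<dots> = (\<Prod>i<n. emeasure std_normal_distribution (A i))"
    using A by (intro prod.cong) (auto simp: emeasure_density)
  finally show "emeasure (density (lborel_PiM {..<n}) (\<lambda>x. ennreal (\<Prod>i<n. std_normal_density (x i)))) (Pi\<^sub>E {..<n} A) =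
    (\<Prod>i\<in>{..<n}. emeasure std_normal_distribution (A i))" .
qed simp

text \<open>The Lebesgue product is preserved, and the density depends only on the sum of squares,
  which the reflection preserves as well.\<close>

lemma nn_integral_gauss_reflection:
  fixes v :: "nat \<Rightarrow> real"
  assumes v: "(\<Sum>i<n. (v i)\<^sup>2) = 1"
    and F: "F \<in> borel_measurable (Pi\<^sub>M {..<n} (\<lambda>_. borel))"
  shows "(\<integral>\<^sup>+x. F (\<lambda>i\<in>{..<n}. x i - 2 * (\<Sum>j<n. v j * x j) * v i) \<partial>gauss n) = (\<integral>\<^sup>+x. F x \<partial>gauss n)"
proof -
  define H where "H x = (\<lambda>i\<in>{..<n}. x i - 2 * (\<Sum>j<n. v j * x j) * v i)" for x :: "nat \<Rightarrow> real"
  define \<rho> where "\<rho> x = ennreal (\<Prod>i<n. std_normal_density (x i))" for x :: "nat \<Rightarrow> real"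
  have setseq: "sets (lborel_PiM {..<n}) = sets (Pi\<^sub>M {..<n} (\<lambda>_. borel :: real measure))"
    by (intro sets_PiM_cong) auto
  have rho: "\<rho> \<in> borel_measurable (Pi\<^sub>M {..<n} (\<lambda>_. borel))"
    unfolding \<rho>_def by measurable
  have H: "H \<in> Pi\<^sub>M {..<n} (\<lambda>_. borel) \<rightarrow>\<^sub>M Pi\<^sub>M {..<n} (\<lambda>_. borel)"
    unfolding H_def
    by (intro measurable_restrict borel_measurable_diff borel_measurable_times borel_measurable_sum
        measurable_const measurable_component_singleton) auto
  have rhoH: "\<rho> (H x) = \<rho> x" for x
  proof -
    define s where "s = (\<Sum>j<n. v j * x j)"
    have "(\<Sum>i<n. (H x i)\<^sup>2) = (\<Sum>i<n. (x i)\<^sup>2 - 4 * s * (v i * x i) + 4 * s\<^sup>2 * (v i)\<^sup>2)"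
      unfolding H_def s_def[symmetric]
      by (intro sum.cong) (auto simp: power2_eq_square algebra_simps)
    also have "\<dots> = (\<Sum>i<n. (x i)\<^sup>2) - 4 * s * (\<Sum>i<n. v i * x i) + 4 * s\<^sup>2 * (\<Sum>i<n. (v i)\<^sup>2)"
      by (simp add: sum.distrib sum_subtractf sum_distrib_left)
    also have "\<dots> = (\<Sum>i<n. (x i)\<^sup>2)"
      using v by (simp add: s_def[symmetric] power2_eq_square)
    finally have *: "(\<Sum>i<n. (H x i)\<^sup>2) = (\<Sum>i<n. (x i)\<^sup>2)" .
    have dens: "(\<Prod>i<n. std_normal_density (z i)) = (1 / sqrt (2 * pi)) ^ n * exp (- (\<Sum>i<n. (z i)\<^sup>2) / 2)"
      for z :: "nat \<Rightarrow> real"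
    proof -
      have "std_normal_density a = (1 / sqrt (2 * pi)) * exp (- (a\<^sup>2 / 2))" for a :: real
        by (simp add: std_normal_density_def)
      then have "(\<Prod>i<n. std_normal_density (z i)) = (1 / sqrt (2 * pi)) ^ n * (\<Prod>i<n. exp (- ((z i)\<^sup>2 / 2)))"
        by (simp only: prod.distrib prod_constant card_lessThan)
      then show ?thesis
        by (simp add: exp_sum[symmetric] sum_negf sum_divide_distrib)
    qed
    show ?thesis unfolding \<rho>_def dens * ..
  qed
  have FH: "(\<lambda>x. F (H x)) \<in> borel_measurable (Pi\<^sub>M {..<n} (\<lambda>_. borel))"
    using measurable_compose[OF H F] .
  have *: "(\<integral>\<^sup>+x. f x \<partial>gauss n) = (\<integral>\<^sup>+x. \<rho> x * f x \<partial>lborel_PiM {..<n})"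
    if "f \<in> borel_measurable (Pi\<^sub>M {..<n} (\<lambda>_. borel))" for f
    unfolding gauss_density \<rho>_def[symmetric] using that rho
    by (intro nn_integral_density) (simp_all cong: measurable_cong_sets add: setseq)
  have "(\<integral>\<^sup>+x. F (H x) \<partial>gauss n) = (\<integral>\<^sup>+x. \<rho> (H x) * F (H x) \<partial>lborel_PiM {..<n})"
    by (simp add: *[OF FH] rhoH)
  also have "\<dots> = (\<integral>\<^sup>+x. \<rho> x * F x \<partial>lborel_PiM {..<n})"
    unfolding H_def
    by (rule nn_integral_PiM_lborel_reflection[OF _ v, of "\<lambda>x. \<rho> x * F x"]) (use rho F in auto)
  also have "\<dots> = (\<integral>\<^sup>+x. F x \<partial>gauss n)" by (simp add: *[OF F])
  finally show ?thesis unfolding H_def .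
qed

text \<open>Given the other coordinates, the equation fixes coordinate \<open>i\<close> at a single
  value, and a single point is null for the normal law. The almost sure non-degeneracy of Gaussian
  vectors used below reduces to this.\<close>

lemma AE_gauss_hyperplane:
  assumes y: "i < n" "y i \<noteq> 0"
  shows "AE g in gauss n. (\<Sum>i<n. y i * g i) \<noteq> (0::real)"
proof -
  let ?J = "{..<n} - {i}"
  have ins: "insert i ?J = {..<n}" and J: "finite ?J" "i \<notin> ?J" using y by auto
  have m: "{g \<in> space (gauss n). (\<Sum>i<n. y i * g i) = 0} \<in> sets (gauss n)" by measurable
  let ?f = "\<lambda>g. indicator {g \<in> space (gauss n). (\<Sum>i<n. y i * g i) = 0} g :: ennreal"
  have "emeasure (gauss n) {g \<in> space (gauss n). (\<Sum>i<n. y i * g i) = 0} = (\<integral>\<^sup>+g. ?f g \<partial>gauss n)"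
    using m by simp
  also have "\<dots> = (\<integral>\<^sup>+x. \<integral>\<^sup>+z. ?f (x(i := z)) \<partial>std_normal_distribution \<partial>Pi\<^sub>M ?J (\<lambda>_. std_normal_distribution))"
    using std_normal_product.product_nn_integral_insert[OF J, of ?f, unfolded ins] m
    by (simp add: gauss_def[symmetric])
  also have "\<dots> = (\<integral>\<^sup>+x. 0 \<partial>Pi\<^sub>M ?J (\<lambda>_. std_normal_distribution))"
  proof (rule nn_integral_cong)
    fix x assume "x \<in> space (Pi\<^sub>M ?J (\<lambda>_. std_normal_distribution))"
    define a where "a = - (\<Sum>j\<in>?J. y j * x j) / y i"
    have "(\<Sum>j<n. y j * (x(i := z)) j) = y i * z + (\<Sum>j\<in>?J. y j * x j)" for z
      using y by (simp add: sum.remove[of _ i])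
    then have "?f (x(i := z)) \<le> indicator {a} z" for z
      using y by (auto simp: indicator_def a_def field_simps split: if_splits)
    then have "(\<integral>\<^sup>+z. ?f (x(i := z)) \<partial>std_normal_distribution) \<le> (\<integral>\<^sup>+z. indicator {a} z \<partial>std_normal_distribution)"
      by (intro nn_integral_mono) auto
    also have "\<dots> = emeasure std_normal_distribution {a}" by simp
    also have "\<dots> = 0"
    proof -
      have "AE z in lborel. z \<noteq> a" by (rule AE_lborel_singleton)
      then show ?thesis
        by (subst emeasure_density) (auto intro!: nn_integral_zero' elim!: AE_mp)
    qed
    finally show "(\<integral>\<^sup>+z. ?f (x(i := z)) \<partial>std_normal_distribution) = 0" by simp
  qed
  also have "\<dots> = 0" by simp
  finally show ?thesis using m
    by (intro AE_I'[of "{g \<in> space (gauss n). (\<Sum>i<n. y i * g i) = 0}"]) (auto simp: null_sets_def)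
qed

section \<open>Reflections and measurability of matrix-valued maps\<close>

definition reflection :: "nat \<Rightarrow> real vec \<Rightarrow> real mat" where
  "reflection n v = 1\<^sub>m n - 2 \<cdot>\<^sub>m outer_square v"

lemma reflection_carrier [simp]: "v \<in> carrier_vec n \<Longrightarrow> reflection n v \<in> carrier_mat n n"
  by (auto simp: reflection_def intro!: minus_carrier_mat)

lemma reflection_mult_vec:
  assumes v: "v \<in> carrier_vec n" and x: "x \<in> carrier_vec n"
  shows "reflection n v *\<^sub>v x = x - (2 * (v \<bullet> x)) \<cdot>\<^sub>v v"
proof -
  have "(2 \<cdot>\<^sub>m outer_square v) *\<^sub>v x = 2 \<cdot>\<^sub>v (outer_square v *\<^sub>v x)"
    using v x by (intro eq_vecI) auto
  then show ?thesis
    unfolding reflection_def using v x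
    by (subst minus_mult_distrib_mat_vec[of _ n n]) (auto simp: outer_square_mult_vec smult_smult_assoc)
qed

lemma reflection_mult_vec_carrier [simp]:
  "v \<in> carrier_vec n \<Longrightarrow> x \<in> carrier_vec n \<Longrightarrow> reflection n v *\<^sub>v x \<in> carrier_vec n"
  by (simp add: reflection_mult_vec)

lemma reflection_transpose: "v \<in> carrier_vec n \<Longrightarrow> transpose_mat (reflection n v) = reflection n v"
  by (intro eq_matI) (auto simp: reflection_def outer_square_def)

lemma reflection_self_adjoint:
  assumes "v \<in> carrier_vec n" "x \<in> carrier_vec n" "y \<in> carrier_vec n"
  shows "(reflection n v *\<^sub>v x) \<bullet> y = x \<bullet> (reflection n v *\<^sub>v y)"
  using transpose_vec_mult_scalar[OF reflection_carrier[OF assms(1)] assms(3,2)] assms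
  by (simp add: reflection_transpose)

lemma reflection_reflection:
  assumes v: "v \<in> carrier_vec n" "v \<bullet> v = 1" and x: "x \<in> carrier_vec n"
  shows "reflection n v *\<^sub>v (reflection n v *\<^sub>v x) = x"
proof -
  have "v \<bullet> (x - (2 * (v \<bullet> x)) \<cdot>\<^sub>v v) = - (v \<bullet> x)"
    using v x by (subst scalar_prod_minus_distrib[of _ n]) auto
  then show ?thesis using v x by (intro eq_vecI) (auto simp: reflection_mult_vec)
qed

lemma reflection_mult_self:
  assumes v: "v \<in> carrier_vec n" "v \<bullet> v = 1"
  shows "reflection n v * reflection n v = 1\<^sub>m n"
  using v by (intro mat_eq_by_mult_vec[of _ n n])
    (auto simp: reflection_reflection assoc_mult_mat_vec[of _ n n _ n] intro: mult_carrier_mat[of _ n n])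

lemma reflection_isometry:
  assumes "v \<in> carrier_vec n" "v \<bullet> v = 1" "x \<in> carrier_vec n" "y \<in> carrier_vec n"
  shows "(reflection n v *\<^sub>v x) \<bullet> (reflection n v *\<^sub>v y) = x \<bullet> y"
  using assms by (simp add: reflection_self_adjoint reflection_reflection)

text \<open>For vectors of equal length,
  \<open>(x - y) \<bullet> (x - y) = 2 * ((x - y) \<bullet> x)\<close>, so the mirror perpendicular
  to \<open>x - y\<close> takes one to the other.\<close>

lemma reflection_exchange:
  assumes x: "x \<in> carrier_vec n" and y: "y \<in> carrier_vec n" and eq: "x \<bullet> x = y \<bullet> y" and ne: "x \<noteq> y"
  shows "reflection n (normalize_vec (x - y)) *\<^sub>v x = y"
proof -
  let ?d = "x - y"
  have d: "?d \<in> carrier_vec n" using x y by simp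
  have d0: "?d \<noteq> 0\<^sub>v n" using vec_zero_diff_eq[OF x y] ne by blast
  have dx: "?d \<bullet> x = x \<bullet> x - y \<bullet> x" using x y by (subst minus_scalar_prod_distrib[of _ n]) auto
  have dy: "?d \<bullet> y = x \<bullet> y - y \<bullet> y" using x y by (subst minus_scalar_prod_distrib[of _ n]) auto
  have dd: "?d \<bullet> ?d = 2 * (?d \<bullet> x)"
    using x y dx dy eq comm_scalar_prod[OF x y] by (subst scalar_prod_minus_distrib[of _ n]) auto
  have pos: "0 < ?d \<bullet> ?d" using scalar_prod_self_pos[OF d d0] .
  have "(2 * (normalize_vec ?d \<bullet> x)) \<cdot>\<^sub>v normalize_vec ?d = ((2 * (?d \<bullet> x)) / (?d \<bullet> ?d)) \<cdot>\<^sub>v ?d"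
    using x d pos by (simp add: normalize_vec_def smult_smult_assoc)
  also have "\<dots> = ?d" using dd pos d by simp
  finally show ?thesis
    using x y d by (subst reflection_mult_vec) auto
qed

lemma reflection_fix:
  assumes "v \<in> carrier_vec n" "x \<in> carrier_vec n" "v \<bullet> x = 0"
  shows "reflection n v *\<^sub>v x = x"
  using assms by (simp add: reflection_mult_vec) (intro eq_vecI, auto)

lemma scalar_prod_range_kernel:
  assumes "is_proj n R" "x \<in> carrier_vec n" "y \<in> carrier_vec n" "R *\<^sub>v x = x" "R *\<^sub>v y = 0\<^sub>v n"
  shows "x \<bullet> y = 0"
  using is_proj_self_adjoint[OF assms(1-3)] assms by simp

lemma proj_reflection_in_range:
  assumes P: "is_proj n P" and v: "v \<in> carrier_vec n" "P *\<^sub>v v = v" and x: "x \<in> carrier_vec n"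
  shows "P *\<^sub>v (reflection n v *\<^sub>v x) = reflection n v *\<^sub>v (P *\<^sub>v x)"
proof -
  note c = is_proj_carrier[OF P]
  have "v \<bullet> (P *\<^sub>v x) = v \<bullet> x" using is_proj_self_adjoint[OF P v(1) x] v by simp
  then show ?thesis
    using P v x c
    by (simp add: reflection_mult_vec mult_minus_distrib_mat_vec[of _ n n] mult_mat_vec[of _ n n])
qed

lemma proj_reflection_in_kernel:
  assumes P: "is_proj n P" and v: "v \<in> carrier_vec n" "P *\<^sub>v v = 0\<^sub>v n" and x: "x \<in> carrier_vec n"
  shows "P *\<^sub>v (reflection n v *\<^sub>v x) = P *\<^sub>v x" "reflection n v *\<^sub>v (P *\<^sub>v x) = P *\<^sub>v x"
proof -
  note c = is_proj_carrier[OF P]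
  show "P *\<^sub>v (reflection n v *\<^sub>v x) = P *\<^sub>v x"
    using P v x c
    by (simp add: reflection_mult_vec mult_minus_distrib_mat_vec[of _ n n] mult_mat_vec[of _ n n])
  have "v \<bullet> (P *\<^sub>v x) = 0" using is_proj_self_adjoint[OF P v(1) x] v x by simp
  then show "reflection n v *\<^sub>v (P *\<^sub>v x) = P *\<^sub>v x"
    using P v x by (intro reflection_fix) auto
qed

text \<open>Projection onto the mirror image of the range of a projection \<open>R\<close>. Right
  multiplication of a matrix by a reflection acts in this way on its row projection.\<close>

definition conj_reflection :: "nat \<Rightarrow> real vec \<Rightarrow> real mat \<Rightarrow> real mat" where
  "conj_reflection n v R = reflection n v * R * reflection n v"

lemma conj_reflection_carrier [simp]:
  "v \<in> carrier_vec n \<Longrightarrow> R \<in> carrier_mat n n \<Longrightarrow> conj_reflection n v R \<in> carrier_mat n n"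
  by (auto simp: conj_reflection_def intro!: mult_carrier_mat[of _ n n])

lemma conj_reflection_mult_vec:
  assumes "v \<in> carrier_vec n" "R \<in> carrier_mat n n" "x \<in> carrier_vec n"
  shows "conj_reflection n v R *\<^sub>v x = reflection n v *\<^sub>v (R *\<^sub>v (reflection n v *\<^sub>v x))"
proof -
  have "conj_reflection n v R *\<^sub>v x = (reflection n v * R) *\<^sub>v (reflection n v *\<^sub>v x)"
    unfolding conj_reflection_def using assms
    by (intro assoc_mult_mat_vec[of _ n n _ n]) (auto intro: mult_carrier_mat[of _ n n])
  also have "\<dots> = reflection n v *\<^sub>v (R *\<^sub>v (reflection n v *\<^sub>v x))"
    using assms by (intro assoc_mult_mat_vec[of _ n n _ n]) (auto intro: mult_carrier_mat[of _ n n])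
  finally show ?thesis .
qed

lemma is_proj_conj_reflection:
  assumes R: "is_proj n R" and v: "v \<in> carrier_vec n" "v \<bullet> v = 1"
  shows "is_proj n (conj_reflection n v R)"
proof (rule is_projI)
  note c = is_proj_carrier[OF R]
  let ?H = "reflection n v"
  fix x y :: "real vec" assume x: "x \<in> carrier_vec n" and y: "y \<in> carrier_vec n"
  have "(?H *\<^sub>v (R *\<^sub>v (?H *\<^sub>v x))) \<bullet> y = (R *\<^sub>v (?H *\<^sub>v x)) \<bullet> (?H *\<^sub>v y)"
    using R v x y by (intro reflection_self_adjoint) auto
  also have "\<dots> = (?H *\<^sub>v x) \<bullet> (R *\<^sub>v (?H *\<^sub>v y))"
    using R v x y by (intro is_proj_self_adjoint) auto
  also have "\<dots> = x \<bullet> (?H *\<^sub>v (R *\<^sub>v (?H *\<^sub>v y)))"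
    using R v x y by (intro reflection_self_adjoint) auto
  finally show "(conj_reflection n v R *\<^sub>v x) \<bullet> y = x \<bullet> (conj_reflection n v R *\<^sub>v y)"
    unfolding conj_reflection_mult_vec[OF v(1) c x] conj_reflection_mult_vec[OF v(1) c y] .
next
  note c = is_proj_carrier[OF R]
  let ?H = "reflection n v"
  fix x :: "real vec" assume x: "x \<in> carrier_vec n"
  have Hx: "?H *\<^sub>v x \<in> carrier_vec n" using v x by simp
  have RHx: "R *\<^sub>v (?H *\<^sub>v x) \<in> carrier_vec n" using R by simp
  show "conj_reflection n v R *\<^sub>v (conj_reflection n v R *\<^sub>v x) = conj_reflection n v R *\<^sub>v x"
    unfolding conj_reflection_mult_vec[OF v(1) c x]
      conj_reflection_mult_vec[OF v(1) c reflection_mult_vec_carrier[OF v(1) RHx]]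
      reflection_reflection[OF v RHx] is_proj_idem[OF R Hx] ..
qed (rule conj_reflection_carrier[OF v(1) is_proj_carrier[OF R]])

section \<open>Measurability of matrix-valued maps and of existential events\<close>

lemma space_mat_borel: "space (mat_borel d n) = carrier_mat d n"
  by (simp add: mat_borel_def)

lemma measurable_mat_entry:
  assumes "i < d" "j < n"
  shows "(\<lambda>A. A $$ (i, j)) \<in> borel_measurable (mat_borel d n)"
proof -
  have "(\<lambda>A. \<lambda>ij\<in>{..<d} \<times> {..<n}. A $$ ij) \<in> mat_borel d n \<rightarrow>\<^sub>M Pi\<^sub>M ({..<d} \<times> {..<n}) (\<lambda>_. borel)"
    unfolding mat_borel_def by (rule measurable_vimage_algebra1) (auto simp: space_PiM)
  from measurable_compose[OF this measurable_component_singleton[of "(i, j)"]]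
  show ?thesis using assms by simp
qed

lemma measurable_mat_borelI:
  assumes "\<And>x. x \<in> space M \<Longrightarrow> f x \<in> carrier_mat d n"
    and "\<And>i j. i < d \<Longrightarrow> j < n \<Longrightarrow> (\<lambda>x. f x $$ (i, j)) \<in> borel_measurable M"
  shows "f \<in> M \<rightarrow>\<^sub>M mat_borel d n"
  unfolding mat_borel_def
proof (rule measurable_vimage_algebra2)
  show "(\<lambda>x. \<lambda>ij\<in>{..<d} \<times> {..<n}. f x $$ ij) \<in> M \<rightarrow>\<^sub>M Pi\<^sub>M ({..<d} \<times> {..<n}) (\<lambda>_. borel)"
    using assms(2) by (intro measurable_restrict) auto
qed (use assms in auto)

lemma measurable_mat_mult_entry:
  assumes "A \<in> M \<rightarrow>\<^sub>M mat_borel d m" "B \<in> M \<rightarrow>\<^sub>M mat_borel m n"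
  shows "(\<lambda>x. A x * B x) \<in> M \<rightarrow>\<^sub>M mat_borel d n"
proof (rule measurable_mat_borelI)
  have c: "A x \<in> carrier_mat d m" "B x \<in> carrier_mat m n" if "x \<in> space M" for x
    using measurable_space[OF assms(1) that] measurable_space[OF assms(2) that] by (auto simp: space_mat_borel)
  then show "A x * B x \<in> carrier_mat d n" if "x \<in> space M" for x
    using that by (intro mult_carrier_mat[of _ d m]) auto
  fix i j assume ij: "i < d" "j < n"
  have "(\<lambda>x. \<Sum>k<m. A x $$ (i, k) * B x $$ (k, j)) \<in> borel_measurable M"
    using ij by (intro borel_measurable_sum borel_measurable_times measurable_compose[OF assms(1) measurable_mat_entry]
        measurable_compose[OF assms(2) measurable_mat_entry]) auto
  moreover have "(\<Sum>k<m. A x $$ (i, k) * B x $$ (k, j)) = (A x * B x) $$ (i, j)" if "x \<in> space M" for x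
    using carrier_matD[OF c(1)[OF that]] carrier_matD[OF c(2)[OF that]] ij
    by (simp add: scalar_prod_def lessThan_atLeast0)
  ultimately show "(\<lambda>x. (A x * B x) $$ (i, j)) \<in> borel_measurable M"
    by (simp cong: measurable_cong)
qed

lemma countable_dense_subset:
  fixes K :: "'b :: second_countable_topology set"
  obtains D where "countable D" "D \<subseteq> K" "\<And>U. open U \<Longrightarrow> U \<inter> K \<noteq> {} \<Longrightarrow> U \<inter> D \<noteq> {}"
proof -
  obtain B :: "'b set set" where B: "countable B" "topological_basis B" using ex_countable_basis by blast
  define D where "D = (\<lambda>U. SOME x. x \<in> U \<inter> K) ` {U \<in> B. U \<inter> K \<noteq> {}}"
  have sel: "(SOME x. x \<in> U \<inter> K) \<in> U \<inter> K" if "U \<inter> K \<noteq> {}" for U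
    using that by (meson ex_in_conv someI_ex)
  have "U \<inter> D \<noteq> {}" if U: "open U" "U \<inter> K \<noteq> {}" for U
  proof -
    obtain x where x: "x \<in> U" "x \<in> K" using U by blast
    obtain V where V: "V \<in> B" "x \<in> V" "V \<subseteq> U" using topological_basisE[OF B(2) U(1) x(1)] by blast
    then have "(SOME x. x \<in> V \<inter> K) \<in> D" using x unfolding D_def by blast
    then show ?thesis using sel[of V] V x by blast
  qed
  moreover have "D \<subseteq> K" unfolding D_def using sel by blast
  moreover have "countable D" unfolding D_def using B by simp
  ultimately show thesis using that by blast
qed

text \<open>An existential quantifier over an uncountable set need not preserve measurability.
  Compactness and continuity reduce it to a countable dense set: an exact zero exists if and only if
  there are approximate zeros of every precision, since the minimum of the absolute value is
  attained.\<close>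

lemma sets_ex_zero_compact:
  fixes K :: "'b :: second_countable_topology set" and \<phi> :: "'a \<Rightarrow> 'b \<Rightarrow> real"
  assumes K: "compact K"
    and meas: "\<And>b. b \<in> K \<Longrightarrow> (\<lambda>a. \<phi> a b) \<in> borel_measurable M"
    and cont: "\<And>a. a \<in> space M \<Longrightarrow> continuous_on K (\<phi> a)"
  shows "{a \<in> space M. \<exists>b\<in>K. \<phi> a b = 0} \<in> sets M"
proof -
  obtain D where D: "countable D" "D \<subseteq> K" "\<And>U. open U \<Longrightarrow> U \<inter> K \<noteq> {} \<Longrightarrow> U \<inter> D \<noteq> {}"
    using countable_dense_subset[of K] by blast
  have "(\<exists>b\<in>K. \<phi> a b = 0) \<longleftrightarrow> (\<forall>k. \<exists>b\<in>D. \<bar>\<phi> a b\<bar> < 1 / real (Suc k))" if a: "a \<in> space M" for a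
  proof
    assume "\<exists>b\<in>K. \<phi> a b = 0"
    then obtain b where b: "b \<in> K" "\<phi> a b = 0" by blast
    show "\<forall>k. \<exists>b\<in>D. \<bar>\<phi> a b\<bar> < 1 / real (Suc k)"
    proof
      fix k
      have "open (ball 0 (1 / real (Suc k)) :: real set)" "\<phi> a b \<in> ball 0 (1 / real (Suc k))"
        using b by auto
      then obtain U where U: "open U" "b \<in> U" "\<And>x. x \<in> K \<Longrightarrow> x \<in> U \<Longrightarrow> \<phi> a x \<in> ball 0 (1 / real (Suc k))"
        using cont[OF a] b(1) unfolding continuous_on_topological by metis
      then obtain x where "x \<in> U" "x \<in> D" using D(3)[OF U(1)] b by blast
      then show "\<exists>b\<in>D. \<bar>\<phi> a b\<bar> < 1 / real (Suc k)" using U(3)[of x] D(2) by (auto simp: dist_real_def)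
    qed
  next
    assume R: "\<forall>k. \<exists>b\<in>D. \<bar>\<phi> a b\<bar> < 1 / real (Suc k)"
    then have ne: "K \<noteq> {}" using D(2) by blast
    have "continuous_on K (\<lambda>b. \<bar>\<phi> a b\<bar>)" using cont[OF a] by (intro continuous_intros)
    then obtain b where b: "b \<in> K" "\<And>x. x \<in> K \<Longrightarrow> \<bar>\<phi> a b\<bar> \<le> \<bar>\<phi> a x\<bar>"
      using continuous_attains_inf[OF K ne] by blast
    have "\<bar>\<phi> a b\<bar> \<le> 0"
    proof (rule ccontr)
      assume "\<not> ?thesis"
      then obtain k where "1 / real (Suc k) < \<bar>\<phi> a b\<bar>" using nat_approx_posE by (metis not_le)
      then show False using R b(2) D(2) by (meson less_le_not_le order.strict_trans subsetD)
    qed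
    then show "\<exists>b\<in>K. \<phi> a b = 0" using b by auto
  qed
  then have "{a \<in> space M. \<exists>b\<in>K. \<phi> a b = 0} = {a \<in> space M. \<forall>k. \<exists>b\<in>D. \<bar>\<phi> a b\<bar> < 1 / real (Suc k)}"
    by blast
  also have "\<dots> \<in> sets M"
    using D meas by (intro sets.sets_Collect_countable_All sets.sets_Collect_countable_Ex' borel_measurable_less
        borel_measurable_abs) auto
  finally show ?thesis .
qed

text \<open>Tychonoff for the product topology on functions. Candidate matrices and vectors will be
  parametrised by functions on a whole countable type; the equations imposed on them do not involve
  coordinates beyond the matrix size.\<close>

lemma compact_box: "compact (Pi\<^sub>E UNIV (\<lambda>_. {-c..c}) :: ('i \<Rightarrow> real) set)"
  using compactin_PiE[of "\<lambda>_::'i. euclidean :: real topology" UNIV "\<lambda>_. {-c..c}"]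
  by (simp add: euclidean_product_topology)

section \<open>General position of random subspaces\<close>

lemma range_le_iff:
  assumes R: "R \<in> carrier_mat n n" and X: "is_proj n X"
  shows "R * X = X \<longleftrightarrow> (\<forall>x\<in>carrier_vec n. X *\<^sub>v x = x \<longrightarrow> R *\<^sub>v x = x)"
proof
  note c = is_proj_carrier[OF X]
  assume eq: "R * X = X"
  show "\<forall>x\<in>carrier_vec n. X *\<^sub>v x = x \<longrightarrow> R *\<^sub>v x = x"
  proof (intro ballI impI)
    fix x assume x: "x \<in> carrier_vec n" "X *\<^sub>v x = x"
    have "(R * X) *\<^sub>v x = R *\<^sub>v (X *\<^sub>v x)" using R c x by (intro assoc_mult_mat_vec[of _ n n _ n]) auto
    then show "R *\<^sub>v x = x" using eq x by simp
  qed
next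
  note c = is_proj_carrier[OF X]
  assume A: "\<forall>x\<in>carrier_vec n. X *\<^sub>v x = x \<longrightarrow> R *\<^sub>v x = x"
  show "R * X = X"
  proof (rule mat_eq_by_mult_vec[of _ n n])
    fix x :: "real vec" assume x: "x \<in> carrier_vec n"
    have "(R * X) *\<^sub>v x = R *\<^sub>v (X *\<^sub>v x)" using R c x by (intro assoc_mult_mat_vec[of _ n n _ n]) auto
    also have "\<dots> = X *\<^sub>v x" using A X x by simp
    finally show "(R * X) *\<^sub>v x = X *\<^sub>v x" .
  qed (use R c in \<open>auto intro: mult_carrier_mat[of _ n n]\<close>)
qed

text \<open>The \<open>k\<close>-dimensional subspace, given by its projection \<open>X\<close>,
  need not be the whole intersection, so membership means common dimension at least
  \<open>k\<close>. Phrased through equations for a matrix \<open>X\<close> with bounded entries,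
  the event is accessible to the compactness argument.\<close>

definition common_subspace_ge :: "nat \<Rightarrow> real mat \<Rightarrow> nat \<Rightarrow> real mat set" where
  "common_subspace_ge n Q k = {R \<in> carrier_mat n n. \<exists>X. is_proj n X \<and> mat_trace X = real k \<and> R * X = X \<and> Q * X = X}"

text \<open>A generic reflection lowers the dimension of a nontrivial intersection. A common
  subspace \<open>X\<close> of \<open>Q\<close> and the reflected \<open>R\<close> must be
  orthogonal to \<open>u\<close>, because \<open>y\<close> is orthogonal to both original ranges but
  not to \<open>u\<close>; so \<open>X\<close> also lies in the range of \<open>R\<close>. As
  \<open>z\<close> is common to \<open>R\<close> and \<open>Q\<close> but not orthogonal to
  \<open>u\<close>, the original intersection is strictly larger than \<open>X\<close>.\<close>

lemma common_subspace_ge_step: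
  assumes R: "is_proj n R" and Q: "is_proj n Q" and u: "u \<in> carrier_vec n" "u \<bullet> u = 1"
    and y: "y \<in> carrier_vec n" "R *\<^sub>v y = 0\<^sub>v n" "Q *\<^sub>v y = 0\<^sub>v n" "u \<bullet> y \<noteq> 0"
    and z: "\<And>x. x \<in> carrier_vec n \<Longrightarrow> R *\<^sub>v x = x \<Longrightarrow> Q *\<^sub>v x = x \<Longrightarrow> x \<noteq> 0\<^sub>v n \<Longrightarrow>
        z \<in> carrier_vec n \<and> R *\<^sub>v z = z \<and> Q *\<^sub>v z = z \<and> u \<bullet> z \<noteq> 0"
    and k: "0 < k" and conj: "conj_reflection n u R \<in> common_subspace_ge n Q k"
  shows "R \<in> common_subspace_ge n Q (Suc k)"
proof -
  let ?H = "reflection n u"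
  note cR = is_proj_carrier[OF R] and cQ = is_proj_carrier[OF Q]
  obtain X where X: "is_proj n X" "mat_trace X = real k" "conj_reflection n u R * X = X" "Q * X = X"
    using conj by (auto simp: common_subspace_ge_def)
  note cX = is_proj_carrier[OF X(1)]
  have XR: "conj_reflection n u R *\<^sub>v x = x" and XQ: "Q *\<^sub>v x = x" if "x \<in> carrier_vec n" "X *\<^sub>v x = x" for x
    using that X(3,4) range_le_iff[OF _ X(1), of "conj_reflection n u R"] range_le_iff[OF cQ X(1)] u cR
    by auto
  have key: "u \<bullet> x = 0 \<and> R *\<^sub>v x = x" if x: "x \<in> carrier_vec n" "X *\<^sub>v x = x" for x
  proof -
    have Hx: "?H *\<^sub>v x \<in> carrier_vec n" using u x by simp
    have RHx: "R *\<^sub>v (?H *\<^sub>v x) \<in> carrier_vec n" using R by simp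
    have "?H *\<^sub>v (R *\<^sub>v (?H *\<^sub>v x)) = x" using XR[OF x] conj_reflection_mult_vec[OF u(1) cR x(1)] by simp
    then have fx: "R *\<^sub>v (?H *\<^sub>v x) = ?H *\<^sub>v x" using reflection_reflection[OF u RHx] by simp
    \<comment> \<open>The reflected vector lies in the range of \<open>R\<close> and is thus
      orthogonal to \<open>y\<close>; since \<open>x\<close> itself is orthogonal to
      \<open>y\<close>, only the term with \<open>u \<bullet> x\<close> survives.\<close>
    have "0 = (?H *\<^sub>v x) \<bullet> y" using scalar_prod_range_kernel[OF R Hx y(1) fx y(2)] by simp
    also have "\<dots> = x \<bullet> y - 2 * (u \<bullet> x) * (u \<bullet> y)"
      using u x y by (subst reflection_mult_vec[OF u(1) x(1)], subst minus_scalar_prod_distrib[of _ n]) auto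
    also have "x \<bullet> y = 0" using scalar_prod_range_kernel[OF Q x(1) y(1) XQ[OF x] y(3)] .
    finally have ux: "u \<bullet> x = 0" using y(4) by simp
    then have "?H *\<^sub>v x = x" using reflection_fix u x by blast
    then show ?thesis using fx ux by simp
  qed
  obtain x0 where x0: "x0 \<in> carrier_vec n" "X *\<^sub>v x0 = x0" "x0 \<bullet> x0 = 1"
    using proj_unit_vec_in_range[OF X(1)] X(2) k by auto
  then have "x0 \<noteq> 0\<^sub>v n" by auto
  then have z: "z \<in> carrier_vec n" "R *\<^sub>v z = z" "Q *\<^sub>v z = z" "u \<bullet> z \<noteq> 0"
    using z[of x0] key[OF x0(1,2)] XQ[OF x0(1,2)] x0(1) by blast+
  \<comment> \<open>The part of \<open>z\<close> outside \<open>X\<close> is nonzero, because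
    \<open>z\<close> has an inner product with \<open>u\<close> and \<open>X\<close> has none; it
    supplies the additional dimension.\<close>
  define w where "w = z - X *\<^sub>v z"
  have w: "w \<in> carrier_vec n" using z X by (simp add: w_def)
  have Xz: "X *\<^sub>v z \<in> carrier_vec n" "X *\<^sub>v (X *\<^sub>v z) = X *\<^sub>v z" using X z by auto
  have Xw: "X *\<^sub>v w = 0\<^sub>v n"
    unfolding w_def using z Xz cX by (simp add: mult_minus_distrib_mat_vec[of _ n n])
  have "u \<bullet> w = u \<bullet> z"
    unfolding w_def using u z Xz key[OF Xz] by (simp add: scalar_prod_minus_distrib[of _ n])
  then have w0: "w \<noteq> 0\<^sub>v n" using z u by auto
  have Rw: "R *\<^sub>v w = w" unfolding w_def using z Xz cR key[OF Xz] by (simp add: mult_minus_distrib_mat_vec[of _ n n])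
  have Qw: "Q *\<^sub>v w = w" unfolding w_def using z Xz cQ XQ[OF Xz] by (simp add: mult_minus_distrib_mat_vec[of _ n n])
  define q where "q = normalize_vec w"
  have q: "q \<in> carrier_vec n" "q \<bullet> q = 1" using w w0 by (auto simp: q_def scalar_prod_normalize_vec)
  have Aq: "A *\<^sub>v q = (1 / sqrt (w \<bullet> w)) \<cdot>\<^sub>v (A *\<^sub>v w)" if "A \<in> carrier_mat n n" for A
    unfolding q_def normalize_vec_def using that w by (simp add: mult_mat_vec[of _ n n])
  have Xq: "X *\<^sub>v q = 0\<^sub>v n" using Aq[OF cX] Xw by simp
  have Rq: "R *\<^sub>v q = q" "Q *\<^sub>v q = q" using Aq[OF cR] Aq[OF cQ] Rw Qw by (auto simp: q_def normalize_vec_def)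
  note add = proj_add_outer[OF X(1) q(1) Xq q(2)]
  have fixed: "A * (X + outer_square q) = X + outer_square q"
    if A: "A \<in> carrier_mat n n" "A *\<^sub>v q = q" "\<And>x. x \<in> carrier_vec n \<Longrightarrow> X *\<^sub>v x = x \<Longrightarrow> A *\<^sub>v x = x" for A
  proof (subst range_le_iff[OF A(1) add(1)], intro ballI impI)
    fix x assume x: "x \<in> carrier_vec n" "(X + outer_square q) *\<^sub>v x = x"
    have Xx: "X *\<^sub>v x \<in> carrier_vec n" "X *\<^sub>v (X *\<^sub>v x) = X *\<^sub>v x" using X x by auto
    have "x = X *\<^sub>v x + (q \<bullet> x) \<cdot>\<^sub>v q" using add(3)[OF x(1)] x(2) by simp
    then have "A *\<^sub>v x = A *\<^sub>v (X *\<^sub>v x + (q \<bullet> x) \<cdot>\<^sub>v q)" by simp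
    also have "\<dots> = X *\<^sub>v x + (q \<bullet> x) \<cdot>\<^sub>v q"
      using A Xx q by (simp add: mult_add_distrib_mat_vec[of _ n n] mult_mat_vec[of _ n n])
    finally show "A *\<^sub>v x = x" using add(3)[OF x(1)] x(2) by simp
  qed
  have "R * (X + outer_square q) = X + outer_square q" "Q * (X + outer_square q) = X + outer_square q"
    using fixed[OF cR Rq(1)] fixed[OF cQ Rq(2)] key XQ by auto
  then show ?thesis
    using add(1,2) X(2) cR unfolding common_subspace_ge_def by force
qed

lemma double_sum_zeroD:
  fixes f :: "nat \<Rightarrow> nat \<Rightarrow> real"
  assumes nn: "\<And>i j. 0 \<le> f i j" and 0: "(\<Sum>i<m. \<Sum>j<n. f i j) = 0" and ij: "i < m" "j < n"
  shows "f i j = 0"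
proof -
  have "(\<Sum>j<n. f i j) = 0"
    using 0 ij nn by (subst (asm) sum_nonneg_eq_0_iff) (auto intro: sum_nonneg)
  then show ?thesis using ij nn by (subst (asm) sum_nonneg_eq_0_iff) auto
qed

lemma sets_common_subspace_ge:
  assumes Q: "is_proj n Q"
  shows "common_subspace_ge n Q k \<in> sets (mat_borel n n)"
proof -
  \<comment> \<open>The squared entries of a projection sum to its trace \<open>k\<close>, and
    \<open>k \<le> (k + 1)\<^sup>2\<close>; a box of half-width \<open>k + 1\<close> therefore
    contains every candidate \<open>X\<close>.\<close>
  define K :: "(nat \<times> nat \<Rightarrow> real) set" where "K = Pi\<^sub>E UNIV (\<lambda>_. {- (real k + 1)..real k + 1})"
  define \<phi> :: "real mat \<Rightarrow> (nat \<times> nat \<Rightarrow> real) \<Rightarrow> real" where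
    "\<phi> R b = (\<Sum>i<n. \<Sum>j<n. \<bar>b (i, j) - b (j, i)\<bar> + \<bar>(\<Sum>l<n. b (i, l) * b (l, j)) - b (i, j)\<bar>
       + \<bar>(\<Sum>l<n. R $$ (i, l) * b (l, j)) - b (i, j)\<bar> + \<bar>(\<Sum>l<n. Q $$ (i, l) * b (l, j)) - b (i, j)\<bar>)
       + \<bar>(\<Sum>i<n. b (i, i)) - real k\<bar>" for R b
  have "{R \<in> space (mat_borel n n). \<exists>b\<in>K. \<phi> R b = 0} \<in> sets (mat_borel n n)"
  proof (rule sets_ex_zero_compact)
    show "compact K" unfolding K_def by (rule compact_box)
    show "(\<lambda>R. \<phi> R b) \<in> borel_measurable (mat_borel n n)" for b
      unfolding \<phi>_def
      by (intro borel_measurable_add borel_measurable_sum borel_measurable_abs borel_measurable_diff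
          borel_measurable_times measurable_mat_entry) auto
    show "continuous_on K (\<phi> R)" for R
      unfolding \<phi>_def by (intro continuous_intros continuous_on_subset[OF continuous_on_product_coordinates]) auto
  qed
  also have "{R \<in> space (mat_borel n n). \<exists>b\<in>K. \<phi> R b = 0} = common_subspace_ge n Q k"
  proof (intro Set.set_eqI iffI)
    fix R assume "R \<in> {R \<in> space (mat_borel n n). \<exists>b\<in>K. \<phi> R b = 0}"
    then obtain b where R: "R \<in> carrier_mat n n" and b: "\<phi> R b = 0" by (auto simp: space_mat_borel)
    define X where "X = mat n n b"
    have cX: "X \<in> carrier_mat n n" by (simp add: X_def)
    have nn: "0 \<le> (\<Sum>i<n. \<Sum>j<n. \<bar>b (i, j) - b (j, i)\<bar> + \<bar>(\<Sum>l<n. b (i, l) * b (l, j)) - b (i, j)\<bar>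
       + \<bar>(\<Sum>l<n. R $$ (i, l) * b (l, j)) - b (i, j)\<bar> + \<bar>(\<Sum>l<n. Q $$ (i, l) * b (l, j)) - b (i, j)\<bar>)"
      by (intro sum_nonneg) auto
    then have tr: "(\<Sum>i<n. b (i, i)) = real k" and
      "(\<Sum>i<n. \<Sum>j<n. \<bar>b (i, j) - b (j, i)\<bar> + \<bar>(\<Sum>l<n. b (i, l) * b (l, j)) - b (i, j)\<bar>
       + \<bar>(\<Sum>l<n. R $$ (i, l) * b (l, j)) - b (i, j)\<bar> + \<bar>(\<Sum>l<n. Q $$ (i, l) * b (l, j)) - b (i, j)\<bar>) = 0"
      using b unfolding \<phi>_def by linarith+
    then have "\<bar>b (i, j) - b (j, i)\<bar> + \<bar>(\<Sum>l<n. b (i, l) * b (l, j)) - b (i, j)\<bar>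
       + \<bar>(\<Sum>l<n. R $$ (i, l) * b (l, j)) - b (i, j)\<bar> + \<bar>(\<Sum>l<n. Q $$ (i, l) * b (l, j)) - b (i, j)\<bar> = 0"
      if "i < n" "j < n" for i j
      using that by (intro double_sum_zeroD[of "\<lambda>i j. \<bar>b (i, j) - b (j, i)\<bar> + \<bar>(\<Sum>l<n. b (i, l) * b (l, j)) - b (i, j)\<bar>
       + \<bar>(\<Sum>l<n. R $$ (i, l) * b (l, j)) - b (i, j)\<bar> + \<bar>(\<Sum>l<n. Q $$ (i, l) * b (l, j)) - b (i, j)\<bar>" n n i j]) auto
    then have e: "b (i, j) = b (j, i)" "(\<Sum>l<n. b (i, l) * b (l, j)) = b (i, j)"
       "(\<Sum>l<n. R $$ (i, l) * b (l, j)) = b (i, j)" "(\<Sum>l<n. Q $$ (i, l) * b (l, j)) = b (i, j)"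
      if "i < n" "j < n" for i j
      using that by fastforce+
    have "is_proj n X"
      unfolding is_proj_def
    proof (intro conjI)
      show "transpose_mat X = X" using e(1) by (intro eq_matI) (auto simp: X_def)
      show "X * X = X" using e(2) by (intro eq_matI) (auto simp: X_def scalar_prod_def lessThan_atLeast0)
    qed (rule cX)
    moreover have "R * X = X" using e(3) R by (intro eq_matI) (auto simp: X_def scalar_prod_def lessThan_atLeast0)
    moreover have "Q * X = X" using e(4) is_proj_carrier[OF Q]
      by (intro eq_matI) (auto simp: X_def scalar_prod_def lessThan_atLeast0)
    moreover have "mat_trace X = real k" using tr by (simp add: X_def mat_trace_def)
    ultimately show "R \<in> common_subspace_ge n Q k" using R by (auto simp: common_subspace_ge_def)
  next
    fix R assume "R \<in> common_subspace_ge n Q k"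
    then obtain X where R: "R \<in> carrier_mat n n" and X: "is_proj n X" "mat_trace X = real k" "R * X = X" "Q * X = X"
      by (auto simp: common_subspace_ge_def)
    note cX = is_proj_carrier[OF X(1)] and cQ = is_proj_carrier[OF Q]
    define b where "b = (\<lambda>(i, j). if i < n \<and> j < n then X $$ (i, j) else 0)"
    have b: "b (i, j) = X $$ (i, j)" if "i < n" "j < n" for i j using that by (simp add: b_def)
    have "X $$ (i, j) \<in> {- (real k + 1)..real k + 1}" if ij: "i < n" "j < n" for i j
    proof -
      have "(X $$ (i, j))\<^sup>2 \<le> (\<Sum>j<n. (X $$ (i, j))\<^sup>2)"
        using ij by (intro member_le_sum) auto
      also have "\<dots> \<le> (\<Sum>i<n. \<Sum>j<n. (X $$ (i, j))\<^sup>2)"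
        using ij by (intro member_le_sum[of i "{..<n}" "\<lambda>i. \<Sum>j<n. (X $$ (i, j))\<^sup>2"]) (auto intro: sum_nonneg)
      also have "\<dots> = real k" using proj_trace_eq[OF X(1)] X(2) by simp
      also have "\<dots> \<le> (real k + 1)\<^sup>2" by (simp add: power2_eq_square algebra_simps)
      finally have "\<bar>X $$ (i, j)\<bar> \<le> real k + 1" by (subst (asm) abs_le_square_iff[symmetric]) auto
      then show ?thesis by auto
    qed
    then have bK: "b \<in> K" by (auto simp: K_def b_def)
    have pr: "(\<Sum>l<n. A $$ (i, l) * b (l, j)) = b (i, j)"
      if "A \<in> carrier_mat n n" "A * X = X" "i < n" "j < n" for A i j
    proof -
      have "(A * X) $$ (i, j) = (\<Sum>l<n. A $$ (i, l) * b (l, j))"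
        using that(1,3,4) cX by (auto simp: scalar_prod_def lessThan_atLeast0 b intro!: sum.cong)
      then show ?thesis unfolding that(2) using that b by simp
    qed
    have "transpose_mat X $$ (i, j) = X $$ (i, j)" for i j using is_proj_transpose[OF X(1)] by simp
    then have sym: "b (i, j) = b (j, i)" if "i < n" "j < n" for i j
      using that cX b by (metis carrier_matD index_transpose_mat(1))
    have sq: "(\<Sum>l<n. b (i, l) * b (l, j)) = b (i, j)" if "i < n" "j < n" for i j
      using pr[OF cX _ that] X(1) that b by (simp add: is_proj_def)
    have tr: "(\<Sum>i<n. b (i, i)) = real k" using X(2) cX b by (simp add: mat_trace_def)
    have "\<phi> R b = 0"
      unfolding \<phi>_def using sym sq tr pr[OF R X(3)] pr[OF cQ X(4)] by (auto intro!: sum.neutral)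
    then show "R \<in> {R \<in> space (mat_borel n n). \<exists>b\<in>K. \<phi> R b = 0}"
      using R bK by (auto simp: space_mat_borel)
  qed
  finally show ?thesis .
qed


text \<open>The laws of random projections used below are only assumed to be invariant under
  conjugation by reflections, which already act transitively on directions.\<close>

locale reflection_invariant_proj = prob_space \<mu> for \<mu> :: "real mat measure" +
  fixes n :: nat and \<rho> :: real
  assumes sets_mu: "sets \<mu> = sets (mat_borel n n)"
    and AE_proj: "AE R in \<mu>. is_proj n R \<and> mat_trace R = \<rho>"
    and inv: "\<And>v. v \<in> carrier_vec n \<Longrightarrow> v \<bullet> v = 1 \<Longrightarrow> distr \<mu> (mat_borel n n) (conj_reflection n v) = \<mu>"
begin

lemma space_mu: "space \<mu> = carrier_mat n n"
  using sets_eq_imp_space_eq[OF sets_mu] by (simp add: space_mat_borel)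

lemma trace_nonneg: "0 \<le> \<rho>"
proof -
  have "AE R in \<mu>. 0 \<le> \<rho>" using AE_proj by eventually_elim (auto dest: proj_trace_nonneg)
  then show ?thesis by (simp add: AE_const)
qed

end

lemma measurable_reflection:
  assumes "v \<in> carrier_vec n"
  shows "(\<lambda>_. reflection n v) \<in> M \<rightarrow>\<^sub>M mat_borel n n"
  using assms by (intro measurable_mat_borelI) auto

lemma measurable_reflection_normalize:
  "(\<lambda>w. reflection n (normalize_vec (vec n w))) \<in> gauss n \<rightarrow>\<^sub>M mat_borel n n"
proof (rule measurable_mat_borelI)
  fix i j assume ij: "i < n" "j < n"
  have eq: "reflection n (normalize_vec (vec n w)) $$ (i, j) =
    (if i = j then 1 else 0) - 2 * ((w i / sqrt (\<Sum>l<n. w l * w l)) * (w j / sqrt (\<Sum>l<n. w l * w l)))" for w :: "nat \<Rightarrow> real"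
    using ij by (simp add: reflection_def outer_square_def normalize_vec_def scalar_prod_def lessThan_atLeast0)
  show "(\<lambda>w. reflection n (normalize_vec (vec n w)) $$ (i, j)) \<in> borel_measurable (gauss n)"
    unfolding eq using ij by measurable
qed simp

lemma measurable_conj_reflection:
  assumes "v \<in> carrier_vec n"
  shows "conj_reflection n v \<in> mat_borel n n \<rightarrow>\<^sub>M mat_borel n n"
  unfolding conj_reflection_def[abs_def] using assms
  by (intro measurable_mat_mult_entry[of _ _ _ n] measurable_reflection) auto

lemma vec_scalar_prod_sum:
  "y \<in> carrier_vec n \<Longrightarrow> vec n w \<bullet> y = (\<Sum>i<n. y $ i * w i)" for w :: "nat \<Rightarrow> real"
  by (auto simp: scalar_prod_def lessThan_atLeast0 mult.commute)

lemma AE_gauss_scalar_prod: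
  assumes y: "y \<in> carrier_vec n" "y \<noteq> 0\<^sub>v n"
  shows "AE w in gauss n. vec n w \<bullet> y \<noteq> 0"
proof -
  obtain i where "i < n" "y $ i \<noteq> 0"
    using y by (metis eq_vecI carrier_vecD index_zero_vec(1) index_zero_vec(2))
  from AE_gauss_hyperplane[of i n "\<lambda>i. y $ i", OF this] show ?thesis using y by (simp add: vec_scalar_prod_sum)
qed

context reflection_invariant_proj
begin

text \<open>The probability of common dimension at least \<open>k\<close> is averaged over an
  independent random reflection, which leaves it unchanged. By
  \<open>common_subspace_ge_step\<close> it is then at most the probability for
  \<open>k + 1\<close>, provided \<open>k > 0\<close>. Iterating up to \<open>n + 1\<close>, where
  the event is empty, shows that it vanishes.\<close>

lemma AE_common_subspace_trivial:
  assumes Q: "is_proj n Q" and dims: "\<rho> + mat_trace Q < n"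
  shows "AE R in \<mu>. \<forall>x\<in>carrier_vec n. R *\<^sub>v x = x \<longrightarrow> Q *\<^sub>v x = x \<longrightarrow> x = 0\<^sub>v n"
proof -
  interpret pair: pair_sigma_finite \<mu> "gauss n" by unfold_locales
  let ?G = "common_subspace_ge n Q"
  let ?u = "\<lambda>w. normalize_vec (vec n w)"
  have G: "?G k \<in> sets (mat_borel n n)" for k by (rule sets_common_subspace_ge[OF Q])
  have Gm: "?G k \<in> sets \<mu>" for k using G sets_mu by simp
  have step: "emeasure \<mu> (?G k) \<le> emeasure \<mu> (?G (Suc k))" if k: "0 < k" for k
  proof -
    have joint: "(\<lambda>(R, w). conj_reflection n (?u w) R) \<in> \<mu> \<Otimes>\<^sub>M gauss n \<rightarrow>\<^sub>M mat_borel n n"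
    proof -
      have "snd \<in> \<mu> \<Otimes>\<^sub>M gauss n \<rightarrow>\<^sub>M gauss n" by simp
      note 1 = measurable_compose[OF this measurable_reflection_normalize]
      have 2: "fst \<in> \<mu> \<Otimes>\<^sub>M gauss n \<rightarrow>\<^sub>M mat_borel n n"
        using measurable_fst[of \<mu> "gauss n"] by (simp cong: measurable_cong_sets add: sets_mu)
      show ?thesis
        using measurable_mat_mult_entry[OF measurable_mat_mult_entry[OF 1 2] 1]
        by (simp add: conj_reflection_def case_prod_unfold)
    qed
    have ind: "(\<lambda>(R, w). indicator (?G k) (conj_reflection n (?u w) R) :: ennreal) \<in> borel_measurable (\<mu> \<Otimes>\<^sub>M gauss n)"
      using measurable_compose[OF joint borel_measurable_indicator[OF G]] by (simp add: case_prod_unfold)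
    have inner: "(\<integral>\<^sup>+R. indicator (?G k) (conj_reflection n (?u w) R) \<partial>\<mu>) = emeasure \<mu> (?G k)"
      if w: "vec n w \<noteq> 0\<^sub>v n" for w
    proof -
      have u: "?u w \<in> carrier_vec n" "?u w \<bullet> ?u w = 1" using w by (auto intro: scalar_prod_normalize_vec)
      have m: "conj_reflection n (?u w) \<in> \<mu> \<rightarrow>\<^sub>M mat_borel n n"
        using measurable_conj_reflection[OF u(1)] by (simp cong: measurable_cong_sets add: sets_mu)
      have "emeasure \<mu> (?G k) = (\<integral>\<^sup>+R. indicator (?G k) R \<partial>distr \<mu> (mat_borel n n) (conj_reflection n (?u w)))"
        using inv[OF u] Gm by simp
      also have "\<dots> = (\<integral>\<^sup>+R. indicator (?G k) (conj_reflection n (?u w) R) \<partial>\<mu>)"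
        using m G by (intro nn_integral_distr) auto
      finally show ?thesis ..
    qed
    have n0: "0 < n" using dims trace_nonneg proj_trace_nonneg[OF Q] by linarith
    have AEne: "AE w in gauss n. vec n w \<noteq> 0\<^sub>v n"
    proof -
      have "unit_vec n 0 \<noteq> (0\<^sub>v n :: real vec)" using n0 by (metis index_unit_vec(1) index_zero_vec(1) zero_neq_one)
      from AE_gauss_scalar_prod[OF unit_vec_carrier this] show ?thesis
        by eventually_elim auto
    qed
    have "emeasure \<mu> (?G k) = (\<integral>\<^sup>+w. emeasure \<mu> (?G k) \<partial>gauss n)"
      by (simp add: gauss.emeasure_space_1)
    also have "\<dots> = (\<integral>\<^sup>+w. \<integral>\<^sup>+R. indicator (?G k) (conj_reflection n (?u w) R) \<partial>\<mu> \<partial>gauss n)"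
    proof (rule nn_integral_cong_AE)
      show "AE w in gauss n. emeasure \<mu> (?G k) = (\<integral>\<^sup>+R. indicator (?G k) (conj_reflection n (?u w) R) \<partial>\<mu>)"
        using AEne by eventually_elim (simp add: inner)
    qed
    also have "\<dots> = (\<integral>\<^sup>+R. \<integral>\<^sup>+w. indicator (?G k) (conj_reflection n (?u w) R) \<partial>gauss n \<partial>\<mu>)"
      using pair.Fubini'[OF ind] .
    also have "\<dots> \<le> (\<integral>\<^sup>+R. indicator (?G (Suc k)) R \<partial>\<mu>)"
    proof (rule nn_integral_mono_AE)
      show "AE R in \<mu>. (\<integral>\<^sup>+w. indicator (?G k) (conj_reflection n (?u w) R) \<partial>gauss n) \<le> indicator (?G (Suc k)) R"
        using AE_proj
      proof eventually_elim
        fix R assume R: "is_proj n R \<and> mat_trace R = \<rho>"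
        obtain y where y: "y \<in> carrier_vec n" "y \<bullet> y = 1" "R *\<^sub>v y = 0\<^sub>v n" "Q *\<^sub>v y = 0\<^sub>v n"
          using proj_common_orthogonal[of n R Q] R Q dims by auto
        \<comment> \<open>The witness \<open>z\<close> must not depend on \<open>w\<close>: it is a
          common vector if one exists and otherwise the nonzero vector \<open>y\<close>, so that a
          single almost sure condition covers both cases.\<close>
        have "\<exists>z. z \<in> carrier_vec n \<and> z \<noteq> 0\<^sub>v n \<and> (\<forall>x\<in>carrier_vec n. R *\<^sub>v x = x \<longrightarrow> Q *\<^sub>v x = x \<longrightarrow> x \<noteq> 0\<^sub>v n \<longrightarrow> R *\<^sub>v z = z \<and> Q *\<^sub>v z = z)"
        proof (cases "\<exists>x\<in>carrier_vec n. R *\<^sub>v x = x \<and> Q *\<^sub>v x = x \<and> x \<noteq> 0\<^sub>v n")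
          case False
          then show ?thesis using y by (intro exI[of _ y]) auto
        qed blast
        then obtain z where z: "z \<in> carrier_vec n" "z \<noteq> 0\<^sub>v n"
          "\<And>x. x \<in> carrier_vec n \<Longrightarrow> R *\<^sub>v x = x \<Longrightarrow> Q *\<^sub>v x = x \<Longrightarrow> x \<noteq> 0\<^sub>v n \<Longrightarrow> R *\<^sub>v z = z \<and> Q *\<^sub>v z = z"
          by blast
        have y0: "y \<noteq> 0\<^sub>v n" using y by auto
        have "AE w in gauss n. indicator (?G k) (conj_reflection n (?u w) R) \<le> (indicator (?G (Suc k)) R :: ennreal)"
          using AE_gauss_scalar_prod[OF y(1) y0] AE_gauss_scalar_prod[OF z(1,2)]
        proof eventually_elim
          fix w assume wy: "vec n w \<bullet> y \<noteq> 0" and wz: "vec n w \<bullet> z \<noteq> 0"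
          have w0: "vec n w \<noteq> 0\<^sub>v n" using wy y by auto
          have u: "?u w \<in> carrier_vec n" "?u w \<bullet> ?u w = 1" using w0 by (auto intro: scalar_prod_normalize_vec)
          have sp: "?u w \<bullet> x \<noteq> 0" if "x \<in> carrier_vec n" "vec n w \<bullet> x \<noteq> 0" for x
            using that scalar_prod_self_pos[OF _ w0] by (simp add: normalize_vec_def)
          have "R \<in> ?G (Suc k)" if "conj_reflection n (?u w) R \<in> ?G k"
            using common_subspace_ge_step[OF _ Q u y(1,3,4) sp[OF y(1) wy], of z k] R z sp[OF z(1) wz] k that
            by blast
          then show "indicator (?G k) (conj_reflection n (?u w) R) \<le> (indicator (?G (Suc k)) R :: ennreal)"
            by (auto simp: indicator_def)
        qed
        then have "(\<integral>\<^sup>+w. indicator (?G k) (conj_reflection n (?u w) R) \<partial>gauss n) \<le> (\<integral>\<^sup>+w. indicator (?G (Suc k)) R \<partial>gauss n)"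
          by (rule nn_integral_mono_AE)
        then show "(\<integral>\<^sup>+w. indicator (?G k) (conj_reflection n (?u w) R) \<partial>gauss n) \<le> indicator (?G (Suc k)) R"
          by (simp add: gauss.emeasure_space_1)
      qed
    qed
    also have "\<dots> = emeasure \<mu> (?G (Suc k))" using Gm by simp
    finally show ?thesis .
  qed
  have "emeasure \<mu> (?G 1) \<le> emeasure \<mu> (?G (Suc k))" for k
    by (induction k) (use step in \<open>auto intro: order_trans\<close>)
  moreover have "?G (Suc n) = {}"
    using proj_trace_le by (fastforce simp: common_subspace_ge_def)
  ultimately have "emeasure \<mu> (?G 1) = 0" by (metis emeasure_empty le_zero_eq)
  then have "AE R in \<mu>. R \<notin> ?G 1" using Gm by (intro AE_I'[of "?G 1"]) (auto simp: null_sets_def)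
  with AE_proj show ?thesis
  proof eventually_elim
    fix R assume R: "is_proj n R \<and> mat_trace R = \<rho>" and not: "R \<notin> ?G 1"
    show "\<forall>x\<in>carrier_vec n. R *\<^sub>v x = x \<longrightarrow> Q *\<^sub>v x = x \<longrightarrow> x = 0\<^sub>v n"
    proof (intro ballI impI, rule ccontr)
      fix x assume x: "x \<in> carrier_vec n" "R *\<^sub>v x = x" "Q *\<^sub>v x = x" "x \<noteq> 0\<^sub>v n"
      define q where "q = normalize_vec x"
      have q: "q \<in> carrier_vec n" "q \<bullet> q = 1" using x by (auto simp: q_def scalar_prod_normalize_vec)
      have Aq: "A *\<^sub>v q = q" if "A \<in> carrier_mat n n" "A *\<^sub>v x = x" for A
        unfolding q_def normalize_vec_def using that x by (simp add: mult_mat_vec[of _ n n])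
      note add = proj_add_outer[OF is_proj_zero q(1) zero_mat_mult_vec[OF q(1)] q(2)]
      have fixed: "A * (0\<^sub>m n n + outer_square q) = 0\<^sub>m n n + outer_square q"
        if A: "A \<in> carrier_mat n n" "A *\<^sub>v x = x" for A
      proof (subst range_le_iff[OF A(1) add(1)], intro ballI impI)
        fix z assume z: "z \<in> carrier_vec n" "(0\<^sub>m n n + outer_square q) *\<^sub>v z = z"
        then have "z = (q \<bullet> z) \<cdot>\<^sub>v q" using add(3)[OF z(1)] q by (simp add: zero_mat_mult_vec)
        then show "A *\<^sub>v z = z" using Aq[OF A] q A by (metis mult_mat_vec)
      qed
      have "R \<in> ?G 1"
        using R is_proj_carrier[of n R] fixed[OF _ x(2)] fixed[OF is_proj_carrier[OF Q] x(3)] add(1,2)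
        unfolding common_subspace_ge_def by (auto intro!: exI[of _ "0\<^sub>m n n + outer_square q"])
      then show False using not by simp
    qed
  qed
qed

end

section \<open>Uniqueness of reflection-invariant laws on directions\<close>

text \<open>Points of \<open>gauss n\<close> are functions with value \<open>undefined\<close>
  outside \<open>{..<n}\<close>, whereas matrices act on vectors; this map and \<open>vec n\<close>
  pass between the two.\<close>

definition vec_coords :: "nat \<Rightarrow> real vec \<Rightarrow> nat \<Rightarrow> real" where
  "vec_coords n x = (\<lambda>i\<in>{..<n}. x $ i)"

lemma vec_vec_coords [simp]: "x \<in> carrier_vec n \<Longrightarrow> vec n (vec_coords n x) = x"
  by (intro eq_vecI) (auto simp: vec_coords_def)

lemma measurable_vec_coords:
  assumes "\<And>i. i < n \<Longrightarrow> (\<lambda>x. f x $ i) \<in> borel_measurable M"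
  shows "(\<lambda>x. vec_coords n (f x)) \<in> M \<rightarrow>\<^sub>M Pi\<^sub>M {..<n} (\<lambda>_. borel)"
  unfolding vec_coords_def using assms by (intro measurable_restrict) auto

lemma nn_integral_gauss_reflection_vec:
  assumes v: "v \<in> carrier_vec n" "v \<bullet> v = 1"
    and F: "F \<in> borel_measurable (Pi\<^sub>M {..<n} (\<lambda>_. borel))"
  shows "(\<integral>\<^sup>+g. F (vec_coords n (reflection n v *\<^sub>v vec n g)) \<partial>gauss n) = (\<integral>\<^sup>+g. F g \<partial>gauss n)"
proof -
  have eq: "vec_coords n (reflection n v *\<^sub>v vec n g) =
    (\<lambda>i\<in>{..<n}. g i - 2 * (\<Sum>j<n. v $ j * g j) * v $ i)" for g :: "nat \<Rightarrow> real"
    using v by (auto simp: vec_coords_def reflection_mult_vec scalar_prod_def lessThan_atLeast0 fun_eq_iff)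
  have "(\<Sum>i<n. (v $ i)\<^sup>2) = 1"
    using v by (simp add: scalar_prod_def lessThan_atLeast0 power2_eq_square)
  then show ?thesis
    unfolding eq by (rule nn_integral_gauss_reflection[OF _ F])
qed

abbreviation near :: "real \<Rightarrow> real vec \<Rightarrow> real vec \<Rightarrow> bool" where
  "near d x y \<equiv> (x - y) \<bullet> (x - y) < d"

abbreviation part :: "real mat \<Rightarrow> nat \<Rightarrow> (nat \<Rightarrow> real) \<Rightarrow> real vec" where
  "part P n g \<equiv> normalize_vec (P *\<^sub>v vec n g)"

lemma near_commute: "x \<in> carrier_vec n \<Longrightarrow> y \<in> carrier_vec n \<Longrightarrow> near d x y \<longleftrightarrow> near d y x"
  by (auto simp: scalar_prod_def algebra_simps intro!: arg_cong[of _ _ "\<lambda>z. z < d"] sum.cong)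

lemma scalar_prod_diff_self:
  fixes x :: "real vec"
  assumes "x \<in> carrier_vec n" "y \<in> carrier_vec n"
  shows "(x - y) \<bullet> (x - y) = (\<Sum>i<n. (x $ i - y $ i)\<^sup>2)"
  using carrier_vecD[OF assms(1)] carrier_vecD[OF assms(2)]
  by (simp add: scalar_prod_def lessThan_atLeast0 power2_eq_square)

lemma proj_part_coord_measurable:
  assumes P: "is_proj n P" and i: "i < n"
  shows "(\<lambda>g. part P n g $ i) \<in> borel_measurable (Pi\<^sub>M {..<n} (\<lambda>_. borel))"
proof -
  note c = is_proj_carrier[OF P]
  have Pg: "(P *\<^sub>v vec n g) $ i = (\<Sum>j<n. P $$ (i, j) * g j)" if "i < n" for i g
    using c that by (auto simp: scalar_prod_def lessThan_atLeast0)
  have eq: "part P n g $ i =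
     (1 / sqrt (\<Sum>k<n. (\<Sum>j<n. P $$ (k, j) * g j) * (\<Sum>j<n. P $$ (k, j) * g j))) * (\<Sum>j<n. P $$ (i, j) * g j)" for g
    using c i Pg by (auto simp: normalize_vec_def scalar_prod_def[of "P *\<^sub>v vec n g" "P *\<^sub>v vec n g"] lessThan_atLeast0 simp del: index_mult_mat_vec)
  show ?thesis unfolding eq by measurable
qed

lemma near_measurable:
  assumes "\<And>x. x \<in> space M \<Longrightarrow> a x \<in> carrier_vec n" "\<And>x. x \<in> space M \<Longrightarrow> b x \<in> carrier_vec n"
    and a: "\<And>i. i < n \<Longrightarrow> (\<lambda>x. a x $ i) \<in> borel_measurable M"
    and b: "\<And>i. i < n \<Longrightarrow> (\<lambda>x. b x $ i) \<in> borel_measurable M"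
  shows "{x \<in> space M. near d (a x) (b x)} \<in> sets M"
proof -
  have "{x \<in> space M. near d (a x) (b x)} = {x \<in> space M. (\<Sum>i<n. (a x $ i - b x $ i)\<^sup>2) < d}"
    using assms(1,2) by (intro Collect_cong conj_cong refl) (simp add: scalar_prod_diff_self[of _ n])
  also have "\<dots> \<in> sets M" using a b by measurable
  finally show ?thesis .
qed

definition reflection_invariant :: "nat \<Rightarrow> real mat \<Rightarrow> (nat \<Rightarrow> real) measure \<Rightarrow> bool" where
  "reflection_invariant n Q \<eta> \<longleftrightarrow> (\<forall>v\<in>carrier_vec n. \<forall>F\<in>borel_measurable (Pi\<^sub>M {..<n} (\<lambda>_. borel)).
     v \<bullet> v = 1 \<longrightarrow> Q *\<^sub>v v = v \<or> Q *\<^sub>v v = 0\<^sub>v n \<longrightarrow>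
     (\<integral>\<^sup>+g. F (vec_coords n (reflection n v *\<^sub>v vec n g)) \<partial>\<eta>) = (\<integral>\<^sup>+g. (F g :: ennreal) \<partial>\<eta>))"

text \<open>A product of two spherical caps, seen through the directions of the two components of
  \<open>g\<close>.\<close>

definition cap :: "nat \<Rightarrow> (nat \<Rightarrow> real) measure \<Rightarrow> real mat \<Rightarrow> real mat \<Rightarrow> real \<Rightarrow> real vec \<Rightarrow> real vec \<Rightarrow> (nat \<Rightarrow> real) set" where
  "cap n \<eta> P Q d x z = {g \<in> space \<eta>. near d (part P n g) x \<and> near d (part Q n g) z}"

lemma normalize_reflection:
  assumes v: "v \<in> carrier_vec n" "v \<bullet> v = 1" and x: "x \<in> carrier_vec n"
  shows "normalize_vec (reflection n v *\<^sub>v x) = reflection n v *\<^sub>v normalize_vec x"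
  using reflection_isometry[OF v x x] mult_mat_vec[OF reflection_carrier[OF v(1)] x] v x
  by (simp add: normalize_vec_def)

lemma near_reflection:
  assumes v: "v \<in> carrier_vec n" "v \<bullet> v = 1" and x: "x \<in> carrier_vec n" and y: "y \<in> carrier_vec n"
  shows "near d (reflection n v *\<^sub>v x) (reflection n v *\<^sub>v y) \<longleftrightarrow> near d x y"
proof -
  have "reflection n v *\<^sub>v x - reflection n v *\<^sub>v y = reflection n v *\<^sub>v (x - y)"
    using v x y by (simp add: mult_minus_distrib_mat_vec[of _ n n])
  then show ?thesis using reflection_isometry[OF v, of "x - y" "x - y"] x y by simp
qed

lemma cap_sets:
  assumes "is_proj n P" "is_proj n Q" "sets \<eta> = sets (Pi\<^sub>M {..<n} (\<lambda>_. borel))" "x \<in> carrier_vec n" "z \<in> carrier_vec n"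
  shows "cap n \<eta> P Q d x z \<in> sets \<eta>"
proof -
  have m: "(\<lambda>g. part P n g $ i) \<in> borel_measurable \<eta>" if "is_proj n P" "i < n" for P i
    using proj_part_coord_measurable[OF that] assms(3) by (simp cong: measurable_cong_sets)
  have "{g \<in> space \<eta>. near d (part P n g) x} \<inter> {g \<in> space \<eta>. near d (part Q n g) z} \<in> sets \<eta>"
    using assms m by (intro sets.Int near_measurable[of _ _ n]) (auto simp del: index_mult_mat_vec)
  also have "{g \<in> space \<eta>. near d (part P n g) x} \<inter> {g \<in> space \<eta>. near d (part Q n g) z} = cap n \<eta> P Q d x z"
    by (auto simp: cap_def)
  finally show ?thesis .
qed

lemma cap_swap: "cap n \<eta> P Q d x z = cap n \<eta> Q P d z x"
  by (auto simp: cap_def)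

text \<open>The reflection exchanging \<open>x\<close> and \<open>y\<close> runs along a vector of
  the range of \<open>P\<close>: it moves the direction of the \<open>P\<close>-component and leaves
  the \<open>Q\<close>-component alone. The projection \<open>Q'\<close> of the invariance is a
  separate parameter because the lemma is applied a second time with \<open>P\<close> and
  \<open>Q\<close> exchanged.\<close>

lemma emeasure_cap_rotate:
  assumes P: "is_proj n P" and Q: "is_proj n Q"
    and sets: "sets \<eta> = sets (Pi\<^sub>M {..<n} (\<lambda>_. borel))"
    and inv: "reflection_invariant n Q' \<eta>"
    and ker: "\<And>v. v \<in> carrier_vec n \<Longrightarrow> P *\<^sub>v v = v \<Longrightarrow> Q *\<^sub>v v = 0\<^sub>v n \<and> (Q' *\<^sub>v v = v \<or> Q' *\<^sub>v v = 0\<^sub>v n)"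
    and x: "x \<in> carrier_vec n" "P *\<^sub>v x = x" "x \<bullet> x = 1"
    and y: "y \<in> carrier_vec n" "P *\<^sub>v y = y" "y \<bullet> y = 1"
    and z: "z \<in> carrier_vec n"
  shows "emeasure \<eta> (cap n \<eta> P Q d x z) = emeasure \<eta> (cap n \<eta> P Q d y z)"
proof (cases "x = y")
  case False
  note cP = is_proj_carrier[OF P]
  define v where "v = normalize_vec (x - y)"
  have xy0: "x - y \<noteq> 0\<^sub>v n" using vec_zero_diff_eq[OF x(1) y(1)] False by blast
  have v: "v \<in> carrier_vec n" "v \<bullet> v = 1"
    using x y xy0 unfolding v_def by (auto intro: scalar_prod_normalize_vec[of _ n])
  have Pv: "P *\<^sub>v v = v"
    unfolding v_def normalize_vec_def using x y cP
    by (simp add: mult_mat_vec[of _ n n] mult_minus_distrib_mat_vec[of _ n n])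
  have Hx: "reflection n v *\<^sub>v x = y"
    unfolding v_def using x y False by (intro reflection_exchange) auto
  note k = ker[OF v(1) Pv]
  have space: "space \<eta> = {..<n} \<rightarrow>\<^sub>E UNIV" using sets_eq_imp_space_eq[OF sets] by (simp add: space_PiM)
  have capm: "cap n \<eta> P Q d y z \<in> sets \<eta>" "cap n \<eta> P Q d x z \<in> sets \<eta>"
    using cap_sets[OF P Q sets] x y z by auto
  have F: "(indicator (cap n \<eta> P Q d y z) :: _ \<Rightarrow> ennreal) \<in> borel_measurable (Pi\<^sub>M {..<n} (\<lambda>_. borel))"
    using capm(1) sets by (intro borel_measurable_indicator) auto
  have "emeasure \<eta> (cap n \<eta> P Q d y z) = (\<integral>\<^sup>+g. indicator (cap n \<eta> P Q d y z) g \<partial>\<eta>)"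
    using capm by simp
  also have "\<dots> = (\<integral>\<^sup>+g. indicator (cap n \<eta> P Q d y z) (vec_coords n (reflection n v *\<^sub>v vec n g)) \<partial>\<eta>)"
    using inv v k F unfolding reflection_invariant_def by metis
  also have "\<dots> = (\<integral>\<^sup>+g. indicator (cap n \<eta> P Q d x z) g \<partial>\<eta>)"
  proof (rule nn_integral_cong)
    fix g assume g: "g \<in> space \<eta>"
    let ?H = "reflection n v"
    have Hg: "?H *\<^sub>v vec n g \<in> carrier_vec n" using v by simp
    have sp: "vec_coords n (?H *\<^sub>v vec n g) \<in> space \<eta>" by (simp add: space vec_coords_def)
    have p1: "normalize_vec (P *\<^sub>v (?H *\<^sub>v vec n g)) = ?H *\<^sub>v part P n g"
      using P v Pv by (simp add: proj_reflection_in_range normalize_reflection)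
    have "near d (?H *\<^sub>v part P n g) y \<longleftrightarrow> near d (part P n g) x"
      using near_reflection[OF v, of "part P n g" x d] P x Hx by simp
    moreover have "Q *\<^sub>v (?H *\<^sub>v vec n g) = Q *\<^sub>v vec n g"
      using proj_reflection_in_kernel(1)[OF Q v(1)] k by simp
    ultimately show "indicator (cap n \<eta> P Q d y z) (vec_coords n (reflection n v *\<^sub>v vec n g)) =
      (indicator (cap n \<eta> P Q d x z) g :: ennreal)"
      using g sp Hg p1 by (simp add: cap_def indicator_def)
  qed
  also have "\<dots> = emeasure \<eta> (cap n \<eta> P Q d x z)" using capm by simp
  finally show ?thesis ..
qed simp

lemma proj_pair_kernel:
  assumes Q: "is_proj n Q" and v: "v \<in> carrier_vec n"
  shows "(1\<^sub>m n - Q) *\<^sub>v v = v \<Longrightarrow> Q *\<^sub>v v = 0\<^sub>v n \<and> (Q *\<^sub>v v = v \<or> Q *\<^sub>v v = 0\<^sub>v n)"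
    and "Q *\<^sub>v v = v \<Longrightarrow> (1\<^sub>m n - Q) *\<^sub>v v = 0\<^sub>v n \<and> (Q *\<^sub>v v = v \<or> Q *\<^sub>v v = 0\<^sub>v n)"
  using proj_compl_eq_0[OF Q v] by auto

lemma emeasure_cap_const:
  assumes Q: "is_proj n Q"
    and sets: "sets \<eta> = sets (Pi\<^sub>M {..<n} (\<lambda>_. borel))"
    and inv: "reflection_invariant n Q \<eta>"
    and x: "x \<in> carrier_vec n" "(1\<^sub>m n - Q) *\<^sub>v x = x" "x \<bullet> x = 1"
    and y: "y \<in> carrier_vec n" "(1\<^sub>m n - Q) *\<^sub>v y = y" "y \<bullet> y = 1"
    and z: "z \<in> carrier_vec n" "Q *\<^sub>v z = z" "z \<bullet> z = 1"
    and w: "w \<in> carrier_vec n" "Q *\<^sub>v w = w" "w \<bullet> w = 1"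
  shows "emeasure \<eta> (cap n \<eta> (1\<^sub>m n - Q) Q d x z) = emeasure \<eta> (cap n \<eta> (1\<^sub>m n - Q) Q d y w)"
proof -
  note P = proj_compl(1)[OF Q]
  have "emeasure \<eta> (cap n \<eta> (1\<^sub>m n - Q) Q d x z) = emeasure \<eta> (cap n \<eta> (1\<^sub>m n - Q) Q d y z)"
    using proj_pair_kernel(1)[OF Q] by (intro emeasure_cap_rotate[OF P Q sets inv _ x y z(1)]) auto
  also have "\<dots> = emeasure \<eta> (cap n \<eta> Q (1\<^sub>m n - Q) d z y)" by (simp add: cap_swap)
  also have "\<dots> = emeasure \<eta> (cap n \<eta> Q (1\<^sub>m n - Q) d w y)"
    using proj_pair_kernel(2)[OF Q] by (intro emeasure_cap_rotate[OF Q P sets inv _ z w y(1)]) auto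
  finally show ?thesis by (simp add: cap_swap)
qed

text \<open>Laws of which only the symmetry and the almost sure presence of both components are
  known. Any two of them agree on events determined by signs of linear forms in the two components;
  the Gaussian measure and the law of the splitting are compared in this way.\<close>

locale direction_measure = prob_space \<eta> for \<eta> :: "(nat \<Rightarrow> real) measure" +
  fixes n :: nat and Q :: "real mat"
  assumes proj: "is_proj n Q"
    and sets_eta: "sets \<eta> = sets (Pi\<^sub>M {..<n} (\<lambda>_. borel))"
    and inv: "reflection_invariant n Q \<eta>"
    and AE_P: "AE g in \<eta>. (1\<^sub>m n - Q) *\<^sub>v vec n g \<noteq> 0\<^sub>v n"
    and AE_Q: "AE g in \<eta>. Q *\<^sub>v vec n g \<noteq> 0\<^sub>v n"
begin

abbreviation "P \<equiv> 1\<^sub>m n - Q"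

lemma proj_P: "is_proj n P"
  by (rule proj_compl(1)[OF proj])

definition good :: "(nat \<Rightarrow> real) \<Rightarrow> bool" where
  "good g \<longleftrightarrow> P *\<^sub>v vec n g \<noteq> 0\<^sub>v n \<and> Q *\<^sub>v vec n g \<noteq> 0\<^sub>v n"

lemma AE_good: "AE g in \<eta>. good g"
  using AE_P AE_Q by eventually_elim (simp add: good_def)

lemma unit_part:
  assumes "is_proj n R" "R *\<^sub>v vec n g \<noteq> 0\<^sub>v n"
  shows "part R n g \<in> carrier_vec n" "R *\<^sub>v part R n g = part R n g" "part R n g \<bullet> part R n g = 1"
proof -
  show "part R n g \<in> carrier_vec n" using assms by simp
  show "R *\<^sub>v part R n g = part R n g"
    unfolding normalize_vec_def using assms is_proj_carrier[OF assms(1)] by (simp add: mult_mat_vec[of _ n n])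
  show "part R n g \<bullet> part R n g = 1" using assms by (intro scalar_prod_normalize_vec) auto
qed

lemma cap_const:
  assumes "good g" "good h"
  shows "emeasure \<eta> (cap n \<eta> P Q d (part P n g) (part Q n g)) = emeasure \<eta> (cap n \<eta> P Q d (part P n h) (part Q n h))"
  using assms unit_part[OF proj_P] unit_part[OF proj] unfolding good_def
  by (intro emeasure_cap_const[OF proj sets_eta inv]) auto

lemma ex_good: "\<exists>g. good g"
proof (rule ccontr)
  assume "\<not> (\<exists>g. good g)"
  then have "AE g in \<eta>. False" using AE_good by auto
  then show False by simp
qed

text \<open>Directions in a common cell of a fine grid are close, and there are only countably many
  cells, so not all caps can be null sets.\<close>

lemma cap_pos:
  assumes g: "good g" and d: "0 < d"
  shows "emeasure \<eta> (cap n \<eta> P Q d (part P n g) (part Q n g)) \<noteq> 0"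
proof
  assume zero: "emeasure \<eta> (cap n \<eta> P Q d (part P n g) (part Q n g)) = 0"
  \<comment> \<open>Two points of a cell of side \<open>\<rho>\<close> have squared distance at most
    \<open>n * \<rho>\<^sup>2\<close>, and \<open>n * d / (n + 1) < d\<close>.\<close>
  define \<rho> where "\<rho> = sqrt (d / (real n + 1))"
  have rho: "0 < \<rho>" "\<rho>\<^sup>2 = d / (real n + 1)" using d by (auto simp: \<rho>_def)
  define cell where "cell R h = map (\<lambda>i. \<lfloor>part R n h $ i / \<rho>\<rfloor>) [0..<n]" for R h
  have close: "near d (part R n h) (part R n h')" if R: "is_proj n R" and eq: "cell R h = cell R h'" for R h h'
  proof -
    have le: "(part R n h $ i - part R n h' $ i)\<^sup>2 \<le> \<rho>\<^sup>2" if i: "i < n" for i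
    proof -
      have "\<lfloor>part R n h $ i / \<rho>\<rfloor> = \<lfloor>part R n h' $ i / \<rho>\<rfloor>"
        using arg_cong[OF eq, of "\<lambda>l. l ! i"] i by (simp add: cell_def)
      then have "\<bar>part R n h $ i / \<rho> - part R n h' $ i / \<rho>\<bar> \<le> 1" by linarith
      then have "\<bar>part R n h $ i - part R n h' $ i\<bar> \<le> \<rho>"
        using rho by (simp add: diff_divide_distrib[symmetric] abs_divide)
      then show ?thesis using rho by (metis abs_le_square_iff abs_of_pos)
    qed
    have c: "part R n h \<in> carrier_vec n" "part R n h' \<in> carrier_vec n" using R by auto
    have "(part R n h - part R n h') \<bullet> (part R n h - part R n h') = (\<Sum>i<n. (part R n h $ i - part R n h' $ i)\<^sup>2)"
      using c by (rule scalar_prod_diff_self)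
    also have "\<dots> \<le> (\<Sum>i<n. \<rho>\<^sup>2)" using le by (intro sum_mono) auto
    also have "\<dots> = real n * (d / (real n + 1))" using rho by simp
    also have "\<dots> < d" using d by (simp add: field_simps)
    finally show ?thesis .
  qed
  define \<kappa> where "\<kappa> h = (cell P h, cell Q h)" for h
  define rep where "rep c = (SOME h. good h \<and> \<kappa> h = c)" for c
  let ?D = "\<kappa> ` {h. good h}"
  have rep: "good (rep (\<kappa> h))" "\<kappa> (rep (\<kappa> h)) = \<kappa> h" if "good h" for h
    using someI[of "\<lambda>h'. good h' \<and> \<kappa> h' = \<kappa> h" h] that by (auto simp: rep_def)
  let ?cap = "\<lambda>c. cap n \<eta> P Q d (part P n (rep c)) (part Q n (rep c))"
  have "?cap c \<in> null_sets \<eta>" if "c \<in> ?D" for c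
  proof -
    have "good (rep c)" using that rep by auto
    then have "emeasure \<eta> (?cap c) = 0" using zero cap_const[OF g, of "rep c" d] by simp
    moreover have "?cap c \<in> sets \<eta>" using proj proj_P by (intro cap_sets sets_eta) auto
    ultimately show ?thesis by auto
  qed
  then have "(\<Union>c\<in>?D. ?cap c) \<in> null_sets \<eta>"
    by (intro null_sets_UN') auto
  then have "AE h in \<eta>. h \<notin> (\<Union>c\<in>?D. ?cap c)" by (rule AE_not_in)
  then have "AE h in \<eta>. False"
    using AE_good AE_space
  proof eventually_elim
    fix h assume no: "h \<notin> (\<Union>c\<in>?D. ?cap c)" and h: "good h" "h \<in> space \<eta>"
    have "cell P h = cell P (rep (\<kappa> h))" "cell Q h = cell Q (rep (\<kappa> h))"
      using rep(2)[OF h(1)] by (auto simp: \<kappa>_def)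
    then have "h \<in> ?cap (\<kappa> h)"
      using close[OF proj_P] close[OF proj] h by (auto simp: cap_def)
    then show False using no h by blast
  qed
  then show False by simp
qed

end

text \<open>The classical double counting for uniqueness of uniformly distributed measures. The
  closeness relation \<open>T\<close> is integrated over both laws: its sections have constant mass,
  and on its support \<open>f h\<close> exceeds \<open>f g\<close> by at most \<open>e\<close>.
  Fubini transfers the integral from one law to the other, and the positive finite constant
  cancels.\<close>

lemma nn_integral_direction_le:
  assumes \<eta>: "direction_measure \<eta> n Q" and \<gamma>: "direction_measure \<gamma> n Q"
    and f: "f \<in> borel_measurable (Pi\<^sub>M {..<n} (\<lambda>_. borel))"
    and d: "0 < d"
    and le: "\<And>g h. near d (part (1\<^sub>m n - Q) n h) (part (1\<^sub>m n - Q) n g) \<Longrightarrow> near d (part Q n h) (part Q n g) \<Longrightarrow> f h \<le> f g + (e::ennreal)"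
  shows "(\<integral>\<^sup>+h. f h \<partial>\<eta>) \<le> (\<integral>\<^sup>+g. f g \<partial>\<gamma>) + e"
proof -
  interpret \<eta>: direction_measure \<eta> n Q by fact
  interpret \<gamma>: direction_measure \<gamma> n Q by fact
  interpret pair: pair_sigma_finite \<eta> \<gamma> by unfold_locales
  let ?P = "1\<^sub>m n - Q"
  note Q = \<eta>.proj and P = \<eta>.proj_P
  obtain g0 where g0: "\<eta>.good g0" using \<eta>.ex_good by blast
  define ch where "ch = emeasure \<eta> (cap n \<eta> ?P Q d (part ?P n g0) (part Q n g0))"
  define cg where "cg = emeasure \<gamma> (cap n \<gamma> ?P Q d (part ?P n g0) (part Q n g0))"
  define S where "S = {p \<in> space (\<eta> \<Otimes>\<^sub>M \<gamma>). near d (part ?P n (fst p)) (part ?P n (snd p)) \<and> near d (part Q n (fst p)) (part Q n (snd p))}"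
  define T :: "(nat \<Rightarrow> real) \<Rightarrow> (nat \<Rightarrow> real) \<Rightarrow> ennreal" where "T h g = indicator S (h, g)" for h g
  have fh: "f \<in> borel_measurable \<eta>" and fg: "f \<in> borel_measurable \<gamma>"
    using f by (simp_all cong: measurable_cong_sets add: \<eta>.sets_eta \<gamma>.sets_eta)
  have m1: "(\<lambda>p. part R n (fst p) $ i) \<in> borel_measurable (\<eta> \<Otimes>\<^sub>M \<gamma>)"
    and m2: "(\<lambda>p. part R n (snd p) $ i) \<in> borel_measurable (\<eta> \<Otimes>\<^sub>M \<gamma>)" if "is_proj n R" "i < n" for R i
  proof -
    have "(\<lambda>g. part R n g $ i) \<in> borel_measurable \<eta>" "(\<lambda>g. part R n g $ i) \<in> borel_measurable \<gamma>"
      using proj_part_coord_measurable[OF that] by (simp_all cong: measurable_cong_sets add: \<eta>.sets_eta \<gamma>.sets_eta)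
    from measurable_compose[OF measurable_fst this(1)] measurable_compose[OF measurable_snd this(2)]
    show "(\<lambda>p. part R n (fst p) $ i) \<in> borel_measurable (\<eta> \<Otimes>\<^sub>M \<gamma>)"
      "(\<lambda>p. part R n (snd p) $ i) \<in> borel_measurable (\<eta> \<Otimes>\<^sub>M \<gamma>)" by auto
  qed
  have "{p \<in> space (\<eta> \<Otimes>\<^sub>M \<gamma>). near d (part R n (fst p)) (part R n (snd p))} \<in> sets (\<eta> \<Otimes>\<^sub>M \<gamma>)"
    if "is_proj n R" for R
    using that by (intro near_measurable[of _ _ n] m1 m2) auto
  from sets.Int[OF this[OF P] this[OF Q]] have S: "S \<in> sets (\<eta> \<Otimes>\<^sub>M \<gamma>)"
    unfolding S_def by (simp add: Int_def conj_ac Collect_conj_eq[symmetric])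
  then have Tm: "(\<lambda>(h, g). T h g) \<in> borel_measurable (\<eta> \<Otimes>\<^sub>M \<gamma>)"
    unfolding T_def by (simp add: case_prod_unfold)
  have Tg: "(\<integral>\<^sup>+g. T h g \<partial>\<gamma>) = cg" if h: "\<eta>.good h" "h \<in> space \<eta>" for h
  proof -
    have "(\<integral>\<^sup>+g. T h g \<partial>\<gamma>) = (\<integral>\<^sup>+g. indicator (cap n \<gamma> ?P Q d (part ?P n h) (part Q n h)) g \<partial>\<gamma>)"
      unfolding T_def S_def cap_def using h P Q
      by (intro nn_integral_cong)
        (auto simp: indicator_def space_pair_measure near_commute[of "part ?P n h" n] near_commute[of "part Q n h" n])
    also have "\<dots> = emeasure \<gamma> (cap n \<gamma> ?P Q d (part ?P n h) (part Q n h))"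
      using P Q by (intro nn_integral_indicator cap_sets \<gamma>.sets_eta) auto
    also have "\<dots> = cg" unfolding cg_def by (rule \<gamma>.cap_const[OF h(1) g0])
    finally show ?thesis .
  qed
  have Th: "(\<integral>\<^sup>+h. T h g \<partial>\<eta>) = ch" if g: "\<eta>.good g" "g \<in> space \<gamma>" for g
  proof -
    have "(\<integral>\<^sup>+h. T h g \<partial>\<eta>) = (\<integral>\<^sup>+h. indicator (cap n \<eta> ?P Q d (part ?P n g) (part Q n g)) h \<partial>\<eta>)"
      unfolding T_def S_def cap_def using g P Q
      by (intro nn_integral_cong) (auto simp: indicator_def space_pair_measure)
    also have "\<dots> = emeasure \<eta> (cap n \<eta> ?P Q d (part ?P n g) (part Q n g))"
      using P Q by (intro nn_integral_indicator cap_sets \<eta>.sets_eta) auto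
    also have "\<dots> = ch" unfolding ch_def by (rule \<eta>.cap_const[OF g(1) g0])
    finally show ?thesis .
  qed
  have AETg: "AE h in \<eta>. (\<integral>\<^sup>+g. T h g \<partial>\<gamma>) = cg"
    using \<eta>.AE_good AE_space by eventually_elim (rule Tg)
  have AETh: "AE g in \<gamma>. (\<integral>\<^sup>+h. T h g \<partial>\<eta>) = ch"
    using \<gamma>.AE_good AE_space by eventually_elim (rule Th)
  \<comment> \<open>Both section masses equal the total mass of \<open>T\<close> under the product
    of the laws, integrated in the two orders.\<close>
  have "cg = (\<integral>\<^sup>+h. \<integral>\<^sup>+g. T h g \<partial>\<gamma> \<partial>\<eta>)"
    using nn_integral_cong_AE[OF AETg] by (simp add: \<eta>.emeasure_space_1)
  also have "\<dots> = (\<integral>\<^sup>+g. \<integral>\<^sup>+h. T h g \<partial>\<eta> \<partial>\<gamma>)"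
    using pair.Fubini'[OF Tm] by simp
  also have "\<dots> = ch"
    using nn_integral_cong_AE[OF AETh] by (simp add: \<gamma>.emeasure_space_1)
  finally have c: "cg = ch" .
  have Tsec: "(\<lambda>g. T h g) \<in> borel_measurable \<gamma>" if "h \<in> space \<eta>" for h
    using measurable_Pair2[OF Tm that] by simp
  have Tsec2: "(\<lambda>h. T h g) \<in> borel_measurable \<eta>" if "g \<in> space \<gamma>" for g
    using measurable_Pair1[OF Tm that] by simp
  have "cg * (\<integral>\<^sup>+h. f h \<partial>\<eta>) = (\<integral>\<^sup>+h. cg * f h \<partial>\<eta>)"
    using fh by (simp add: nn_integral_cmult)
  also have "\<dots> = (\<integral>\<^sup>+h. (\<integral>\<^sup>+g. T h g * f h \<partial>\<gamma>) \<partial>\<eta>)"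
  proof (rule nn_integral_cong_AE)
    show "AE h in \<eta>. cg * f h = (\<integral>\<^sup>+g. T h g * f h \<partial>\<gamma>)"
      using AETg AE_space by eventually_elim (simp add: nn_integral_multc Tsec)
  qed
  also have "\<dots> \<le> (\<integral>\<^sup>+h. (\<integral>\<^sup>+g. T h g * (f g + e) \<partial>\<gamma>) \<partial>\<eta>)"
    using le by (intro nn_integral_mono) (auto simp: T_def S_def indicator_def)
  also have "\<dots> = (\<integral>\<^sup>+g. (\<integral>\<^sup>+h. T h g * (f g + e) \<partial>\<eta>) \<partial>\<gamma>)"
  proof (rule pair.Fubini'[symmetric])
    have "(\<lambda>p. f (snd p) + e) \<in> borel_measurable (\<eta> \<Otimes>\<^sub>M \<gamma>)"
      by (intro borel_measurable_add borel_measurable_const measurable_compose[OF measurable_snd fg])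
    then show "(\<lambda>(h, g). T h g * (f g + e)) \<in> borel_measurable (\<eta> \<Otimes>\<^sub>M \<gamma>)"
      using Tm by (auto simp: case_prod_unfold)
  qed
  also have "\<dots> = (\<integral>\<^sup>+g. cg * (f g + e) \<partial>\<gamma>)"
  proof (rule nn_integral_cong_AE)
    show "AE g in \<gamma>. (\<integral>\<^sup>+h. T h g * (f g + e) \<partial>\<eta>) = cg * (f g + e)"
      using AETh AE_space by eventually_elim (simp add: nn_integral_multc Tsec2 c)
  qed
  also have "\<dots> = cg * ((\<integral>\<^sup>+g. f g \<partial>\<gamma>) + e)"
    using fg by (simp add: nn_integral_cmult nn_integral_add \<gamma>.emeasure_space_1)
  finally have "cg * (\<integral>\<^sup>+h. f h \<partial>\<eta>) \<le> cg * ((\<integral>\<^sup>+g. f g \<partial>\<gamma>) + e)" .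
  moreover have "cg \<noteq> 0" unfolding cg_def by (rule \<gamma>.cap_pos[OF g0 d])
  moreover have "cg \<noteq> \<infinity>" unfolding cg_def by simp
  ultimately show ?thesis by (simp add: ennreal_mult_le_mult_iff)
qed

text \<open>The hypothesis is uniform continuity of \<open>f\<close> as a function of the two
  directions; the one-sided estimate is used in both orders of the laws, with \<open>e\<close>
  arbitrary.\<close>

lemma nn_integral_direction_eq:
  assumes \<eta>: "direction_measure \<eta> n Q" and \<gamma>: "direction_measure \<gamma> n Q"
    and f: "f \<in> borel_measurable (Pi\<^sub>M {..<n} (\<lambda>_. borel))"
    and cont: "\<And>e. 0 < e \<Longrightarrow> \<exists>d>0. \<forall>g h. near d (part (1\<^sub>m n - Q) n h) (part (1\<^sub>m n - Q) n g) \<longrightarrow>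
       near d (part Q n h) (part Q n g) \<longrightarrow> f h \<le> f g + (e::real)"
  shows "(\<integral>\<^sup>+h. ennreal (f h) \<partial>\<eta>) = (\<integral>\<^sup>+g. ennreal (f g) \<partial>\<gamma>)"
proof -
  have fm: "(\<lambda>h. ennreal (f h)) \<in> borel_measurable (Pi\<^sub>M {..<n} (\<lambda>_. borel))" using f by measurable
  have *: "(\<integral>\<^sup>+h. ennreal (f h) \<partial>\<eta>) \<le> (\<integral>\<^sup>+g. ennreal (f g) \<partial>\<gamma>)"
    if \<eta>: "direction_measure \<eta> n Q" and \<gamma>: "direction_measure \<gamma> n Q" for \<eta> \<gamma>
  proof (rule ennreal_le_epsilon)
    fix e :: real assume e: "0 < e"
    obtain d where d: "0 < d" "\<And>g h. near d (part (1\<^sub>m n - Q) n h) (part (1\<^sub>m n - Q) n g) \<Longrightarrow>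
       near d (part Q n h) (part Q n g) \<Longrightarrow> f h \<le> f g + e"
      using cont[OF e] by blast
    have le: "ennreal (f h) \<le> ennreal (f g) + ennreal e" if "f h \<le> f g + e" for g h
    proof -
      have "ennreal (f h) \<le> ennreal (max 0 (f g) + e)" using that by (intro ennreal_leI) auto
      also have "\<dots> = ennreal (f g) + ennreal e" using e by (simp add: ennreal_plus max_def ennreal_neg)
      finally show ?thesis .
    qed
    show "(\<integral>\<^sup>+h. ennreal (f h) \<partial>\<eta>) \<le> (\<integral>\<^sup>+g. ennreal (f g) \<partial>\<gamma>) + ennreal e"
      using d le by (intro nn_integral_direction_le[OF \<eta> \<gamma> fm, of d]) blast+
  qed
  show ?thesis using *[OF \<eta> \<gamma>] *[OF \<gamma> \<eta>] by (rule antisym)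
qed

section \<open>Cone events as limits of continuous functions of directions\<close>

definition clamp01 :: "real \<Rightarrow> real" where
  "clamp01 s = max 0 (min 1 s)"

lemma clamp01_bounds [simp]: "0 \<le> clamp01 s" "clamp01 s \<le> 1" "\<bar>clamp01 s\<bar> \<le> 1"
  by (auto simp: clamp01_def)

lemma clamp01_diff: "\<bar>clamp01 s - clamp01 t\<bar> \<le> \<bar>s - t\<bar>"
  by (auto simp: clamp01_def max_def min_def)

lemma clamp01_measurable [measurable]: "clamp01 \<in> borel_measurable borel"
  unfolding clamp01_def[abs_def] by measurable

text \<open>Strict inequalities are approximated from below by \<open>clamp01 (m * s)\<close>, weak
  ones from above by \<open>clamp01 (1 + m * s)\<close>; a cone mixes both kinds.\<close>

lemma clamp01_tendsto_pos: "(\<lambda>m. clamp01 (real m * s)) \<longlonglongrightarrow> (if 0 < s then 1 else 0)"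
proof (cases "0 < s")
  case True
  obtain m0 where m0: "1 / s < real m0" using reals_Archimedean2 by blast
  have "clamp01 (real m * s) = 1" if "m0 \<le> m" for m
  proof -
    have "1 / s \<le> real m" using m0 that by linarith
    then have "1 \<le> real m * s" using True by (simp add: field_simps)
    then show ?thesis by (simp add: clamp01_def)
  qed
  then have "eventually (\<lambda>m. clamp01 (real m * s) = 1) sequentially" by (auto simp: eventually_sequentially)
  then show ?thesis using True by (simp add: tendsto_eventually)
next
  case False
  then have "real m * s \<le> 0" for m by (simp add: mult_nonneg_nonpos)
  then have "clamp01 (real m * s) = 0" for m
    unfolding clamp01_def by (metis max.absorb1 min.coboundedI2)
  then show ?thesis using False by simp
qed

lemma clamp01_tendsto_nonneg: "(\<lambda>m. clamp01 (1 + real m * s)) \<longlonglongrightarrow> (if 0 \<le> s then 1 else 0)"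
proof (cases "0 \<le> s")
  case True
  then have "clamp01 (1 + real m * s) = 1" for m by (simp add: clamp01_def)
  then show ?thesis using True by simp
next
  case False
  have "clamp01 (1 + real m * s) = 1 - clamp01 (real m * (- s))" for m
    by (auto simp: clamp01_def max_def min_def)
  then show ?thesis using tendsto_diff[OF tendsto_const[of 1] clamp01_tendsto_pos[of "-s"]] False by simp
qed

lemma scalar_prod_abs_le:
  assumes "a \<in> carrier_vec n" "x \<in> carrier_vec n"
  shows "\<bar>a \<bullet> x\<bar> \<le> sqrt (a \<bullet> a) * sqrt (x \<bullet> (x :: real vec))"
proof -
  have "(a \<bullet> x)\<^sup>2 \<le> (a \<bullet> a) * (x \<bullet> x)"
    using Cauchy_Schwarz_ineq_sum[of "\<lambda>i. a $ i" "\<lambda>i. x $ i" "{0..<n}"] carrier_vecD[OF assms(1)] carrier_vecD[OF assms(2)]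
    by (simp add: scalar_prod_def power2_eq_square)
  then have "sqrt ((a \<bullet> x)\<^sup>2) \<le> sqrt ((a \<bullet> a) * (x \<bullet> x))" by (rule real_sqrt_le_mono)
  then show ?thesis by (simp add: real_sqrt_mult)
qed

lemma scalar_prod_normalize_sign:
  assumes "a \<in> carrier_vec n" "x \<in> carrier_vec n"
  shows "0 < a \<bullet> normalize_vec x \<longleftrightarrow> 0 < a \<bullet> x" "0 \<le> a \<bullet> normalize_vec x \<longleftrightarrow> 0 \<le> a \<bullet> x"
proof -
  have eq: "a \<bullet> normalize_vec x = (a \<bullet> x) / sqrt (x \<bullet> x)"
    using assms by (simp add: normalize_vec_def)
  consider "x = 0\<^sub>v n" | "0 < x \<bullet> x" using scalar_prod_self_pos[OF assms(2)] by blast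
  then show "0 < a \<bullet> normalize_vec x \<longleftrightarrow> 0 < a \<bullet> x" "0 \<le> a \<bullet> normalize_vec x \<longleftrightarrow> 0 \<le> a \<bullet> x"
    unfolding eq using assms by (cases; auto simp: zero_less_divide_iff zero_le_divide_iff)+
qed

text \<open>Strict conditions on the component in the kernel of \<open>Q\<close>, weak ones on the
  component in its range. This covers a relatively open face together with its normal cone, and also
  the combination with the roles reversed; the strict half will identify the face.\<close>

definition cone :: "nat \<Rightarrow> real mat \<Rightarrow> nat set \<Rightarrow> nat set \<Rightarrow> (nat \<Rightarrow> real vec) \<Rightarrow> (nat \<Rightarrow> real vec) \<Rightarrow> (nat \<Rightarrow> real) set" where
  "cone n Q S1 S2 a b = {g \<in> {..<n} \<rightarrow>\<^sub>E UNIV. (\<forall>i\<in>S1. 0 < a i \<bullet> ((1\<^sub>m n - Q) *\<^sub>v vec n g)) \<and> (\<forall>i\<in>S2. 0 \<le> b i \<bullet> (Q *\<^sub>v vec n g))}"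

text \<open>Indicators of cones are limits of products of clamped linear functions of the two
  directions. These products are Lipschitz in the directions, so the uniqueness result applies to
  them, and dominated convergence passes to the limit.\<close>

lemma emeasure_cone_eq:
  assumes \<eta>: "direction_measure \<eta> n Q" and \<gamma>: "direction_measure \<gamma> n Q"
    and fin: "finite S1" "finite S2"
    and a: "\<And>i. i \<in> S1 \<Longrightarrow> a i \<in> carrier_vec n" and b: "\<And>i. i \<in> S2 \<Longrightarrow> b i \<in> carrier_vec n"
  shows "emeasure \<eta> (cone n Q S1 S2 a b) = emeasure \<gamma> (cone n Q S1 S2 a b)"
    and "cone n Q S1 S2 a b \<in> sets (Pi\<^sub>M {..<n} (\<lambda>_. borel))"
proof -
  interpret \<eta>: direction_measure \<eta> n Q by fact
  let ?P = "1\<^sub>m n - Q" and ?B = "Pi\<^sub>M {..<n} (\<lambda>_. borel :: real measure)"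
  note Q = \<eta>.proj and P = \<eta>.proj_P
  define f1 where "f1 m g = (\<Prod>i\<in>S1. clamp01 (real m * (a i \<bullet> part ?P n g)))" for m :: nat and g
  define f2 where "f2 m g = (\<Prod>i\<in>S2. clamp01 (1 + real m * (b i \<bullet> part Q n g)))" for m :: nat and g
  have c: "part ?P n g \<in> carrier_vec n" "part Q n g \<in> carrier_vec n" for g using P Q by auto
  have lin: "(\<lambda>g. a \<bullet> part R n g) \<in> borel_measurable ?B" if "is_proj n R" for a R
  proof -
    have "a \<bullet> part R n g = (\<Sum>j<n. a $ j * part R n g $ j)" for g
      using is_proj_carrier[OF that] by (simp add: scalar_prod_def lessThan_atLeast0 del: index_mult_mat_vec)
    then show ?thesis using proj_part_coord_measurable[OF that] by simp
  qed
  have f1m: "f1 m \<in> borel_measurable ?B" for m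
    unfolding f1_def using lin[OF P] by measurable
  have f2m: "f2 m \<in> borel_measurable ?B" for m
    unfolding f2_def using lin[OF Q] by measurable
  have f01: "0 \<le> f1 m g" "f1 m g \<le> 1" "0 \<le> f2 m g" "f2 m g \<le> 1" for m g
    unfolding f1_def f2_def by (auto intro!: prod_nonneg prod_le_1)
  have eq: "(\<integral>\<^sup>+h. ennreal (f1 m h * f2 m h) \<partial>\<eta>) = (\<integral>\<^sup>+g. ennreal (f1 m g * f2 m g) \<partial>\<gamma>)" for m
  proof (rule nn_integral_direction_eq[OF \<eta> \<gamma>])
    show "(\<lambda>h. f1 m h * f2 m h) \<in> borel_measurable ?B" using f1m f2m by measurable
    fix e :: real assume e: "0 < e"
    \<comment> \<open>All factors lie in \<open>[0, 1]\<close>, so a difference of products is at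
      most the sum of the differences of the factors; \<open>C\<close> is the resulting Lipschitz
      constant. The summand 1 in \<open>C + 1\<close> prevents division by zero.\<close>
    define C where "C = real m * (\<Sum>i\<in>S1. sqrt (a i \<bullet> a i)) + real m * (\<Sum>i\<in>S2. sqrt (b i \<bullet> b i))"
    have C: "0 \<le> C" unfolding C_def by (intro add_nonneg_nonneg mult_nonneg_nonneg sum_nonneg) (auto simp: scalar_prod_self_nonneg)
    define d where "d = (e / (C + 1))\<^sup>2"
    have d: "0 < d" "sqrt d = e / (C + 1)" using e C by (auto simp: d_def)
    have "f1 m h * f2 m h \<le> f1 m g * f2 m g + e"
      if n1: "near d (part ?P n h) (part ?P n g)" and n2: "near d (part Q n h) (part Q n g)" for g h
    proof -
      have l: "\<bar>z \<bullet> x - z \<bullet> y\<bar> \<le> sqrt (z \<bullet> z) * sqrt d"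
        if "near d x y" "x \<in> carrier_vec n" "y \<in> carrier_vec n" "z \<in> carrier_vec n" for x y z
      proof -
        have "\<bar>z \<bullet> x - z \<bullet> y\<bar> = \<bar>z \<bullet> (x - y)\<bar>" using that by (simp add: scalar_prod_minus_distrib[of _ n])
        also have "\<dots> \<le> sqrt (z \<bullet> z) * sqrt ((x - y) \<bullet> (x - y))" using that by (intro scalar_prod_abs_le[of _ n]) auto
        also have "\<dots> \<le> sqrt (z \<bullet> z) * sqrt d"
          using that(1) by (intro mult_left_mono real_sqrt_le_mono) (auto simp: scalar_prod_self_nonneg)
        finally show ?thesis .
      qed
      have "norm (f1 m h - f1 m g) \<le> (\<Sum>i\<in>S1. norm (clamp01 (real m * (a i \<bullet> part ?P n h)) - clamp01 (real m * (a i \<bullet> part ?P n g))))"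
        unfolding f1_def by (rule norm_prod_diff) auto
      also have "\<dots> \<le> (\<Sum>i\<in>S1. real m * (sqrt (a i \<bullet> a i) * sqrt d))"
      proof (rule sum_mono)
        fix i assume i: "i \<in> S1"
        have "norm (clamp01 (real m * (a i \<bullet> part ?P n h)) - clamp01 (real m * (a i \<bullet> part ?P n g)))
          \<le> \<bar>real m * (a i \<bullet> part ?P n h) - real m * (a i \<bullet> part ?P n g)\<bar>"
          unfolding real_norm_def by (rule clamp01_diff)
        also have "\<dots> = real m * \<bar>a i \<bullet> part ?P n h - a i \<bullet> part ?P n g\<bar>"
          by (simp add: abs_mult flip: right_diff_distrib)
        also have "\<dots> \<le> real m * (sqrt (a i \<bullet> a i) * sqrt d)"
          using l[OF n1 c(1) c(1) a[OF i]] by (intro mult_left_mono) auto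
        finally show "norm (clamp01 (real m * (a i \<bullet> part ?P n h)) - clamp01 (real m * (a i \<bullet> part ?P n g)))
          \<le> real m * (sqrt (a i \<bullet> a i) * sqrt d)" .
      qed
      finally have 1: "\<bar>f1 m h - f1 m g\<bar> \<le> real m * (\<Sum>i\<in>S1. sqrt (a i \<bullet> a i)) * sqrt d"
        by (simp add: sum_distrib_left sum_distrib_right mult.assoc)
      have "norm (f2 m h - f2 m g) \<le> (\<Sum>i\<in>S2. norm (clamp01 (1 + real m * (b i \<bullet> part Q n h)) - clamp01 (1 + real m * (b i \<bullet> part Q n g))))"
        unfolding f2_def by (rule norm_prod_diff) auto
      also have "\<dots> \<le> (\<Sum>i\<in>S2. real m * (sqrt (b i \<bullet> b i) * sqrt d))"
      proof (rule sum_mono)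
        fix i assume i: "i \<in> S2"
        have "norm (clamp01 (1 + real m * (b i \<bullet> part Q n h)) - clamp01 (1 + real m * (b i \<bullet> part Q n g)))
          \<le> \<bar>(1 + real m * (b i \<bullet> part Q n h)) - (1 + real m * (b i \<bullet> part Q n g))\<bar>"
          unfolding real_norm_def by (rule clamp01_diff)
        also have "\<dots> = real m * \<bar>b i \<bullet> part Q n h - b i \<bullet> part Q n g\<bar>"
          by (simp add: abs_mult flip: right_diff_distrib)
        also have "\<dots> \<le> real m * (sqrt (b i \<bullet> b i) * sqrt d)"
          using l[OF n2 c(2) c(2) b[OF i]] by (intro mult_left_mono) auto
        finally show "norm (clamp01 (1 + real m * (b i \<bullet> part Q n h)) - clamp01 (1 + real m * (b i \<bullet> part Q n g)))
          \<le> real m * (sqrt (b i \<bullet> b i) * sqrt d)" .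
      qed
      finally have 2: "\<bar>f2 m h - f2 m g\<bar> \<le> real m * (\<Sum>i\<in>S2. sqrt (b i \<bullet> b i)) * sqrt d"
        by (simp add: sum_distrib_left sum_distrib_right mult.assoc)
      have "f1 m h * f2 m h - f1 m g * f2 m g = (f1 m h - f1 m g) * f2 m h + f1 m g * (f2 m h - f2 m g)"
        by (simp add: algebra_simps)
      also have "\<dots> \<le> \<bar>f1 m h - f1 m g\<bar> * f2 m h + f1 m g * \<bar>f2 m h - f2 m g\<bar>"
        using f01 by (intro add_mono mult_right_mono mult_left_mono) auto
      also have "\<dots> \<le> \<bar>f1 m h - f1 m g\<bar> * 1 + 1 * \<bar>f2 m h - f2 m g\<bar>"
        using f01 by (intro add_mono mult_right_mono mult_left_mono) auto
      also have "\<dots> \<le> C * sqrt d" using 1 2 by (simp add: C_def distrib_right)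
      also have "\<dots> \<le> e" using C e by (simp add: d(2) field_simps)
      finally show ?thesis by simp
    qed
    then show "\<exists>d>0. \<forall>g h. near d (part ?P n h) (part ?P n g) \<longrightarrow> near d (part Q n h) (part Q n g) \<longrightarrow>
       f1 m h * f2 m h \<le> f1 m g * f2 m g + e" using d by blast
  qed
  have e1: "0 < a i \<bullet> part ?P n g \<longleftrightarrow> 0 < a i \<bullet> (?P *\<^sub>v vec n g)" if "i \<in> S1" for i g
    using scalar_prod_normalize_sign(1)[OF a[OF that]] P by simp
  have e2: "0 \<le> b i \<bullet> part Q n g \<longleftrightarrow> 0 \<le> b i \<bullet> (Q *\<^sub>v vec n g)" if "i \<in> S2" for i g
    using scalar_prod_normalize_sign(2)[OF b[OF that]] Q by simp
  have limit: "(\<lambda>m. f1 m g * f2 m g) \<longlonglongrightarrow> indicator (cone n Q S1 S2 a b) g" if g: "g \<in> {..<n} \<rightarrow>\<^sub>E UNIV" for g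
  proof -
    have t1: "(\<lambda>m. f1 m g) \<longlonglongrightarrow> (\<Prod>i\<in>S1. if 0 < a i \<bullet> part ?P n g then 1 else 0)"
      unfolding f1_def by (intro tendsto_prod clamp01_tendsto_pos)
    have t2: "(\<lambda>m. f2 m g) \<longlonglongrightarrow> (\<Prod>i\<in>S2. if 0 \<le> b i \<bullet> part Q n g then 1 else 0)"
      unfolding f2_def by (intro tendsto_prod clamp01_tendsto_nonneg)
    have t3: "(\<Prod>i\<in>S1. if 0 < a i \<bullet> part ?P n g then 1 else 0) * (\<Prod>i\<in>S2. if 0 \<le> b i \<bullet> part Q n g then 1 else 0)
      = (indicator (cone n Q S1 S2 a b) g :: real)"
    proof -
      have "(\<Prod>i\<in>S1. if 0 < a i \<bullet> part ?P n g then 1 else 0) = (if \<forall>i\<in>S1. 0 < a i \<bullet> part ?P n g then 1 else 0 :: real)"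
        using fin by (auto intro: prod.neutral prod_zero)
      moreover have "(\<Prod>i\<in>S2. if 0 \<le> b i \<bullet> part Q n g then 1 else 0) = (if \<forall>i\<in>S2. 0 \<le> b i \<bullet> part Q n g then 1 else 0 :: real)"
        using fin by (auto intro: prod.neutral prod_zero)
      ultimately show ?thesis
        using g e1 e2 by (simp add: cone_def indicator_def)
    qed
    show ?thesis using tendsto_mult[OF t1 t2] unfolding t3 .
  qed
  show sets: "cone n Q S1 S2 a b \<in> sets ?B"
  proof -
    have "cone n Q S1 S2 a b = {g \<in> space ?B. (\<forall>i\<in>S1. 0 < a i \<bullet> part ?P n g) \<and> (\<forall>i\<in>S2. 0 \<le> b i \<bullet> part Q n g)}"
      unfolding cone_def using e1 e2 by (simp add: space_PiM cong: ball_cong)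
    also have "\<dots> \<in> sets ?B" using lin[OF P] lin[OF Q] fin by measurable
    finally show ?thesis .
  qed
  have lim: "(\<lambda>m. \<integral>\<^sup>+g. ennreal (f1 m g * f2 m g) \<partial>\<nu>) \<longlonglongrightarrow> emeasure \<nu> (cone n Q S1 S2 a b)"
    if \<nu>: "direction_measure \<nu> n Q" for \<nu>
  proof -
    interpret \<nu>: direction_measure \<nu> n Q by fact
    have space: "space \<nu> = {..<n} \<rightarrow>\<^sub>E UNIV" using sets_eq_imp_space_eq[OF \<nu>.sets_eta] by (simp add: space_PiM)
    have ms: "f1 m \<in> borel_measurable \<nu>" "f2 m \<in> borel_measurable \<nu>" for m
      using f1m f2m by (simp_all cong: measurable_cong_sets add: \<nu>.sets_eta)
    have cs: "cone n Q S1 S2 a b \<in> sets \<nu>" using sets \<nu>.sets_eta by simp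
    have "(\<lambda>m. \<integral>\<^sup>+g. ennreal (f1 m g * f2 m g) \<partial>\<nu>) \<longlonglongrightarrow> (\<integral>\<^sup>+g. ennreal (indicator (cone n Q S1 S2 a b) g) \<partial>\<nu>)"
    proof (rule nn_integral_dominated_convergence[where w = "\<lambda>_. 1"])
      show "(\<lambda>g. ennreal (f1 m g * f2 m g)) \<in> borel_measurable \<nu>" for m using ms by measurable
      show "(\<lambda>g. ennreal (indicator (cone n Q S1 S2 a b) g)) \<in> borel_measurable \<nu>" using cs by measurable
      show "AE g in \<nu>. ennreal (f1 m g * f2 m g) \<le> 1" for m
        using f01 by (intro AE_I2) (auto intro!: mult_le_one)
      show "AE g in \<nu>. (\<lambda>m. ennreal (f1 m g * f2 m g)) \<longlonglongrightarrow> ennreal (indicator (cone n Q S1 S2 a b) g)"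
        using limit space by (intro AE_I2 tendsto_ennrealI) auto
    qed (auto simp: \<nu>.emeasure_space_1)
    also have "(\<integral>\<^sup>+g. ennreal (indicator (cone n Q S1 S2 a b) g) \<partial>\<nu>) = emeasure \<nu> (cone n Q S1 S2 a b)"
      using cs by (simp add: ennreal_indicator)
    finally show ?thesis .
  qed
  show "emeasure \<eta> (cone n Q S1 S2 a b) = emeasure \<gamma> (cone n Q S1 S2 a b)"
    using lim[OF \<eta>] lim[OF \<gamma>] unfolding eq by (rule LIMSEQ_unique)
qed

section \<open>Splitting a vector along two subspaces\<close>

text \<open>If the ranges of \<open>R\<close> and \<open>Q\<close> meet only in \<open>0\<close>, every \<open>g\<close> is congruent modulo the range of \<open>R\<close>
  to a unique \<open>h\<close> whose component \<open>h - Q h\<close> lies in the kernel of \<open>R\<close>; that component is the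
  orthogonal projection of \<open>g\<close> onto the intersection of the kernels of \<open>R\<close> and \<open>Q\<close>.\<close>

definition is_split :: "nat \<Rightarrow> real mat \<Rightarrow> real mat \<Rightarrow> real vec \<Rightarrow> real vec \<Rightarrow> bool" where
  "is_split n R Q g h \<longleftrightarrow> h \<in> carrier_vec n \<and> R *\<^sub>v (h - g) = h - g \<and> R *\<^sub>v ((1\<^sub>m n - Q) *\<^sub>v h) = 0\<^sub>v n"

definition ranges_independent :: "nat \<Rightarrow> real mat \<Rightarrow> real mat \<Rightarrow> bool" where
  "ranges_independent n R Q \<longleftrightarrow> (\<forall>x\<in>carrier_vec n. R *\<^sub>v x = x \<longrightarrow> Q *\<^sub>v x = x \<longrightarrow> x = 0\<^sub>v n)"

text \<open>The compression of \<open>1\<^sub>m n - Q\<close> to the range of \<open>R\<close>,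
  completed by the identity on the kernel of \<open>R\<close>, so that invertibility of the
  compression becomes a condition on the determinant of a square matrix.\<close>

definition split_mat :: "nat \<Rightarrow> real mat \<Rightarrow> real mat \<Rightarrow> real mat" where
  "split_mat n R Q = R * (1\<^sub>m n - Q) * R + (1\<^sub>m n - R)"

text \<open>Inversion by the adjugate yields the \<open>v\<close> in the range of \<open>R\<close>
  for which the component of \<open>g - v\<close> orthogonal to the range of \<open>Q\<close> lies
  in the kernel of \<open>R\<close>. The closed formula is visibly measurable in \<open>R\<close>
  and \<open>g\<close>; where the determinant vanishes, \<open>1 / 0 = 0\<close> makes the value
  \<open>g\<close>.\<close>

definition split_vec :: "nat \<Rightarrow> real mat \<Rightarrow> real mat \<Rightarrow> real vec \<Rightarrow> real vec" where
  "split_vec n R Q g = g - (1 / det (split_mat n R Q)) \<cdot>\<^sub>v (adj_mat (split_mat n R Q) *\<^sub>v (R *\<^sub>v ((1\<^sub>m n - Q) *\<^sub>v g)))"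

lemma split_mat_carrier [simp]:
  "R \<in> carrier_mat n n \<Longrightarrow> Q \<in> carrier_mat n n \<Longrightarrow> split_mat n R Q \<in> carrier_mat n n"
  unfolding split_mat_def
  by (intro add_carrier_mat minus_carrier_mat mult_carrier_mat[of _ n n _ n]) auto

lemma split_vec_carrier [simp]:
  assumes "R \<in> carrier_mat n n" "Q \<in> carrier_mat n n" "g \<in> carrier_vec n"
  shows "split_vec n R Q g \<in> carrier_vec n"
  using mult_mat_vec_carrier[OF adj_mat(1)[OF split_mat_carrier[OF assms(1,2)]]
      mult_mat_vec_carrier[OF assms(1) mult_mat_vec_carrier[OF minus_carrier_mat[OF assms(2)] assms(3)]]] assms(3)
  unfolding split_vec_def by (intro minus_carrier_vec) (simp_all only: smult_carrier_vec)

lemma split_mat_mult_vec: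
  assumes R: "is_proj n R" and Q: "is_proj n Q" and x: "x \<in> carrier_vec n"
  shows "split_mat n R Q *\<^sub>v x = R *\<^sub>v ((1\<^sub>m n - Q) *\<^sub>v (R *\<^sub>v x)) + (x - R *\<^sub>v x)"
proof -
  note c = is_proj_carrier[OF R] is_proj_carrier[OF proj_compl(1)[OF Q]] is_proj_carrier[OF proj_compl(1)[OF R]]
  have RP: "R * (1\<^sub>m n - Q) \<in> carrier_mat n n" using c by (intro mult_carrier_mat[of _ n n])
  have "split_mat n R Q *\<^sub>v x = (R * (1\<^sub>m n - Q) * R) *\<^sub>v x + (1\<^sub>m n - R) *\<^sub>v x"
    unfolding split_mat_def using c RP x
    by (intro add_mult_distrib_mat_vec[of _ n n] mult_carrier_mat[of _ n n _ n]) auto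
  also have "(R * (1\<^sub>m n - Q) * R) *\<^sub>v x = (R * (1\<^sub>m n - Q)) *\<^sub>v (R *\<^sub>v x)"
    using RP c x by (intro assoc_mult_mat_vec[of _ n n _ n]) auto
  also have "\<dots> = R *\<^sub>v ((1\<^sub>m n - Q) *\<^sub>v (R *\<^sub>v x))"
    using c R by (intro assoc_mult_mat_vec[of _ n n _ n]) auto
  finally show ?thesis using proj_compl(3)[OF R x] by simp
qed

text \<open>Write \<open>P\<close> for the complement of \<open>Q\<close>. The squared length of
  \<open>P x\<close> is the inner product of \<open>x\<close> with \<open>P x\<close>; since
  \<open>R x = x\<close>, it is also that of \<open>x\<close> with \<open>R (P x) = 0\<close>. So
  \<open>x\<close> lies in both ranges.\<close>

lemma split_mat_cancel:
  assumes R: "is_proj n R" and Q: "is_proj n Q" and ind: "ranges_independent n R Q"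
    and x: "x \<in> carrier_vec n" "R *\<^sub>v x = x" "R *\<^sub>v ((1\<^sub>m n - Q) *\<^sub>v x) = 0\<^sub>v n"
  shows "x = 0\<^sub>v n"
proof -
  note P = proj_compl(1)[OF Q]
  have "((1\<^sub>m n - Q) *\<^sub>v x) \<bullet> ((1\<^sub>m n - Q) *\<^sub>v x) = x \<bullet> ((1\<^sub>m n - Q) *\<^sub>v x)"
    using is_proj_self_adjoint[OF P x(1), of "(1\<^sub>m n - Q) *\<^sub>v x"] P x(1) by simp
  also have "\<dots> = 0"
    using is_proj_self_adjoint[OF R x(1), of "(1\<^sub>m n - Q) *\<^sub>v x"] P x by simp
  finally have "(1\<^sub>m n - Q) *\<^sub>v x = 0\<^sub>v n" using scalar_prod_self_eq_0[of "(1\<^sub>m n - Q) *\<^sub>v x" n] P by simp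
  then have "Q *\<^sub>v x = x" using proj_compl_eq_0(1)[OF Q x(1)] by simp
  then show ?thesis using ind x by (simp add: ranges_independent_def)
qed

lemma det_split_mat:
  assumes R: "is_proj n R" and Q: "is_proj n Q" and ind: "ranges_independent n R Q"
  shows "det (split_mat n R Q) \<noteq> 0"
proof
  note c = is_proj_carrier[OF R] is_proj_carrier[OF Q]
  note P = proj_compl(1)[OF Q]
  assume "det (split_mat n R Q) = 0"
  then obtain x where x: "x \<in> carrier_vec n" "x \<noteq> 0\<^sub>v n" "split_mat n R Q *\<^sub>v x = 0\<^sub>v n"
    using det_0_iff_vec_prod_zero[of "split_mat n R Q" n] c by auto
  \<comment> \<open>The image of \<open>x\<close> is sorted into a part in the range of
    \<open>R\<close> and a part in its kernel; their sum is zero, so both vanish separately.\<close>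
  define a where "a = R *\<^sub>v ((1\<^sub>m n - Q) *\<^sub>v (R *\<^sub>v x))"
  define b where "b = x - R *\<^sub>v x"
  have ab: "a \<in> carrier_vec n" "b \<in> carrier_vec n" using R P x by (auto simp: a_def b_def)
  have Ra: "R *\<^sub>v a = a" unfolding a_def using R P x by simp
  have Rb: "R *\<^sub>v b = 0\<^sub>v n" unfolding b_def using R x c by (simp add: mult_minus_distrib_mat_vec[of _ n n])
  have sum: "a + b = 0\<^sub>v n" using split_mat_mult_vec[OF R Q x(1)] x(3) by (simp add: a_def b_def)
  then have "R *\<^sub>v (a + b) = 0\<^sub>v n" using c by (simp add: mat_mult_zero_vec)
  then have a0: "a = 0\<^sub>v n" using Ra Rb ab c by (simp add: mult_add_distrib_mat_vec[of _ n n])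
  then have "b = 0\<^sub>v n" using sum ab by simp
  then have Rx: "R *\<^sub>v x = x" using vec_zero_diff_eq[OF x(1), of "R *\<^sub>v x"] R by (simp add: b_def)
  then have "x = 0\<^sub>v n" using split_mat_cancel[OF R Q ind x(1) Rx] a0 by (simp add: a_def)
  then show False using x by simp
qed

lemma is_split_split_vec:
  assumes R: "is_proj n R" and Q: "is_proj n Q" and ind: "ranges_independent n R Q" and g: "g \<in> carrier_vec n"
  shows "is_split n R Q g (split_vec n R Q g)"
proof -
  note c = is_proj_carrier[OF R] is_proj_carrier[OF Q]
  note P = proj_compl(1)[OF Q] and cP = is_proj_carrier[OF proj_compl(1)[OF Q]]
  let ?M = "split_mat n R Q" and ?P = "1\<^sub>m n - Q"
  have M: "?M \<in> carrier_mat n n" using c by simp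
  have d: "det ?M \<noteq> 0" by (rule det_split_mat[OF R Q ind])
  define y where "y = R *\<^sub>v (?P *\<^sub>v g)"
  have y: "y \<in> carrier_vec n" using R by (simp add: y_def)
  define v where "v = (1 / det ?M) \<cdot>\<^sub>v (adj_mat ?M *\<^sub>v y)"
  have adjy: "adj_mat ?M *\<^sub>v y \<in> carrier_vec n" using adj_mat(1)[OF M] y by simp
  have v: "v \<in> carrier_vec n" using adjy by (simp add: v_def)
  have "?M *\<^sub>v v = (1 / det ?M) \<cdot>\<^sub>v (?M *\<^sub>v (adj_mat ?M *\<^sub>v y))"
    unfolding v_def using M adjy by (simp add: mult_mat_vec[of _ n n])
  also have "?M *\<^sub>v (adj_mat ?M *\<^sub>v y) = (?M * adj_mat ?M) *\<^sub>v y"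
    using M adj_mat(1)[OF M] y by (simp add: assoc_mult_mat_vec[of _ n n _ n])
  also have "\<dots> = det ?M \<cdot>\<^sub>v y"
    unfolding adj_mat(2)[OF M] using y by (intro eq_vecI) auto
  finally have Mv: "?M *\<^sub>v v = y" using d y by (simp add: smult_smult_assoc)
  define a where "a = R *\<^sub>v (?P *\<^sub>v (R *\<^sub>v v))"
  define b where "b = v - R *\<^sub>v v"
  have ab: "a \<in> carrier_vec n" "b \<in> carrier_vec n" using R P v by (auto simp: a_def b_def)
  have Ra: "R *\<^sub>v a = a" unfolding a_def using R P v by simp
  have Rb: "R *\<^sub>v b = 0\<^sub>v n" unfolding b_def using R v c by (simp add: mult_minus_distrib_mat_vec[of _ n n])
  have sum: "a + b = y" using split_mat_mult_vec[OF R Q v] Mv by (simp add: a_def b_def)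
  have "R *\<^sub>v (a + b) = y" unfolding sum y_def using R P g by simp
  then have ay: "a = y" using Ra Rb ab c by (simp add: mult_add_distrib_mat_vec[of _ n n])
  have "b = (a + b) - a" using ab by (intro eq_vecI) auto
  then have "b = 0\<^sub>v n" using sum ay y by simp
  then have Rv: "R *\<^sub>v v = v" using vec_zero_diff_eq[OF v, of "R *\<^sub>v v"] R by (simp add: b_def)
  have h: "split_vec n R Q g = g - v" by (simp add: split_vec_def v_def y_def)
  have hg: "split_vec n R Q g - g = - v" unfolding h using g v by (intro eq_vecI) auto
  have "- v = (-1) \<cdot>\<^sub>v v" by (intro eq_vecI) auto
  then have "R *\<^sub>v (- v) = - v" using Rv v c by (simp add: mult_mat_vec[of _ n n])
  moreover have "R *\<^sub>v (?P *\<^sub>v (g - v)) = y - a"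
    unfolding y_def a_def Rv using g v c cP P by (simp add: mult_minus_distrib_mat_vec[of _ n n])
  ultimately show ?thesis
    unfolding is_split_def hg using h ay y g v by simp
qed

lemma is_split_unique:
  assumes R: "is_proj n R" and Q: "is_proj n Q" and ind: "ranges_independent n R Q" and g: "g \<in> carrier_vec n"
    and h: "is_split n R Q g h" and h': "is_split n R Q g h'"
  shows "h = h'"
proof -
  note c = is_proj_carrier[OF R] and P = proj_compl(1)[OF Q] and cP = is_proj_carrier[OF proj_compl(1)[OF Q]]
  have hc: "h \<in> carrier_vec n" "h' \<in> carrier_vec n" using h h' by (auto simp: is_split_def)
  have "h - h' = (h - g) - (h' - g)" using hc g by (intro eq_vecI) auto
  then have 1: "R *\<^sub>v (h - h') = h - h'"
    using h h' hc g c by (simp add: is_split_def mult_minus_distrib_mat_vec[of _ n n])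
  have 2: "R *\<^sub>v ((1\<^sub>m n - Q) *\<^sub>v (h - h')) = 0\<^sub>v n"
    using h h' hc c cP P by (simp add: is_split_def mult_minus_distrib_mat_vec[of _ n n])
  have "h - h' = 0\<^sub>v n" using hc by (intro split_mat_cancel[OF R Q ind _ 1 2]) auto
  then show ?thesis using vec_zero_diff_eq hc by blast
qed

lemma proj_reflection_commute:
  assumes Q: "is_proj n Q" and v: "v \<in> carrier_vec n" "Q *\<^sub>v v = v \<or> Q *\<^sub>v v = 0\<^sub>v n" and x: "x \<in> carrier_vec n"
  shows "Q *\<^sub>v (reflection n v *\<^sub>v x) = reflection n v *\<^sub>v (Q *\<^sub>v x)"
  using v(2) proj_reflection_in_range[OF Q v(1) _ x] proj_reflection_in_kernel[OF Q v(1) _ x] by auto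

lemma ranges_independent_reflection:
  assumes R: "is_proj n R" and Q: "is_proj n Q" and ind: "ranges_independent n R Q"
    and v: "v \<in> carrier_vec n" "v \<bullet> v = 1" "Q *\<^sub>v v = v \<or> Q *\<^sub>v v = 0\<^sub>v n"
  shows "ranges_independent n (conj_reflection n v R) Q"
  unfolding ranges_independent_def
proof (intro ballI impI)
  fix x assume x: "x \<in> carrier_vec n" and Rx: "conj_reflection n v R *\<^sub>v x = x" and Qx: "Q *\<^sub>v x = x"
  let ?H = "reflection n v"
  have Hx: "?H *\<^sub>v x \<in> carrier_vec n" using v x by simp
  have RHx: "R *\<^sub>v (?H *\<^sub>v x) \<in> carrier_vec n" using R by simp
  have "?H *\<^sub>v (R *\<^sub>v (?H *\<^sub>v x)) = x" using Rx conj_reflection_mult_vec[OF v(1) is_proj_carrier[OF R] x] by simp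
  then have "R *\<^sub>v (?H *\<^sub>v x) = ?H *\<^sub>v x" using reflection_reflection[OF v(1,2) RHx] by simp
  moreover have "Q *\<^sub>v (?H *\<^sub>v x) = ?H *\<^sub>v x" using proj_reflection_commute[OF Q v(1,3) x] Qx by simp
  ultimately have "?H *\<^sub>v x = 0\<^sub>v n" using ind Hx by (simp add: ranges_independent_def)
  then have "?H *\<^sub>v (?H *\<^sub>v x) = 0\<^sub>v n" using v by (simp add: mat_mult_zero_vec)
  then show "x = 0\<^sub>v n" using reflection_reflection[OF v(1,2) x] by simp
qed

text \<open>A reflection commuting with \<open>Q\<close> may be applied to all data of the splitting
  at once; with uniqueness this makes \<open>split_vec\<close> equivariant.\<close>

lemma is_split_reflection:
  assumes R: "is_proj n R" and Q: "is_proj n Q"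
    and v: "v \<in> carrier_vec n" "v \<bullet> v = 1" "Q *\<^sub>v v = v \<or> Q *\<^sub>v v = 0\<^sub>v n"
    and g: "g \<in> carrier_vec n" and h: "is_split n R Q g h"
  shows "is_split n (conj_reflection n v R) Q (reflection n v *\<^sub>v g) (reflection n v *\<^sub>v h)"
proof -
  let ?H = "reflection n v" and ?P = "1\<^sub>m n - Q"
  note P = proj_compl(1)[OF Q] and cR = is_proj_carrier[OF R]
  have hc: "h \<in> carrier_vec n" and h1: "R *\<^sub>v (h - g) = h - g" and h2: "R *\<^sub>v (?P *\<^sub>v h) = 0\<^sub>v n"
    using h by (auto simp: is_split_def)
  have Hc: "?H \<in> carrier_mat n n" using v by simp
  have Pv: "?P *\<^sub>v v = v \<or> ?P *\<^sub>v v = 0\<^sub>v n" using v proj_compl_eq_0[OF Q v(1)] by auto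
  have diff: "?H *\<^sub>v h - ?H *\<^sub>v g = ?H *\<^sub>v (h - g)"
    using hc g Hc by (simp add: mult_minus_distrib_mat_vec[of _ n n])
  have hg: "h - g \<in> carrier_vec n" and Hhg: "?H *\<^sub>v (h - g) \<in> carrier_vec n" using hc g v by auto
  have "conj_reflection n v R *\<^sub>v (?H *\<^sub>v (h - g)) = ?H *\<^sub>v (R *\<^sub>v (?H *\<^sub>v (?H *\<^sub>v (h - g))))"
    by (rule conj_reflection_mult_vec[OF v(1) cR Hhg])
  also have "\<dots> = ?H *\<^sub>v (h - g)" using reflection_reflection[OF v(1,2) hg] h1 by simp
  finally have 1: "conj_reflection n v R *\<^sub>v (?H *\<^sub>v h - ?H *\<^sub>v g) = ?H *\<^sub>v h - ?H *\<^sub>v g" by (simp add: diff)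
  have Ph: "?P *\<^sub>v h \<in> carrier_vec n" using P by simp
  have "?P *\<^sub>v (?H *\<^sub>v h) = ?H *\<^sub>v (?P *\<^sub>v h)" by (rule proj_reflection_commute[OF P v(1) Pv hc])
  then have "conj_reflection n v R *\<^sub>v (?P *\<^sub>v (?H *\<^sub>v h)) = ?H *\<^sub>v (R *\<^sub>v (?H *\<^sub>v (?H *\<^sub>v (?P *\<^sub>v h))))"
    using conj_reflection_mult_vec[OF v(1) cR, of "?H *\<^sub>v (?P *\<^sub>v h)"] v Ph by simp
  also have "\<dots> = 0\<^sub>v n" using reflection_reflection[OF v(1,2) Ph] h2 Hc by (simp add: mat_mult_zero_vec)
  finally show ?thesis using 1 hc v by (simp add: is_split_def)
qed

lemma split_vec_reflection:
  assumes R: "is_proj n R" and Q: "is_proj n Q" and ind: "ranges_independent n R Q"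
    and v: "v \<in> carrier_vec n" "v \<bullet> v = 1" "Q *\<^sub>v v = v \<or> Q *\<^sub>v v = 0\<^sub>v n" and g: "g \<in> carrier_vec n"
  shows "split_vec n (conj_reflection n v R) Q (reflection n v *\<^sub>v g) = reflection n v *\<^sub>v split_vec n R Q g"
proof -
  note R' = is_proj_conj_reflection[OF R v(1,2)] and ind' = ranges_independent_reflection[OF R Q ind v]
  have Hg: "reflection n v *\<^sub>v g \<in> carrier_vec n" using v g by simp
  show ?thesis
    using is_split_unique[OF R' Q ind' Hg is_split_split_vec[OF R' Q ind' Hg]
      is_split_reflection[OF R Q v g is_split_split_vec[OF R Q ind g]]] .
qed

section \<open>Joint measurability of the splitting\<close>

lemma measurable_det:
  assumes f: "f \<in> M \<rightarrow>\<^sub>M mat_borel n n"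
  shows "(\<lambda>x. det (f x)) \<in> borel_measurable M"
proof -
  have c: "f x \<in> carrier_mat n n" if "x \<in> space M" for x
    using measurable_space[OF f that] by (simp add: space_mat_borel)
  have "(\<lambda>x. \<Sum>p | p permutes {0..<n}. signof p * (\<Prod>i = 0..<n. f x $$ (i, p i))) \<in> borel_measurable M"
    by (intro borel_measurable_sum borel_measurable_times borel_measurable_prod borel_measurable_const
        measurable_compose[OF f measurable_mat_entry]) (auto dest: permutes_in_image)
  then show ?thesis
    by (rule measurable_cong[THEN iffD1, rotated]) (simp add: det_def'[OF c])
qed

lemma measurable_adj_mat:
  assumes f: "f \<in> M \<rightarrow>\<^sub>M mat_borel n n"
  shows "(\<lambda>x. adj_mat (f x)) \<in> M \<rightarrow>\<^sub>M mat_borel n n"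
proof (rule measurable_mat_borelI)
  have c: "f x \<in> carrier_mat n n" if "x \<in> space M" for x
    using measurable_space[OF f that] by (simp add: space_mat_borel)
  then show "adj_mat (f x) \<in> carrier_mat n n" if "x \<in> space M" for x using that adj_mat(1) by blast
  fix i j assume ij: "i < n" "j < n"
  have "(\<lambda>x. mat_delete (f x) j i) \<in> M \<rightarrow>\<^sub>M mat_borel (n - 1) (n - 1)"
  proof (rule measurable_mat_borelI)
    show "mat_delete (f x) j i \<in> carrier_mat (n - 1) (n - 1)" if "x \<in> space M" for x
      using mat_delete_carrier[OF c[OF that]] by simp
    fix k l assume kl: "k < n - 1" "l < n - 1"
    have "(\<lambda>x. f x $$ (if k < j then k else Suc k, if l < i then l else Suc l)) \<in> borel_measurable M"
      using kl by (intro measurable_compose[OF f measurable_mat_entry]) auto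
    then show "(\<lambda>x. mat_delete (f x) j i $$ (k, l)) \<in> borel_measurable M"
    proof (rule measurable_cong[THEN iffD1, rotated])
      fix w assume "w \<in> space M"
      from carrier_matD[OF c[OF this]]
      show "f w $$ (if k < j then k else Suc k, if l < i then l else Suc l) = mat_delete (f w) j i $$ (k, l)"
        using kl by (simp add: mat_delete_def)
    qed
  qed
  from measurable_det[OF this]
  have "(\<lambda>x. (-1) ^ (j + i) * det (mat_delete (f x) j i)) \<in> borel_measurable M" by measurable
  then show "(\<lambda>x. adj_mat (f x) $$ (i, j)) \<in> borel_measurable M"
  proof (rule measurable_cong[THEN iffD1, rotated])
    fix w assume "w \<in> space M"
    from carrier_matD[OF c[OF this]]
    show "(-1) ^ (j + i) * det (mat_delete (f w) j i) = adj_mat (f w) $$ (i, j)"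
      using ij by (simp add: adj_mat_def cofactor_def)
  qed
qed

lemma measurable_mult_vec_entry:
  assumes A: "A \<in> M \<rightarrow>\<^sub>M mat_borel m n" and x: "\<And>z. z \<in> space M \<Longrightarrow> x z \<in> carrier_vec n"
    and xm: "\<And>j. j < n \<Longrightarrow> (\<lambda>z. x z $ j) \<in> borel_measurable M" and i: "i < m"
  shows "(\<lambda>z. (A z *\<^sub>v x z) $ i) \<in> borel_measurable M"
proof -
  have c: "A z \<in> carrier_mat m n" if "z \<in> space M" for z
    using measurable_space[OF A that] by (simp add: space_mat_borel)
  have "(\<lambda>z. \<Sum>j<n. A z $$ (i, j) * x z $ j) \<in> borel_measurable M"
    using i by (intro borel_measurable_sum borel_measurable_times measurable_compose[OF A measurable_mat_entry] xm) auto
  moreover have "(\<Sum>j<n. A z $$ (i, j) * x z $ j) = (A z *\<^sub>v x z) $ i" if "z \<in> space M" for z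
    using carrier_matD[OF c[OF that]] carrier_vecD[OF x[OF that]] i by (simp add: scalar_prod_def lessThan_atLeast0)
  ultimately show ?thesis by (simp cong: measurable_cong)
qed

lemma measurable_const_mat: "Q \<in> carrier_mat m n \<Longrightarrow> (\<lambda>_. Q) \<in> M \<rightarrow>\<^sub>M mat_borel m n"
  by (intro measurable_mat_borelI) auto

lemma measurable_mat_add:
  assumes A: "A \<in> M \<rightarrow>\<^sub>M mat_borel m n" and B: "B \<in> M \<rightarrow>\<^sub>M mat_borel m n"
  shows "(\<lambda>x. A x + B x) \<in> M \<rightarrow>\<^sub>M mat_borel m n"
proof (rule measurable_mat_borelI)
  have c: "A z \<in> carrier_mat m n" "B z \<in> carrier_mat m n" if "z \<in> space M" for z
    using measurable_space[OF A that] measurable_space[OF B that] by (auto simp: space_mat_borel)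
  then show "A x + B x \<in> carrier_mat m n" if "x \<in> space M" for x using that by simp
  fix i j assume ij: "i < m" "j < n"
  have "(\<lambda>x. A x $$ (i, j) + B x $$ (i, j)) \<in> borel_measurable M"
    using ij by (intro borel_measurable_add measurable_compose[OF A measurable_mat_entry] measurable_compose[OF B measurable_mat_entry])
  then show "(\<lambda>x. (A x + B x) $$ (i, j)) \<in> borel_measurable M"
  proof (rule measurable_cong[THEN iffD1, rotated])
    fix w assume "w \<in> space M"
    from carrier_matD[OF c(2)[OF this]]
    show "A w $$ (i, j) + B w $$ (i, j) = (A w + B w) $$ (i, j)" using ij by simp
  qed
qed

lemma measurable_mat_compl:
  assumes A: "A \<in> M \<rightarrow>\<^sub>M mat_borel n n"
  shows "(\<lambda>x. 1\<^sub>m n - A x) \<in> M \<rightarrow>\<^sub>M mat_borel n n"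
proof (rule measurable_mat_borelI)
  have c: "A z \<in> carrier_mat n n" if "z \<in> space M" for z
    using measurable_space[OF A that] by (auto simp: space_mat_borel)
  then show "1\<^sub>m n - A x \<in> carrier_mat n n" if "x \<in> space M" for x using that by (intro minus_carrier_mat) simp
  fix i j assume ij: "i < n" "j < n"
  have "(\<lambda>x. (if i = j then 1 else 0) - A x $$ (i, j)) \<in> borel_measurable M"
    using ij by (intro borel_measurable_diff borel_measurable_const measurable_compose[OF A measurable_mat_entry])
  then show "(\<lambda>x. (1\<^sub>m n - A x) $$ (i, j)) \<in> borel_measurable M"
  proof (rule measurable_cong[THEN iffD1, rotated])
    fix w assume "w \<in> space M"
    from carrier_matD[OF c[OF this]]
    show "(if i = j then 1 else 0) - A w $$ (i, j) = (1\<^sub>m n - A w) $$ (i, j)" using ij by simp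
  qed
qed

lemma measurable_split_vec:
  assumes R: "R \<in> M \<rightarrow>\<^sub>M mat_borel n n" and g: "g \<in> M \<rightarrow>\<^sub>M Pi\<^sub>M {..<n} (\<lambda>_. borel)" and Q: "Q \<in> carrier_mat n n" and i: "i < n"
  shows "(\<lambda>x. split_vec n (R x) Q (vec n (g x)) $ i) \<in> borel_measurable M"
proof -
  let ?P = "1\<^sub>m n - Q"
  have P: "?P \<in> carrier_mat n n" using Q by (rule minus_carrier_mat)
  have Rc: "R z \<in> carrier_mat n n" if "z \<in> space M" for z
    using measurable_space[OF R that] by (auto simp: space_mat_borel)
  have M: "(\<lambda>x. split_mat n (R x) Q) \<in> M \<rightarrow>\<^sub>M mat_borel n n"
    unfolding split_mat_def
    by (intro measurable_mat_add measurable_mat_mult_entry[of _ _ _ n] measurable_mat_compl measurable_const_mat R Q)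
  have gi: "(\<lambda>x. g x i) \<in> borel_measurable M" if "i < n" for i
    using measurable_compose[OF g measurable_component_singleton[of i]] that by simp
  have 1: "(\<lambda>x. (?P *\<^sub>v vec n (g x)) $ j) \<in> borel_measurable M" if "j < n" for j
    by (rule measurable_mult_vec_entry[OF measurable_const_mat[OF P] _ _ that]) (simp_all add: gi)
  have 2: "(\<lambda>x. (R x *\<^sub>v (?P *\<^sub>v vec n (g x))) $ j) \<in> borel_measurable M" if "j < n" for j
    by (rule measurable_mult_vec_entry[OF R _ 1 that]) (rule mult_mat_vec_carrier[OF P vec_carrier])
  have 3: "(\<lambda>x. (adj_mat (split_mat n (R x) Q) *\<^sub>v (R x *\<^sub>v (?P *\<^sub>v vec n (g x)))) $ j) \<in> borel_measurable M" if "j < n" for j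
    by (rule measurable_mult_vec_entry[OF measurable_adj_mat[OF M] _ 2 that])
      (rule mult_mat_vec_carrier[OF Rc mult_mat_vec_carrier[OF P vec_carrier]])
  have "(\<lambda>x. g x i - (1 / det (split_mat n (R x) Q)) *
      (adj_mat (split_mat n (R x) Q) *\<^sub>v (R x *\<^sub>v (?P *\<^sub>v vec n (g x)))) $ i) \<in> borel_measurable M"
    using gi[OF i] 3[OF i] measurable_det[OF M] by measurable
  then show ?thesis
  proof (rule measurable_cong[THEN iffD1, rotated])
    fix w assume w: "w \<in> space M"
    have "dim_row (adj_mat (split_mat n (R w) Q)) = n"
      using adj_mat(1)[OF split_mat_carrier[OF Rc[OF w] Q]] by simp
    then show "g w i - (1 / det (split_mat n (R w) Q)) *
      (adj_mat (split_mat n (R w) Q) *\<^sub>v (R w *\<^sub>v (?P *\<^sub>v vec n (g w)))) $ i = split_vec n (R w) Q (vec n (g w)) $ i"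
      using i by (simp add: split_vec_def del: index_mult_mat_vec)
  qed
qed

section \<open>The law of the splitting\<close>

lemma sets_proj_nonzero:
  fixes R :: "real mat"
  assumes R: "R \<in> carrier_mat n n"
  shows "{g \<in> space (Pi\<^sub>M {..<n} (\<lambda>_. borel)). R *\<^sub>v vec n g \<noteq> 0\<^sub>v n} \<in> sets (Pi\<^sub>M {..<n} (\<lambda>_. borel))"
proof -
  have "R *\<^sub>v vec n g \<noteq> 0\<^sub>v n \<longleftrightarrow> (\<exists>i\<in>{..<n}. (\<Sum>j<n. R $$ (i, j) * g j) \<noteq> 0)" for g :: "nat \<Rightarrow> real"
  proof -
    have e: "(R *\<^sub>v vec n g) $ i = (\<Sum>j<n. R $$ (i, j) * g j)" if "i < n" for i
      using R that by (auto simp: scalar_prod_def lessThan_atLeast0)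
    have "R *\<^sub>v vec n g = 0\<^sub>v n \<longleftrightarrow> (\<forall>i\<in>{..<n}. (R *\<^sub>v vec n g) $ i = 0)"
      using R by (auto intro!: eq_vecI simp del: index_mult_mat_vec)
    then show ?thesis using e by simp
  qed
  then show ?thesis by simp
qed

lemma reflection_invariant_gauss:
  "reflection_invariant n Q (gauss n)"
  unfolding reflection_invariant_def using nn_integral_gauss_reflection_vec by blast

lemma scalar_prod_range:
  assumes "is_proj n R" "x \<in> carrier_vec n" "y \<in> carrier_vec n" "R *\<^sub>v y = y"
  shows "x \<bullet> y = (R *\<^sub>v x) \<bullet> y"
  using is_proj_self_adjoint[OF assms(1,2,3)] assms(4) by simp

lemma AE_gauss_proj_nonzero:
  assumes Q: "is_proj n Q" and tr: "0 < mat_trace Q"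
  shows "AE g in gauss n. Q *\<^sub>v vec n g \<noteq> 0\<^sub>v n"
proof -
  obtain x where x: "x \<in> carrier_vec n" "Q *\<^sub>v x = x" "x \<bullet> x = 1"
    using proj_unit_vec_in_range[OF Q tr] by blast
  have "x \<noteq> 0\<^sub>v n" using x by auto
  from AE_gauss_scalar_prod[OF x(1) this] show ?thesis
  proof eventually_elim
    fix g :: "nat \<Rightarrow> real" assume "vec n g \<bullet> x \<noteq> 0"
    then show "Q *\<^sub>v vec n g \<noteq> 0\<^sub>v n"
      using scalar_prod_range[OF Q vec_carrier x(1,2), of g] x(1) by auto
  qed
qed

lemma direction_measure_gauss:
  assumes Q: "is_proj n Q" and tr: "0 < mat_trace Q" "mat_trace Q < n"
  shows "direction_measure (gauss n) n Q"
proof unfold_locales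
  show "AE g in gauss n. (1\<^sub>m n - Q) *\<^sub>v vec n g \<noteq> 0\<^sub>v n"
    using tr by (intro AE_gauss_proj_nonzero proj_compl(1)[OF Q]) (simp add: proj_compl(2)[OF Q])
qed (use Q tr in \<open>simp_all add: sets_gauss reflection_invariant_gauss AE_gauss_proj_nonzero\<close>)

context reflection_invariant_proj
begin

lemma AE_ranges_independent:
  assumes "is_proj n Q" "\<rho> + mat_trace Q < n"
  shows "AE R in \<mu>. is_proj n R \<and> ranges_independent n R Q"
  using AE_common_subspace_trivial[OF assms] AE_proj
  by eventually_elim (simp add: ranges_independent_def)

definition split_law :: "real mat \<Rightarrow> (nat \<Rightarrow> real) measure" where
  "split_law Q = distr (\<mu> \<Otimes>\<^sub>M gauss n) (Pi\<^sub>M {..<n} (\<lambda>_. borel))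
     (\<lambda>p. vec_coords n (split_vec n (fst p) Q (vec n (snd p))))"

lemma measurable_fst_mat: "fst \<in> \<mu> \<Otimes>\<^sub>M gauss n \<rightarrow>\<^sub>M mat_borel n n"
  using measurable_fst[of \<mu> "gauss n"] by (simp cong: measurable_cong_sets add: sets_mu)

lemma measurable_snd_gauss: "snd \<in> \<mu> \<Otimes>\<^sub>M gauss n \<rightarrow>\<^sub>M Pi\<^sub>M {..<n} (\<lambda>_. borel)"
  using measurable_snd[of \<mu> "gauss n"] by (simp cong: measurable_cong_sets add: sets_gauss)

lemma measurable_split:
  assumes Q: "is_proj n Q"
  shows "(\<lambda>p. vec_coords n (split_vec n (fst p) Q (vec n (snd p)))) \<in> \<mu> \<Otimes>\<^sub>M gauss n \<rightarrow>\<^sub>M Pi\<^sub>M {..<n} (\<lambda>_. borel)"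
  by (intro measurable_vec_coords measurable_split_vec measurable_fst_mat measurable_snd_gauss is_proj_carrier[OF Q])

lemma AE_split_law:
  assumes Q: "is_proj n Q" and S: "S \<in> sets (Pi\<^sub>M {..<n} (\<lambda>_. borel))"
    and AE: "AE R in \<mu>. AE g in gauss n. vec_coords n (split_vec n R Q (vec n g)) \<in> S"
  shows "AE h in split_law Q. h \<in> S"
proof -
  interpret pair: pair_sigma_finite \<mu> "gauss n" by unfold_locales
  have m: "{p \<in> space (\<mu> \<Otimes>\<^sub>M gauss n). vec_coords n (split_vec n (fst p) Q (vec n (snd p))) \<in> S} \<in> sets (\<mu> \<Otimes>\<^sub>M gauss n)"
    using measurable_sets[OF measurable_split[OF Q] S] by (simp add: vimage_def Int_def conj_commute)
  have "AE p in \<mu> \<Otimes>\<^sub>M gauss n. vec_coords n (split_vec n (fst p) Q (vec n (snd p))) \<in> S"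
    using m AE by (intro pair.AE_pair_measure) simp_all
  moreover have "{h \<in> space (Pi\<^sub>M {..<n} (\<lambda>_. borel)). h \<in> S} \<in> sets (Pi\<^sub>M {..<n} (\<lambda>_. borel))"
    using S sets.sets_into_space[OF S] by (simp add: Collect_conj_eq Int_absorb1)
  ultimately show ?thesis
    unfolding split_law_def by (subst AE_distr_iff[OF measurable_split[OF Q]]) auto
qed

text \<open>By equivariance, reflecting the result of the splitting is the same as splitting the
  reflected pair. For fixed \<open>R\<close> the Gaussian law absorbs the reflection of
  \<open>g\<close>; afterwards \<open>\<mu>\<close> absorbs the conjugation of
  \<open>R\<close>.\<close>

lemma reflection_invariant_split_law:
  assumes Q: "is_proj n Q" and dims: "\<rho> + mat_trace Q < n"
  shows "reflection_invariant n Q (split_law Q)"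
  unfolding reflection_invariant_def
proof (intro ballI impI)
  fix v and F :: "(nat \<Rightarrow> real) \<Rightarrow> ennreal"
  assume v: "v \<in> carrier_vec n" and F: "F \<in> borel_measurable (Pi\<^sub>M {..<n} (\<lambda>_. borel))"
    and vv: "v \<bullet> v = 1" and Qv: "Q *\<^sub>v v = v \<or> Q *\<^sub>v v = 0\<^sub>v n"
  let ?H = "reflection n v" and ?C = "conj_reflection n v"
  note cQ = is_proj_carrier[OF Q]
  let ?\<Psi> = "\<lambda>R g. F (vec_coords n (split_vec n R Q (vec n g)))"
  have HF: "(\<lambda>h. F (vec_coords n (?H *\<^sub>v vec n h))) \<in> borel_measurable (Pi\<^sub>M {..<n} (\<lambda>_. borel))"
  proof (rule measurable_compose[OF measurable_vec_coords F])
    fix i assume i: "i < n"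
    show "(\<lambda>h. (?H *\<^sub>v vec n h) $ i) \<in> borel_measurable (Pi\<^sub>M {..<n} (\<lambda>_. borel))"
      by (rule measurable_mult_vec_entry[OF measurable_const_mat[OF reflection_carrier[OF v]] _ _ i]) auto
  qed
  have \<Psi>m: "(\<lambda>p. ?\<Psi> (fst p) (snd p)) \<in> borel_measurable (\<mu> \<Otimes>\<^sub>M gauss n)"
    by (rule measurable_compose[OF measurable_split[OF Q] F])
  have \<Psi>g: "?\<Psi> R \<in> borel_measurable (Pi\<^sub>M {..<n} (\<lambda>_. borel))" if "R \<in> carrier_mat n n" for R
    by (intro measurable_compose[OF measurable_vec_coords F] measurable_split_vec measurable_const_mat cQ that) auto
  have \<Psi>R: "(\<lambda>R. \<integral>\<^sup>+g. ?\<Psi> R g \<partial>gauss n) \<in> borel_measurable \<mu>"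
    using gauss.borel_measurable_nn_integral_fst[OF \<Psi>m] by simp
  have C: "?C \<in> \<mu> \<rightarrow>\<^sub>M mat_borel n n"
    using measurable_conj_reflection[OF v] by (simp cong: measurable_cong_sets add: sets_mu)
  have "(\<integral>\<^sup>+h. F (vec_coords n (?H *\<^sub>v vec n h)) \<partial>split_law Q) =
    (\<integral>\<^sup>+p. F (vec_coords n (?H *\<^sub>v vec n (vec_coords n (split_vec n (fst p) Q (vec n (snd p)))))) \<partial>(\<mu> \<Otimes>\<^sub>M gauss n))"
    unfolding split_law_def using HF by (intro nn_integral_distr measurable_split Q) simp
  also have "\<dots> = (\<integral>\<^sup>+R. \<integral>\<^sup>+g. F (vec_coords n (?H *\<^sub>v vec n (vec_coords n (split_vec n R Q (vec n g))))) \<partial>gauss n \<partial>\<mu>)"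
    using gauss.nn_integral_fst[OF measurable_compose[OF measurable_split[OF Q] HF]] by simp
  also have "\<dots> = (\<integral>\<^sup>+R. \<integral>\<^sup>+g. ?\<Psi> (?C R) g \<partial>gauss n \<partial>\<mu>)"
  proof (rule nn_integral_cong_AE)
    show "AE R in \<mu>. (\<integral>\<^sup>+g. F (vec_coords n (?H *\<^sub>v vec n (vec_coords n (split_vec n R Q (vec n g))))) \<partial>gauss n)
      = (\<integral>\<^sup>+g. ?\<Psi> (?C R) g \<partial>gauss n)"
      using AE_ranges_independent[OF Q dims]
    proof eventually_elim
      fix R assume R: "is_proj n R \<and> ranges_independent n R Q"
      then have cR: "R \<in> carrier_mat n n" by (simp add: is_proj_carrier)
      have "F (vec_coords n (?H *\<^sub>v vec n (vec_coords n (split_vec n R Q (vec n g))))) =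
        ?\<Psi> (?C R) (vec_coords n (?H *\<^sub>v vec n g))" for g
        using split_vec_reflection[of n R Q v "vec n g"] R Q v vv Qv cR cQ by simp
      then have "(\<integral>\<^sup>+g. F (vec_coords n (?H *\<^sub>v vec n (vec_coords n (split_vec n R Q (vec n g))))) \<partial>gauss n)
        = (\<integral>\<^sup>+g. ?\<Psi> (?C R) (vec_coords n (?H *\<^sub>v vec n g)) \<partial>gauss n)" by simp
      also have "\<dots> = (\<integral>\<^sup>+g. ?\<Psi> (?C R) g \<partial>gauss n)"
        using cR v by (intro nn_integral_gauss_reflection_vec[OF v vv \<Psi>g]) simp
      finally show "(\<integral>\<^sup>+g. F (vec_coords n (?H *\<^sub>v vec n (vec_coords n (split_vec n R Q (vec n g))))) \<partial>gauss n)
        = (\<integral>\<^sup>+g. ?\<Psi> (?C R) g \<partial>gauss n)" .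
    qed
  qed
  also have "\<dots> = (\<integral>\<^sup>+R. \<integral>\<^sup>+g. ?\<Psi> R g \<partial>gauss n \<partial>distr \<mu> (mat_borel n n) ?C)"
    using \<Psi>R by (intro nn_integral_distr[symmetric] C) (simp cong: measurable_cong_sets add: sets_mu)
  also have "\<dots> = (\<integral>\<^sup>+R. \<integral>\<^sup>+g. ?\<Psi> R g \<partial>gauss n \<partial>\<mu>)" by (simp add: inv[OF v vv])
  also have "\<dots> = (\<integral>\<^sup>+p. ?\<Psi> (fst p) (snd p) \<partial>(\<mu> \<Otimes>\<^sub>M gauss n))"
    using gauss.nn_integral_fst[OF \<Psi>m] by simp
  also have "\<dots> = (\<integral>\<^sup>+h. F h \<partial>split_law Q)"
    unfolding split_law_def using F by (intro nn_integral_distr[symmetric] measurable_split Q) simp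
  finally show "(\<integral>\<^sup>+h. F (vec_coords n (?H *\<^sub>v vec n h)) \<partial>split_law Q) = (\<integral>\<^sup>+h. F h \<partial>split_law Q)" .
qed

lemma AE_split_law_components:
  assumes Q: "is_proj n Q" and dims: "\<rho> + mat_trace Q < n" and tr: "0 < mat_trace Q"
  shows "AE h in split_law Q. (1\<^sub>m n - Q) *\<^sub>v vec n h \<noteq> 0\<^sub>v n" "AE h in split_law Q. Q *\<^sub>v vec n h \<noteq> 0\<^sub>v n"
proof -
  note cQ = is_proj_carrier[OF Q] and P = proj_compl(1)[OF Q]
  note cP = is_proj_carrier[OF P]
  let ?B = "Pi\<^sub>M {..<n} (\<lambda>_. borel :: real measure)"
  have sp: "vec_coords n x \<in> space ?B" for x by (simp add: space_PiM vec_coords_def)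
  have "AE h in split_law Q. h \<in> {h \<in> space ?B. (1\<^sub>m n - Q) *\<^sub>v vec n h \<noteq> 0\<^sub>v n}"
  proof (rule AE_split_law[OF Q sets_proj_nonzero[OF cP]])
    show "AE R in \<mu>. AE g in gauss n. vec_coords n (split_vec n R Q (vec n g)) \<in> {h \<in> space ?B. (1\<^sub>m n - Q) *\<^sub>v vec n h \<noteq> 0\<^sub>v n}"
      using AE_ranges_independent[OF Q dims] AE_proj
    proof eventually_elim
      fix R assume "is_proj n R \<and> ranges_independent n R Q" and tR: "is_proj n R \<and> mat_trace R = \<rho>"
      then have R: "is_proj n R" and ind: "ranges_independent n R Q" by auto
      \<comment> \<open>A vector orthogonal to both ranges does not see the change from
        \<open>g\<close> to \<open>h\<close>, so \<open>h \<bullet> x = vec n g \<bullet> x\<close>,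
        which is almost surely nonzero.\<close>
      obtain x where x: "x \<in> carrier_vec n" "x \<bullet> x = 1" "R *\<^sub>v x = 0\<^sub>v n" "Q *\<^sub>v x = 0\<^sub>v n"
        using proj_common_orthogonal[OF R Q] tR dims by auto
      have "x \<noteq> 0\<^sub>v n" using x by auto
      from AE_gauss_scalar_prod[OF x(1) this]
      show "AE g in gauss n. vec_coords n (split_vec n R Q (vec n g)) \<in> {h \<in> space ?B. (1\<^sub>m n - Q) *\<^sub>v vec n h \<noteq> 0\<^sub>v n}"
      proof eventually_elim
        fix g :: "nat \<Rightarrow> real" assume gx: "vec n g \<bullet> x \<noteq> 0"
        define h where "h = split_vec n R Q (vec n g)"
        have "is_split n R Q (vec n g) h" unfolding h_def by (rule is_split_split_vec[OF R Q ind]) simp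
        then have h: "h \<in> carrier_vec n" "R *\<^sub>v (h - vec n g) = h - vec n g" by (auto simp: is_split_def)
        have "(h - vec n g) \<bullet> x = 0" using h x by (intro scalar_prod_range_kernel[OF R]) auto
        then have "h \<bullet> x = vec n g \<bullet> x" using h x by (simp add: minus_scalar_prod_distrib[of _ n])
        moreover have "(1\<^sub>m n - Q) *\<^sub>v x = x" using proj_compl_eq_0(2)[OF Q x(1)] x by simp
        ultimately have "(1\<^sub>m n - Q) *\<^sub>v h \<noteq> 0\<^sub>v n"
          using scalar_prod_range[OF P h(1) x(1)] gx x by auto
        then show "vec_coords n (split_vec n R Q (vec n g)) \<in> {h \<in> space ?B. (1\<^sub>m n - Q) *\<^sub>v vec n h \<noteq> 0\<^sub>v n}"
          using h(1) sp by (simp add: h_def[symmetric])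
      qed
    qed
  qed
  then show "AE h in split_law Q. (1\<^sub>m n - Q) *\<^sub>v vec n h \<noteq> 0\<^sub>v n" by eventually_elim simp
  have "AE h in split_law Q. h \<in> {h \<in> space ?B. Q *\<^sub>v vec n h \<noteq> 0\<^sub>v n}"
  proof (rule AE_split_law[OF Q sets_proj_nonzero[OF cQ]])
    show "AE R in \<mu>. AE g in gauss n. vec_coords n (split_vec n R Q (vec n g)) \<in> {h \<in> space ?B. Q *\<^sub>v vec n h \<noteq> 0\<^sub>v n}"
      using AE_ranges_independent[OF Q dims]
    proof eventually_elim
      fix R assume "is_proj n R \<and> ranges_independent n R Q"
      then have R: "is_proj n R" and ind: "ranges_independent n R Q" by auto
      obtain y where y: "y \<in> carrier_vec n" "Q *\<^sub>v y = y" "y \<bullet> y = 1"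
        using proj_unit_vec_in_range[OF Q tr] by blast
      \<comment> \<open>Independence of the ranges makes \<open>z\<close> nonzero. It is orthogonal
        to the range of \<open>R\<close>, hence \<open>h \<bullet> z = vec n g \<bullet> z\<close>;
        if the \<open>Q\<close>-component of \<open>h\<close> were zero, \<open>h\<close> would be
        orthogonal both to \<open>y\<close> and to the range of \<open>R\<close>, and so to
        \<open>z\<close>.\<close>
      define z where "z = y - R *\<^sub>v y"
      have z: "z \<in> carrier_vec n" using R y by (simp add: z_def)
      have "z \<noteq> 0\<^sub>v n"
      proof
        assume "z = 0\<^sub>v n"
        then have "R *\<^sub>v y = y" using vec_zero_diff_eq[OF y(1), of "R *\<^sub>v y"] R by (simp add: z_def)
        then have "y = 0\<^sub>v n" using ind y by (simp add: ranges_independent_def)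
        then show False using y by simp
      qed
      from AE_gauss_scalar_prod[OF z this]
      show "AE g in gauss n. vec_coords n (split_vec n R Q (vec n g)) \<in> {h \<in> space ?B. Q *\<^sub>v vec n h \<noteq> 0\<^sub>v n}"
      proof eventually_elim
        fix g :: "nat \<Rightarrow> real" assume gz: "vec n g \<bullet> z \<noteq> 0"
        define h where "h = split_vec n R Q (vec n g)"
        have "is_split n R Q (vec n g) h" unfolding h_def by (rule is_split_split_vec[OF R Q ind]) simp
        then have h: "h \<in> carrier_vec n" "R *\<^sub>v (h - vec n g) = h - vec n g" "R *\<^sub>v ((1\<^sub>m n - Q) *\<^sub>v h) = 0\<^sub>v n"
          by (auto simp: is_split_def)
        have Rz: "R *\<^sub>v z = 0\<^sub>v n"
          unfolding z_def using R y is_proj_carrier[OF R] by (simp add: mult_minus_distrib_mat_vec[of _ n n])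
        have "(h - vec n g) \<bullet> z = 0" using h z Rz by (intro scalar_prod_range_kernel[OF R]) auto
        then have hz: "h \<bullet> z = vec n g \<bullet> z" using h z by (simp add: minus_scalar_prod_distrib[of _ n])
        have "Q *\<^sub>v h \<noteq> 0\<^sub>v n"
        proof
          assume Qh: "Q *\<^sub>v h = 0\<^sub>v n"
          then have "(1\<^sub>m n - Q) *\<^sub>v h = h" using proj_compl_eq_0(2)[OF Q h(1)] by simp
          then have Rh: "R *\<^sub>v h = 0\<^sub>v n" using h(3) by simp
          have "h \<bullet> z = h \<bullet> y - h \<bullet> (R *\<^sub>v y)"
            unfolding z_def using h y R by (simp add: scalar_prod_minus_distrib[of _ n])
          also have "h \<bullet> y = 0" using scalar_prod_range[OF Q h(1) y(1,2)] Qh y by simp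
          also have "h \<bullet> (R *\<^sub>v y) = 0" using is_proj_self_adjoint[OF R h(1) y(1)] Rh y by simp
          finally show False using hz gz by simp
        qed
        then show "vec_coords n (split_vec n R Q (vec n g)) \<in> {h \<in> space ?B. Q *\<^sub>v vec n h \<noteq> 0\<^sub>v n}"
          using h(1) sp by (simp add: h_def[symmetric])
      qed
    qed
  qed
  then show "AE h in split_law Q. Q *\<^sub>v vec n h \<noteq> 0\<^sub>v n" by eventually_elim simp
qed

lemma direction_measure_split_law:
  assumes Q: "is_proj n Q" and dims: "\<rho> + mat_trace Q < n" and tr: "0 < mat_trace Q"
  shows "direction_measure (split_law Q) n Q"
proof -
  interpret pair: pair_prob_space \<mu> "gauss n" by unfold_locales
  interpret law: prob_space "split_law Q"
    unfolding split_law_def by (rule pair.prob_space_distr[OF measurable_split[OF Q]])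
  show ?thesis
    by unfold_locales (use assms AE_split_law_components reflection_invariant_split_law in \<open>auto simp: split_law_def\<close>)
qed

definition split_event :: "real mat \<Rightarrow> (nat \<Rightarrow> real) set \<Rightarrow> (real mat \<times> (nat \<Rightarrow> real)) set" where
  "split_event Q S = {p \<in> space (\<mu> \<Otimes>\<^sub>M gauss n). vec_coords n (split_vec n (fst p) Q (vec n (snd p))) \<in> S}"

lemma sets_split_event:
  assumes "is_proj n Q" "S \<in> sets (Pi\<^sub>M {..<n} (\<lambda>_. borel))"
  shows "split_event Q S \<in> sets (\<mu> \<Otimes>\<^sub>M gauss n)"
  using measurable_sets[OF measurable_split[OF assms(1)] assms(2)]
  by (simp add: split_event_def vimage_def Int_def conj_commute)

text \<open>The exchange on which the probability estimates rest: the oblique splitting along a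
  random subspace and the orthogonal splitting of a Gaussian vector give a cone the same
  probability.\<close>

lemma emeasure_split_event_cone:
  assumes Q: "is_proj n Q" and dims: "\<rho> + mat_trace Q < n" and tr: "0 < mat_trace Q"
    and fin: "finite S1" "finite S2"
    and a: "\<And>i. i \<in> S1 \<Longrightarrow> a i \<in> carrier_vec n" and b: "\<And>i. i \<in> S2 \<Longrightarrow> b i \<in> carrier_vec n"
  shows "emeasure (\<mu> \<Otimes>\<^sub>M gauss n) (split_event Q (cone n Q S1 S2 a b)) = emeasure (gauss n) (cone n Q S1 S2 a b)"
    and "cone n Q S1 S2 a b \<in> sets (Pi\<^sub>M {..<n} (\<lambda>_. borel))"
proof -
  have tr': "mat_trace Q < n" using dims trace_nonneg by linarith
  note eq = emeasure_cone_eq[OF direction_measure_split_law[OF Q dims tr] direction_measure_gauss[OF Q tr tr'] fin a b]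
  show s: "cone n Q S1 S2 a b \<in> sets (Pi\<^sub>M {..<n} (\<lambda>_. borel))" by (rule eq(2))
  have "emeasure (split_law Q) (cone n Q S1 S2 a b) = emeasure (\<mu> \<Otimes>\<^sub>M gauss n) (split_event Q (cone n Q S1 S2 a b))"
    unfolding split_law_def emeasure_distr[OF measurable_split[OF Q] s] split_event_def
    by (simp add: vimage_def Int_def conj_commute)
  then show "emeasure (\<mu> \<Otimes>\<^sub>M gauss n) (split_event Q (cone n Q S1 S2 a b)) = emeasure (gauss n) (cone n Q S1 S2 a b)"
    using eq(1) by simp
qed

end

section \<open>Faces of the cone\<close>

text \<open>Projection onto the orthogonal complement of
  \<open>{x. x\<^sub>i = 0 for i \<in> J, \<Sum>i. x\<^sub>i = 0}\<close>, the span of a face of the cone under consideration.\<close>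

definition face_proj :: "nat \<Rightarrow> nat set \<Rightarrow> real mat" where
  "face_proj n J = mat n n (\<lambda>(i, j). if i \<in> J \<or> j \<in> J then (if i = j then 1 else 0) else 1 / real (card ({..<n} - J)))"

lemma face_proj_carrier [simp]: "face_proj n J \<in> carrier_mat n n"
  by (simp add: face_proj_def)

lemma face_proj_mult_vec:
  assumes x: "x \<in> carrier_vec n" and i: "i < n"
  shows "(face_proj n J *\<^sub>v x) $ i = (if i \<in> J then x $ i else (\<Sum>j\<in>{..<n} - J. x $ j) / real (card ({..<n} - J)))"
proof -
  have "(face_proj n J *\<^sub>v x) $ i = (\<Sum>j<n. face_proj n J $$ (i, j) * x $ j)"
    using x i by (auto simp: scalar_prod_def lessThan_atLeast0 face_proj_def)
  also have "\<dots> = (if i \<in> J then x $ i else (\<Sum>j\<in>{..<n} - J. x $ j) / real (card ({..<n} - J)))"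
  proof (cases "i \<in> J")
    case True
    then have "(\<Sum>j<n. face_proj n J $$ (i, j) * x $ j) = (\<Sum>j<n. if j = i then x $ j else 0)"
      using i by (intro sum.cong) (auto simp: face_proj_def)
    then show ?thesis using True i by simp
  next
    case False
    have "(\<Sum>j<n. face_proj n J $$ (i, j) * x $ j) = (\<Sum>j<n. if j \<in> J then 0 else x $ j / real (card ({..<n} - J)))"
      using i False by (intro sum.cong) (auto simp: face_proj_def)
    also have "\<dots> = (\<Sum>j\<in>{..<n} - J. x $ j / real (card ({..<n} - J)))"
      by (intro sum.mono_neutral_cong_right) auto
    finally show ?thesis using False by (simp add: sum_divide_distrib)
  qed
  finally show ?thesis .
qed

lemma is_proj_face_proj:
  assumes i0: "i0 < n" "i0 \<notin> J"
  shows "is_proj n (face_proj n J)"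
proof -
  have card: "real (card ({..<n} - J)) \<noteq> 0" using i0 by (auto simp: card_eq_0_iff)
  have "face_proj n J * face_proj n J = face_proj n J"
  proof (rule mat_eq_by_mult_vec[of _ n n])
    fix x :: "real vec" assume x: "x \<in> carrier_vec n"
    have "(face_proj n J * face_proj n J) *\<^sub>v x = face_proj n J *\<^sub>v (face_proj n J *\<^sub>v x)"
      using x by (intro assoc_mult_mat_vec[of _ n n _ n]) auto
    also have "\<dots> = face_proj n J *\<^sub>v x"
    proof (rule eq_vecI)
      fix i assume "i < dim_vec (face_proj n J *\<^sub>v x)"
      then have i: "i < n" by (simp add: face_proj_def)
      have y: "face_proj n J *\<^sub>v x \<in> carrier_vec n" using x by (intro mult_mat_vec_carrier[of _ n n]) auto
      have "(\<Sum>j\<in>{..<n} - J. (face_proj n J *\<^sub>v x) $ j) = (\<Sum>j\<in>{..<n} - J. (\<Sum>j\<in>{..<n} - J. x $ j) / real (card ({..<n} - J)))"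
        by (intro sum.cong) (auto simp: face_proj_mult_vec[OF x] simp del: index_mult_mat_vec)
      also have "\<dots> = (\<Sum>j\<in>{..<n} - J. x $ j)" using card by simp
      finally show "(face_proj n J *\<^sub>v (face_proj n J *\<^sub>v x)) $ i = (face_proj n J *\<^sub>v x) $ i"
        using face_proj_mult_vec[OF y i] face_proj_mult_vec[OF x i] by (simp del: index_mult_mat_vec)
    qed (simp add: face_proj_def)
    finally show "(face_proj n J * face_proj n J) *\<^sub>v x = face_proj n J *\<^sub>v x" .
  qed (auto intro: mult_carrier_mat[of _ n n])
  moreover have "transpose_mat (face_proj n J) = face_proj n J"
    by (intro eq_matI) (auto simp: face_proj_def)
  ultimately show ?thesis by (simp add: is_proj_def)
qed

text \<open>The coordinates in \<open>J\<close> contribute one each, and the averaging block on the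
  remaining coordinates contributes one in total; this is the codimension of the span of the
  face.\<close>

lemma mat_trace_face_proj:
  assumes i0: "i0 < n" "i0 \<notin> J" and J: "J \<subseteq> {..<n}"
  shows "mat_trace (face_proj n J) = real (card J) + 1"
proof -
  have card: "real (card ({..<n} - J)) \<noteq> 0" using i0 by (auto simp: card_eq_0_iff)
  have fin: "finite J" using J finite_subset by blast
  have "mat_trace (face_proj n J) = (\<Sum>i<n. if i \<in> J then 1 else 1 / real (card ({..<n} - J)))"
    by (auto simp: mat_trace_def face_proj_def intro!: sum.cong)
  also have "\<dots> = (\<Sum>i\<in>J. 1) + (\<Sum>i\<in>{..<n} - J. 1 / real (card ({..<n} - J)))"
    using J by (subst sum.If_cases) (auto simp: Int_absorb1 Diff_eq intro!: arg_cong2[of _ _ _ _ "(+)"])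
  also have "\<dots> = real (card J) + 1" using card by simp
  finally show ?thesis .
qed

text \<open>The variational inequality for metric projection. Both candidates \<open>p\<close> and
  \<open>p'\<close> lie in the kernel of \<open>R\<close>, and the residual \<open>g - p\<close> is
  the normal part minus a vector of the range of \<open>R\<close>. The two sign hypotheses therefore
  give \<open>(g - p) \<bullet> (p' - p) \<le> 0\<close> and its counterpart, and the left-hand
  sides add up to the squared distance of \<open>p\<close> and \<open>p'\<close>.\<close>

lemma split_component_unique:
  assumes R: "is_proj n R" and Q: "is_proj n Q" and Q': "is_proj n Q'" and g: "g \<in> carrier_vec n"
    and h: "is_split n R Q g h" and h': "is_split n R Q' g h'"
    and le: "(Q *\<^sub>v h) \<bullet> ((1\<^sub>m n - Q') *\<^sub>v h') \<le> 0" and le': "(Q' *\<^sub>v h') \<bullet> ((1\<^sub>m n - Q) *\<^sub>v h) \<le> 0"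
  shows "(1\<^sub>m n - Q) *\<^sub>v h = (1\<^sub>m n - Q') *\<^sub>v h'"
proof -
  have key: "(g - (1\<^sub>m n - Q) *\<^sub>v h) \<bullet> ((1\<^sub>m n - Q') *\<^sub>v h' - (1\<^sub>m n - Q) *\<^sub>v h) \<le> 0"
    if Q: "is_proj n Q" and Q': "is_proj n Q'" and h: "is_split n R Q g h" and h': "is_split n R Q' g h'"
      and le: "(Q *\<^sub>v h) \<bullet> ((1\<^sub>m n - Q') *\<^sub>v h') \<le> 0" for Q Q' h h'
  proof -
    define p p' where "p = (1\<^sub>m n - Q) *\<^sub>v h" and "p' = (1\<^sub>m n - Q') *\<^sub>v h'"
    have hc: "h \<in> carrier_vec n" "h' \<in> carrier_vec n" using h h' by (auto simp: is_split_def)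
    have p: "p \<in> carrier_vec n" "p' \<in> carrier_vec n"
      using proj_compl(1)[OF Q] proj_compl(1)[OF Q'] by (auto simp: p_def p'_def)
    have Qh: "Q *\<^sub>v h \<in> carrier_vec n" using Q by simp
    define e where "e = h - g"
    have e: "e \<in> carrier_vec n" "R *\<^sub>v e = e" using hc g h by (auto simp: e_def is_split_def)
    have gp: "g - p = Q *\<^sub>v h - e"
      using proj_compl(3)[OF Q hc(1)] hc g Qh is_proj_carrier[OF Q]
      by (intro eq_vecI) (auto simp: p_def e_def)
    have Rp: "R *\<^sub>v p = 0\<^sub>v n" "R *\<^sub>v p' = 0\<^sub>v n" using h h' by (auto simp: is_split_def p_def p'_def)
    have ep: "e \<bullet> p = 0" "e \<bullet> p' = 0" using scalar_prod_range_kernel[OF R e(1) _ e(2)] p Rp by auto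
    have QQh: "Q *\<^sub>v (Q *\<^sub>v h) = Q *\<^sub>v h" using Q hc by simp
    have "Q *\<^sub>v p = 0\<^sub>v n"
      unfolding p_def using proj_compl(3)[OF Q hc(1)] Q hc is_proj_carrier[OF Q]
      by (simp add: mult_minus_distrib_mat_vec[of _ n n])
    then have "(Q *\<^sub>v h) \<bullet> p = 0" using scalar_prod_range_kernel[OF Q Qh p(1) QQh] by simp
    then have "(g - p) \<bullet> (p' - p) = (Q *\<^sub>v h) \<bullet> p'"
      unfolding gp using p e Qh ep
      by (simp add: minus_scalar_prod_distrib[of _ n] scalar_prod_minus_distrib[of _ n])
    then show ?thesis using le by (simp add: p_def p'_def)
  qed
  define p p' where "p = (1\<^sub>m n - Q) *\<^sub>v h" and "p' = (1\<^sub>m n - Q') *\<^sub>v h'"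
  have p: "p \<in> carrier_vec n" "p' \<in> carrier_vec n"
    using proj_compl(1)[OF Q] proj_compl(1)[OF Q'] by (auto simp: p_def p'_def)
  have 1: "(g - p) \<bullet> (p' - p) \<le> 0" "(g - p') \<bullet> (p - p') \<le> 0"
    using key[OF Q Q' h h' le] key[OF Q' Q h' h le'] by (auto simp: p_def p'_def)
  have "(p' - p) \<bullet> (p' - p) = (g - p) \<bullet> (p' - p) + (g - p') \<bullet> (p - p')"
    using p g by (simp add: minus_scalar_prod_distrib[of _ n] scalar_prod_minus_distrib[of _ n] algebra_simps)
  then have "(p' - p) \<bullet> (p' - p) = 0" using 1 scalar_prod_self_nonneg[of "p' - p"] by linarith
  then have "p' - p = 0\<^sub>v n" using scalar_prod_self_eq_0[of "p' - p" n] p by simp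
  then have "p' = p" using vec_zero_diff_eq p by blast
  then show ?thesis by (simp add: p_def p'_def)
qed

text \<open>Since \<open>p\<close> has coordinate sum zero, a common constant \<open>t\<close> may
  be subtracted from \<open>q\<close> without changing the inner product.\<close>

lemma scalar_prod_le_0:
  fixes q p :: "real vec"
  assumes "q \<in> carrier_vec n" "p \<in> carrier_vec n" "(\<Sum>i<n. p $ i) = 0"
    and le: "\<And>i. i < n \<Longrightarrow> (q $ i - t) * p $ i \<le> 0"
  shows "q \<bullet> p \<le> 0"
proof -
  have "q \<bullet> p = (\<Sum>i<n. (q $ i - t) * p $ i) + t * (\<Sum>i<n. p $ i)"
    using carrier_vecD[OF assms(2)]
    by (simp add: scalar_prod_def lessThan_atLeast0 sum_distrib_left sum.distrib[symmetric] algebra_simps)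
  then show ?thesis using le assms(3) by (auto intro: sum_nonpos)
qed

text \<open>The event that the kernel of \<open>R\<close> meets the cone outside the origin, with
  the row of ones turned into the condition on the coordinate sum.\<close>

definition feasible :: "nat \<Rightarrow> nat set \<Rightarrow> real mat set" where
  "feasible n I = {R \<in> carrier_mat n n. \<exists>x\<in>carrier_vec n. x \<noteq> 0\<^sub>v n \<and> R *\<^sub>v x = 0\<^sub>v n \<and>
     (\<forall>i\<in>I. 0 \<le> x $ i) \<and> (\<Sum>i<n. x $ i) = 0}"

lemma sets_feasible:
  assumes I: "I \<subseteq> {..<n}"
  shows "feasible n I \<in> sets (mat_borel n n)"
proof -
  have finI: "finite I" using I finite_subset by blast
  \<comment> \<open>A feasible vector can be scaled to length one, so its coordinates may be sought
    in \<open>[-1, 1]\<close>.\<close>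
  define K :: "(nat \<Rightarrow> real) set" where "K = Pi\<^sub>E UNIV (\<lambda>_. {-1..1})"
  define \<phi> :: "real mat \<Rightarrow> (nat \<Rightarrow> real) \<Rightarrow> real" where
    "\<phi> R b = \<bar>(\<Sum>i<n. b i * b i) - 1\<bar> + (\<Sum>i<n. \<bar>\<Sum>j<n. R $$ (i, j) * b j\<bar>) + (\<Sum>i\<in>I. max 0 (- b i)) + \<bar>\<Sum>i<n. b i\<bar>" for R b
  have "{R \<in> space (mat_borel n n). \<exists>b\<in>K. \<phi> R b = 0} \<in> sets (mat_borel n n)"
  proof (rule sets_ex_zero_compact)
    show "compact K" unfolding K_def by (rule compact_box)
    show "(\<lambda>R. \<phi> R b) \<in> borel_measurable (mat_borel n n)" for b
      unfolding \<phi>_def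
      by (intro borel_measurable_add borel_measurable_sum borel_measurable_abs borel_measurable_diff
          borel_measurable_times borel_measurable_const measurable_mat_entry) auto
    show "continuous_on K (\<phi> R)" for R
      unfolding \<phi>_def by (intro continuous_intros continuous_on_subset[OF continuous_on_product_coordinates]) auto
  qed
  also have "{R \<in> space (mat_borel n n). \<exists>b\<in>K. \<phi> R b = 0} = feasible n I"
  proof (intro Set.set_eqI iffI)
    fix R assume "R \<in> {R \<in> space (mat_borel n n). \<exists>b\<in>K. \<phi> R b = 0}"
    then obtain b where R: "R \<in> carrier_mat n n" and b: "\<phi> R b = 0" by (auto simp: space_mat_borel)
    have "0 \<le> (\<Sum>i<n. \<bar>\<Sum>j<n. R $$ (i, j) * b j\<bar>)" "0 \<le> (\<Sum>i\<in>I. max 0 (- b i))"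
      by (auto intro: sum_nonneg)
    then have e: "(\<Sum>i<n. b i * b i) = 1" "(\<Sum>i<n. \<bar>\<Sum>j<n. R $$ (i, j) * b j\<bar>) = 0"
      "(\<Sum>i\<in>I. max 0 (- b i)) = 0" "(\<Sum>i<n. b i) = 0"
      using b unfolding \<phi>_def by linarith+
    have e2: "(\<Sum>j<n. R $$ (i, j) * b j) = 0" if "i < n" for i
      using e(2) that by (subst (asm) sum_nonneg_eq_0_iff) auto
    have e3: "0 \<le> b i" if "i \<in> I" for i
      using e(3) that finI by (subst (asm) sum_nonneg_eq_0_iff) (auto simp: max_def split: if_splits)
    have "R *\<^sub>v vec n b = 0\<^sub>v n" using e2 R by (intro eq_vecI) (auto simp: scalar_prod_def lessThan_atLeast0)
    moreover have "vec n b \<noteq> 0\<^sub>v n"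
    proof
      assume "vec n b = 0\<^sub>v n"
      then have "b i = 0" if "i < n" for i using that by (metis index_vec index_zero_vec(1))
      then show False using e(1) by simp
    qed
    ultimately show "R \<in> feasible n I"
      using R e(4) e3 I by (auto simp: feasible_def intro!: bexI[of _ "vec n b"])
  next
    fix R assume "R \<in> feasible n I"
    then obtain x where R: "R \<in> carrier_mat n n" and x: "x \<in> carrier_vec n" "x \<noteq> 0\<^sub>v n" "R *\<^sub>v x = 0\<^sub>v n"
      "\<And>i. i \<in> I \<Longrightarrow> 0 \<le> x $ i" "(\<Sum>i<n. x $ i) = 0" by (auto simp: feasible_def)
    define u where "u = normalize_vec x"
    have pos: "0 < x \<bullet> x" using scalar_prod_self_pos[OF x(1,2)] .
    have u: "u \<in> carrier_vec n" "u \<bullet> u = 1" using x by (auto simp: u_def intro: scalar_prod_normalize_vec)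
    have ui: "u $ i = x $ i / sqrt (x \<bullet> x)" if "i < n" for i using that x by (simp add: u_def normalize_vec_def)
    define b where "b i = (if i < n then u $ i else 0)" for i
    have bs: "(\<Sum>i<n. b i * b i) = 1" using u by (simp add: b_def scalar_prod_def lessThan_atLeast0)
    have "\<bar>b i\<bar> \<le> 1" for i
    proof (cases "i < n")
      case True
      have "b i * b i \<le> (\<Sum>i<n. b i * b i)" using True by (intro member_le_sum) auto
      then show ?thesis using bs by (metis abs_le_square_iff abs_one one_power2 power2_eq_square)
    qed (simp add: b_def)
    then have "b \<in> K" by (auto simp: K_def abs_le_iff)
    moreover have "\<phi> R b = 0"
    proof -
      have "R *\<^sub>v u = 0\<^sub>v n" unfolding u_def normalize_vec_def using R x by (simp add: mult_mat_vec[of _ n n])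
      then have "(R *\<^sub>v u) $ i = 0" if "i < n" for i using that by simp
      moreover have "(R *\<^sub>v u) $ i = (\<Sum>j<n. R $$ (i, j) * b j)" if "i < n" for i
        using that R u(1) by (simp add: b_def scalar_prod_def lessThan_atLeast0)
      ultimately have "(\<Sum>j<n. R $$ (i, j) * b j) = 0" if "i < n" for i using that by simp
      moreover have "max 0 (- b i) = 0" if "i \<in> I" for i
      proof -
        have "0 \<le> x $ i / sqrt (x \<bullet> x)" using x(4)[OF that] pos by simp
        then show ?thesis using that I by (auto simp: b_def ui)
      qed
      moreover have "(\<Sum>i<n. b i) = 0" using x(5) by (simp add: b_def ui sum_divide_distrib[symmetric])
      ultimately show ?thesis using bs by (simp add: \<phi>_def)
    qed
    ultimately show "R \<in> {R \<in> space (mat_borel n n). \<exists>b\<in>K. \<phi> R b = 0}"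
      using R by (auto simp: space_mat_borel)
  qed
  finally show ?thesis .
qed

abbreviation (input) diff_unit :: "nat \<Rightarrow> nat \<Rightarrow> nat \<Rightarrow> real vec" where
  "diff_unit n i0 i \<equiv> unit_vec n i0 - unit_vec n i"

text \<open>The face is given by the set \<open>J\<close> of coordinates forced to zero, and the
  strict half describes its relative interior. A normal vector is constant outside \<open>J\<close>
  and no larger on \<open>J\<close>; the constant is read off at the unconstrained index
  \<open>i0\<close>.\<close>

definition primal_cone :: "nat \<Rightarrow> nat set \<Rightarrow> nat \<Rightarrow> nat set \<Rightarrow> (nat \<Rightarrow> real) set" where
  "primal_cone n I i0 J = cone n (face_proj n J) (I - J) J (unit_vec n) (diff_unit n i0)"

text \<open>The same two components with the roles exchanged: now the face of the polar cone is the
  relatively open one, so the strict inequalities move to the normal component.\<close>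

definition dual_cone :: "nat \<Rightarrow> nat set \<Rightarrow> nat \<Rightarrow> nat set \<Rightarrow> (nat \<Rightarrow> real) set" where
  "dual_cone n I i0 J = cone n (1\<^sub>m n - face_proj n J) J (I - J) (diff_unit n i0) (unit_vec n)"

lemma diff_unit_scalar_prod:
  fixes x :: "real vec"
  assumes "x \<in> carrier_vec n" "i0 < n" "i < n"
  shows "diff_unit n i0 i \<bullet> x = x $ i0 - x $ i"
  using assms by (simp add: minus_scalar_prod_distrib[of _ n])

locale face_setup =
  fixes n :: nat and I :: "nat set" and i0 :: nat
  assumes I: "I \<subseteq> {..<n}" and i0: "i0 < n" "i0 \<notin> I"
begin

abbreviation "Q J \<equiv> face_proj n J"

lemma Q_proj: "J \<subseteq> I \<Longrightarrow> is_proj n (Q J)"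
  using i0 by (intro is_proj_face_proj[of i0]) auto

lemma Q_trace: "J \<subseteq> I \<Longrightarrow> mat_trace (Q J) = real (card J) + 1"
  using i0 I by (intro mat_trace_face_proj[of i0]) auto

lemma compl_compl: "1\<^sub>m n - (1\<^sub>m n - Q J) = Q J"
  by (intro eq_matI) (auto simp: face_proj_def)

lemma Q_outside:
  assumes "J \<subseteq> I" "h \<in> carrier_vec n" "i < n" "i \<notin> J"
  shows "(Q J *\<^sub>v h) $ i = (Q J *\<^sub>v h) $ i0"
  using assms i0 face_proj_mult_vec[OF assms(2), of _ J] by (auto simp del: index_mult_mat_vec)

lemma P_face:
  assumes J: "J \<subseteq> I" and h: "h \<in> carrier_vec n"
  shows "\<And>i. i \<in> J \<Longrightarrow> ((1\<^sub>m n - Q J) *\<^sub>v h) $ i = 0" "(\<Sum>i<n. ((1\<^sub>m n - Q J) *\<^sub>v h) $ i) = 0"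
proof -
  have card: "real (card ({..<n} - J)) \<noteq> 0" using i0 J by (auto simp: card_eq_0_iff)
  have c: "Q J *\<^sub>v h \<in> carrier_vec n" using Q_proj[OF J] by simp
  have e: "((1\<^sub>m n - Q J) *\<^sub>v h) $ i = h $ i - (Q J *\<^sub>v h) $ i" if "i < n" for i
    using proj_compl(3)[OF Q_proj[OF J] h] that c carrier_vecD[OF c] by (simp del: index_mult_mat_vec)
  show "((1\<^sub>m n - Q J) *\<^sub>v h) $ i = 0" if "i \<in> J" for i
    using that e[of i] J I face_proj_mult_vec[OF h, of i J] by (auto simp del: index_mult_mat_vec)
  have "(\<Sum>i<n. ((1\<^sub>m n - Q J) *\<^sub>v h) $ i) = (\<Sum>i<n. if i \<in> J then 0 else h $ i - (\<Sum>j\<in>{..<n} - J. h $ j) / real (card ({..<n} - J)))"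
    using face_proj_mult_vec[OF h, of _ J] by (intro sum.cong) (auto simp: e simp del: index_mult_mat_vec)
  also have "\<dots> = (\<Sum>i\<in>{..<n} - J. h $ i - (\<Sum>j\<in>{..<n} - J. h $ j) / real (card ({..<n} - J)))"
    by (intro sum.mono_neutral_cong_right) auto
  also have "\<dots> = 0" using card by (simp add: sum_subtractf)
  finally show "(\<Sum>i<n. ((1\<^sub>m n - Q J) *\<^sub>v h) $ i) = 0" .
qed

lemma primal_coneD:
  assumes J: "J \<subseteq> I" and h: "h \<in> carrier_vec n" and c: "vec_coords n h \<in> primal_cone n I i0 J"
  shows "\<And>i. i \<in> I - J \<Longrightarrow> 0 < ((1\<^sub>m n - Q J) *\<^sub>v h) $ i"
    and "\<And>i. i \<in> J \<Longrightarrow> (Q J *\<^sub>v h) $ i \<le> (Q J *\<^sub>v h) $ i0"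
proof -
  have P: "(1\<^sub>m n - Q J) *\<^sub>v h \<in> carrier_vec n" and Qc: "Q J *\<^sub>v h \<in> carrier_vec n"
    using Q_proj[OF J] proj_compl(1)[OF Q_proj[OF J]] by auto
  show "0 < ((1\<^sub>m n - Q J) *\<^sub>v h) $ i" if "i \<in> I - J" for i
  proof -
    have "0 < unit_vec n i \<bullet> ((1\<^sub>m n - Q J) *\<^sub>v h)" using c that h by (simp add: primal_cone_def cone_def)
    then show ?thesis using P that I by (subst (asm) scalar_prod_left_unit[OF P]) auto
  qed
  show "(Q J *\<^sub>v h) $ i \<le> (Q J *\<^sub>v h) $ i0" if "i \<in> J" for i
  proof -
    have "0 \<le> diff_unit n i0 i \<bullet> (Q J *\<^sub>v h)" using c that h by (simp add: primal_cone_def cone_def)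
    then show ?thesis using that J I i0 by (subst (asm) diff_unit_scalar_prod[OF Qc]) auto
  qed
qed

lemma dual_coneD:
  assumes J: "J \<subseteq> I" and h: "h \<in> carrier_vec n" and c: "vec_coords n h \<in> dual_cone n I i0 J"
  shows "\<And>i. i \<in> J \<Longrightarrow> (Q J *\<^sub>v h) $ i < (Q J *\<^sub>v h) $ i0"
    and "\<And>i. i \<in> I - J \<Longrightarrow> 0 \<le> ((1\<^sub>m n - Q J) *\<^sub>v h) $ i"
proof -
  have P: "(1\<^sub>m n - Q J) *\<^sub>v h \<in> carrier_vec n" and Qc: "Q J *\<^sub>v h \<in> carrier_vec n"
    using Q_proj[OF J] proj_compl(1)[OF Q_proj[OF J]] by auto
  show "0 \<le> ((1\<^sub>m n - Q J) *\<^sub>v h) $ i" if "i \<in> I - J" for i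
  proof -
    have "0 \<le> unit_vec n i \<bullet> ((1\<^sub>m n - Q J) *\<^sub>v h)" using c that h by (simp add: dual_cone_def cone_def)
    then show ?thesis using P that I by (subst (asm) scalar_prod_left_unit[OF P]) auto
  qed
  show "(Q J *\<^sub>v h) $ i < (Q J *\<^sub>v h) $ i0" if "i \<in> J" for i
  proof -
    have "0 < diff_unit n i0 i \<bullet> (Q J *\<^sub>v h)" using c that h by (simp add: dual_cone_def cone_def compl_compl)
    then show ?thesis using that J I i0 by (subst (asm) diff_unit_scalar_prod[OF Qc]) auto
  qed
qed

text \<open>The component in the span of the face is determined by the variational inequality, and
  the strict inequalities make \<open>J\<close> its zero set inside \<open>I\<close>.\<close>

lemma primal_face_unique:
  assumes R: "is_proj n R" and g: "g \<in> carrier_vec n" and J: "J \<subseteq> I" and J': "J' \<subseteq> I"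
    and h: "is_split n R (Q J) g h" and h': "is_split n R (Q J') g h'"
    and c: "vec_coords n h \<in> primal_cone n I i0 J" and c': "vec_coords n h' \<in> primal_cone n I i0 J'"
  shows "J = J'"
proof -
  have hc: "h \<in> carrier_vec n" "h' \<in> carrier_vec n" using h h' by (auto simp: is_split_def)
  have nonneg: "0 \<le> ((1\<^sub>m n - Q J) *\<^sub>v h) $ i"
    if "J \<subseteq> I" "h \<in> carrier_vec n" "vec_coords n h \<in> primal_cone n I i0 J" "i \<in> I" for J h i
    using P_face(1)[OF that(1,2), of i] primal_coneD(1)[OF that(1,2,3), of i] that(4) by (cases "i \<in> J") auto
  have le: "(Q J *\<^sub>v h) \<bullet> ((1\<^sub>m n - Q J') *\<^sub>v h') \<le> 0"
    if J: "J \<subseteq> I" and h: "h \<in> carrier_vec n" and c: "vec_coords n h \<in> primal_cone n I i0 J"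
      and J': "J' \<subseteq> I" and h': "h' \<in> carrier_vec n" and c': "vec_coords n h' \<in> primal_cone n I i0 J'" for J h J' h'
  proof (rule scalar_prod_le_0[where t = "(Q J *\<^sub>v h) $ i0" and n = n])
    show "(\<Sum>i<n. ((1\<^sub>m n - Q J') *\<^sub>v h') $ i) = 0" by (rule P_face(2)[OF J' h'])
    fix i assume i: "i < n"
    show "((Q J *\<^sub>v h) $ i - (Q J *\<^sub>v h) $ i0) * ((1\<^sub>m n - Q J') *\<^sub>v h') $ i \<le> 0"
    proof (cases "i \<in> J")
      case True
      then show ?thesis using primal_coneD(2)[OF J h c True] nonneg[OF J' h' c', of i] J
        by (intro mult_nonpos_nonneg) auto
    next
      case False
      then show ?thesis using Q_outside[OF J h i] by simp
    qed
  qed (use Q_proj[OF J] proj_compl(1)[OF Q_proj[OF J']] in auto)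
  have eq: "(1\<^sub>m n - Q J) *\<^sub>v h = (1\<^sub>m n - Q J') *\<^sub>v h'"
    using le[OF J hc(1) c J' hc(2) c'] le[OF J' hc(2) c' J hc(1) c]
    by (intro split_component_unique[OF R Q_proj[OF J] Q_proj[OF J'] g h h'])
  have zero: "J = {i \<in> I. ((1\<^sub>m n - Q J) *\<^sub>v h) $ i = 0}"
    if "J \<subseteq> I" "h \<in> carrier_vec n" "vec_coords n h \<in> primal_cone n I i0 J" for J h
    using P_face(1)[OF that(1,2)] primal_coneD(1)[OF that] that(1) by fastforce
  show ?thesis using zero[OF J hc(1) c] zero[OF J' hc(2) c'] eq by simp
qed

text \<open>Here it is the normal component that is determined, and \<open>J\<close> consists of the
  indices where it falls strictly below its value at \<open>i0\<close>.\<close>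

lemma dual_face_unique:
  assumes R: "is_proj n R" and g: "g \<in> carrier_vec n" and J: "J \<subseteq> I" and J': "J' \<subseteq> I"
    and h: "is_split n R (1\<^sub>m n - Q J) g h" and h': "is_split n R (1\<^sub>m n - Q J') g h'"
    and c: "vec_coords n h \<in> dual_cone n I i0 J" and c': "vec_coords n h' \<in> dual_cone n I i0 J'"
  shows "J = J'"
proof -
  have hc: "h \<in> carrier_vec n" "h' \<in> carrier_vec n" using h h' by (auto simp: is_split_def)
  have le: "((1\<^sub>m n - Q J) *\<^sub>v h) \<bullet> (Q J' *\<^sub>v h') \<le> 0"
    if J: "J \<subseteq> I" and h: "h \<in> carrier_vec n" and c: "vec_coords n h \<in> dual_cone n I i0 J"
      and J': "J' \<subseteq> I" and h': "h' \<in> carrier_vec n" and c': "vec_coords n h' \<in> dual_cone n I i0 J'" for J h J' h'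
  proof -
    have cc: "(1\<^sub>m n - Q J) *\<^sub>v h \<in> carrier_vec n" "Q J' *\<^sub>v h' \<in> carrier_vec n"
      using Q_proj[OF J'] proj_compl(1)[OF Q_proj[OF J]] by auto
    have "(Q J' *\<^sub>v h') \<bullet> ((1\<^sub>m n - Q J) *\<^sub>v h) \<le> 0"
    proof (rule scalar_prod_le_0[where t = "(Q J' *\<^sub>v h') $ i0" and n = n])
      show "(\<Sum>i<n. ((1\<^sub>m n - Q J) *\<^sub>v h) $ i) = 0" by (rule P_face(2)[OF J h])
      fix i assume i: "i < n"
      show "((Q J' *\<^sub>v h') $ i - (Q J' *\<^sub>v h') $ i0) * ((1\<^sub>m n - Q J) *\<^sub>v h) $ i \<le> 0"
      proof (cases "i \<in> J'")
        case True
        have "0 \<le> ((1\<^sub>m n - Q J) *\<^sub>v h) $ i"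
          using P_face(1)[OF J h, of i] dual_coneD(2)[OF J h c, of i] True J' by (cases "i \<in> J") auto
        then show ?thesis using dual_coneD(1)[OF J' h' c' True]
          by (intro mult_nonpos_nonneg) auto
      next
        case False
        then show ?thesis using Q_outside[OF J' h' i] by simp
      qed
    qed (use cc in auto)
    then show ?thesis using comm_scalar_prod[OF cc] by simp
  qed
  have eq: "Q J *\<^sub>v h = Q J' *\<^sub>v h'"
    using split_component_unique[OF R proj_compl(1)[OF Q_proj[OF J]] proj_compl(1)[OF Q_proj[OF J']] g h h']
      le[OF J hc(1) c J' hc(2) c'] le[OF J' hc(2) c' J hc(1) c]
    by (simp add: compl_compl)
  have zero: "J = {i \<in> I. (Q J *\<^sub>v h) $ i < (Q J *\<^sub>v h) $ i0}"
    if "J \<subseteq> I" "h \<in> carrier_vec n" "vec_coords n h \<in> dual_cone n I i0 J" for J h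
  proof (intro Set.set_eqI iffI)
    fix i assume "i \<in> J"
    then show "i \<in> {i \<in> I. (Q J *\<^sub>v h) $ i < (Q J *\<^sub>v h) $ i0}"
      using dual_coneD(1)[OF that] that(1) by blast
  next
    fix i assume "i \<in> {i \<in> I. (Q J *\<^sub>v h) $ i < (Q J *\<^sub>v h) $ i0}"
    then have i: "i < n" "(Q J *\<^sub>v h) $ i \<noteq> (Q J *\<^sub>v h) $ i0" using I by auto
    show "i \<in> J" using Q_outside[OF that(1,2) i(1)] i(2) by blast
  qed
  show ?thesis using zero[OF J hc(1) c] zero[OF J' hc(2) c'] eq by simp
qed

lemma primal_feasible:
  assumes R: "is_proj n R" and J: "J \<subseteq> I" and dims: "mat_trace R + mat_trace (Q J) < n"
    and h: "is_split n R (Q J) g h" and c: "vec_coords n h \<in> primal_cone n I i0 J"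
  shows "R \<in> feasible n I"
proof (cases "J = I")
  case True
  \<comment> \<open>For \<open>J = I\<close> there are no strict inequalities, and the projected
    component may vanish. The face is then a linear space, and the dimension count alone provides a
    nonzero vector of it in the kernel of \<open>R\<close>.\<close>
  obtain x where x: "x \<in> carrier_vec n" "x \<bullet> x = 1" "R *\<^sub>v x = 0\<^sub>v n" "Q J *\<^sub>v x = 0\<^sub>v n"
    using proj_common_orthogonal[OF R Q_proj[OF J] dims] by blast
  have Px: "(1\<^sub>m n - Q J) *\<^sub>v x = x" using proj_compl_eq_0(2)[OF Q_proj[OF J] x(1)] x by simp
  have "x \<noteq> 0\<^sub>v n" using x by auto
  then show ?thesis
    using x P_face[OF J x(1)] is_proj_carrier[OF R] True unfolding feasible_def Px
    by (auto intro!: bexI[of _ x])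
next
  case False
  have hc: "h \<in> carrier_vec n" using h by (auto simp: is_split_def)
  let ?p = "(1\<^sub>m n - Q J) *\<^sub>v h"
  have pc: "?p \<in> carrier_vec n" using proj_compl(1)[OF Q_proj[OF J]] by simp
  obtain i where i: "i \<in> I" "i \<notin> J" using False J by blast
  have "?p $ i \<noteq> 0" using primal_coneD(1)[OF J hc c, of i] i by simp
  then have "?p \<noteq> 0\<^sub>v n" using i I by auto
  moreover have "0 \<le> ?p $ i" if "i \<in> I" for i
    using P_face(1)[OF J hc, of i] primal_coneD(1)[OF J hc c, of i] that by (cases "i \<in> J") auto
  moreover have "R *\<^sub>v ?p = 0\<^sub>v n" using h by (simp add: is_split_def)
  ultimately show ?thesis
    using pc P_face(2)[OF J hc] is_proj_carrier[OF R] unfolding feasible_def by blast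
qed

text \<open>The range of \<open>R\<close> is the subspace to be tested, and the normal component
  \<open>Q J *\<^sub>v h\<close> is a separating certificate: it is orthogonal to that range, yet
  its inner product with any cone element has a definite sign. Equality forces the element into the
  span of the face, which meets the range of \<open>R\<close> only in zero.\<close>

lemma dual_infeasible:
  assumes R: "is_proj n R" and J: "J \<subseteq> I" and ind: "ranges_independent n R (1\<^sub>m n - Q J)"
    and h: "is_split n R (1\<^sub>m n - Q J) g h" and c: "vec_coords n h \<in> dual_cone n I i0 J"
  shows "1\<^sub>m n - R \<notin> feasible n I"
proof
  assume "1\<^sub>m n - R \<in> feasible n I"
  then obtain x where x: "x \<in> carrier_vec n" "x \<noteq> 0\<^sub>v n" "(1\<^sub>m n - R) *\<^sub>v x = 0\<^sub>v n"
    "\<And>i. i \<in> I \<Longrightarrow> 0 \<le> x $ i" "(\<Sum>i<n. x $ i) = 0" by (auto simp: feasible_def)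
  have hc: "h \<in> carrier_vec n" using h by (auto simp: is_split_def)
  let ?y = "Q J *\<^sub>v h"
  have yc: "?y \<in> carrier_vec n" using Q_proj[OF J] by simp
  have Ry: "R *\<^sub>v ?y = 0\<^sub>v n" using h by (simp add: is_split_def compl_compl)
  have Rx: "R *\<^sub>v x = x" using proj_compl_eq_0(1)[OF R x(1)] x(3) by simp
  have "x \<bullet> ?y = 0" by (rule scalar_prod_range_kernel[OF R x(1) yc Rx Ry])
  then have "0 = (\<Sum>i<n. x $ i * ?y $ i)"
    using carrier_vecD[OF yc] by (simp add: scalar_prod_def lessThan_atLeast0 del: index_mult_mat_vec)
  also have "\<dots> = (\<Sum>i<n. x $ i * (?y $ i - ?y $ i0)) + (\<Sum>i<n. x $ i) * ?y $ i0"
    by (simp add: right_diff_distrib sum_subtractf sum_distrib_right del: index_mult_mat_vec)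
  also have "\<dots> = - (\<Sum>i<n. x $ i * (?y $ i0 - ?y $ i))"
    using x(5) by (simp add: sum_negf[symmetric] algebra_simps del: index_mult_mat_vec)
  finally have sum0: "(\<Sum>i<n. x $ i * (?y $ i0 - ?y $ i)) = 0" by simp
  have nn: "0 \<le> x $ i * (?y $ i0 - ?y $ i)" if "i < n" for i
  proof (cases "i \<in> J")
    case True
    then show ?thesis using dual_coneD(1)[OF J hc c True] x(4)[of i] J by (intro mult_nonneg_nonneg) auto
  next
    case False
    then show ?thesis using Q_outside[OF J hc that] by simp
  qed
  have xJ: "x $ i = 0" if "i \<in> J" for i
  proof -
    have "i < n" using that J I by auto
    then have "x $ i * (?y $ i0 - ?y $ i) = 0"
      using sum0 nn by (subst (asm) sum_nonneg_eq_0_iff) auto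
    then show ?thesis using dual_coneD(1)[OF J hc c that] by auto
  qed
  have "(\<Sum>i\<in>{..<n} - J. x $ i) = (\<Sum>i<n. x $ i)"
    using xJ by (intro sum.mono_neutral_left) auto
  then have "Q J *\<^sub>v x = 0\<^sub>v n"
    using x(5) xJ face_proj_mult_vec[OF x(1), of _ J] carrier_vecD[OF is_proj_mult_vec_carrier[OF Q_proj[OF J]]]
    by (intro eq_vecI) (auto simp del: index_mult_mat_vec)
  then have "(1\<^sub>m n - Q J) *\<^sub>v x = x" using proj_compl_eq_0(2)[OF Q_proj[OF J] x(1)] by simp
  then have "x = 0\<^sub>v n" using ind Rx x(1) by (simp add: ranges_independent_def)
  then show False using x by simp
qed

end

section \<open>Sums over faces\<close>

context reflection_invariant_proj
begin

text \<open>On the Gaussian side the union bound suffices. Each summand is replaced by the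
  probability of a split event; for almost every \<open>R\<close> and all \<open>g\<close> at most
  one of these events occurs, so their sum is bounded by the indicator of \<open>Z\<close>.\<close>

lemma emeasure_union_cone_le:
  assumes fin: "finite \<J>"
    and QQ: "\<And>J. J \<in> \<J> \<Longrightarrow> is_proj n (QQ J)" "\<And>J. J \<in> \<J> \<Longrightarrow> \<rho> + mat_trace (QQ J) < n" "\<And>J. J \<in> \<J> \<Longrightarrow> 0 < mat_trace (QQ J)"
    and C: "\<And>J. J \<in> \<J> \<Longrightarrow> C J = cone n (QQ J) (S1 J) (S2 J) (a J) (b J)"
    and finS: "\<And>J. J \<in> \<J> \<Longrightarrow> finite (S1 J)" "\<And>J. J \<in> \<J> \<Longrightarrow> finite (S2 J)"
    and ab: "\<And>J i. J \<in> \<J> \<Longrightarrow> i \<in> S1 J \<Longrightarrow> a J i \<in> carrier_vec n" "\<And>J i. J \<in> \<J> \<Longrightarrow> i \<in> S2 J \<Longrightarrow> b J i \<in> carrier_vec n"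
    and Z: "Z \<in> sets (mat_borel n n)"
    and uniq: "\<And>R g J J' h h'. is_proj n R \<Longrightarrow> g \<in> carrier_vec n \<Longrightarrow> J \<in> \<J> \<Longrightarrow> J' \<in> \<J> \<Longrightarrow>
      is_split n R (QQ J) g h \<Longrightarrow> is_split n R (QQ J') g h' \<Longrightarrow> vec_coords n h \<in> C J \<Longrightarrow> vec_coords n h' \<in> C J' \<Longrightarrow> J = J'"
    and inZ: "\<And>R g J h. is_proj n R \<Longrightarrow> mat_trace R = \<rho> \<Longrightarrow> J \<in> \<J> \<Longrightarrow> ranges_independent n R (QQ J) \<Longrightarrow>
      is_split n R (QQ J) g h \<Longrightarrow> vec_coords n h \<in> C J \<Longrightarrow> R \<in> Z"
    and G: "G \<subseteq> (\<Union>J\<in>\<J>. C J)"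
  shows "emeasure (gauss n) G \<le> emeasure \<mu> Z"
proof -
  interpret pair: pair_sigma_finite \<mu> "gauss n" by unfold_locales
  let ?E = "\<lambda>J. split_event (QQ J) (C J)"
  have Cs: "C J \<in> sets (Pi\<^sub>M {..<n} (\<lambda>_. borel))"
    and Ce: "emeasure (\<mu> \<Otimes>\<^sub>M gauss n) (?E J) = emeasure (gauss n) (C J)" if J: "J \<in> \<J>" for J
    using emeasure_split_event_cone[OF QQ(1,2,3)[OF J] finS(1,2)[OF J], of "a J" "b J"] ab J C[OF J] by auto
  have Es: "?E J \<in> sets (\<mu> \<Otimes>\<^sub>M gauss n)" if "J \<in> \<J>" for J
    using sets_split_event[OF QQ(1)[OF that] Cs[OF that]] .
  have "emeasure (gauss n) G \<le> emeasure (gauss n) (\<Union>J\<in>\<J>. C J)"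
    using fin Cs G by (intro emeasure_mono) (auto simp: sets_gauss)
  also have "\<dots> \<le> (\<Sum>J\<in>\<J>. emeasure (gauss n) (C J))"
    using fin Cs by (intro emeasure_subadditive_finite) (auto simp: sets_gauss)
  also have "\<dots> = (\<Sum>J\<in>\<J>. \<integral>\<^sup>+p. indicator (?E J) p \<partial>(\<mu> \<Otimes>\<^sub>M gauss n))"
    using Es Ce by (intro sum.cong) simp_all
  also have "\<dots> = (\<integral>\<^sup>+p. (\<Sum>J\<in>\<J>. indicator (?E J) p) \<partial>(\<mu> \<Otimes>\<^sub>M gauss n))"
    using Es by (intro nn_integral_sum[symmetric]) auto
  also have "\<dots> = (\<integral>\<^sup>+R. \<integral>\<^sup>+g. (\<Sum>J\<in>\<J>. indicator (?E J) (R, g)) \<partial>gauss n \<partial>\<mu>)"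
    using Es by (intro gauss.nn_integral_fst[symmetric] borel_measurable_sum) auto
  also have "\<dots> \<le> (\<integral>\<^sup>+R. indicator Z R \<partial>\<mu>)"
  proof (rule nn_integral_mono_AE)
    have "AE R in \<mu>. \<forall>J\<in>\<J>. is_proj n R \<and> ranges_independent n R (QQ J)"
      using fin QQ AE_ranges_independent by (intro AE_finite_allI) auto
    then show "AE R in \<mu>. (\<integral>\<^sup>+g. (\<Sum>J\<in>\<J>. indicator (?E J) (R, g)) \<partial>gauss n) \<le> indicator Z R"
      using AE_proj
    proof eventually_elim
      fix R assume ind: "\<forall>J\<in>\<J>. is_proj n R \<and> ranges_independent n R (QQ J)" and R: "is_proj n R \<and> mat_trace R = \<rho>"
      have split: "is_split n R (QQ J) (vec n g) (split_vec n R (QQ J) (vec n g))" if "J \<in> \<J>" for J and g :: "nat \<Rightarrow> real"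
        using that ind QQ by (intro is_split_split_vec) auto
      have "(\<Sum>J\<in>\<J>. indicator (?E J) (R, g)) \<le> (indicator Z R :: ennreal)" for g
      proof (cases "\<exists>J\<in>\<J>. (R, g) \<in> ?E J")
        case True
        then obtain J where J: "J \<in> \<J>" "(R, g) \<in> ?E J" by blast
        have cJ: "vec_coords n (split_vec n R (QQ J) (vec n g)) \<in> C J" using J by (simp add: split_event_def)
        have only: "J' = J" if "J' \<in> \<J>" "(R, g) \<in> ?E J'" for J'
          by (rule uniq[OF _ _ that(1) J(1) split[OF that(1), of g] split[OF J(1), of g] _ cJ])
            (use R that in \<open>auto simp: split_event_def\<close>)
        have "(\<Sum>J'\<in>\<J>. indicator (?E J') (R, g)) = (\<Sum>J'\<in>\<J>. if J' = J then 1 else 0 :: ennreal)"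
        proof (rule sum.cong[OF refl])
          fix J' assume J': "J' \<in> \<J>"
          show "indicator (?E J') (R, g) = (if J' = J then 1 else 0 :: ennreal)"
          proof (cases "J' = J")
            case True
            then show ?thesis using J(2) by simp
          next
            case False
            then have "(R, g) \<notin> ?E J'" using only[OF J'] by blast
            then show ?thesis using False by simp
          qed
        qed
        also have "\<dots> = 1" using fin J by simp
        finally show ?thesis using inZ[OF _ _ J(1) _ split[OF J(1)] cJ] R ind J by simp
      next
        case False
        then show ?thesis by (simp add: sum.neutral)
      qed
      then have "(\<integral>\<^sup>+g. (\<Sum>J\<in>\<J>. indicator (?E J) (R, g)) \<partial>gauss n) \<le> (\<integral>\<^sup>+g. indicator Z R \<partial>gauss n)"
        by (intro nn_integral_mono) auto
      then show "(\<integral>\<^sup>+g. (\<Sum>J\<in>\<J>. indicator (?E J) (R, g)) \<partial>gauss n) \<le> indicator Z R"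
        by (simp add: gauss.emeasure_space_1)
    qed
  qed
  also have "\<dots> = emeasure \<mu> Z" using Z sets_mu by simp
  finally show ?thesis .
qed

text \<open>\<open>card J + 1\<close> is the codimension of the span of the face; the dimension
  condition says that the face has dimension larger than \<open>\<rho>\<close>.\<close>

lemma emeasure_primal_cones_le:
  assumes "face_setup n I i0" and \<J>: "\<J> \<subseteq> Pow I" and dims: "\<And>J. J \<in> \<J> \<Longrightarrow> \<rho> + real (card J) + 1 < n"
    and G: "G \<subseteq> (\<Union>J\<in>\<J>. primal_cone n I i0 J)"
  shows "emeasure (gauss n) G \<le> emeasure \<mu> (feasible n I)"
proof -
  interpret face_setup n I i0 by fact
  have finI: "finite I" using I finite_subset by blast
  have J: "J \<subseteq> I" if "J \<in> \<J>" for J using that \<J> by blast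
  show ?thesis
  proof (rule emeasure_union_cone_le[OF _ _ _ _ _ _ _ _ _ _ _ _ G])
    show "finite \<J>" using finI \<J> by (metis finite_Pow_iff finite_subset)
    show "is_proj n (face_proj n J)" if "J \<in> \<J>" for J by (rule Q_proj[OF J[OF that]])
    show "\<rho> + mat_trace (face_proj n J) < n" "0 < mat_trace (face_proj n J)" if "J \<in> \<J>" for J
      using Q_trace[OF J[OF that]] dims[OF that] by auto
    show "primal_cone n I i0 J = cone n (face_proj n J) (I - J) J (unit_vec n) (diff_unit n i0)" for J
      by (simp add: primal_cone_def)
    show "finite (I - J)" for J using finI by simp
    show "finite J" if "J \<in> \<J>" for J using finite_subset[OF J[OF that] finI] .
    show "feasible n I \<in> sets (mat_borel n n)" by (rule sets_feasible[OF I])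
    show "J = J'" if "is_proj n R" "g \<in> carrier_vec n" "J \<in> \<J>" "J' \<in> \<J>"
      "is_split n R (face_proj n J) g h" "is_split n R (face_proj n J') g h'"
      "vec_coords n h \<in> primal_cone n I i0 J" "vec_coords n h' \<in> primal_cone n I i0 J'" for R g J J' h h'
      using primal_face_unique[OF that(1,2) J[OF that(3)] J[OF that(4)] that(5-8)] .
    show "R \<in> feasible n I" if "is_proj n R" "mat_trace R = \<rho>" "J \<in> \<J>" "ranges_independent n R (face_proj n J)"
      "is_split n R (face_proj n J) g h" "vec_coords n h \<in> primal_cone n I i0 J" for R g J h
      using primal_feasible[OF that(1) J[OF that(3)] _ that(5,6)] Q_trace[OF J[OF that(3)]] dims[OF that(3)] that(2) by simp
  qed auto
qed

text \<open>The tested subspace is here the range of \<open>R\<close>, and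
  \<open>1\<^sub>m n - face_proj n J\<close> takes the place of \<open>Q\<close>. The first
  inequality is the general position condition for these two; \<open>card J + 1 < n\<close> keeps
  the span of the face from being zero.\<close>

lemma emeasure_dual_cones_le:
  assumes "face_setup n I i0" and \<J>: "\<J> \<subseteq> Pow I" and dims: "\<And>J. J \<in> \<J> \<Longrightarrow> \<rho> < real (card J) + 1 \<and> card J + 1 < n"
    and G: "G \<subseteq> (\<Union>J\<in>\<J>. dual_cone n I i0 J)"
  shows "emeasure (gauss n) G \<le> emeasure \<mu> {R \<in> space \<mu>. 1\<^sub>m n - R \<notin> feasible n I}"
proof -
  interpret face_setup n I i0 by fact
  have finI: "finite I" using I finite_subset by blast
  have J: "J \<subseteq> I" if "J \<in> \<J>" for J using that \<J> by blast
  let ?Z = "{R \<in> space \<mu>. 1\<^sub>m n - R \<notin> feasible n I}"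
  have Z: "?Z \<in> sets (mat_borel n n)"
  proof -
    have "(\<lambda>R. 1\<^sub>m n - R) \<in> \<mu> \<rightarrow>\<^sub>M mat_borel n n"
      using measurable_mat_compl[of "\<lambda>R. R" "mat_borel n n" n] by (simp cong: measurable_cong_sets add: sets_mu)
    then have "{R \<in> space \<mu>. 1\<^sub>m n - R \<in> - feasible n I \<inter> space (mat_borel n n)} \<in> sets \<mu>"
      using measurable_sets[of "\<lambda>R. 1\<^sub>m n - R" \<mu> "mat_borel n n" "- feasible n I \<inter> space (mat_borel n n)"]
        sets.compl_sets[OF sets_feasible[OF I]] by (simp add: vimage_def Int_def conj_commute Diff_eq)
    moreover have "{R \<in> space \<mu>. 1\<^sub>m n - R \<in> - feasible n I \<inter> space (mat_borel n n)} = ?Z"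
      by (auto simp: space_mu space_mat_borel intro: minus_carrier_mat)
    ultimately show ?thesis using sets_mu by simp
  qed
  show ?thesis
  proof (rule emeasure_union_cone_le[OF _ _ _ _ _ _ _ _ _ _ _ _ G])
    show "finite \<J>" using finI \<J> by (metis finite_Pow_iff finite_subset)
    show "is_proj n (1\<^sub>m n - face_proj n J)" if "J \<in> \<J>" for J by (rule proj_compl(1)[OF Q_proj[OF J[OF that]]])
    show "\<rho> + mat_trace (1\<^sub>m n - face_proj n J) < n" "0 < mat_trace (1\<^sub>m n - face_proj n J)" if "J \<in> \<J>" for J
      using Q_trace[OF J[OF that]] dims[OF that] by (auto simp: proj_compl(2)[OF Q_proj[OF J[OF that]]])
    show "dual_cone n I i0 J = cone n (1\<^sub>m n - face_proj n J) J (I - J) (diff_unit n i0) (unit_vec n)" for J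
      by (simp add: dual_cone_def)
    show "finite (I - J)" for J using finI by simp
    show "finite J" if "J \<in> \<J>" for J using finite_subset[OF J[OF that] finI] .
    show "?Z \<in> sets (mat_borel n n)" by (rule Z)
    show "J = J'" if "is_proj n R" "g \<in> carrier_vec n" "J \<in> \<J>" "J' \<in> \<J>"
      "is_split n R (1\<^sub>m n - face_proj n J) g h" "is_split n R (1\<^sub>m n - face_proj n J') g h'"
      "vec_coords n h \<in> dual_cone n I i0 J" "vec_coords n h' \<in> dual_cone n I i0 J'" for R g J J' h h'
      using dual_face_unique[OF that(1,2) J[OF that(3)] J[OF that(4)] that(5-8)] .
    show "R \<in> ?Z" if "is_proj n R" "mat_trace R = \<rho>" "J \<in> \<J>" "ranges_independent n R (1\<^sub>m n - face_proj n J)"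
      "is_split n R (1\<^sub>m n - face_proj n J) g h" "vec_coords n h \<in> dual_cone n I i0 J" for R g J h
      using dual_infeasible[OF that(1) J[OF that(3)] that(4,5,6)] is_proj_carrier[OF that(1)] by (simp add: space_mu)
  qed auto
qed

end

section \<open>Passing to the orthogonal complement of the random subspace\<close>

lemma sets_proj_trace: "{R \<in> space (mat_borel n n). is_proj n R \<and> mat_trace R = c} \<in> sets (mat_borel n n)"
proof -
  have "is_proj n R \<and> mat_trace R = c \<longleftrightarrow>
    (\<forall>i\<in>{..<n}. \<forall>j\<in>{..<n}. R $$ (i, j) = R $$ (j, i) \<and> (\<Sum>k<n. R $$ (i, k) * R $$ (k, j)) = R $$ (i, j)) \<and> (\<Sum>i<n. R $$ (i, i)) = c"
    if R: "R \<in> carrier_mat n n" for R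
  proof -
    have 1: "transpose_mat R = R \<longleftrightarrow> (\<forall>i\<in>{..<n}. \<forall>j\<in>{..<n}. R $$ (i, j) = R $$ (j, i))"
      using carrier_matD[OF R] by (auto simp: mat_eq_iff)
    have e: "(R * R) $$ (i, j) = (\<Sum>k<n. R $$ (i, k) * R $$ (k, j))" if "i < n" "j < n" for i j
      using that carrier_matD[OF R] by (simp add: scalar_prod_def lessThan_atLeast0)
    have 2: "R * R = R \<longleftrightarrow> (\<forall>i\<in>{..<n}. \<forall>j\<in>{..<n}. (\<Sum>k<n. R $$ (i, k) * R $$ (k, j)) = R $$ (i, j))"
      using carrier_matD[OF R] e by (auto simp: mat_eq_iff)
    show ?thesis using R carrier_matD[OF R] unfolding is_proj_def 1 2 mat_trace_def by auto
  qed
  then have "{R \<in> space (mat_borel n n). is_proj n R \<and> mat_trace R = c} =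
    {R \<in> space (mat_borel n n). (\<forall>i\<in>{..<n}. \<forall>j\<in>{..<n}. R $$ (i, j) = R $$ (j, i) \<and> (\<Sum>k<n. R $$ (i, k) * R $$ (k, j)) = R $$ (i, j)) \<and> (\<Sum>i<n. R $$ (i, i)) = c}"
    by (auto simp: space_mat_borel)
  also have "\<dots> \<in> sets (mat_borel n n)"
    by (intro sets.sets_Collect_conj sets.sets_Collect_finite_All borel_measurable_eq borel_measurable_sum
        borel_measurable_times borel_measurable_const measurable_mat_entry) auto
  finally show ?thesis .
qed

lemma conj_reflection_compl:
  assumes R: "R \<in> carrier_mat n n" and v: "v \<in> carrier_vec n" "v \<bullet> v = 1"
  shows "conj_reflection n v (1\<^sub>m n - R) = 1\<^sub>m n - conj_reflection n v R"
proof -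
  let ?H = "reflection n v"
  have H: "?H \<in> carrier_mat n n" using v by simp
  have HR: "?H * R \<in> carrier_mat n n" using H R by (rule mult_carrier_mat)
  have "?H * (1\<^sub>m n - R) = ?H - ?H * R" using H R by (subst mult_minus_distrib_mat[of _ n n]) auto
  then have "conj_reflection n v (1\<^sub>m n - R) = (?H - ?H * R) * ?H" by (simp add: conj_reflection_def)
  also have "\<dots> = ?H * ?H - ?H * R * ?H" by (rule minus_mult_distrib_mat[OF H HR H])
  finally show ?thesis using reflection_mult_self[OF v] by (simp add: conj_reflection_def)
qed

lemma (in reflection_invariant_proj) reflection_invariant_proj_compl:
  "reflection_invariant_proj (distr \<mu> (mat_borel n n) (\<lambda>R. 1\<^sub>m n - R)) n (real n - \<rho>)"
proof -
  have m: "(\<lambda>R. 1\<^sub>m n - R) \<in> \<mu> \<rightarrow>\<^sub>M mat_borel n n" and m': "(\<lambda>R. 1\<^sub>m n - R) \<in> mat_borel n n \<rightarrow>\<^sub>M mat_borel n n"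
    using measurable_mat_compl[of "\<lambda>R. R" "mat_borel n n" n] by (simp_all cong: measurable_cong_sets add: sets_mu)
  interpret d: prob_space "distr \<mu> (mat_borel n n) (\<lambda>R. 1\<^sub>m n - R)" by (rule prob_space_distr[OF m])
  show ?thesis
  proof unfold_locales
    show "AE R in distr \<mu> (mat_borel n n) (\<lambda>R. 1\<^sub>m n - R). is_proj n R \<and> mat_trace R = real n - \<rho>"
    proof -
      have "AE R in \<mu>. is_proj n (1\<^sub>m n - R) \<and> mat_trace (1\<^sub>m n - R) = real n - \<rho>"
        using AE_proj by eventually_elim (auto simp: proj_compl)
      moreover have "{R \<in> space (mat_borel n n). is_proj n R \<and> mat_trace R = real n - \<rho>} \<in> sets (mat_borel n n)"
        by (rule sets_proj_trace)
      ultimately show ?thesis by (subst AE_distr_iff[OF m]) auto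
    qed
    show "distr (distr \<mu> (mat_borel n n) (\<lambda>R. 1\<^sub>m n - R)) (mat_borel n n) (conj_reflection n v) = distr \<mu> (mat_borel n n) (\<lambda>R. 1\<^sub>m n - R)"
      if v: "v \<in> carrier_vec n" "v \<bullet> v = 1" for v
    proof -
      have c: "conj_reflection n v \<in> mat_borel n n \<rightarrow>\<^sub>M mat_borel n n" by (rule measurable_conj_reflection[OF v(1)])
      have c': "conj_reflection n v \<in> \<mu> \<rightarrow>\<^sub>M mat_borel n n" using c by (simp cong: measurable_cong_sets add: sets_mu)
      have "distr (distr \<mu> (mat_borel n n) (\<lambda>R. 1\<^sub>m n - R)) (mat_borel n n) (conj_reflection n v) =
        distr \<mu> (mat_borel n n) (conj_reflection n v \<circ> (\<lambda>R. 1\<^sub>m n - R))"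
        by (rule distr_distr[OF c m])
      also have "\<dots> = distr \<mu> (mat_borel n n) ((\<lambda>R. 1\<^sub>m n - R) \<circ> conj_reflection n v)"
        using conj_reflection_compl[OF _ v] by (intro distr_cong) (auto simp: space_mu)
      also have "\<dots> = distr (distr \<mu> (mat_borel n n) (conj_reflection n v)) (mat_borel n n) (\<lambda>R. 1\<^sub>m n - R)"
        by (rule distr_distr[OF m' c', symmetric])
      finally show ?thesis by (simp add: inv[OF v])
    qed
  qed simp
qed

text \<open>The polar bound is applied to the law of \<open>1\<^sub>m n - R\<close>, a projection of
  trace \<open>n - \<rho>\<close> whose range is the kernel of \<open>R\<close>.\<close>

lemma (in reflection_invariant_proj) emeasure_infeasible_ge:
  assumes fs: "face_setup n I i0" and \<J>: "\<J> \<subseteq> Pow I" and dims: "\<And>J. J \<in> \<J> \<Longrightarrow> n < \<rho> + real (card J) + 1 \<and> card J + 1 < n"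
    and G: "G \<subseteq> (\<Union>J\<in>\<J>. dual_cone n I i0 J)"
  shows "emeasure (gauss n) G \<le> emeasure \<mu> (space \<mu> - feasible n I)"
proof -
  interpret c: reflection_invariant_proj "distr \<mu> (mat_borel n n) (\<lambda>R. 1\<^sub>m n - R)" n "real n - \<rho>"
    by (rule reflection_invariant_proj_compl)
  interpret face_setup n I i0 by fact
  have m: "(\<lambda>R. 1\<^sub>m n - R) \<in> \<mu> \<rightarrow>\<^sub>M mat_borel n n"
    using measurable_mat_compl[of "\<lambda>R. R" "mat_borel n n" n] by (simp_all cong: measurable_cong_sets add: sets_mu)
  let ?Z = "{R \<in> carrier_mat n n. 1\<^sub>m n - R \<notin> feasible n I}"
  have Z: "?Z \<in> sets (mat_borel n n)"
  proof -
    have m': "(\<lambda>R. 1\<^sub>m n - R) \<in> mat_borel n n \<rightarrow>\<^sub>M mat_borel n n"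
      using measurable_mat_compl[of "\<lambda>R. R" "mat_borel n n" n] by simp
    have "(\<lambda>R. 1\<^sub>m n - R) -` (space (mat_borel n n) - feasible n I) \<inter> space (mat_borel n n) \<in> sets (mat_borel n n)"
      by (rule measurable_sets[OF m' sets.compl_sets[OF sets_feasible[OF I]]])
    also have "(\<lambda>R. 1\<^sub>m n - R) -` (space (mat_borel n n) - feasible n I) \<inter> space (mat_borel n n) = ?Z"
      by (auto simp: space_mat_borel intro: minus_carrier_mat)
    finally show ?thesis .
  qed
  have "emeasure (gauss n) G \<le> emeasure (distr \<mu> (mat_borel n n) (\<lambda>R. 1\<^sub>m n - R)) ?Z"
  proof -
    have "real n - \<rho> < real (card J) + 1 \<and> card J + 1 < n" if "J \<in> \<J>" for J using dims[OF that] by linarith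
    from c.emeasure_dual_cones_le[OF fs \<J> this G] show ?thesis by (simp add: space_mat_borel)
  qed
  also have "\<dots> = emeasure \<mu> ((\<lambda>R. 1\<^sub>m n - R) -` ?Z \<inter> space \<mu>)"
    by (rule emeasure_distr[OF m Z])
  also have "(\<lambda>R. 1\<^sub>m n - R) -` ?Z \<inter> space \<mu> = space \<mu> - feasible n I"
  proof -
    have "1\<^sub>m n - (1\<^sub>m n - R) = R" if "R \<in> carrier_mat n n" for R :: "real mat"
      using that by (intro eq_matI) auto
    then show ?thesis by (auto simp: space_mu intro: minus_carrier_mat)
  qed
  finally show ?thesis .
qed

section \<open>The row space of a rotationally invariant matrix\<close>

lemma mult_vec_entry:
  assumes "A \<in> carrier_mat m n" "x \<in> carrier_vec n" "k < m"
  shows "(A *\<^sub>v x) $ k = (\<Sum>l<n. A $$ (k, l) * x $ l)"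
  using assms(3) carrier_matD[OF assms(1)] carrier_vecD[OF assms(2)]
  by (simp add: scalar_prod_def lessThan_atLeast0)

text \<open>Normal equations: any solution \<open>u\<close> yields the same vector
  \<open>transpose_mat A *\<^sub>v u\<close>, even though \<open>u\<close> itself need not be
  unique. The projection is thereby described by polynomial equations in \<open>A\<close> and
  \<open>u\<close>, as the measurability proof requires.\<close>

lemma row_proj_unit:
  assumes A: "A \<in> carrier_mat d n" and j: "j < n"
  shows "\<exists>u\<in>carrier_vec d. A *\<^sub>v (transpose_mat A *\<^sub>v u) = col A j \<and> transpose_mat A *\<^sub>v u = col (row_proj A) j"
    and "u \<in> carrier_vec d \<Longrightarrow> A *\<^sub>v (transpose_mat A *\<^sub>v u) = col A j \<Longrightarrow> transpose_mat A *\<^sub>v u = col (row_proj A) j"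
proof -
  note R = row_proj[OF A] and At = transpose_carrier_mat[of A n d]
  have cR: "row_proj A \<in> carrier_mat n n" using is_proj_carrier[OF R(2)] .
  have At: "transpose_mat A \<in> carrier_mat n d" using A by simp
  have e: "row_proj A *\<^sub>v unit_vec n j = col (row_proj A) j" "A *\<^sub>v unit_vec n j = col A j"
    using mat_mult_unit_vec[OF cR j] mat_mult_unit_vec[OF A j] by auto
  obtain C where C: "C \<in> carrier_mat d n" "row_proj A = transpose_mat A * C"
    using R(1) A by (auto simp: is_row_proj_def)
  have 1: "transpose_mat A *\<^sub>v col C j = col (row_proj A) j"
    unfolding C(2) by (rule col_mult2[OF At C(1) j, symmetric])
  have cc: "col C j \<in> carrier_vec d" by (rule col_carrier_vec[OF j C(1)])
  have "A *\<^sub>v col (row_proj A) j = (A * row_proj A) *\<^sub>v unit_vec n j"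
    using A cR j by (simp add: assoc_mult_mat_vec[of _ d n _ n] e)
  then have 2: "A *\<^sub>v (transpose_mat A *\<^sub>v col C j) = col A j" using R(3) e 1 by simp
  show "\<exists>u\<in>carrier_vec d. A *\<^sub>v (transpose_mat A *\<^sub>v u) = col A j \<and> transpose_mat A *\<^sub>v u = col (row_proj A) j"
    using 1 2 cc by blast
  assume u: "u \<in> carrier_vec d" "A *\<^sub>v (transpose_mat A *\<^sub>v u) = col A j"
  have w: "transpose_mat A *\<^sub>v u \<in> carrier_vec n" using mult_mat_vec_carrier[OF At u(1)] .
  have "A *\<^sub>v (transpose_mat A *\<^sub>v u - unit_vec n j) = 0\<^sub>v d"
    using A w u(2) e(2) minus_cancel_vec[OF col_carrier_vec[OF j A]]
    by (simp add: mult_minus_distrib_mat_vec[of _ d n])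
  then have "row_proj A *\<^sub>v (transpose_mat A *\<^sub>v u - unit_vec n j) = 0\<^sub>v n"
    using row_proj_kernel[OF A, of "transpose_mat A *\<^sub>v u - unit_vec n j"] w by simp
  then have eq0: "row_proj A *\<^sub>v (transpose_mat A *\<^sub>v u) - col (row_proj A) j = 0\<^sub>v n"
    using cR w e by (simp add: mult_minus_distrib_mat_vec[of _ n n])
  have "row_proj A * transpose_mat A = transpose_mat (A * row_proj A)"
    using transpose_mult[OF A cR] is_proj_transpose[OF R(2)] by simp
  then have "row_proj A *\<^sub>v (transpose_mat A *\<^sub>v u) = transpose_mat A *\<^sub>v u"
    using assoc_mult_mat_vec[OF cR At u(1)] R(3) by simp
  then show "transpose_mat A *\<^sub>v u = col (row_proj A) j"
    using eq0 vec_zero_diff_eq[OF w col_carrier_vec[OF j cR]] by simp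
qed

lemma measurable_row_proj: "row_proj \<in> mat_borel d n \<rightarrow>\<^sub>M mat_borel n n"
proof (rule measurable_mat_borelI)
  show "row_proj A \<in> carrier_mat n n" if "A \<in> space (mat_borel d n)" for A
    using is_proj_carrier[OF row_proj(2)] that by (simp add: space_mat_borel)
  fix i j assume ij: "i < n" "j < n"
  show "(\<lambda>A. row_proj A $$ (i, j)) \<in> borel_measurable (mat_borel d n)"
  proof (subst borel_measurable_iff_le, intro allI)
    fix c :: real
    \<comment> \<open>A solution of the normal equations has no bound uniform in \<open>A\<close>,
      so the compactness argument is applied to boxes of growing size and the union is
      taken.\<close>
    define K :: "nat \<Rightarrow> (nat \<Rightarrow> real) set" where "K m = Pi\<^sub>E UNIV (\<lambda>_. {- real m..real m})" for m
    define w :: "real mat \<Rightarrow> (nat \<Rightarrow> real) \<Rightarrow> nat \<Rightarrow> real" where "w A b l = (\<Sum>k<d. A $$ (k, l) * b k)" for A b l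
    \<comment> \<open>A zero means that \<open>b\<close> solves the normal equations and that the
      resulting entry is at most \<open>c\<close>.\<close>
    define \<phi> :: "real mat \<Rightarrow> (nat \<Rightarrow> real) \<Rightarrow> real" where
      "\<phi> A b = (\<Sum>k<d. \<bar>(\<Sum>l<n. A $$ (k, l) * w A b l) - A $$ (k, j)\<bar>) + max 0 (w A b i - c)" for A b
    have "{A \<in> space (mat_borel d n). \<exists>b\<in>K m. \<phi> A b = 0} \<in> sets (mat_borel d n)" for m
    proof (rule sets_ex_zero_compact)
      show "compact (K m)" unfolding K_def by (rule compact_box)
      show "(\<lambda>A. \<phi> A b) \<in> borel_measurable (mat_borel d n)" for b
        unfolding \<phi>_def w_def using ij
        by (intro borel_measurable_add borel_measurable_sum borel_measurable_abs borel_measurable_diff borel_measurable_max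
            borel_measurable_times borel_measurable_const measurable_mat_entry) auto
      show "continuous_on (K m) (\<phi> A)" for A
        unfolding \<phi>_def w_def by (intro continuous_intros continuous_on_subset[OF continuous_on_product_coordinates]) auto
    qed
    then have "(\<Union>m. {A \<in> space (mat_borel d n). \<exists>b\<in>K m. \<phi> A b = 0}) \<in> sets (mat_borel d n)"
      by (intro sets.countable_UN) auto
    also have "(\<Union>m. {A \<in> space (mat_borel d n). \<exists>b\<in>K m. \<phi> A b = 0}) = {A \<in> space (mat_borel d n). row_proj A $$ (i, j) \<le> c}"
    proof (intro Set.set_eqI iffI)
      fix A assume "A \<in> (\<Union>m. {A \<in> space (mat_borel d n). \<exists>b\<in>K m. \<phi> A b = 0})"
      then obtain b where A: "A \<in> carrier_mat d n" and b: "\<phi> A b = 0" by (auto simp: space_mat_borel)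
      have w: "(transpose_mat A *\<^sub>v vec d b) $ l = w A b l" if "l < n" for l
        using that mult_vec_entry[of "transpose_mat A" n d "vec d b" l] A by (simp add: w_def del: index_mult_mat_vec)
      have cw: "transpose_mat A *\<^sub>v vec d b \<in> carrier_vec n"
        using A by (intro mult_mat_vec_carrier[of _ n d]) auto
      have "0 \<le> (\<Sum>k<d. \<bar>(\<Sum>l<n. A $$ (k, l) * w A b l) - A $$ (k, j)\<bar>)" by (intro sum_nonneg) auto
      then have s: "(\<Sum>k<d. \<bar>(\<Sum>l<n. A $$ (k, l) * w A b l) - A $$ (k, j)\<bar>) = 0" and le: "w A b i \<le> c"
        using b unfolding \<phi>_def by linarith+
      have "(\<Sum>l<n. A $$ (k, l) * w A b l) = A $$ (k, j)" if "k < d" for k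
        using s that by (subst (asm) sum_nonneg_eq_0_iff) auto
      moreover have "(A *\<^sub>v (transpose_mat A *\<^sub>v vec d b)) $ k = (\<Sum>l<n. A $$ (k, l) * w A b l)" if "k < d" for k
      proof -
        have "(A *\<^sub>v (transpose_mat A *\<^sub>v vec d b)) $ k = (\<Sum>l<n. A $$ (k, l) * (transpose_mat A *\<^sub>v vec d b) $ l)"
          by (rule mult_vec_entry[OF A cw that])
        then show ?thesis using w by simp
      qed
      ultimately have "A *\<^sub>v (transpose_mat A *\<^sub>v vec d b) = col A j"
        using carrier_matD[OF A] ij by (intro eq_vecI) (auto simp del: index_mult_mat_vec)
      then have "transpose_mat A *\<^sub>v vec d b = col (row_proj A) j" using row_proj_unit(2)[OF A ij(2)] by simp
      then have "row_proj A $$ (i, j) = w A b i"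
        using w[OF ij(1)] ij is_proj_carrier[OF row_proj(2)[OF A]] by (metis carrier_matD index_col)
      then show "A \<in> {A \<in> space (mat_borel d n). row_proj A $$ (i, j) \<le> c}" using le A by (simp add: space_mat_borel)
    next
      fix A assume "A \<in> {A \<in> space (mat_borel d n). row_proj A $$ (i, j) \<le> c}"
      then have A: "A \<in> carrier_mat d n" and le: "row_proj A $$ (i, j) \<le> c" by (auto simp: space_mat_borel)
      obtain u where u: "u \<in> carrier_vec d" "A *\<^sub>v (transpose_mat A *\<^sub>v u) = col A j" "transpose_mat A *\<^sub>v u = col (row_proj A) j"
        using row_proj_unit(1)[OF A ij(2)] by blast
      define b where "b k = (if k < d then u $ k else 0)" for k
      have w: "w A b l = (transpose_mat A *\<^sub>v u) $ l" if "l < n" for l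
        using that mult_vec_entry[of "transpose_mat A" n d u l] A u(1) by (simp add: w_def b_def del: index_mult_mat_vec)
      have eq: "(\<Sum>l<n. A $$ (k, l) * w A b l) = A $$ (k, j)" if "k < d" for k
      proof -
        have cw: "transpose_mat A *\<^sub>v u \<in> carrier_vec n"
          using A u(1) by (intro mult_mat_vec_carrier[of _ n d]) auto
        have "(A *\<^sub>v (transpose_mat A *\<^sub>v u)) $ k = (\<Sum>l<n. A $$ (k, l) * (transpose_mat A *\<^sub>v u) $ l)"
          by (rule mult_vec_entry[OF A cw that])
        then show ?thesis using w u(2) that ij carrier_matD[OF A] by simp
      qed
      have "w A b i \<le> c"
        using w[OF ij(1)] u(3) le ij is_proj_carrier[OF row_proj(2)[OF A]] by (metis carrier_matD index_col)
      then have "\<phi> A b = 0" using eq by (simp add: \<phi>_def)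
      moreover obtain m where "b \<in> K m"
      proof -
        define B where "B = (\<Sum>k<d. \<bar>u $ k\<bar>)"
        obtain m where m: "B \<le> real m" using real_arch_simple by blast
        have "\<bar>b k\<bar> \<le> real m" for k
        proof (cases "k < d")
          case True
          then have "\<bar>u $ k\<bar> \<le> B" unfolding B_def by (intro member_le_sum) auto
          then show ?thesis using m True by (simp add: b_def)
        qed (simp add: b_def)
        then have "b \<in> K m" by (auto simp: K_def abs_le_iff minus_le_iff)
        then show thesis using that by blast
      qed
      ultimately show "A \<in> (\<Union>m. {A \<in> space (mat_borel d n). \<exists>b\<in>K m. \<phi> A b = 0})"
        using A by (auto simp: space_mat_borel)
    qed
    finally show "{A \<in> space (mat_borel d n). row_proj A $$ (i, j) \<le> c} \<in> sets (mat_borel d n)" .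
  qed
qed

text \<open>As \<open>reflection n v\<close> is its own inverse, the conjugated projection satisfies
  the defining properties of the row projection of the product, and uniqueness applies.\<close>

lemma row_proj_mult_reflection:
  assumes A: "A \<in> carrier_mat d n" and v: "v \<in> carrier_vec n" "v \<bullet> v = 1"
  shows "row_proj (A * reflection n v) = conj_reflection n v (row_proj A)"
proof -
  let ?H = "reflection n v"
  note R = row_proj[OF A] and cR = is_proj_carrier[OF row_proj(2)[OF A]]
  have H: "?H \<in> carrier_mat n n" using v by simp
  have AH: "A * ?H \<in> carrier_mat d n" using A H by (rule mult_carrier_mat)
  have At: "transpose_mat A \<in> carrier_mat n d" using A by simp
  have RH: "row_proj A * ?H \<in> carrier_mat n n" using cR H by (rule mult_carrier_mat)
  have conj: "conj_reflection n v (row_proj A) = ?H * (row_proj A * ?H)"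
    unfolding conj_reflection_def by (rule assoc_mult_mat[OF H cR H])
  obtain C where C: "C \<in> carrier_mat d n" "row_proj A = transpose_mat A * C"
    using R(1) A by (auto simp: is_row_proj_def)
  have CH: "C * ?H \<in> carrier_mat d n" using C H by (intro mult_carrier_mat) auto
  have "(A * ?H) * conj_reflection n v (row_proj A) = A * (?H * (?H * (row_proj A * ?H)))"
    unfolding conj using H RH by (intro assoc_mult_mat[OF A H]) (rule mult_carrier_mat)
  also have "?H * (?H * (row_proj A * ?H)) = (?H * ?H) * (row_proj A * ?H)" by (rule assoc_mult_mat[OF H H RH, symmetric])
  also have "\<dots> = row_proj A * ?H" using left_mult_one_mat[OF RH] by (simp only: reflection_mult_self[OF v])
  also have "A * (row_proj A * ?H) = (A * row_proj A) * ?H" by (rule assoc_mult_mat[OF A cR H, symmetric])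
  finally have 1: "(A * ?H) * conj_reflection n v (row_proj A) = A * ?H" by (simp add: R(3))
  have "transpose_mat (A * ?H) = ?H * transpose_mat A"
    using transpose_mult[OF A H] v by (simp add: reflection_transpose)
  then have "transpose_mat (A * ?H) * (C * ?H) = ?H * (transpose_mat A * (C * ?H))"
    using assoc_mult_mat[OF H At CH] by simp
  also have "transpose_mat A * (C * ?H) = row_proj A * ?H" unfolding C(2) by (rule assoc_mult_mat[OF At C(1) H, symmetric])
  finally have 2: "conj_reflection n v (row_proj A) = transpose_mat (A * ?H) * (C * ?H)" by (simp add: conj)
  have "is_row_proj (A * ?H) (conj_reflection n v (row_proj A))"
    unfolding is_row_proj_def using 1 2 CH is_proj_conj_reflection[OF R(2) v] carrier_matD[OF AH] by auto
  then show ?thesis by (rule row_proj_eqI[OF AH])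
qed

text \<open>Reflections are orthogonal matrices, so rotational invariance applies to them; the
  almost sure rank becomes the almost sure trace.\<close>

lemma reflection_invariant_proj_row_proj:
  assumes M: "prob_space M" and A: "A \<in> M \<rightarrow>\<^sub>M mat_borel d n"
    and inv: "right_rotationally_invariant M d n A"
    and rank: "AE \<omega> in M. vec_space.rank d (A \<omega>) = r"
  shows "reflection_invariant_proj (distr M (mat_borel n n) (\<lambda>\<omega>. row_proj (A \<omega>))) n (real r)"
proof -
  interpret M: prob_space M by fact
  have RA: "(\<lambda>\<omega>. row_proj (A \<omega>)) \<in> M \<rightarrow>\<^sub>M mat_borel n n" by (rule measurable_compose[OF A measurable_row_proj])
  have Ac: "A \<omega> \<in> carrier_mat d n" if "\<omega> \<in> space M" for \<omega>
    using measurable_space[OF A that] by (simp add: space_mat_borel)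
  interpret d: prob_space "distr M (mat_borel n n) (\<lambda>\<omega>. row_proj (A \<omega>))" by (rule M.prob_space_distr[OF RA])
  show ?thesis
  proof unfold_locales
    have "AE \<omega> in M. is_proj n (row_proj (A \<omega>)) \<and> mat_trace (row_proj (A \<omega>)) = real r"
      using rank AE_space by eventually_elim (use Ac row_proj(2) rank_eq_mat_trace_row_proj in metis)
    moreover have "{R \<in> space (mat_borel n n). is_proj n R \<and> mat_trace R = real r} \<in> sets (mat_borel n n)"
      by (rule sets_proj_trace)
    ultimately show "AE R in distr M (mat_borel n n) (\<lambda>\<omega>. row_proj (A \<omega>)). is_proj n R \<and> mat_trace R = real r"
      by (subst AE_distr_iff[OF RA]) auto
    show "distr (distr M (mat_borel n n) (\<lambda>\<omega>. row_proj (A \<omega>))) (mat_borel n n) (conj_reflection n v) =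
      distr M (mat_borel n n) (\<lambda>\<omega>. row_proj (A \<omega>))" if v: "v \<in> carrier_vec n" "v \<bullet> v = 1" for v
    proof -
      let ?H = "reflection n v"
      have H: "?H \<in> carrier_mat n n" "transpose_mat ?H * ?H = 1\<^sub>m n"
        using v by (simp_all add: reflection_transpose reflection_mult_self)
      have AH: "(\<lambda>\<omega>. A \<omega> * ?H) \<in> M \<rightarrow>\<^sub>M mat_borel d n"
        by (intro measurable_mat_mult_entry[OF A measurable_const_mat] H)
      have "distr (distr M (mat_borel n n) (\<lambda>\<omega>. row_proj (A \<omega>))) (mat_borel n n) (conj_reflection n v) =
        distr M (mat_borel n n) (conj_reflection n v \<circ> (\<lambda>\<omega>. row_proj (A \<omega>)))"
        by (rule distr_distr[OF measurable_conj_reflection[OF v(1)] RA])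
      also have "\<dots> = distr M (mat_borel n n) (row_proj \<circ> (\<lambda>\<omega>. A \<omega> * ?H))"
        using row_proj_mult_reflection[OF Ac v] by (intro distr_cong) auto
      also have "\<dots> = distr (distr M (mat_borel d n) (\<lambda>\<omega>. A \<omega> * ?H)) (mat_borel n n) row_proj"
        by (rule distr_distr[OF measurable_row_proj AH, symmetric])
      also have "distr M (mat_borel d n) (\<lambda>\<omega>. A \<omega> * ?H) = distr M (mat_borel d n) A"
        using inv H unfolding right_rotationally_invariant_def by blast
      also have "distr (distr M (mat_borel d n) A) (mat_borel n n) row_proj = distr M (mat_borel n n) (row_proj \<circ> A)"
        by (rule distr_distr[OF measurable_row_proj A])
      finally show ?thesis by (simp add: comp_def)
    qed
  qed simp
qed

lemma A_semi_random_mult_vec: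
  assumes A: "A \<in> carrier_mat d n" and x: "x \<in> carrier_vec n"
  shows "A_semi_random A *\<^sub>v x = 0\<^sub>v (dim_row (A_semi_random A)) \<longleftrightarrow> (\<Sum>i<n. x $ i) = 0 \<and> A *\<^sub>v x = 0\<^sub>v d"
proof -
  let ?B = "mat 1 n (\<lambda>_. 1) :: real mat"
  have B: "?B \<in> carrier_mat 1 n" by simp
  have s: "A_semi_random A = ?B @\<^sub>r A" using A by (simp add: A_semi_random_def)
  have dim: "dim_row (?B @\<^sub>r A) = 1 + d" using carrier_append_rows[OF B A] by auto
  have Bx: "?B *\<^sub>v x = vec 1 (\<lambda>_. \<Sum>i<n. x $ i)"
    using x by (intro eq_vecI) (auto simp: scalar_prod_def lessThan_atLeast0)
  have "(A_semi_random A *\<^sub>v x = 0\<^sub>v (1 + d)) \<longleftrightarrow> (?B *\<^sub>v x) @\<^sub>v (A *\<^sub>v x) = 0\<^sub>v 1 @\<^sub>v 0\<^sub>v d"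
    unfolding s mat_mult_append[OF B A x] by (simp add: append_vec_def zero_vec_def cong: ) (auto intro!: eq_vecI)
  also have "\<dots> \<longleftrightarrow> ?B *\<^sub>v x = 0\<^sub>v 1 \<and> A *\<^sub>v x = 0\<^sub>v d"
    using mult_mat_vec_carrier[OF B x] by (intro append_vec_eq[of _ 1]) auto
  also have "?B *\<^sub>v x = 0\<^sub>v 1 \<longleftrightarrow> (\<Sum>i<n. x $ i) = 0"
    unfolding Bx by (auto simp: vec_eq_iff zero_vec_def)
  finally show ?thesis using s dim by simp
qed

lemma kernel_semi_random_cone:
  assumes A: "A \<in> carrier_mat d n" and I: "I \<subseteq> {..<n}"
  shows "mat_kernel (A_semi_random A) \<inter> nonneg_on n I = {0\<^sub>v n} \<longleftrightarrow> row_proj A \<notin> feasible n I"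
proof -
  let ?S = "A_semi_random A"
  have c: "?S \<in> carrier_mat (1 + d) n" unfolding A_semi_random_def using A by (intro carrier_append_rows) auto
  have mem: "x \<in> mat_kernel ?S \<inter> nonneg_on n I \<longleftrightarrow>
      x \<in> carrier_vec n \<and> (\<Sum>i<n. x $ i) = 0 \<and> row_proj A *\<^sub>v x = 0\<^sub>v n \<and> (\<forall>i\<in>I. 0 \<le> x $ i)" for x
    using A_semi_random_mult_vec[OF A, of x] row_proj_kernel[OF A, of x] carrier_matD[OF c]
    by (auto simp: mat_kernel_def nonneg_on_def)
  have z: "0\<^sub>v n \<in> mat_kernel ?S \<inter> nonneg_on n I"
    using mem[of "0\<^sub>v n"] is_proj_carrier[OF row_proj(2)[OF A]] I by (auto simp: mat_mult_zero_vec)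
  show ?thesis
  proof
    assume eq: "mat_kernel ?S \<inter> nonneg_on n I = {0\<^sub>v n}"
    show "row_proj A \<notin> feasible n I"
    proof
      assume "row_proj A \<in> feasible n I"
      then obtain x where "x \<in> mat_kernel ?S \<inter> nonneg_on n I" "x \<noteq> 0\<^sub>v n"
        unfolding feasible_def mem by blast
      then show False using eq by blast
    qed
  next
    assume no: "row_proj A \<notin> feasible n I"
    have "x = 0\<^sub>v n" if "x \<in> mat_kernel ?S \<inter> nonneg_on n I" for x
      using no that is_proj_carrier[OF row_proj(2)[OF A]] unfolding mem feasible_def by blast
    then show "mat_kernel ?S \<inter> nonneg_on n I = {0\<^sub>v n}" using z by blast
  qed
qed

section \<open>The threshold and the law of large numbers\<close>

text \<open>Expected overshoot of a standard normal variable above \<open>s\<close>: the limit of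
  the averages of values truncated at threshold \<open>s\<close>.\<close>

definition normal_excess :: "real \<Rightarrow> real" where
  "normal_excess s = (LINT x|std_normal_distribution. max 0 (x - s))"

lemma borel_measurable_std_normal: "borel_measurable std_normal_distribution = borel_measurable borel"
  by (intro measurable_cong_sets) simp_all

lemma std_normal_prob_UNIV: "measure std_normal_distribution UNIV = 1"
  using std_normal.prob_space by simp

lemma integrable_std_normal_id: "integrable std_normal_distribution (\<lambda>x. x)"
  using integrable_std_normal_distribution_moment[of 1] by simp

lemma integrable_std_normal_square: "integrable std_normal_distribution (\<lambda>x. x\<^sup>2)"
  by (rule integrable_std_normal_distribution_moment)

lemma integrable_std_normal_excess: "integrable std_normal_distribution (\<lambda>x. max 0 (x - s))"
  by (intro Bochner_Integration.integrable_max Bochner_Integration.integrable_diff integrable_std_normal_id std_normal.integrable_const)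

lemma integrable_std_normal_le_square:
  assumes f: "f \<in> borel_measurable borel" and le: "\<And>x. \<bar>f x\<bar> \<le> \<bar>x\<bar> + c"
  shows "integrable std_normal_distribution (\<lambda>x. (f x)\<^sup>2)"
proof (rule Bochner_Integration.integrable_bound)
  show "integrable std_normal_distribution (\<lambda>x. 2 * x\<^sup>2 + 2 * c\<^sup>2)"
    by (intro Bochner_Integration.integrable_add integrable_mult_right integrable_std_normal_square std_normal.integrable_const)
  show "(\<lambda>x. (f x)\<^sup>2) \<in> borel_measurable std_normal_distribution" unfolding borel_measurable_std_normal using f by (rule borel_measurable_power)
  have "(f x)\<^sup>2 \<le> 2 * x\<^sup>2 + 2 * c\<^sup>2" for x
  proof -
    have "(f x)\<^sup>2 \<le> (\<bar>x\<bar> + c)\<^sup>2" using power_mono[OF le[of x], of 2] by simp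
    also have "\<dots> \<le> 2 * x\<^sup>2 + 2 * c\<^sup>2"
      using sum_squares_ge_zero[of "\<bar>x\<bar> - c" 0] by (simp add: power2_eq_square algebra_simps)
    finally show ?thesis .
  qed
  then show "AE x in std_normal_distribution. norm ((f x)\<^sup>2) \<le> norm (2 * x\<^sup>2 + 2 * c\<^sup>2)"
    by (intro AE_I2) simp
qed

lemma std_normal_prob_greater:
  "measure std_normal_distribution {s<..} = 1 - std_normal_cdf s"
proof -
  have "measure std_normal_distribution {s<..} = measure std_normal_distribution (space std_normal_distribution - {..s})"
    by (intro arg_cong[where f = "measure std_normal_distribution"]) auto
  also have "\<dots> = 1 - measure std_normal_distribution {..s}"
    by (intro std_normal.prob_compl) simp
  finally show ?thesis by (simp add: std_normal_cdf_def cdf_def)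
qed

text \<open>\<open>- std_normal_density\<close> is an antiderivative of
  \<open>x * std_normal_density x\<close>, which evaluates the integral above \<open>s\<close>. The
  closed form connects \<open>mu_equation\<close> with an expectation.\<close>

lemma normal_excess_eq:
  assumes s: "0 \<le> s"
  shows "normal_excess s = std_normal_density s - s * (1 - std_normal_cdf s)"
proof -
  let ?f = "\<lambda>x. x * std_normal_density x"
  have lim: "((\<lambda>x. - std_normal_density x) \<longlongrightarrow> 0) at_top"
    unfolding std_normal_density_def by real_asymp
  have deriv: "DERIV (\<lambda>x. - std_normal_density x) x :> ?f x" for x
    unfolding std_normal_density_def
    by (auto intro!: derivative_eq_intros simp: field_simps power2_eq_square)
  have "(\<integral>\<^sup>+x. ennreal (?f x) * indicator {s..} x \<partial>lborel) = ennreal (0 - (- std_normal_density s))"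
    using s by (intro nn_integral_FTC_atLeast[OF _ deriv _ lim]) auto
  then have nn: "(\<integral>\<^sup>+x. ennreal (indicator {s..} x * ?f x) \<partial>lborel) = ennreal (std_normal_density s)"
    by (subst (asm) nn_integral_cong[of _ _ "\<lambda>x. ennreal (indicator {s..} x * ?f x)"])
      (auto simp: indicator_def)
  have "has_bochner_integral lborel (\<lambda>x. indicator {s..} x * ?f x) (std_normal_density s)"
    using s nn by (intro has_bochner_integral_nn_integral) (auto simp: indicator_def)
  then have hb: "(LINT x|lborel. indicator {s..} x * ?f x) = std_normal_density s"
    by (rule has_bochner_integral_integral_eq)
  have 1: "(LINT x|std_normal_distribution. indicator {s..} x * x) = std_normal_density s"
    using hb by (subst integral_density) (auto simp: mult_ac)
  have int1: "integrable std_normal_distribution (\<lambda>x. indicator {s..} x * x)"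
    using integrable_real_mult_indicator[OF _ integrable_std_normal_id, of "{s..}"] by (simp add: mult.commute)
  have int2: "integrable std_normal_distribution (\<lambda>x. s * indicator {s<..} x :: real)"
    by (intro integrable_mult_right integrable_real_indicator) (auto simp: std_normal.emeasure_finite less_top[symmetric])
  have "normal_excess s = (LINT x|std_normal_distribution. indicator {s..} x * x - s * indicator {s<..} x - s * indicator {s} x)"
    unfolding normal_excess_def by (intro Bochner_Integration.integral_cong) (auto simp: indicator_def)
  also have "\<dots> = (LINT x|std_normal_distribution. indicator {s..} x * x - s * indicator {s<..} x)"
  proof (rule integral_cong_AE)
    have "AE x in lborel. x \<noteq> s" by (rule AE_lborel_singleton)
    then show "AE x in std_normal_distribution. indicator {s..} x * x - s * indicator {s<..} x - s * indicator {s} x =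
       indicator {s..} x * x - s * indicator {s<..} x"
      by (subst AE_density, simp, eventually_elim) simp
  qed auto
  also have "\<dots> = std_normal_density s - s * measure std_normal_distribution {s<..}"
    using int1 int2 1 by (subst Bochner_Integration.integral_diff) auto
  finally show ?thesis by (simp add: std_normal_prob_greater)
qed

lemma normal_excess_antimono: "s \<le> t \<Longrightarrow> normal_excess t \<le> normal_excess s"
  unfolding normal_excess_def by (intro integral_mono integrable_std_normal_excess) auto

lemma normal_excess_lipschitz: "s \<le> t \<Longrightarrow> normal_excess s \<le> normal_excess t + (t - s)"
proof -
  assume st: "s \<le> t"
  have "normal_excess s \<le> (LINT x|std_normal_distribution. max 0 (x - t) + (t - s))"
    unfolding normal_excess_def using st
    by (intro integral_mono integrable_std_normal_excess Bochner_Integration.integrable_add std_normal.integrable_const) auto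
  also have "\<dots> = normal_excess t + (t - s)"
    unfolding normal_excess_def using integrable_std_normal_excess[of t]
    by (subst Bochner_Integration.integral_add) (auto simp: std_normal_prob_UNIV)
  finally show ?thesis .
qed

text \<open>Minus the limit in probability of \<open>level_sum N (I N) g s / N\<close>. Positive
  values mean that the level \<open>s\<close> lies above the asymptotic threshold, negative values
  that it lies below.\<close>

definition mu_fun :: "real \<Rightarrow> real \<Rightarrow> real" where
  "mu_fun \<epsilon> s = \<epsilon> * s - (1 - \<epsilon>) * normal_excess s"

lemma mu_equation_iff:
  assumes "0 \<le> s"
  shows "mu_equation \<epsilon> s \<longleftrightarrow> mu_fun \<epsilon> s = 0"
  unfolding mu_equation_def mu_fun_def normal_excess_eq[OF assms] by (auto simp: algebra_simps)

lemma mu_fun_strict_mono: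
  assumes "0 < \<epsilon>" "\<epsilon> < 1" "s < t"
  shows "mu_fun \<epsilon> s < mu_fun \<epsilon> t"
proof -
  have "\<epsilon> * s < \<epsilon> * t" using assms by simp
  moreover have "(1 - \<epsilon>) * normal_excess t \<le> (1 - \<epsilon>) * normal_excess s"
    using assms normal_excess_antimono[of s t] by (intro mult_left_mono) auto
  ultimately show ?thesis unfolding mu_fun_def by linarith
qed

lemma isCont_normal_excess: "isCont normal_excess x"
proof -
  have *: "\<bar>normal_excess y - normal_excess x\<bar> \<le> \<bar>y - x\<bar>" for y
    using normal_excess_antimono[of x y] normal_excess_antimono[of y x]
      normal_excess_lipschitz[of x y] normal_excess_lipschitz[of y x] by linarith
  show ?thesis
    unfolding isCont_def
  proof (rule LIM_I)
    fix r :: real assume "0 < r"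
    then show "\<exists>s>0. \<forall>y. y \<noteq> x \<and> norm (y - x) < s \<longrightarrow> norm (normal_excess y - normal_excess x) < r"
      using * by (intro exI[of _ r]) (auto intro: le_less_trans)
  qed
qed

lemma mu_star_ex1:
  assumes \<epsilon>: "0 < \<epsilon>" "\<epsilon> < 1"
  shows "\<exists>!\<mu>. 0 < \<mu> \<and> mu_equation \<epsilon> \<mu>"
proof -
  have cont: "isCont (mu_fun \<epsilon>) x" for x
    unfolding mu_fun_def[abs_def] using isCont_normal_excess by (intro continuous_intros)
  have e0: "normal_excess 0 = std_normal_density 0" using normal_excess_eq[of 0] by simp
  have pos0: "0 < normal_excess 0" unfolding e0 by (simp add: std_normal_density_def)
  have m0: "mu_fun \<epsilon> 0 < 0" using \<epsilon> pos0 by (simp add: mu_fun_def)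
  \<comment> \<open>At this point \<open>\<epsilon> * b\<close> equals the overshoot at zero, which
    dominates \<open>(1 - \<epsilon>) * normal_excess b\<close> by monotonicity.\<close>
  define b where "b = normal_excess 0 / \<epsilon>"
  have b: "0 < b" using \<epsilon> pos0 by (simp add: b_def)
  have "0 \<le> mu_fun \<epsilon> b"
  proof -
    have "(1 - \<epsilon>) * normal_excess b \<le> 1 * normal_excess 0"
    proof (rule mult_mono)
      show "0 \<le> normal_excess b" unfolding normal_excess_def by (intro Bochner_Integration.integral_nonneg) simp
    qed (use \<epsilon> b normal_excess_antimono[of 0 b] in auto)
    then show ?thesis using \<epsilon> by (simp add: mu_fun_def b_def)
  qed
  then obtain x where x: "0 \<le> x" "mu_fun \<epsilon> x = 0"
    using IVT[of "mu_fun \<epsilon>" 0 0 b] m0 b cont by auto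
  have "x \<noteq> 0" using x m0 by auto
  then have "0 < x \<and> mu_equation \<epsilon> x" using x mu_equation_iff[OF x(1)] by simp
  moreover have "y = x" if "0 < y \<and> mu_equation \<epsilon> y" for y
    using that x mu_equation_iff[of y \<epsilon>] mu_fun_strict_mono[OF \<epsilon>, of x y] mu_fun_strict_mono[OF \<epsilon>, of y x]
    by (cases y x rule: linorder_cases) auto
  ultimately show ?thesis by blast
qed

lemma mu_star:
  assumes \<epsilon>: "0 < \<epsilon>" "\<epsilon> < 1"
  shows "0 < mu_star \<epsilon>" "mu_fun \<epsilon> (mu_star \<epsilon>) = 0"
proof -
  have "0 < mu_star \<epsilon> \<and> mu_equation \<epsilon> (mu_star \<epsilon>)"
    unfolding mu_star_def by (rule theI'[OF mu_star_ex1[OF \<epsilon>]])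
  then show "0 < mu_star \<epsilon>" "mu_fun \<epsilon> (mu_star \<epsilon>) = 0" using mu_equation_iff[of "mu_star \<epsilon>" \<epsilon>] by auto
qed

lemma isCont_std_normal_cdf: "isCont std_normal_cdf x"
proof -
  interpret real_distribution std_normal_distribution by (rule real_dist_normal_dist)
  have "AE z in lborel. z \<noteq> x" by (rule AE_lborel_singleton)
  then have "emeasure std_normal_distribution {x} = 0"
    by (subst emeasure_density) (auto intro!: nn_integral_zero' elim!: AE_mp)
  then have "measure std_normal_distribution {x} = 0" by (simp add: measure_def)
  then show ?thesis using isCont_cdf by (simp add: std_normal_cdf_def)
qed

text \<open>A level slightly above \<open>mu_star \<epsilon>\<close> keeps the strict inequality, by
  continuity of the distribution function, and makes \<open>mu_fun\<close> strictly positive.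
  Working at one fixed level replaces a convergence statement for the random threshold.\<close>

lemma ex_level_above_mu_star:
  assumes \<epsilon>: "0 < \<epsilon>" "\<epsilon> < 1" and lt: "\<alpha> < delta_star \<epsilon>"
  obtains s where "0 < mu_fun \<epsilon> s" "(1 - \<epsilon>) * std_normal_cdf s < 1 - \<alpha>"
proof -
  let ?m = "mu_star \<epsilon>"
  have "(1 - \<epsilon>) * std_normal_cdf ?m < 1 - \<alpha>" using lt by (simp add: delta_star_def)
  moreover have "isCont (\<lambda>s. (1 - \<epsilon>) * std_normal_cdf s) ?m"
    by (intro continuous_intros isCont_std_normal_cdf)
  ultimately have "eventually (\<lambda>s. (1 - \<epsilon>) * std_normal_cdf s < 1 - \<alpha>) (at ?m)"
    unfolding isCont_def by (rule order_tendstoD(2)[rotated])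
  then have "eventually (\<lambda>s. (1 - \<epsilon>) * std_normal_cdf s < 1 - \<alpha>) (at_right ?m)"
    by (simp add: eventually_at_split)
  moreover have "eventually (\<lambda>s. s \<in> {?m<..}) (at_right ?m)" by (simp add: eventually_at_right_less)
  ultimately have "eventually (\<lambda>s. (1 - \<epsilon>) * std_normal_cdf s < 1 - \<alpha> \<and> s \<in> {?m<..}) (at_right ?m)"
    by (rule eventually_conj)
  then obtain s where s: "(1 - \<epsilon>) * std_normal_cdf s < 1 - \<alpha>" "?m < s"
    using eventually_happens'[OF trivial_limit_at_right_real] by blast
  then show thesis using that mu_fun_strict_mono[OF \<epsilon>, of ?m s] mu_star[OF \<epsilon>] by auto
qed

lemma ex_level_below_mu_star:
  assumes \<epsilon>: "0 < \<epsilon>" "\<epsilon> < 1" and gt: "delta_star \<epsilon> < \<alpha>"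
  obtains s where "mu_fun \<epsilon> s < 0" "1 - \<alpha> < (1 - \<epsilon>) * std_normal_cdf s"
proof -
  let ?m = "mu_star \<epsilon>"
  have "1 - \<alpha> < (1 - \<epsilon>) * std_normal_cdf ?m" using gt by (simp add: delta_star_def)
  moreover have "isCont (\<lambda>s. (1 - \<epsilon>) * std_normal_cdf s) ?m"
    by (intro continuous_intros isCont_std_normal_cdf)
  ultimately have "eventually (\<lambda>s. 1 - \<alpha> < (1 - \<epsilon>) * std_normal_cdf s) (at ?m)"
    unfolding isCont_def by (rule order_tendstoD(1)[rotated])
  then have "eventually (\<lambda>s. 1 - \<alpha> < (1 - \<epsilon>) * std_normal_cdf s) (at_left ?m)"
    by (simp add: eventually_at_split)
  moreover have "eventually (\<lambda>s. s \<in> {..<?m}) (at_left ?m)" by (auto simp: eventually_at_filter)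
  ultimately have "eventually (\<lambda>s. 1 - \<alpha> < (1 - \<epsilon>) * std_normal_cdf s \<and> s \<in> {..<?m}) (at_left ?m)"
    by (rule eventually_conj)
  then obtain s where s: "1 - \<alpha> < (1 - \<epsilon>) * std_normal_cdf s" "s < ?m"
    using eventually_happens'[OF trivial_limit_at_left_real] by blast
  then show thesis using that mu_fun_strict_mono[OF \<epsilon>, of s ?m] mu_star[OF \<epsilon>] by auto
qed

section \<open>Second moments and a weak law of large numbers under the Gaussian product\<close>

lemma gauss_integral_prod:
  assumes "\<And>i. i < n \<Longrightarrow> integrable std_normal_distribution (f i)"
  shows "(LINT g|gauss n. (\<Prod>i<n. f i (g i))) = (\<Prod>i<n. LINT x|std_normal_distribution. (f i x :: real))"
    and "integrable (gauss n) (\<lambda>g. \<Prod>i<n. f i (g i))"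
  unfolding gauss_def using assms
  by (auto intro!: std_normal_product.product_integral_prod std_normal_product.product_integrable_prod)

lemma gauss_pair_moment:
  assumes f: "integrable std_normal_distribution f" "(LINT x|std_normal_distribution. f x) = (0::real)"
    and f2: "integrable std_normal_distribution (\<lambda>x. (f x)\<^sup>2)" and ij: "i < n" "j < n"
  shows "integrable (gauss n) (\<lambda>g. f (g i) * f (g j))"
    and "(LINT g|gauss n. f (g i) * f (g j)) = (if i = j then (LINT x|std_normal_distribution. (f x)\<^sup>2) else 0)"
proof -
  \<comment> \<open>The product of two factors is written as a product over all coordinates with
    trivial factors elsewhere, and with a square where the two indices coincide, so that the product
    formula for integrals applies.\<close>
  define F where "F k = (if k = i \<and> k = j then (\<lambda>x. (f x)\<^sup>2) else if k = i \<or> k = j then f else (\<lambda>_. 1))" for k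
  have int: "integrable std_normal_distribution (F k)" for k using f f2 by (auto simp: F_def)
  have prod: "(\<Prod>k<n. F k (g k)) = f (g i) * f (g j)" for g
  proof (cases "i = j")
    case True
    then have "(\<Prod>k<n. F k (g k)) = (\<Prod>k<n. if k = i then (f (g k))\<^sup>2 else 1)"
      by (intro prod.cong) (auto simp: F_def)
    then show ?thesis using ij True by (simp add: power2_eq_square)
  next
    case False
    then have "(\<Prod>k<n. F k (g k)) = (\<Prod>k<n. (if k = i then f (g k) else 1) * (if k = j then f (g k) else 1))"
      by (intro prod.cong) (auto simp: F_def)
    then show ?thesis using ij by (simp add: prod.distrib)
  qed
  have val: "(\<Prod>k<n. LINT x|std_normal_distribution. F k x) = (if i = j then (LINT x|std_normal_distribution. (f x)\<^sup>2) else 0)"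
  proof (cases "i = j")
    case True
    then have "(\<Prod>k<n. LINT x|std_normal_distribution. F k x) = (\<Prod>k<n. if k = i then (LINT x|std_normal_distribution. (f x)\<^sup>2) else 1)"
      by (intro prod.cong) (auto simp: F_def std_normal_prob_UNIV)
    then show ?thesis using ij True by simp
  next
    case False
    then have "(LINT x|std_normal_distribution. F i x) = 0" using f(2) by (simp add: F_def)
    then show ?thesis using ij False by (auto intro!: prod_zero)
  qed
  show "integrable (gauss n) (\<lambda>g. f (g i) * f (g j))"
    using gauss_integral_prod(2)[of n F] int by (simp add: prod)
  show "(LINT g|gauss n. f (g i) * f (g j)) = (if i = j then (LINT x|std_normal_distribution. (f x)\<^sup>2) else 0)"
    using gauss_integral_prod(1)[of n F] int by (simp add: prod val)
qed

text \<open>After centring, mixed products integrate to zero, so the second moment of the sum is at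
  most \<open>n\<close> times the variance.\<close>

lemma gauss_chebyshev:
  assumes F: "F \<in> borel_measurable borel" and F2: "integrable std_normal_distribution (\<lambda>x. (F x)\<^sup>2)"
    and T: "T \<subseteq> {..<n}" and a: "0 < a"
  defines "m \<equiv> (LINT x|std_normal_distribution. F x)"
  shows "measure (gauss n) {g \<in> space (gauss n). a \<le> \<bar>(\<Sum>i\<in>T. F (g i)) - real (card T) * m\<bar>}
    \<le> real n * (LINT x|std_normal_distribution. (F x - m)\<^sup>2) / a\<^sup>2"
proof -
  define f where "f x = F x - m" for x
  have finT: "finite T" using T finite_subset by blast
  have Fi: "integrable std_normal_distribution F"
  proof (rule std_normal.square_integrable_imp_integrable[OF _ F2])
    show "F \<in> borel_measurable std_normal_distribution" using F by (simp only: borel_measurable_std_normal)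
  qed
  have fi: "integrable std_normal_distribution f" unfolding f_def using Fi by simp
  have f0: "(LINT x|std_normal_distribution. f x) = 0"
    unfolding f_def using Fi by (simp add: m_def std_normal_prob_UNIV)
  have f2: "integrable std_normal_distribution (\<lambda>x. (f x)\<^sup>2)"
    unfolding f_def power2_diff using Fi F2 by (intro Bochner_Integration.integrable_add Bochner_Integration.integrable_diff) (auto simp: mult.assoc)
  define V where "V = (LINT x|std_normal_distribution. (f x)\<^sup>2)"
  have V: "0 \<le> V" unfolding V_def by (intro Bochner_Integration.integral_nonneg) simp
  have sq: "(\<Sum>i\<in>T. f (g i))\<^sup>2 = (\<Sum>i\<in>T. \<Sum>j\<in>T. f (g i) * f (g j))" for g
    by (simp add: power2_eq_square sum_product)
  note pm = gauss_pair_moment[OF fi f0 f2]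
  have Tn: "i < n" if "i \<in> T" for i using that T by auto
  have int: "integrable (gauss n) (\<lambda>g. (\<Sum>i\<in>T. f (g i))\<^sup>2)"
    unfolding sq using pm(1) Tn by (intro Bochner_Integration.integrable_sum) auto
  have "(LINT g|gauss n. (\<Sum>i\<in>T. f (g i))\<^sup>2) = (\<Sum>i\<in>T. \<Sum>j\<in>T. if i = j then V else 0)"
    unfolding sq using pm Tn
    by (subst Bochner_Integration.integral_sum) (auto intro!: sum.cong Bochner_Integration.integrable_sum simp: V_def)
  also have "\<dots> = real (card T) * V" using finT by simp
  also have "\<dots> \<le> real n * V" using V card_mono[OF _ T] by (intro mult_right_mono) auto
  finally have E: "(LINT g|gauss n. (\<Sum>i\<in>T. f (g i))\<^sup>2) \<le> real n * V" .
  have meas: "(\<lambda>g. \<Sum>i\<in>T. f (g i)) \<in> borel_measurable (gauss n)"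
    unfolding f_def using Tn F
    by (intro borel_measurable_sum borel_measurable_diff borel_measurable_const measurable_compose[OF measurable_gauss_component]) auto
  have "measure (gauss n) {g \<in> space (gauss n). a \<le> \<bar>\<Sum>i\<in>T. f (g i)\<bar>} \<le> (LINT g|gauss n. (\<Sum>i\<in>T. f (g i))\<^sup>2) / a\<^sup>2"
    by (rule gauss.second_moment_method[OF meas int a])
  also have "\<dots> \<le> real n * V / a\<^sup>2" using E by (intro divide_right_mono) auto
  finally show ?thesis by (simp add: f_def V_def sum_subtractf)
qed

lemma gauss_lln:
  assumes F: "F \<in> borel_measurable borel" and F2: "integrable std_normal_distribution (\<lambda>x. (F x)\<^sup>2)"
    and T: "\<And>N. T N \<subseteq> {..<N}" and \<tau>: "(\<lambda>N. real (card (T N)) / real N) \<longlonglongrightarrow> \<tau>" and a: "0 < a"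
  defines "m \<equiv> (LINT x|std_normal_distribution. F x)"
  shows "(\<lambda>N. measure (gauss N) {g \<in> space (gauss N). a * real N \<le> \<bar>(\<Sum>i\<in>T N. F (g i)) - real N * (\<tau> * m)\<bar>}) \<longlonglongrightarrow> 0"
proof (rule tendsto_sandwich[where f = "\<lambda>_. 0"])
  define V where "V = (LINT x|std_normal_distribution. (F x - m)\<^sup>2)"
  have "(\<lambda>N. real (card (T N)) / real N * m) \<longlonglongrightarrow> \<tau> * m" using \<tau> by (intro tendsto_intros)
  \<comment> \<open>Half of the tolerance \<open>a\<close> is spent on replacing the proportion of
    \<open>T N\<close> by its limit, the other half on the random fluctuation.\<close>
  then have "eventually (\<lambda>N. dist (real (card (T N)) / real N * m) (\<tau> * m) < a / 2) sequentially"
    by (rule tendstoD[OF _ half_gt_zero[OF a]])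
  then show "eventually (\<lambda>N. measure (gauss N) {g \<in> space (gauss N). a * real N \<le> \<bar>(\<Sum>i\<in>T N. F (g i)) - real N * (\<tau> * m)\<bar>}
      \<le> 4 * V / a\<^sup>2 / real N) sequentially"
    using eventually_gt_at_top[of 0]
  proof eventually_elim
    fix N :: nat assume close: "dist (real (card (T N)) / real N * m) (\<tau> * m) < a / 2" and N: "0 < N"
    have "\<bar>real (card (T N)) * m - real N * (\<tau> * m)\<bar> = real N * \<bar>real (card (T N)) / real N * m - \<tau> * m\<bar>"
    proof -
      have "real (card (T N)) * m - real N * (\<tau> * m) = real N * (real (card (T N)) / real N * m - \<tau> * m)"
        using N by (simp add: field_simps)
      then show ?thesis by (simp only: abs_mult abs_of_nat)
    qed
    also have "\<dots> \<le> real N * (a / 2)" using close by (intro mult_left_mono) (auto simp: dist_real_def)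
    finally have c: "\<bar>real (card (T N)) * m - real N * (\<tau> * m)\<bar> \<le> real N * (a / 2)" .
    have Tn: "i < N" if "i \<in> T N" for i using T[of N] that by auto
    have meas: "(\<lambda>g. \<Sum>i\<in>T N. F (g i)) \<in> borel_measurable (gauss N)"
      using Tn F by (intro borel_measurable_sum measurable_compose[OF measurable_gauss_component]) auto
    have "measure (gauss N) {g \<in> space (gauss N). a * real N \<le> \<bar>(\<Sum>i\<in>T N. F (g i)) - real N * (\<tau> * m)\<bar>}
      \<le> measure (gauss N) {g \<in> space (gauss N). real N * (a / 2) \<le> \<bar>(\<Sum>i\<in>T N. F (g i)) - real (card (T N)) * m\<bar>}"
    proof (rule gauss.finite_measure_mono)
      show "{g \<in> space (gauss N). a * real N \<le> \<bar>(\<Sum>i\<in>T N. F (g i)) - real N * (\<tau> * m)\<bar>}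
         \<subseteq> {g \<in> space (gauss N). real N * (a / 2) \<le> \<bar>(\<Sum>i\<in>T N. F (g i)) - real (card (T N)) * m\<bar>}"
      proof (intro subsetI CollectI conjI)
        fix g assume g: "g \<in> {g \<in> space (gauss N). a * real N \<le> \<bar>(\<Sum>i\<in>T N. F (g i)) - real N * (\<tau> * m)\<bar>}"
        then show "g \<in> space (gauss N)" by simp
        have e: "real N * (a / 2) = a * real N / 2" by simp
        have "a * real N \<le> \<bar>(\<Sum>i\<in>T N. F (g i)) - real N * (\<tau> * m)\<bar>" using g by simp
        then show "real N * (a / 2) \<le> \<bar>(\<Sum>i\<in>T N. F (g i)) - real (card (T N)) * m\<bar>"
          using c unfolding e by linarith
      qed
    qed (use meas in measurable)
    also have "\<dots> \<le> real N * V / (real N * (a / 2))\<^sup>2"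
      unfolding V_def m_def using N a by (intro gauss_chebyshev F F2 T) auto
    also have "\<dots> = 4 * V / a\<^sup>2 / real N" using N a by (simp add: field_simps power2_eq_square)
    finally show "measure (gauss N) {g \<in> space (gauss N). a * real N \<le> \<bar>(\<Sum>i\<in>T N. F (g i)) - real N * (\<tau> * m)\<bar>}
      \<le> 4 * V / a\<^sup>2 / real N" .
  qed
  show "(\<lambda>N. 4 * V / a\<^sup>2 / real N) \<longlonglongrightarrow> 0" by (rule lim_const_over_n)
qed auto


text \<open>Coordinate sum of the vector obtained from \<open>g\<close> by subtracting
  \<open>t\<close> and replacing negative values on \<open>I\<close> by zero. At a root
  \<open>t\<close> this vector lies in the cone and is the projection of \<open>g\<close> onto
  it.\<close>

definition level_sum :: "nat \<Rightarrow> nat set \<Rightarrow> (nat \<Rightarrow> real) \<Rightarrow> real \<Rightarrow> real" where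
  "level_sum n I g t = (\<Sum>i\<in>I. max 0 (g i - t)) + (\<Sum>i\<in>{..<n} - I. g i - t)"

lemma continuous_level_sum: "continuous_on A (level_sum n I g)"
  unfolding level_sum_def[abs_def] by (intro continuous_intros)

context face_setup
begin

lemma level_sum_antimono: "s \<le> t \<Longrightarrow> level_sum n I g t \<le> level_sum n I g s"
  unfolding level_sum_def by (intro add_mono sum_mono) auto

lemma level_sum_root_below:
  assumes "level_sum n I g s < 0"
  obtains t where "t \<le> s" "level_sum n I g t = 0"
proof -
  \<comment> \<open>At the level \<open>- M\<close> every term is nonnegative, which gives the other
    endpoint for the intermediate value theorem.\<close>
  define M where "M = (\<Sum>i<n. \<bar>g i\<bar>)"
  have gM: "- M \<le> g i" if "i < n" for i
  proof -
    have "\<bar>g i\<bar> \<le> M" unfolding M_def using that by (intro member_le_sum) auto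
    then show ?thesis by linarith
  qed
  have "0 \<le> level_sum n I g (- M)"
    unfolding level_sum_def using gM by (intro add_nonneg_nonneg sum_nonneg) force+
  moreover have "- M \<le> s"
  proof (rule ccontr)
    assume "\<not> - M \<le> s"
    then have "level_sum n I g (- M) \<le> level_sum n I g s" by (intro level_sum_antimono) simp
    then show False using calculation assms by simp
  qed
  ultimately obtain t where "- M \<le> t" "t \<le> s" "level_sum n I g t = 0"
    using IVT2'[of "level_sum n I g" s 0 "- M"] continuous_level_sum assms by force
  then show thesis using that by blast
qed

lemma level_sum_root_above:
  assumes "0 < level_sum n I g s"
  obtains t where "s < t" "level_sum n I g t = 0"
proof -
  define M where "M = (\<Sum>i<n. \<bar>g i\<bar>)"
  have gM: "g i \<le> M" if "i < n" for i
  proof -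
    have "\<bar>g i\<bar> \<le> M" unfolding M_def using that by (intro member_le_sum) auto
    then show ?thesis by linarith
  qed
  have "level_sum n I g M \<le> 0"
    unfolding level_sum_def using gM I by (intro add_nonpos_nonpos sum_nonpos) force+
  moreover have "s \<le> M"
  proof (rule ccontr)
    assume "\<not> s \<le> M"
    then have "level_sum n I g s \<le> level_sum n I g M" by (intro level_sum_antimono) simp
    then show False using calculation assms by simp
  qed
  ultimately obtain t where "s \<le> t" "t \<le> M" "level_sum n I g t = 0"
    using IVT2'[of "level_sum n I g" M 0 s] continuous_level_sum assms by force
  moreover from this assms have "s < t" by (cases "s = t") auto
  ultimately show thesis using that by blast
qed

text \<open>The sum condition says that \<open>t\<close> is the average of \<open>g\<close> over the
  coordinates outside \<open>J\<close>, which is the value that \<open>Q J\<close> puts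
  there.\<close>

lemma level_face_components:
  assumes J: "J \<subseteq> I" and sum: "(\<Sum>i\<in>{..<n} - J. g i - t) = 0" and i: "i < n"
  shows "(Q J *\<^sub>v vec n g) $ i = (if i \<in> J then g i else t)"
    and "((1\<^sub>m n - Q J) *\<^sub>v vec n g) $ i = (if i \<in> J then 0 else g i - t)"
proof -
  have card: "real (card ({..<n} - J)) \<noteq> 0" using i0 J by (auto simp: card_eq_0_iff)
  have "(\<Sum>i\<in>{..<n} - J. g i) = real (card ({..<n} - J)) * t" using sum by (simp add: sum_subtractf)
  then have mean: "(\<Sum>i\<in>{..<n} - J. vec n g $ i) / real (card ({..<n} - J)) = t" using card by simp
  show 1: "(Q J *\<^sub>v vec n g) $ i = (if i \<in> J then g i else t)"
    using face_proj_mult_vec[of "vec n g" n i J] i mean by simp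
  have c: "Q J *\<^sub>v vec n g \<in> carrier_vec n" using Q_proj[OF J] by simp
  show "((1\<^sub>m n - Q J) *\<^sub>v vec n g) $ i = (if i \<in> J then 0 else g i - t)"
    using proj_compl(3)[OF Q_proj[OF J], of "vec n g"] 1 i carrier_vecD[OF c] by (simp del: index_mult_mat_vec)
qed

text \<open>Ties \<open>g i = t\<close> are put into \<open>J\<close>, because the strict
  inequalities concern the coordinates of \<open>I\<close> outside \<open>J\<close> while the weak
  ones on \<open>J\<close> allow equality.\<close>

lemma primal_cone_level:
  assumes t: "level_sum n I g t = 0" and g: "g \<in> {..<n} \<rightarrow>\<^sub>E UNIV"
  shows "g \<in> primal_cone n I i0 {i \<in> I. g i \<le> t}"
proof -
  let ?J = "{i \<in> I. g i \<le> t}"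
  have J: "?J \<subseteq> I" by auto
  have finI: "finite I" using I finite_subset by blast
  have "(\<Sum>i\<in>{..<n} - ?J. g i - t) = (\<Sum>i\<in>I - ?J. g i - t) + (\<Sum>i\<in>{..<n} - I. g i - t)"
    using I finI by (subst sum.union_disjoint[symmetric]) (auto intro!: sum.cong)
  also have "(\<Sum>i\<in>I - ?J. g i - t) = (\<Sum>i\<in>I. max 0 (g i - t))"
    using finI by (intro sum.mono_neutral_cong_left) auto
  finally have sum: "(\<Sum>i\<in>{..<n} - ?J. g i - t) = 0" using t by (simp add: level_sum_def)
  note comp = level_face_components[OF J sum]
  have P: "(1\<^sub>m n - Q ?J) *\<^sub>v vec n g \<in> carrier_vec n" and Qc: "Q ?J *\<^sub>v vec n g \<in> carrier_vec n"
    using Q_proj[OF J] proj_compl(1)[OF Q_proj[OF J]] by auto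
  have "0 < unit_vec n i \<bullet> ((1\<^sub>m n - Q ?J) *\<^sub>v vec n g)" if "i \<in> I - ?J" for i
    using that I comp(2)[of i] by (subst scalar_prod_left_unit[OF P]) (auto simp del: index_mult_mat_vec)
  moreover have "0 \<le> diff_unit n i0 i \<bullet> (Q ?J *\<^sub>v vec n g)" if "i \<in> ?J" for i
    using that I i0 comp(1)[of i] comp(1)[of i0] by (subst diff_unit_scalar_prod[OF Qc]) (auto simp del: index_mult_mat_vec)
  ultimately show ?thesis using g by (simp add: primal_cone_def cone_def)
qed

text \<open>Here the strict inequalities concern \<open>J\<close>, so ties \<open>g i = t\<close>
  are left outside it.\<close>

lemma dual_cone_level:
  assumes t: "level_sum n I g t = 0" and g: "g \<in> {..<n} \<rightarrow>\<^sub>E UNIV"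
  shows "g \<in> dual_cone n I i0 {i \<in> I. g i < t}"
proof -
  let ?J = "{i \<in> I. g i < t}"
  have J: "?J \<subseteq> I" by auto
  have finI: "finite I" using I finite_subset by blast
  have "(\<Sum>i\<in>{..<n} - ?J. g i - t) = (\<Sum>i\<in>I - ?J. g i - t) + (\<Sum>i\<in>{..<n} - I. g i - t)"
    using I finI by (subst sum.union_disjoint[symmetric]) (auto intro!: sum.cong)
  also have "(\<Sum>i\<in>I - ?J. g i - t) = (\<Sum>i\<in>I. max 0 (g i - t))"
    using finI by (intro sum.mono_neutral_cong_left) auto
  finally have sum: "(\<Sum>i\<in>{..<n} - ?J. g i - t) = 0" using t by (simp add: level_sum_def)
  note comp = level_face_components[OF J sum]
  have P: "(1\<^sub>m n - Q ?J) *\<^sub>v vec n g \<in> carrier_vec n" and Qc: "Q ?J *\<^sub>v vec n g \<in> carrier_vec n"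
    using Q_proj[OF J] proj_compl(1)[OF Q_proj[OF J]] by auto
  have "0 \<le> unit_vec n i \<bullet> ((1\<^sub>m n - Q ?J) *\<^sub>v vec n g)" if "i \<in> I - ?J" for i
    using that I comp(2)[of i] by (subst scalar_prod_left_unit[OF P]) (auto simp del: index_mult_mat_vec)
  moreover have "0 < diff_unit n i0 i \<bullet> (Q ?J *\<^sub>v vec n g)" if "i \<in> ?J" for i
    using that I i0 comp(1)[of i] comp(1)[of i0] by (subst diff_unit_scalar_prod[OF Qc]) (auto simp del: index_mult_mat_vec)
  ultimately show ?thesis using g by (simp add: dual_cone_def cone_def compl_compl)
qed

end

section \<open>The phase transition\<close>

text \<open>Three averages at the fixed level \<open>s\<close> are controlled together: the
  truncated sum over \<open>I\<close>, the plain sum over its complement, and the number of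
  coordinates of \<open>I\<close> that are at most \<open>s\<close>. The first two make up
  \<open>level_sum\<close>, hence its error \<open>2 * a\<close>.\<close>

lemma level_whp:
  assumes I: "\<And>N. I N \<subseteq> {..<N}" and K: "\<And>N. K N \<le> N" "\<And>N. card (I N) = N - K N"
    and \<epsilon>: "(\<lambda>N. real (K N) / real N) \<longlonglongrightarrow> \<epsilon>" and a: "0 < a"
  obtains G where "\<And>N. G N \<in> sets (gauss N)" "(\<lambda>N. measure (gauss N) (G N)) \<longlonglongrightarrow> 1"
    "\<And>N g. g \<in> G N \<Longrightarrow> g \<in> {..<N} \<rightarrow>\<^sub>E UNIV \<and> \<bar>level_sum N (I N) g s + real N * mu_fun \<epsilon> s\<bar> < 2 * a * real N \<and>
       \<bar>real (card {i \<in> I N. g i \<le> s}) - real N * ((1 - \<epsilon>) * std_normal_cdf s)\<bar> < a * real N"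
proof -
  have finI: "finite (I N)" for N using I[of N] finite_subset by blast
  have ratioI: "(\<lambda>N. real (card (I N)) / real N) \<longlonglongrightarrow> 1 - \<epsilon>"
  proof (rule Lim_transform_eventually)
    show "(\<lambda>N. 1 - real (K N) / real N) \<longlonglongrightarrow> 1 - \<epsilon>" using \<epsilon> by (intro tendsto_intros)
    show "eventually (\<lambda>N. 1 - real (K N) / real N = real (card (I N)) / real N) sequentially"
      using eventually_gt_at_top[of 0]
      by eventually_elim (use K in \<open>simp add: of_nat_diff diff_divide_distrib\<close>)
  qed
  have ratioC: "(\<lambda>N. real (card ({..<N} - I N)) / real N) \<longlonglongrightarrow> \<epsilon>"
  proof -
    have "card ({..<N} - I N) = K N" for N
      using card_Diff_subset[OF finI I[of N]] K[of N] by simp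
    then show ?thesis using \<epsilon> by simp
  qed
  define F1 F2 F3 :: "real \<Rightarrow> real" where "F1 x = max 0 (x - s)" and "F2 x = x - s" and "F3 x = indicator {..s} x" for x
  have F1: "F1 \<in> borel_measurable borel" "integrable std_normal_distribution (\<lambda>x. (F1 x)\<^sup>2)"
    unfolding F1_def[abs_def] by (simp, intro integrable_std_normal_le_square[where c = "\<bar>s\<bar>"]) auto
  have F2: "F2 \<in> borel_measurable borel" "integrable std_normal_distribution (\<lambda>x. (F2 x)\<^sup>2)"
    unfolding F2_def[abs_def] by (simp, intro integrable_std_normal_le_square[where c = "\<bar>s\<bar>"]) auto
  have F3: "F3 \<in> borel_measurable borel" "integrable std_normal_distribution (\<lambda>x. (F3 x)\<^sup>2)"
    unfolding F3_def[abs_def] by (simp, intro integrable_std_normal_le_square[where c = 1]) (auto simp: indicator_def)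
  have m1: "(LINT x|std_normal_distribution. F1 x) = normal_excess s" by (simp add: F1_def normal_excess_def)
  have m2: "(LINT x|std_normal_distribution. F2 x) = - s"
    unfolding F2_def using integrable_std_normal_id integral_std_normal_distribution_moment_odd[of 1]
    by (subst Bochner_Integration.integral_diff) (auto simp: std_normal_prob_UNIV)
  have m3: "(LINT x|std_normal_distribution. F3 x) = std_normal_cdf s"
    unfolding F3_def by (simp add: std_normal_cdf_def cdf_def)
  define B where "B F T c N = {g \<in> space (gauss N). a * real N \<le> \<bar>(\<Sum>i\<in>T N. F (g i)) - real N * c\<bar>}"
    for F :: "real \<Rightarrow> real" and T :: "nat \<Rightarrow> nat set" and c N
  have Bm: "B F T c N \<in> sets (gauss N)" if "F \<in> borel_measurable borel" "T N \<subseteq> {..<N}" for F T c N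
  proof -
    have "(\<lambda>g. \<Sum>i\<in>T N. F (g i)) \<in> borel_measurable (gauss N)"
      using that by (intro borel_measurable_sum measurable_compose[OF measurable_gauss_component]) auto
    then show ?thesis unfolding B_def by measurable
  qed
  let ?C = "\<lambda>N. {..<N} - I N"
  let ?B1 = "B F1 I ((1 - \<epsilon>) * normal_excess s)" and ?B2 = "B F2 ?C (\<epsilon> * (- s))" and ?B3 = "B F3 I ((1 - \<epsilon>) * std_normal_cdf s)"
  have B1: "?B1 N \<in> sets (gauss N)" and B2: "?B2 N \<in> sets (gauss N)" and B3: "?B3 N \<in> sets (gauss N)" for N
    using Bm F1 F2 F3 I by auto
  have l1: "(\<lambda>N. measure (gauss N) (?B1 N)) \<longlonglongrightarrow> 0"
    using gauss_lln[OF F1 I ratioI a] by (simp add: B_def m1)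
  have l2: "(\<lambda>N. measure (gauss N) (?B2 N)) \<longlonglongrightarrow> 0"
    using gauss_lln[OF F2 _ ratioC a] by (simp add: B_def m2)
  have l3: "(\<lambda>N. measure (gauss N) (?B3 N)) \<longlonglongrightarrow> 0"
    using gauss_lln[OF F3 I ratioI a] by (simp add: B_def m3)
  define G where "G N = space (gauss N) - (?B1 N \<union> ?B2 N \<union> ?B3 N)" for N
  have Gm: "G N \<in> sets (gauss N)" for N using B1 B2 B3 by (auto simp: G_def)
  have "(\<lambda>N. measure (gauss N) (G N)) \<longlonglongrightarrow> 1"
  proof (rule tendsto_sandwich[where h = "\<lambda>_. 1"])
    have "1 - (measure (gauss N) (?B1 N) + measure (gauss N) (?B2 N) + measure (gauss N) (?B3 N)) \<le> measure (gauss N) (G N)" for N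
    proof -
      have "measure (gauss N) (G N) = 1 - measure (gauss N) (?B1 N \<union> ?B2 N \<union> ?B3 N)"
        unfolding G_def using B1 B2 B3 by (intro gauss.prob_compl) auto
      moreover have "measure (gauss N) (?B1 N \<union> ?B2 N \<union> ?B3 N) \<le> measure (gauss N) (?B1 N \<union> ?B2 N) + measure (gauss N) (?B3 N)"
        using B1 B2 B3 by (intro measure_Un_le) auto
      moreover have "measure (gauss N) (?B1 N \<union> ?B2 N) \<le> measure (gauss N) (?B1 N) + measure (gauss N) (?B2 N)"
        using B1 B2 by (intro measure_Un_le) auto
      ultimately show ?thesis by linarith
    qed
    then show "eventually (\<lambda>N. 1 - (measure (gauss N) (?B1 N) + measure (gauss N) (?B2 N) + measure (gauss N) (?B3 N)) \<le> measure (gauss N) (G N)) sequentially"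
      by simp
    show "(\<lambda>N. 1 - (measure (gauss N) (?B1 N) + measure (gauss N) (?B2 N) + measure (gauss N) (?B3 N))) \<longlonglongrightarrow> 1"
      using tendsto_diff[OF tendsto_const[of 1] tendsto_add[OF tendsto_add[OF l1 l2] l3]] by simp
  qed auto
  moreover have "g \<in> {..<N} \<rightarrow>\<^sub>E UNIV \<and> \<bar>level_sum N (I N) g s + real N * mu_fun \<epsilon> s\<bar> < 2 * a * real N \<and>
       \<bar>real (card {i \<in> I N. g i \<le> s}) - real N * ((1 - \<epsilon>) * std_normal_cdf s)\<bar> < a * real N" if g: "g \<in> G N" for g N
  proof -
    have c: "(\<Sum>i\<in>I N. F3 (g i)) = real (card {i \<in> I N. g i \<le> s})"
      using finI[of N] by (simp add: F3_def indicator_def sum.If_cases Int_def)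
    have 1: "\<bar>(\<Sum>i\<in>I N. F1 (g i)) - real N * ((1 - \<epsilon>) * normal_excess s)\<bar> < a * real N"
      and 2: "\<bar>(\<Sum>i\<in>?C N. F2 (g i)) - real N * (\<epsilon> * (- s))\<bar> < a * real N"
      and 3: "\<bar>(\<Sum>i\<in>I N. F3 (g i)) - real N * ((1 - \<epsilon>) * std_normal_cdf s)\<bar> < a * real N"
      using g by (auto simp: G_def B_def not_le)
    have "level_sum N (I N) g s = (\<Sum>i\<in>I N. F1 (g i)) + (\<Sum>i\<in>?C N. F2 (g i))"
      by (simp add: level_sum_def F1_def F2_def)
    moreover have "real N * mu_fun \<epsilon> s = - (real N * ((1 - \<epsilon>) * normal_excess s)) - real N * (\<epsilon> * (- s))"
      by (simp add: mu_fun_def algebra_simps)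
    ultimately have "\<bar>level_sum N (I N) g s + real N * mu_fun \<epsilon> s\<bar> < 2 * a * real N"
      using 1 2 by linarith
    then show ?thesis using 3 c g by (auto simp: G_def space_gauss)
  qed
  ultimately show thesis using that[of G] Gm by blast
qed

lemma measure_row_proj_feasible:
  assumes M: "prob_space M" and A: "A \<in> M \<rightarrow>\<^sub>M mat_borel d n" and I: "I \<subseteq> {..<n}"
  defines "\<mu> \<equiv> distr M (mat_borel n n) (\<lambda>\<omega>. row_proj (A \<omega>))"
  shows "measure M {\<omega> \<in> space M. mat_kernel (A_semi_random (A \<omega>)) \<inter> nonneg_on n I \<noteq> {0\<^sub>v n}} = measure \<mu> (feasible n I)"
    and "measure M {\<omega> \<in> space M. mat_kernel (A_semi_random (A \<omega>)) \<inter> nonneg_on n I = {0\<^sub>v n}} = measure \<mu> (space \<mu> - feasible n I)"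
proof -
  have RA: "(\<lambda>\<omega>. row_proj (A \<omega>)) \<in> M \<rightarrow>\<^sub>M mat_borel n n" by (rule measurable_compose[OF A measurable_row_proj])
  have Ac: "A \<omega> \<in> carrier_mat d n" if "\<omega> \<in> space M" for \<omega>
    using measurable_space[OF A that] by (simp add: space_mat_borel)
  have F: "feasible n I \<in> sets (mat_borel n n)" by (rule sets_feasible[OF I])
  have "{\<omega> \<in> space M. mat_kernel (A_semi_random (A \<omega>)) \<inter> nonneg_on n I \<noteq> {0\<^sub>v n}} = (\<lambda>\<omega>. row_proj (A \<omega>)) -` feasible n I \<inter> space M"
    using kernel_semi_random_cone[OF Ac I] by auto
  then show "measure M {\<omega> \<in> space M. mat_kernel (A_semi_random (A \<omega>)) \<inter> nonneg_on n I \<noteq> {0\<^sub>v n}} = measure \<mu> (feasible n I)"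
    unfolding \<mu>_def by (simp add: measure_distr[OF RA F])
  have "{\<omega> \<in> space M. mat_kernel (A_semi_random (A \<omega>)) \<inter> nonneg_on n I = {0\<^sub>v n}} =
     (\<lambda>\<omega>. row_proj (A \<omega>)) -` (space (mat_borel n n) - feasible n I) \<inter> space M"
    using kernel_semi_random_cone[OF Ac I] measurable_space[OF RA] by auto
  then show "measure M {\<omega> \<in> space M. mat_kernel (A_semi_random (A \<omega>)) \<inter> nonneg_on n I = {0\<^sub>v n}} = measure \<mu> (space \<mu> - feasible n I)"
    unfolding \<mu>_def using F by (simp add: measure_distr[OF RA])
qed

locale semi_random_problem =
  fixes M :: "nat \<Rightarrow> 'a measure" and d K r :: "nat \<Rightarrow> nat" and I :: "nat \<Rightarrow> nat set"
    and A :: "nat \<Rightarrow> 'a \<Rightarrow> real mat" and \<alpha> \<epsilon> :: real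
  assumes M: "\<And>N. prob_space (M N)"
    and K: "\<And>N. K N \<le> N" and I: "\<And>N. I N \<subseteq> {..<N}" and cardI: "\<And>N. card (I N) = N - K N"
    and A: "\<And>N. A N \<in> M N \<rightarrow>\<^sub>M mat_borel (d N) N"
    and inv: "\<And>N. right_rotationally_invariant (M N) (d N) N (A N)"
    and rank: "\<And>N. AE \<omega> in M N. vec_space.rank (d N) (A N \<omega>) = r N"
    and Klim: "filterlim K at_top sequentially"
    and \<alpha>: "(\<lambda>N. real (r N) / real N) \<longlonglongrightarrow> \<alpha>"
    and \<epsilon>: "(\<lambda>N. real (K N) / real N) \<longlonglongrightarrow> \<epsilon>" "0 < \<epsilon>" "\<epsilon> < 1"
begin

lemma proj_law: "reflection_invariant_proj (distr (M N) (mat_borel N N) (\<lambda>\<omega>. row_proj (A N \<omega>))) N (real (r N))"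
  by (rule reflection_invariant_proj_row_proj[OF M A inv rank])

lemma ex_free_index:
  assumes "0 < K N"
  shows "\<exists>i0. face_setup N (I N) i0"
proof -
  have "card (I N) < card {..<N}" using assms K[of N] cardI[of N] by simp
  then have "I N \<noteq> {..<N}" by (metis less_irrefl)
  then obtain i0 where "i0 < N" "i0 \<notin> I N" using I[of N] by blast
  then have "face_setup N (I N) i0" using I[of N] by unfold_locales
  then show ?thesis by blast
qed

text \<open>The value 2 rather than 1 secures \<open>card J + 1 < N\<close> in the polar bound,
  since \<open>card J \<le> N - K N\<close>.\<close>

lemma eventually_K: "eventually (\<lambda>N. 2 \<le> K N) sequentially"
  using Klim by (auto simp: filterlim_at_top)

lemma eventually_r:
  assumes "0 < a"
  shows "eventually (\<lambda>N. \<bar>real (r N) - real N * \<alpha>\<bar> \<le> a * real N) sequentially"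
proof -
  have "eventually (\<lambda>N. dist (real (r N) / real N) \<alpha> < a) sequentially" using \<alpha> assms by (rule tendstoD)
  then show ?thesis using eventually_gt_at_top[of 0]
  proof eventually_elim
    fix N :: nat assume N: "0 < N" and d: "dist (real (r N) / real N) \<alpha> < a"
    have "real (r N) - real N * \<alpha> = real N * (real (r N) / real N - \<alpha>)" using N by (simp add: field_simps)
    then have "\<bar>real (r N) - real N * \<alpha>\<bar> = real N * \<bar>real (r N) / real N - \<alpha>\<bar>" by (simp only: abs_mult abs_of_nat)
    also have "\<dots> \<le> real N * a" using d by (intro mult_left_mono) (auto simp: dist_real_def)
    finally show "\<bar>real (r N) - real N * \<alpha>\<bar> \<le> a * real N" by (simp add: mult.commute)
  qed
qed

text \<open>A root of the level sum at or below \<open>s\<close> puts into \<open>J\<close> at most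
  as many coordinates as lie below \<open>s\<close>, so with high probability the face containing
  the projection has dimension above the rank.\<close>

lemma feasible_whp:
  assumes lt: "\<alpha> < delta_star \<epsilon>"
  shows "(\<lambda>N. measure (M N) {\<omega> \<in> space (M N). mat_kernel (A_semi_random (A N \<omega>)) \<inter> nonneg_on N (I N) \<noteq> {0\<^sub>v N}}) \<longlonglongrightarrow> 1"
proof -
  obtain s where s: "0 < mu_fun \<epsilon> s" "(1 - \<epsilon>) * std_normal_cdf s < 1 - \<alpha>"
    using ex_level_above_mu_star[OF \<epsilon>(2,3) lt] by blast
  define \<kappa> where "\<kappa> = (1 - \<epsilon>) * std_normal_cdf s"
  \<comment> \<open>A quarter of the smaller gap: \<open>2 * a\<close> absorbs the error of the
    level sum, and \<open>3 * a\<close> the errors of the count and of the rank together with the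
    summand 1 of the codimension.\<close>
  define a where "a = min (mu_fun \<epsilon> s / 4) ((1 - \<alpha> - \<kappa>) / 4)"
  have a1: "a \<le> mu_fun \<epsilon> s / 4" and a2: "a \<le> (1 - \<alpha> - \<kappa>) / 4" unfolding a_def by (rule min.cobounded1, rule min.cobounded2)
  have a: "0 < a" "4 * a \<le> mu_fun \<epsilon> s" "4 * a \<le> 1 - \<alpha> - \<kappa>"
    subgoal using s by (simp add: a_def \<kappa>_def)
    subgoal using a1 by linarith
    subgoal using mult_left_mono[OF a2, of 4] by simp
    done
  obtain G where G: "\<And>N. G N \<in> sets (gauss N)" "(\<lambda>N. measure (gauss N) (G N)) \<longlonglongrightarrow> 1"
    "\<And>N g. g \<in> G N \<Longrightarrow> g \<in> {..<N} \<rightarrow>\<^sub>E UNIV \<and> \<bar>level_sum N (I N) g s + real N * mu_fun \<epsilon> s\<bar> < 2 * a * real N \<and>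
       \<bar>real (card {i \<in> I N. g i \<le> s}) - real N * ((1 - \<epsilon>) * std_normal_cdf s)\<bar> < a * real N"
    using level_whp[OF I K cardI \<epsilon>(1) a(1), of s] by blast
  have "eventually (\<lambda>N. 1 < a * real N) sequentially"
    using a(1) by real_asymp
  then have ev: "eventually (\<lambda>N. measure (gauss N) (G N) \<le>
      measure (M N) {\<omega> \<in> space (M N). mat_kernel (A_semi_random (A N \<omega>)) \<inter> nonneg_on N (I N) \<noteq> {0\<^sub>v N}}) sequentially"
    using eventually_K eventually_r[OF a(1)] eventually_gt_at_top[of 0]
  proof eventually_elim
    fix N :: nat assume aN: "1 < a * real N" and KN: "2 \<le> K N" and rN: "\<bar>real (r N) - real N * \<alpha>\<bar> \<le> a * real N" and N: "0 < N"
    obtain i0 where fs: "face_setup N (I N) i0" using ex_free_index[of N] KN by auto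
    interpret face_setup N "I N" i0 by fact
    let ?\<mu> = "distr (M N) (mat_borel N N) (\<lambda>\<omega>. row_proj (A N \<omega>))"
    interpret rp: reflection_invariant_proj ?\<mu> N "real (r N)" by (rule proj_law)
    define \<J> where "\<J> = {J. J \<subseteq> I N \<and> real (r N) + real (card J) + 1 < real N}"
    have finI: "finite (I N)" using I finite_subset by blast
    have "G N \<subseteq> (\<Union>J\<in>\<J>. primal_cone N (I N) i0 J)"
    proof
      fix g assume "g \<in> G N"
      from G(3)[OF this] have g: "g \<in> {..<N} \<rightarrow>\<^sub>E UNIV"
        and lev: "\<bar>level_sum N (I N) g s + real N * mu_fun \<epsilon> s\<bar> < 2 * a * real N"
        and cnt: "\<bar>real (card {i \<in> I N. g i \<le> s}) - real N * \<kappa>\<bar> < a * real N" by (auto simp: \<kappa>_def)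
      have "4 * a * real N \<le> real N * mu_fun \<epsilon> s" using mult_right_mono[OF a(2), of "real N"] by (simp add: mult_ac)
      moreover have "0 < a * real N" using aN by linarith
      ultimately have "level_sum N (I N) g s < 0" using lev by linarith
      then obtain t where t: "t \<le> s" "level_sum N (I N) g t = 0" using level_sum_root_below by blast
      let ?J = "{i \<in> I N. g i \<le> t}"
      have "card ?J \<le> card {i \<in> I N. g i \<le> s}" using t finI by (intro card_mono) auto
      then have "real (card ?J) < real N * \<kappa> + a * real N" using cnt by linarith
      moreover have "4 * a * real N \<le> real N - real N * \<alpha> - real N * \<kappa>"
        using mult_right_mono[OF a(3), of "real N"] by (simp add: algebra_simps)
      ultimately have "real (r N) + real (card ?J) + 1 < real N" using rN aN by linarith
      then have "?J \<in> \<J>" by (auto simp: \<J>_def)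
      then show "g \<in> (\<Union>J\<in>\<J>. primal_cone N (I N) i0 J)" using primal_cone_level[OF t(2) g] by blast
    qed
    then have "emeasure (gauss N) (G N) \<le> emeasure ?\<mu> (feasible N (I N))"
      by (intro rp.emeasure_primal_cones_le[OF fs, of \<J>]) (auto simp: \<J>_def)
    then have "measure (gauss N) (G N) \<le> measure ?\<mu> (feasible N (I N))"
      by (simp add: gauss.emeasure_eq_measure rp.emeasure_eq_measure)
    then show "measure (gauss N) (G N) \<le>
      measure (M N) {\<omega> \<in> space (M N). mat_kernel (A_semi_random (A N \<omega>)) \<inter> nonneg_on N (I N) \<noteq> {0\<^sub>v N}}"
      by (simp add: measure_row_proj_feasible(1)[OF M A I])
  qed
  show ?thesis
    by (rule tendsto_sandwich[OF ev _ G(2) tendsto_const]) (simp add: prob_space.prob_le_1[OF M])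
qed

text \<open>The inequalities are reversed: the root lies strictly above \<open>s\<close>, so
  \<open>J\<close> contains every coordinate of \<open>I\<close> with value at most
  \<open>s\<close>, and the dimension of the face falls below the rank.\<close>

lemma infeasible_whp:
  assumes gt: "delta_star \<epsilon> < \<alpha>"
  shows "(\<lambda>N. measure (M N) {\<omega> \<in> space (M N). mat_kernel (A_semi_random (A N \<omega>)) \<inter> nonneg_on N (I N) = {0\<^sub>v N}}) \<longlonglongrightarrow> 1"
proof -
  obtain s where s: "mu_fun \<epsilon> s < 0" "1 - \<alpha> < (1 - \<epsilon>) * std_normal_cdf s"
    using ex_level_below_mu_star[OF \<epsilon>(2,3) gt] by blast
  define \<kappa> where "\<kappa> = (1 - \<epsilon>) * std_normal_cdf s"
  define a where "a = min (- mu_fun \<epsilon> s / 4) ((\<kappa> - (1 - \<alpha>)) / 4)"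
  have a1: "a \<le> - mu_fun \<epsilon> s / 4" and a2: "a \<le> (\<kappa> - (1 - \<alpha>)) / 4" unfolding a_def by (rule min.cobounded1, rule min.cobounded2)
  have a: "0 < a" "4 * a \<le> - mu_fun \<epsilon> s" "4 * a \<le> \<kappa> - (1 - \<alpha>)"
    subgoal using s by (simp add: a_def \<kappa>_def)
    subgoal using a1 by linarith
    subgoal using mult_left_mono[OF a2, of 4] by simp
    done
  obtain G where G: "\<And>N. G N \<in> sets (gauss N)" "(\<lambda>N. measure (gauss N) (G N)) \<longlonglongrightarrow> 1"
    "\<And>N g. g \<in> G N \<Longrightarrow> g \<in> {..<N} \<rightarrow>\<^sub>E UNIV \<and> \<bar>level_sum N (I N) g s + real N * mu_fun \<epsilon> s\<bar> < 2 * a * real N \<and>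
       \<bar>real (card {i \<in> I N. g i \<le> s}) - real N * ((1 - \<epsilon>) * std_normal_cdf s)\<bar> < a * real N"
    using level_whp[OF I K cardI \<epsilon>(1) a(1), of s] by blast
  have ev: "eventually (\<lambda>N. measure (gauss N) (G N) \<le>
      measure (M N) {\<omega> \<in> space (M N). mat_kernel (A_semi_random (A N \<omega>)) \<inter> nonneg_on N (I N) = {0\<^sub>v N}}) sequentially"
    using eventually_K eventually_r[OF a(1)] eventually_gt_at_top[of 0]
  proof eventually_elim
    fix N :: nat assume KN: "2 \<le> K N" and rN: "\<bar>real (r N) - real N * \<alpha>\<bar> \<le> a * real N" and N: "0 < N"
    obtain i0 where fs: "face_setup N (I N) i0" using ex_free_index[of N] KN by auto
    interpret face_setup N "I N" i0 by fact
    let ?\<mu> = "distr (M N) (mat_borel N N) (\<lambda>\<omega>. row_proj (A N \<omega>))"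
    interpret rp: reflection_invariant_proj ?\<mu> N "real (r N)" by (rule proj_law)
    define \<J> where "\<J> = {J. J \<subseteq> I N \<and> real N < real (r N) + real (card J) + 1 \<and> card J + 1 < N}"
    have finI: "finite (I N)" using I finite_subset by blast
    have "G N \<subseteq> (\<Union>J\<in>\<J>. dual_cone N (I N) i0 J)"
    proof
      fix g assume "g \<in> G N"
      from G(3)[OF this] have g: "g \<in> {..<N} \<rightarrow>\<^sub>E UNIV"
        and lev: "\<bar>level_sum N (I N) g s + real N * mu_fun \<epsilon> s\<bar> < 2 * a * real N"
        and cnt: "\<bar>real (card {i \<in> I N. g i \<le> s}) - real N * \<kappa>\<bar> < a * real N" by (auto simp: \<kappa>_def)
      have "4 * a * real N \<le> - (real N * mu_fun \<epsilon> s)" using mult_right_mono[OF a(2), of "real N"] by (simp add: mult_ac)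
      moreover have aN: "0 < a * real N" using a(1) N by simp
      ultimately have "0 < level_sum N (I N) g s" using lev by linarith
      then obtain t where t: "s < t" "level_sum N (I N) g t = 0" using level_sum_root_above by blast
      let ?J = "{i \<in> I N. g i < t}"
      have "card {i \<in> I N. g i \<le> s} \<le> card ?J" using t finI by (intro card_mono) auto
      then have "real N * \<kappa> - a * real N < real (card ?J)" using cnt by linarith
      moreover have "4 * a * real N \<le> real N * \<kappa> - (real N - real N * \<alpha>)"
        using mult_right_mono[OF a(3), of "real N"] by (simp add: algebra_simps)
      ultimately have "real N < real (r N) + real (card ?J) + 1" using rN aN by linarith
      moreover have "card ?J \<le> card (I N)" using finI by (intro card_mono) auto
      then have "card ?J + 1 < N" using cardI[of N] KN K[of N] by linarith
      ultimately have "?J \<in> \<J>" by (auto simp: \<J>_def)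
      then show "g \<in> (\<Union>J\<in>\<J>. dual_cone N (I N) i0 J)" using dual_cone_level[OF t(2) g] by blast
    qed
    then have "emeasure (gauss N) (G N) \<le> emeasure ?\<mu> (space ?\<mu> - feasible N (I N))"
      by (intro rp.emeasure_infeasible_ge[OF fs, of \<J>]) (auto simp: \<J>_def)
    then have "measure (gauss N) (G N) \<le> measure ?\<mu> (space ?\<mu> - feasible N (I N))"
      by (simp only: gauss.emeasure_eq_measure rp.emeasure_eq_measure ennreal_le_iff[OF measure_nonneg])
    then show "measure (gauss N) (G N) \<le>
      measure (M N) {\<omega> \<in> space (M N). mat_kernel (A_semi_random (A N \<omega>)) \<inter> nonneg_on N (I N) = {0\<^sub>v N}}"
      by (simp only: measure_row_proj_feasible(2)[OF M A I])
  qed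
  show ?thesis
    by (rule tendsto_sandwich[OF ev _ G(2) tendsto_const]) (simp add: prob_space.prob_le_1[OF M])
qed

end

theorem theorem1:
  shows "(\<forall>\<epsilon>. 0 < \<epsilon> \<and> \<epsilon> < 1 \<longrightarrow> (\<exists>!\<mu>. 0 < \<mu> \<and> mu_equation \<epsilon> \<mu>)) \<and>
    (\<forall>(M :: nat \<Rightarrow> 'a measure) (L :: nat \<Rightarrow> nat) (K :: nat \<Rightarrow> nat) (r :: nat \<Rightarrow> nat)
        (I :: nat \<Rightarrow> nat set) (A :: nat \<Rightarrow> 'a \<Rightarrow> real mat) (S :: nat \<Rightarrow> 'a \<Rightarrow> real mat)
        (\<alpha> :: real) (\<epsilon> :: real).
      (\<forall>N. prob_space (M N)) \<longrightarrow>
      (\<forall>N. K N \<le> N \<and> I N \<subseteq> {..<N} \<and> card (I N) = N - K N) \<longrightarrow>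
      (\<forall>N. S N \<in> M N \<rightarrow>\<^sub>M mat_borel (L N) N) \<longrightarrow>
      (\<forall>N. A N \<in> M N \<rightarrow>\<^sub>M mat_borel (num_lower (L N)) N) \<longrightarrow>
      (\<forall>N. right_rotationally_invariant (M N) (num_lower (L N)) N (A N)) \<longrightarrow>
      (\<forall>N. AE \<omega> in M N. vec_space.rank (num_lower (L N)) (A N \<omega>) = r N) \<longrightarrow>
      same_spectrum M A (\<lambda>N \<omega>. A2_mat (S N \<omega>)) \<longrightarrow>
      filterlim K at_top sequentially \<longrightarrow>
      filterlim r at_top sequentially \<longrightarrow>
      (\<lambda>N. real (r N) / real N) \<longlonglongrightarrow> \<alpha> \<longrightarrow> 0 < \<alpha> \<longrightarrow> \<alpha> < 1 \<longrightarrow>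
      (\<lambda>N. real (K N) / real N) \<longlonglongrightarrow> \<epsilon> \<longrightarrow> 0 < \<epsilon> \<longrightarrow> \<epsilon> < 1 \<longrightarrow>
      (\<alpha> > delta_star \<epsilon> \<longrightarrow>
        (\<lambda>N. measure (M N) {\<omega> \<in> space (M N).
           mat_kernel (A_semi_random (A N \<omega>)) \<inter> nonneg_on N (I N) = {0\<^sub>v N}})
          \<longlonglongrightarrow> 1) \<and>
      (\<alpha> < delta_star \<epsilon> \<longrightarrow>
        (\<lambda>N. measure (M N) {\<omega> \<in> space (M N).
           mat_kernel (A_semi_random (A N \<omega>)) \<inter> nonneg_on N (I N) \<noteq> {0\<^sub>v N}})
          \<longlonglongrightarrow> 1))"

proof (intro conjI allI impI)
  show "\<exists>!\<mu>. 0 < \<mu> \<and> mu_equation \<epsilon> \<mu>" if "0 < \<epsilon> \<and> \<epsilon> < 1" for \<epsilon>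
    using mu_star_ex1 that by blast
next
  fix M :: "nat \<Rightarrow> 'a measure" and L K r :: "nat \<Rightarrow> nat" and I :: "nat \<Rightarrow> nat set"
    and A S :: "nat \<Rightarrow> 'a \<Rightarrow> real mat" and \<alpha> \<epsilon> :: real
  assume "\<forall>N. prob_space (M N)" "\<forall>N. K N \<le> N \<and> I N \<subseteq> {..<N} \<and> card (I N) = N - K N"
    "\<forall>N. A N \<in> M N \<rightarrow>\<^sub>M mat_borel (num_lower (L N)) N"
    "\<forall>N. right_rotationally_invariant (M N) (num_lower (L N)) N (A N)"
    "\<forall>N. AE \<omega> in M N. vec_space.rank (num_lower (L N)) (A N \<omega>) = r N"
    "filterlim K at_top sequentially" "(\<lambda>N. real (r N) / real N) \<longlonglongrightarrow> \<alpha>"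
    "(\<lambda>N. real (K N) / real N) \<longlonglongrightarrow> \<epsilon>" "0 < \<epsilon>" "\<epsilon> < 1"
  then have "semi_random_problem M (\<lambda>N. num_lower (L N)) K r I A \<alpha> \<epsilon>"
    unfolding semi_random_problem_def by blast
  then interpret semi_random_problem M "\<lambda>N. num_lower (L N)" K r I A \<alpha> \<epsilon> .
  show "(\<lambda>N. measure (M N) {\<omega> \<in> space (M N). mat_kernel (A_semi_random (A N \<omega>)) \<inter> nonneg_on N (I N) = {0\<^sub>v N}}) \<longlonglongrightarrow> 1"
    if "\<alpha> > delta_star \<epsilon>" using infeasible_whp[OF that] .
  show "(\<lambda>N. measure (M N) {\<omega> \<in> space (M N). mat_kernel (A_semi_random (A N \<omega>)) \<inter> nonneg_on N (I N) \<noteq> {0\<^sub>v N}}) \<longlonglongrightarrow> 1"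
    if "\<alpha> < delta_star \<epsilon>" using feasible_whp[OF that] .
qed

end
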